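(* Let $Y=G(p_1,q_1,p_2,q_2,\dots)$ be Griffiths' space. Two reduced tame words $w_1,w_2$ over the alphabet $\{p_1,q_1,p_2,q_2,\dots\}$ represent the same element in $\pi_1(Y)$ if and only if each of them can be transformed to the same reduced tame word by applying a finite number of transformations of type (i) and finally the transformation of type (ii): (i) deletion of a countable subword containing only $p$-letters or only $q$-letters (i.e. only letters $p_n^{\pm1}$, or only letters $q_n^{\pm1}$); (ii) reducing the resulting countable word, i.e. replacing it by its reduced form.
   Context: Words. For an alphabet $X$ put $X^{\pm}=X\cup X^{-1}$ (letters and formal inverses). A countable word over $X$ is a family $W=(x_i)_{i\in I}$ with $I$ a countable (possibly finite or empty) linearly ordered set and $x_i\in X^{\pm}$. Words $(x_i)_{i\in I}$, $(y_j)_{j\in J}$ are regarded as equal (written $\equiv$) if there is an order-preserving bijection $\varphi:I\to J$ with $y_{\varphi(i)}=x_i$. A subword is the restriction to an order-convex subset of $I$. Concatenation $UV$ puts the indices of $U$ before those of $V$. $U^{-1}$ is obtained by reversing the order and inverting all letters. A word is restricted if each letter of $X^{\pm}$ occurs only finitely many times in it. An arch-system for $W$ is a set of pairwise disjoint two-element subsets $\{i\prec j\}$ of $I$ (arches) such that: $x_j=x_i^{-1}$; no two arches cross; and if $\{i\prec j\}$ is an arch, every $k$ with $i\prec k\prec j$ belongs to an arch both of whose elements lie strictly between $i$ and $j$. $W$ is reduced if its only arch-system is the empty one. Every restricted word $W$ has a unique reduced form: the word obtained by deleting the endpoints of all arches of a maximal (under inclusion) arch-system. A reduced tame word is a restricted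 reduced countable word; a tame word is a finite concatenation of reduced tame words. Spaces. Let $P=\{p_1,p_2,\dots\}$ and $Q=\{q_1,q_2,\dots\}$ be disjoint. The Hawaiian Earring $H(P)$ is the union of circles of radii $1/n$ ($n\ge1$) in the plane, pairwise meeting only in one common base point, on the same side of a common tangent; the circle of radius $1/n$, and also the loop traversing it once counterclockwise, is called $p_n$; similarly $H(Q)$. Griffiths' space $G(p_1,q_1,p_2,q_2,\dots)$ is the one-point union of the cones over $H(P)$ and over $H(Q)$, glued at the base points of the two Earrings. Representation. A restricted word $U=(x_i)_{i\in I}$ over $P\cup Q$ represents the class of a loop $f_U:[0,1]\to H(P)\vee H(Q)\subset Y$: choose disjoint open intervals $J_i\subset(0,1)$, ordered as $I$; let $f_U$ traverse the loop $x_i$ (the inverse loop if $x_i$ is an inverse letter) on $J_i$, and be the base point elsewhere. The based homotopy class of $f_U$ is well defined and depends only on the reduced form of $U$. *)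

theory Defs
  imports "HOL-Analysis.Analysis"
begin

section \<open>Words\<close>

datatype 'x signed = Pos 'x | Neg 'x

primrec inverse_letter :: "'x signed \<Rightarrow> 'x signed" where
  "inverse_letter (Pos x) = Neg x"
| "inverse_letter (Neg x) = Pos x"

text \<open>
  A word over the alphabet \<open>'x\<close> is a family of signed letters indexed by the domain of a partial
  map; the index set carries the order of the ambient linear order \<open>'i\<close>. Every countable linear
  order occurs as such an index set (for instance inside the rationals).
\<close>

type_synonym ('i, 'x) word = "'i \<rightharpoonup> 'x signed"

definition word_equiv :: "('i::linorder, 'x) word \<Rightarrow> ('j::linorder, 'x) word \<Rightarrow> bool" where
  "word_equiv V W \<longleftrightarrow>
     (\<exists>\<phi>. bij_betw \<phi> (dom V) (dom W) \<and> strict_mono_on (dom V) \<phi> \<and> (\<forall>i\<in>dom V. W (\<phi> i) = V i))"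

definition convex_in :: "'i::linorder set \<Rightarrow> 'i set \<Rightarrow> bool" where
  "convex_in I J \<longleftrightarrow> J \<subseteq> I \<and> (\<forall>i\<in>J. \<forall>j\<in>J. \<forall>k\<in>I. i < k \<and> k < j \<longrightarrow> k \<in> J)"

definition restricted :: "('i, 'x) word \<Rightarrow> bool" where
  "restricted W \<longleftrightarrow> (\<forall>x. finite {i. W i = Some x})"

text \<open>
  An arch \<open>{i \<prec> j}\<close> is represented by the ordered pair \<open>(i, j)\<close> with \<open>i < j\<close>.
\<close>

definition arch_system :: "('i::linorder, 'x) word \<Rightarrow> ('i \<times> 'i) set \<Rightarrow> bool" where
  "arch_system W A \<longleftrightarrow>
     (\<forall>(i, j)\<in>A. i < j \<and> (\<exists>x. W i = Some x \<and> W j = Some (inverse_letter x))) \<and>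
     (\<forall>(i, j)\<in>A. \<forall>(k, l)\<in>A. (i, j) \<noteq> (k, l) \<longrightarrow> {i, j} \<inter> {k, l} = {}) \<and>
     (\<forall>(i, j)\<in>A. \<forall>(k, l)\<in>A. \<not> (i < k \<and> k < j \<and> j < l)) \<and>
     (\<forall>(i, j)\<in>A. \<forall>k\<in>dom W. i < k \<and> k < j \<longrightarrow>
        (\<exists>(l, m)\<in>A. k \<in> {l, m} \<and> i < l \<and> m < j))"

definition maximal_arch_system :: "('i::linorder, 'x) word \<Rightarrow> ('i \<times> 'i) set \<Rightarrow> bool" where
  "maximal_arch_system W A \<longleftrightarrow>
     arch_system W A \<and> (\<forall>B. arch_system W B \<and> A \<subseteq> B \<longrightarrow> B = A)"

definition reduced :: "('i::linorder, 'x) word \<Rightarrow> bool" where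
  "reduced W \<longleftrightarrow> (\<forall>A. arch_system W A \<longrightarrow> A = {})"

text \<open>
  The reduced form is only determined up to \<^const>\<open>word_equiv\<close>, as it depends on the chosen maximal
  arch-system; hence it is a relation.
\<close>

definition reduced_form :: "('i::linorder, 'x) word \<Rightarrow> ('i, 'x) word \<Rightarrow> bool" where
  "reduced_form W V \<longleftrightarrow>
     (\<exists>A. maximal_arch_system W A \<and> V = W |` (- (fst ` A \<union> snd ` A)))"

definition reduced_tame :: "('i::linorder, 'x) word \<Rightarrow> bool" where
  "reduced_tame W \<longleftrightarrow> countable (dom W) \<and> restricted W \<and> reduced W"


section \<open>The alphabet and the transformations\<close>

text \<open>\<open>P n\<close> and \<open>Q n\<close> stand for the letters with index \<open>n + 1\<close>.\<close>

datatype gen = P nat | Q nat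

definition only_p :: "('i, gen) word \<Rightarrow> bool" where
  "only_p U \<longleftrightarrow> ran U \<subseteq> range (Pos \<circ> P) \<union> range (Neg \<circ> P)"

definition only_q :: "('i, gen) word \<Rightarrow> bool" where
  "only_q U \<longleftrightarrow> ran U \<subseteq> range (Pos \<circ> Q) \<union> range (Neg \<circ> Q)"

definition deletion :: "('i::linorder, gen) word \<Rightarrow> ('i, gen) word \<Rightarrow> bool" where
  "deletion W W' \<longleftrightarrow>
     (\<exists>J. convex_in (dom W) J \<and> countable J \<and> (only_p (W |` J) \<or> only_q (W |` J)) \<and>
          W' = W |` (- J))"

definition transforms_to :: "('i::linorder, gen) word \<Rightarrow> ('i, gen) word \<Rightarrow> bool" where
  "transforms_to W V \<longleftrightarrow> (\<exists>W'. deletion\<^sup>*\<^sup>* W W' \<and> reduced_form W' V)"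


section \<open>Griffiths' space\<close>

text \<open>
  Everything takes place in \<open>\<complex> \<times> \<real>\<close>. Both Earrings lie in the plane \<open>\<complex> \<times> {0}\<close>, on opposite sides of
  their common tangent at the common base point 0; the apexes of the two cones have height 1.
\<close>

definition earring_P :: "complex set" where
  "earring_P = (\<Union>n. sphere (of_real (1 / real (Suc n))) (1 / real (Suc n)))"

definition earring_Q :: "complex set" where
  "earring_Q = (\<Union>n. sphere (- of_real (1 / real (Suc n))) (1 / real (Suc n)))"

definition cone_map :: "complex \<times> real \<Rightarrow> complex \<times> real \<Rightarrow> complex \<times> real" where
  "cone_map a = (\<lambda>(z, t). (1 - t) *\<^sub>R (z, 0) + t *\<^sub>R a)"

text \<open>
  The cone over a compact subset \<open>H\<close> of the plane, as the union of the segments from \<open>H\<close> to an apex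
  \<open>a\<close> of height 1. By the lemmas \<open>quotient_map_cone_map\<close> and \<open>cone_map_eq_iff\<close> below this is the
  quotient of \<open>H \<times> [0, 1]\<close> by \<open>H \<times> {1}\<close>.
\<close>

definition cone_over :: "complex \<times> real \<Rightarrow> complex set \<Rightarrow> (complex \<times> real) set" where
  "cone_over a H = cone_map a ` (H \<times> {0..1})"

definition griffiths_space :: "(complex \<times> real) set" where
  "griffiths_space = cone_over (1, 1) earring_P \<union> cone_over (-1, 1) earring_Q"

lemma cone_map_eq_iff:
  assumes "snd a = 1" "t \<in> {0..1}" "u \<in> {0..1}"
  shows "cone_map a (z, t) = cone_map a (w, u) \<longleftrightarrow> (z, t) = (w, u) \<or> (t = 1 \<and> u = 1)"
  using assms by (cases a) (auto simp: cone_map_def scaleR_prod_def)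

lemma quotient_map_cone_map:
  assumes "compact H"
  shows "quotient_map (prod_topology (top_of_set H) (top_of_set {0..1}))
           (top_of_set (cone_over a H)) (cone_map a)"
proof -
  have eq: "prod_topology (top_of_set H) (top_of_set {0..1::real}) = top_of_set (H \<times> {0..1})"
    by simp
  have "compact (H \<times> {0..1::real})"
    using assms by (intro compact_Times) auto
  moreover have "continuous_on (H \<times> {0..1}) (cone_map a)"
    unfolding cone_map_def case_prod_unfold by (intro continuous_intros)
  ultimately show ?thesis
    unfolding eq
    by (intro T1_Spaces.continuous_imp_quotient_map)
       (auto simp: cone_over_def compact_space_subtopology Hausdorff_space_subtopology)
qed

lemma earring_Q_eq: "earring_Q = uminus ` earring_P"
proof -
  have "uminus ` sphere a r = sphere (- a) r" for a :: complex and r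
  proof (intro equalityI subsetI)
    fix x assume "x \<in> sphere (- a) r"
    then have "x = - (- x)" "- x \<in> sphere a r"
      using norm_minus_cancel[of "a + x"] by (simp_all add: dist_norm)
    then show "x \<in> uminus ` sphere a r" by (rule image_eqI)
  qed (auto simp: dist_norm norm_minus_commute)
  then show ?thesis by (simp add: earring_P_def earring_Q_def image_UN)
qed

lemma compact_earring_P: "compact earring_P"
proof -
  let ?S = "\<lambda>n. sphere (of_real (1 / real (Suc n)) :: complex) (1 / real (Suc n))"
  have sub: "?S n \<subseteq> cball 0 (2 / real (Suc n))" for n
  proof
    fix z assume "z \<in> ?S n"
    then have "norm (of_real (1 / real (Suc n)) - z) = 1 / real (Suc n)"
      by (simp add: dist_norm)
    moreover have "norm (of_real (1 / real (Suc n)) :: complex) = 1 / real (Suc n)"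
      by (simp only: norm_of_real) simp
    moreover have "norm z \<le> norm (of_real (1 / real (Suc n)) :: complex) +
        norm (of_real (1 / real (Suc n)) - z)"
      using norm_triangle_ineq4[of "of_real (1 / real (Suc n))" "of_real (1 / real (Suc n)) - z"]
      by simp
    ultimately show "z \<in> cball 0 (2 / real (Suc n))"
      by simp
  qed
  have "earring_P = (\<Inter>N. (\<Union>n<N. ?S n) \<union> cball 0 (2 / real (Suc N)))"
  proof (intro equalityI subsetI)
    fix z assume "z \<in> earring_P"
    then obtain n where n: "z \<in> ?S n" unfolding earring_P_def by blast
    show "z \<in> (\<Inter>N. (\<Union>n<N. ?S n) \<union> cball 0 (2 / real (Suc N)))"
    proof
      fix N
      have "z \<in> cball 0 (2 / real (Suc N))" if "N \<le> n"
        using sub[of n] n frac_le[of 2 2 "real (Suc N)" "real (Suc n)"] that by fastforce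
      then show "z \<in> (\<Union>n<N. ?S n) \<union> cball 0 (2 / real (Suc N))"
        using n by (cases "n < N") (blast, simp)
    qed
  next
    fix z assume z: "z \<in> (\<Inter>N. (\<Union>n<N. ?S n) \<union> cball 0 (2 / real (Suc N)))"
    show "z \<in> earring_P"
    proof (cases "z = 0")
      case True
      then have "z \<in> ?S 0" by simp
      then show ?thesis unfolding earring_P_def by blast
    next
      case False
      then obtain N where "inverse (real (Suc N)) < norm z / 2"
        using reals_Archimedean[of "norm z / 2"] by auto
      then have "z \<notin> cball 0 (2 / real (Suc N))" by (simp add: field_simps)
      then show ?thesis using z unfolding earring_P_def by blast
    qed
  qed
  moreover have "closed \<dots>"
    by (intro closed_INT ballI closed_Un closed_UN) auto
  moreover have "earring_P \<subseteq> cball 0 2"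
  proof -
    have "?S n \<subseteq> cball 0 2" for n
      using sub[of n] frac_le[of 2 2 1 "real (Suc n)"] by fastforce
    then show ?thesis unfolding earring_P_def by blast
  qed
  ultimately show ?thesis
    by (metis bounded_cball bounded_subset compact_eq_bounded_closed)
qed

lemma compact_earring_Q: "compact earring_Q"
  unfolding earring_Q_eq using compact_earring_P by (intro compact_continuous_image continuous_intros)

lemma earring_P_right:
  assumes "z \<in> earring_P" shows "0 \<le> Re z" and "Re z = 0 \<Longrightarrow> z = 0"
proof -
  obtain n where "dist (of_real (1 / real (Suc n))) z = 1 / real (Suc n)"
    using assms unfolding earring_P_def by auto
  then obtain r where r: "r > 0" "norm (of_real r - z) = r"
    by (metis dist_norm divide_pos_pos of_nat_0_less_iff zero_less_Suc zero_less_one)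
  show "0 \<le> Re z"
    using abs_Re_le_cmod[of "of_real r - z"] r by simp
  assume "Re z = 0"
  then have "r\<^sup>2 + (Im z)\<^sup>2 = r\<^sup>2"
    using r cmod_power2[of "of_real r - z"] by simp
  then show "z = 0" using \<open>Re z = 0\<close> by (simp add: complex_eq_iff)
qed

text \<open>The two cones share only the base point, so their union is the one-point union.\<close>

lemma cones_Int: "cone_over (1, 1) earring_P \<inter> cone_over (-1, 1) earring_Q = {0}"
proof (intro equalityI subsetI)
  fix x assume x: "x \<in> cone_over (1, 1) earring_P \<inter> cone_over (-1, 1) earring_Q"
  obtain z t where 1: "x = cone_map (1, 1) (z, t)" "z \<in> earring_P" "0 \<le> t" "t \<le> 1"
    using x unfolding cone_over_def by fastforce
  obtain w u where 2: "x = cone_map (-1, 1) (- w, u)" "w \<in> earring_P" "0 \<le> u" "u \<le> 1"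
    using x unfolding cone_over_def earring_Q_eq by fastforce
  have eq: "u = t" "(1 - t) * Re z + t = - ((1 - t) * Re w) - t"
    using 1(1) 2(1) by (auto simp: cone_map_def scaleR_prod_def complex_eq_iff)
  have "0 \<le> (1 - t) * Re z" "0 \<le> (1 - t) * Re w"
    using 1 2 earring_P_right(1) by simp_all
  then have "t = 0" "(1 - t) * Re z = 0" using eq(2) 1(3) by linarith+
  then have "z = 0" using earring_P_right(2)[OF 1(2)] by simp
  then show "x \<in> {0}" using 1(1) \<open>t = 0\<close> by (simp add: cone_map_def zero_prod_def)
next
  fix x :: "complex \<times> real" assume "x \<in> {0}"
  moreover have "0 \<in> sphere (of_real (1 / real (Suc 0)) :: complex) (1 / real (Suc 0))" by simp
  then have "0 \<in> earring_P" unfolding earring_P_def by blast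
  moreover from this have "0 \<in> earring_Q" unfolding earring_Q_eq by force
  moreover have "cone_map a (0, 0) = 0" for a by (simp add: cone_map_def zero_prod_def)
  ultimately show "x \<in> cone_over (1, 1) earring_P \<inter> cone_over (-1, 1) earring_Q"
    unfolding cone_over_def by (force simp: image_iff intro: bexI[of _ "(0, 0)"])
qed


section \<open>Homotopy classes and representation\<close>

definition homotopy_class :: "'a::topological_space set \<Rightarrow> (real \<Rightarrow> 'a) \<Rightarrow> (real \<Rightarrow> 'a) set" where
  "homotopy_class X f = {g. homotopic_paths X f g}"

definition pi1 :: "'a::topological_space set \<Rightarrow> 'a \<Rightarrow> (real \<Rightarrow> 'a) set set" where
  "pi1 X b =
     homotopy_class X ` {f. path f \<and> path_image f \<subseteq> X \<and> pathstart f = b \<and> pathfinish f = b}"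

text \<open>
  The circles traversed once counterclockwise; the factor in front of \<^const>\<open>cis\<close> has the sign which
  makes the loop start at the base point 0.
\<close>

primrec gen_loop :: "gen \<Rightarrow> real \<Rightarrow> complex" where
  "gen_loop (P n) = (\<lambda>t. of_real (1 / real (Suc n)) - of_real (1 / real (Suc n)) * cis (2 * pi * t))"
| "gen_loop (Q n) = (\<lambda>t. - of_real (1 / real (Suc n)) + of_real (1 / real (Suc n)) * cis (2 * pi * t))"

primrec letter_loop :: "gen signed \<Rightarrow> real \<Rightarrow> complex \<times> real" where
  "letter_loop (Pos x) = (\<lambda>t. (gen_loop x t, 0))"
| "letter_loop (Neg x) = reversepath (\<lambda>t. (gen_loop x t, 0))"

text \<open>
  \<open>loop_of_word W f\<close>: the map \<open>f\<close> is \<open>f\<^sub>W\<close> for some choice of the disjoint open intervals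
  \<open>{a i<..<b i}\<close>.
\<close>

definition loop_of_word :: "('i::linorder, gen) word \<Rightarrow> (real \<Rightarrow> complex \<times> real) \<Rightarrow> bool" where
  "loop_of_word W f \<longleftrightarrow>
     (\<exists>a b.
        (\<forall>i\<in>dom W. 0 \<le> a i \<and> a i < b i \<and> b i \<le> 1) \<and>
        (\<forall>i\<in>dom W. \<forall>j\<in>dom W. i < j \<longrightarrow> b i \<le> a j) \<and>
        (\<forall>i x. W i = Some x \<longrightarrow>
           (\<forall>t\<in>{a i<..<b i}. f t = letter_loop x ((t - a i) / (b i - a i)))) \<and>
        (\<forall>t\<in>{0..1} - (\<Union>i\<in>dom W. {a i<..<b i}). f t = 0))"

definition represents :: "('i::linorder, gen) word \<Rightarrow> (real \<Rightarrow> complex \<times> real) set \<Rightarrow> bool" where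
  "represents W c \<longleftrightarrow> c \<in> pi1 griffiths_space 0 \<and> (\<exists>f\<in>c. loop_of_word W f)"

end

theory Submission
  imports Defs "HOL-Library.Function_Algebras"
begin

text \<open>
  Two ideas carry the proof. The first is that a restricted word is described by its finite truncations.
  Letters act as permutations on freely reduced lists, which gives every truncation a value in a free group,
  and all these values together form the value of the word. Deleting arches does not change the value.
  Conversely, a word whose value vanishes has a total arch system: each truncation can be matched completely by
  free cancellation, and a compactness argument makes these matchings coherent
  (\<open>total_arch_system_if_val_zero\<close>). Therefore reduced words with equal values are equal
  (\<open>word_equiv_if_val_eq\<close>). A total arch system also contracts the loop of a word explicitly, so
  words of equal value have homotopic loops (\<open>homotopic_if_val_eq\<close>). A deletion removes a closed
  subpath that lies in a cone (\<open>deletion_homotopic\<close>). This proves that words with a common reduct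
  represent the same element.

  The second idea serves the converse. Counting how a path in the earrings passes the far points of the circles
  gives it a holonomy, an element of the same group as the values. It is constructed from local data, without
  covering spaces: crossings on small scales form a cocycle, which integrates over convex sets. The loop of a
  word has the value of the word as holonomy (\<open>hol_loop_of_word\<close>), and every path in the earrings
  has the holonomy of some word (\<open>word_of_path_exists\<close>). Now cut a homotopy in Griffiths' space
  into small squares. Those that avoid the apexes of the cones have a boundary with trivial holonomy after
  retraction to the earrings, and the others lie in a single cone, so that their boundaries have the holonomy
  of a word in letters of one kind. Hence the values of two words with homotopic loops differ by a finite
  product of conjugates \<open>x s x\<inverse>\<close> with pure words \<open>s\<close>
  (\<open>homotopic_imp_pure_closure\<close>).

  It remains to turn such a product into finitely many deletions of convex subwords
  (\<open>normal_closure_deletion\<close>). The word \<open>w2\<inverse> x\<^sub>0 s\<^sub>0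
  x\<^sub>0\<inverse> \<dots> w1\<close> has value zero and so a total arch system. From each letter of some
  \<open>s\<^sub>k\<close> follow the arches, passing between the two copies of \<open>x\<^sub>k\<close>
  whenever one of them is met, for as long as possible;
  a path that stops does so in \<open>w1\<close>, in \<open>w2\<close> or in some \<open>s\<^sub>l\<close>. Deleting all letters met in this way leaves a word from which \<open>w1\<close> and
  \<open>w2\<close> inherit equal values. The deleted letters of \<open>w1\<close> and \<open>w2\<close> form
  finitely many convex pure subwords, since only finitely many itineraries occur, as for interval exchanges
  (\<open>finite_itineraries\<close>).
\<close>

text \<open>
  The permutations of a type, written additively: \<open>a + b\<close> is composition and \<open>- a\<close>
  the inverse. With this notation they form an instance of group_add, so that finite products are list sums and
  families of permutations are multiplied pointwise.
\<close>

typedef 'a bijection = "{f :: 'a \<Rightarrow> 'a. bij f}" morphisms app Abs_bijection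
  by (auto intro: bij_id)

setup_lifting type_definition_bijection

instantiation bijection :: (type) group_add
begin

lift_definition zero_bijection :: "'a bijection" is id by simp
lift_definition plus_bijection :: "'a bijection \<Rightarrow> 'a bijection \<Rightarrow> 'a bijection" is "(\<circ>)"
  by (rule bij_comp)
lift_definition uminus_bijection :: "'a bijection \<Rightarrow> 'a bijection" is inv
  by (rule bij_imp_bij_inv)
definition minus_bijection :: "'a bijection \<Rightarrow> 'a bijection \<Rightarrow> 'a bijection" where
  "minus_bijection a b = a + - b"

instance
  by standard (simp_all add: minus_bijection_def, (transfer, simp add: o_assoc bij_is_inj)+)

end

section \<open>Letters as permutations of freely reduced lists\<close>

lemma inverse_letter_involution [simp]: "inverse_letter (inverse_letter x) = x"
  by (cases x) auto

definition freely_reduced :: "'x signed list \<Rightarrow> bool" where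
  "freely_reduced s \<longleftrightarrow> successively (\<lambda>x y. y \<noteq> inverse_letter x) s"

text \<open>
  Left multiplication by one letter on freely reduced words. Lists that are not freely reduced are fixed, which
  makes this a permutation of the whole type.
\<close>

definition push :: "'x signed \<Rightarrow> 'x signed list \<Rightarrow> 'x signed list" where
  "push x s = (if \<not> freely_reduced s then s
     else case s of [] \<Rightarrow> [x] | y # s' \<Rightarrow> if y = inverse_letter x then s' else x # s)"

lemma push_inverse: "push (inverse_letter x) (push x s) = s"
proof (cases "freely_reduced s")
  case False
  then show ?thesis by (simp add: push_def)
next
  case True
  show ?thesis
  proof (cases s)
    case Nil
    then show ?thesis by (simp add: push_def freely_reduced_def)
  next
    case (Cons y s')
    have s': "freely_reduced s'" "s' = [] \<or> hd s' \<noteq> inverse_letter y"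
      using True unfolding Cons freely_reduced_def successively_Cons by auto
    show ?thesis
    proof (cases "y = inverse_letter x")
      case y: True
      have "push x s = s'" using True y by (simp add: push_def Cons)
      moreover have "push (inverse_letter x) s' = s"
        using s' y by (cases s') (auto simp: push_def Cons)
      ultimately show ?thesis by simp
    next
      case y: False
      have "push x s = x # s" "freely_reduced (x # s)"
        using True y by (simp_all add: push_def Cons freely_reduced_def)
      then show ?thesis by (simp add: push_def)
    qed
  qed
qed

lift_definition letter :: "'x signed \<Rightarrow> 'x signed list bijection" is push
proof -
  fix x :: "'x signed"
  show "bij (push x)"
    by (rule o_bij[of "push (inverse_letter x)"])
      (use push_inverse[of x] push_inverse[of "inverse_letter x"] in \<open>auto simp: fun_eq_iff\<close>)
qed

lemma letter_inverse: "letter (inverse_letter x) = - letter x"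
proof -
  have "letter (inverse_letter x) + letter x = 0"
    by transfer (auto simp: fun_eq_iff push_inverse)
  then show ?thesis using minus_unique neg_eq_iff_add_eq_0 by (metis add.inverse_inverse)
qed

text \<open>
  Words with a complete non-crossing matching of mutually inverse letters: the finite words that have a total
  arch system.
\<close>

inductive dyck :: "'x signed list \<Rightarrow> bool" where
  dyck_Nil: "dyck []"
| dyck_arch: "dyck xs \<Longrightarrow> dyck ys \<Longrightarrow> dyck (x # xs @ inverse_letter x # ys)"

lemma dyck_append: "dyck xs \<Longrightarrow> dyck ys \<Longrightarrow> dyck (xs @ ys)"
  by (induction rule: dyck.induct) (auto intro: dyck.intros)

text \<open>
  The second list arises from the first by deleting Dyck words before, between and after its letters.
\<close>

inductive dyck_residue :: "'x signed list \<Rightarrow> 'x signed list \<Rightarrow> bool" where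
  residue_Nil: "dyck n \<Longrightarrow> dyck_residue n []"
| residue_Cons: "dyck n \<Longrightarrow> dyck_residue xs r \<Longrightarrow> dyck_residue (n @ x # xs) (x # r)"

lemma dyck_residue_append:
  assumes "dyck_residue xs r" "dyck m" shows "dyck_residue (m @ xs) r"
  using assms(1)
proof cases
  case residue_Nil
  then show ?thesis using assms(2) by (auto intro: dyck_append dyck_residue.intros)
next
  case (residue_Cons n ys r' x)
  then show ?thesis using dyck_residue.residue_Cons[of "m @ n" ys r' x] dyck_append[OF assms(2)]
    by simp
qed

lemma freely_reduced_push: "freely_reduced (push x s) \<longleftrightarrow> freely_reduced s"
proof (cases "freely_reduced s")
  case True
  then show ?thesis
    by (cases s) (auto simp: push_def freely_reduced_def successively_Cons)
qed (simp add: push_def)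

text \<open>
  Free reduction only ever deletes Dyck words. If the letter \<open>x\<close> cancels the head
  \<open>inverse_letter x\<close> of the reduced form, then \<open>x\<close> and this letter enclose a Dyck
  word.
\<close>

lemma dyck_residue_foldr_push: "dyck_residue xs (foldr push xs [])"
proof (induction xs)
  case Nil
  show ?case by (simp add: dyck_Nil residue_Nil)
next
  case (Cons x xs)
  define r where "r = foldr push xs []"
  have red: "freely_reduced r"
    unfolding r_def by (induction xs) (simp add: freely_reduced_def, simp add: freely_reduced_push)
  show ?case
  proof (cases "\<exists>r'. r = inverse_letter x # r'")
    case True
    then obtain r' where r': "r = inverse_letter x # r'" by blast
    have "dyck_residue xs (inverse_letter x # r')" using Cons r' by (simp add: r_def)
    then obtain n ys where n: "dyck n" "xs = n @ inverse_letter x # ys" "dyck_residue ys r'"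
      by cases auto
    have "dyck_residue ((x # n @ [inverse_letter x]) @ ys) r'"
      using n dyck_arch[OF n(1) dyck_Nil] by (intro dyck_residue_append) auto
    moreover have "foldr push (x # xs) [] = r'" using red r' by (simp add: r_def[symmetric] push_def)
    ultimately show ?thesis unfolding n(2) by simp
  next
    case False
    then have "push x r = x # r" using red by (auto simp: push_def split: list.splits)
    then show ?thesis using residue_Cons[OF dyck_Nil Cons, of x] by (simp add: r_def)
  qed
qed

text \<open>
  The permutation of a word maps the empty list to the reduced form of the word. So a word that acts trivially
  has an empty reduced form.
\<close>

lemma dyck_if_sum_zero:
  assumes "sum_list (map letter xs) = 0" shows "dyck xs"
proof -
  have "app (sum_list (map letter xs)) s = foldr push xs s" for s
  proof (induction xs arbitrary: s)
    case Nil
    then show ?case by (simp add: zero_bijection.rep_eq)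
  next
    case (Cons a xs)
    then show ?case by (simp add: plus_bijection.rep_eq letter.rep_eq)
  qed
  then have "foldr push xs [] = []" using assms by (metis zero_bijection.rep_eq id_apply)
  then have "dyck_residue xs []" using dyck_residue_foldr_push by metis
  then show ?thesis by cases
qed

section \<open>Sums over finite ordered sets\<close>

definition ordered_sum :: "('i::linorder \<Rightarrow> 'g::monoid_add) \<Rightarrow> 'i set \<Rightarrow> 'g" where
  "ordered_sum f S = sum_list (map f (sorted_list_of_set S))"

lemma ordered_sum_empty [simp]: "ordered_sum f {} = 0"
  by (simp add: ordered_sum_def)

lemma ordered_sum_singleton [simp]: "ordered_sum f {i} = f i"
  by (simp add: ordered_sum_def)

lemma ordered_sum_cong:
  assumes "S = T" "\<And>i. i \<in> T \<Longrightarrow> f i = g i" shows "ordered_sum f S = ordered_sum g T"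
proof (cases "finite T")
  case True
  then have "map f (sorted_list_of_set T) = map g (sorted_list_of_set T)"
    using assms(2) by simp
  then show ?thesis by (simp only: ordered_sum_def assms(1))
qed (simp add: ordered_sum_def assms)

lemma ordered_sum_Un:
  assumes "finite S" "finite T" "\<And>s t. s \<in> S \<Longrightarrow> t \<in> T \<Longrightarrow> s < t"
  shows "ordered_sum f (S \<union> T) = ordered_sum f S + ordered_sum f T"
proof -
  have "sorted_list_of_set (S \<union> T) = sorted_list_of_set S @ sorted_list_of_set T"
  proof (rule sorted_distinct_set_unique)
    show "sorted (sorted_list_of_set S @ sorted_list_of_set T)"
      using assms by (auto simp: sorted_append less_imp_le)
    show "distinct (sorted_list_of_set S @ sorted_list_of_set T)"
      using assms by auto
  qed (use assms in auto)
  then show ?thesis by (simp add: ordered_sum_def)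
qed

lemma ordered_sum_insert_max:
  assumes "finite S" "\<And>s. s \<in> S \<Longrightarrow> s < m"
  shows "ordered_sum f (insert m S) = ordered_sum f S + f m"
  using ordered_sum_Un[of S "{m}" f] assms by simp

lemma ordered_sum_insert_min:
  assumes "finite S" "\<And>s. s \<in> S \<Longrightarrow> m < s"
  shows "ordered_sum f (insert m S) = f m + ordered_sum f S"
  using ordered_sum_Un[of "{m}" S f] assms by simp

lemma ordered_sum_strict_mono:
  fixes g :: "'i::linorder \<Rightarrow> 'g::monoid_add" and \<phi> :: "'i \<Rightarrow> 'j::linorder"
  assumes "finite S" "strict_mono_on S \<phi>" "\<And>i. i \<in> S \<Longrightarrow> f (\<phi> i) = g i"
  shows "ordered_sum f (\<phi> ` S) = ordered_sum g S"
  using assms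
proof (induction S rule: finite_linorder_max_induct)
  case empty
  then show ?case by simp
next
  case (insert m S)
  have "ordered_sum f (insert (\<phi> m) (\<phi> ` S)) = ordered_sum f (\<phi> ` S) + f (\<phi> m)"
    using insert by (intro ordered_sum_insert_max) (auto simp: strict_mono_on_def)
  also have "\<dots> = ordered_sum g S + g m"
    using insert by (auto simp: strict_mono_on_def)
  finally show ?case using insert ordered_sum_insert_max[of S m g] by simp
qed

lemma ordered_sum_strict_antimono:
  fixes g :: "'i::linorder \<Rightarrow> 'g::group_add" and \<phi> :: "'i \<Rightarrow> 'j::linorder"
  assumes "finite S" "\<And>i j. i \<in> S \<Longrightarrow> j \<in> S \<Longrightarrow> i < j \<Longrightarrow> \<phi> j < \<phi> i"
    "\<And>i. i \<in> S \<Longrightarrow> f (\<phi> i) = - g i"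
  shows "ordered_sum f (\<phi> ` S) = - ordered_sum g S"
  using assms
proof (induction S rule: finite_linorder_max_induct)
  case empty
  then show ?case by simp
next
  case (insert m S)
  have "ordered_sum f (insert (\<phi> m) (\<phi> ` S)) = f (\<phi> m) + ordered_sum f (\<phi> ` S)"
    using insert by (intro ordered_sum_insert_min) auto
  also have "\<dots> = - g m + - ordered_sum g S"
    using insert by auto
  finally show ?case using insert ordered_sum_insert_max[of S m g] by (simp add: minus_add)
qed

section \<open>The value of a restricted word\<close>

primrec base :: "'x signed \<Rightarrow> 'x" where
  "base (Pos x) = x"
| "base (Neg x) = x"

primrec gen_index :: "gen \<Rightarrow> nat" where
  "gen_index (P n) = n"
| "gen_index (Q n) = n"

definition letter_index :: "gen signed \<Rightarrow> nat" where
  "letter_index a = gen_index (base a)"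

lemma base_inverse_letter [simp]: "base (inverse_letter a) = base a"
  by (cases a) auto

lemma letter_index_inverse [simp]: "letter_index (inverse_letter a) = letter_index a"
  by (simp add: letter_index_def)

lemma finite_gen_index_less: "finite {x. gen_index x < N}"
proof -
  have "{x. gen_index x < N} \<subseteq> P ` {..<N} \<union> Q ` {..<N}"
  proof
    fix x assume "x \<in> {x. gen_index x < N}"
    then show "x \<in> P ` {..<N} \<union> Q ` {..<N}" by (cases x) auto
  qed
  then show ?thesis by (rule finite_subset) auto
qed

lemma finite_letter_index_less: "finite {a. letter_index a < N}"
proof -
  have "{a. letter_index a < N} \<subseteq> Pos ` {x. gen_index x < N} \<union> Neg ` {x. gen_index x < N}"
  proof
    fix a assume "a \<in> {a. letter_index a < N}"
    then show "a \<in> Pos ` {x. gen_index x < N} \<union> Neg ` {x. gen_index x < N}"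
      by (cases a) (auto simp: letter_index_def)
  qed
  then show ?thesis by (rule finite_subset) (simp add: finite_gen_index_less)
qed

definition level :: "nat \<Rightarrow> ('i, gen) word \<Rightarrow> 'i set" where
  "level N W = {i. \<exists>a. W i = Some a \<and> letter_index a < N}"

text \<open>
  The component at \<open>N\<close> belongs to the truncation of words to letters of index below
  \<open>N\<close>. The values of words lie in the inverse limit of the free groups on these finite alphabets,
  here realised as groups of permutations.
\<close>

type_synonym free_limit = "nat \<Rightarrow> gen signed list bijection"

definition val :: "('i::linorder, gen) word \<Rightarrow> free_limit" where
  "val W N = ordered_sum (\<lambda>i. letter (the (W i))) (level N W)"

lemma finite_level: "restricted W \<Longrightarrow> finite (level N W)"
proof -
  assume "restricted W"
  moreover have "level N W = (\<Union>a\<in>{a. letter_index a < N}. {i. W i = Some a})"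
    by (auto simp: level_def)
  ultimately show ?thesis using finite_letter_index_less by (simp add: restricted_def)
qed

lemma level_restrict_map: "level N (W |` S) = level N W \<inter> S"
  by (auto simp: level_def restrict_map_def)

lemma level_subset_dom: "level N W \<subseteq> dom W"
  by (auto simp: level_def)

lemma restricted_if_finite_levels:
  assumes "\<And>N. finite (level N W)" shows "restricted W"
  unfolding restricted_def
proof
  fix a
  have "{i. W i = Some a} \<subseteq> level (Suc (letter_index a)) W" by (auto simp: level_def)
  then show "finite {i. W i = Some a}" using assms finite_subset by blast
qed

lemma restricted_restrict_map: "restricted W \<Longrightarrow> restricted (W |` S)"
  unfolding restricted_def
proof
  fix x assume "\<forall>x. finite {i. W i = Some x}"
  moreover have "{i. (W |` S) i = Some x} \<subseteq> {i. W i = Some x}" by (auto simp: restrict_map_def)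
  ultimately show "finite {i. (W |` S) i = Some x}" using finite_subset by blast
qed

lemma val_restrict_map: "val (W |` S) N = ordered_sum (\<lambda>i. letter (the (W i))) (level N W \<inter> S)"
  unfolding val_def level_restrict_map by (rule ordered_sum_cong) auto

lemma val_empty [simp]: "val Map.empty = 0"
  by (rule ext) (simp add: val_def level_def)

lemma level_word_equiv:
  assumes "bij_betw \<phi> (dom V) (dom W)" "\<And>i. i \<in> dom V \<Longrightarrow> W (\<phi> i) = V i"
  shows "level N W = \<phi> ` level N V"
proof (intro equalityI subsetI)
  fix j assume j: "j \<in> level N W"
  then have "j \<in> dom W" using level_subset_dom[of N W] by blast
  also have "dom W = \<phi> ` dom V" using assms(1) by (simp add: bij_betw_def)
  finally obtain i where i: "i \<in> dom V" "j = \<phi> i" by blast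
  then have "i \<in> level N V" using j assms(2)[OF i(1)] by (simp add: level_def)
  then show "j \<in> \<phi> ` level N V" using i by blast
next
  fix j assume "j \<in> \<phi> ` level N V"
  then obtain i where i: "i \<in> level N V" "j = \<phi> i" by blast
  then have "i \<in> dom V" using level_subset_dom[of N V] by blast
  then show "j \<in> level N W" using i assms(2)[of i] by (simp add: level_def)
qed

lemma word_equiv_restricted:
  fixes V :: "('i::linorder, gen) word" and W :: "('j::linorder, gen) word"
  assumes "word_equiv V W" "restricted V" shows "restricted W"
proof -
  obtain \<phi> where "bij_betw \<phi> (dom V) (dom W)" "\<forall>i\<in>dom V. W (\<phi> i) = V i"
    using assms(1) unfolding word_equiv_def by blast
  then show ?thesis
    using level_word_equiv[of \<phi> V W] finite_level[OF assms(2)]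
    by (intro restricted_if_finite_levels) auto
qed

lemma val_word_equiv:
  assumes "word_equiv V W" "restricted V" shows "val V = val W"
proof
  fix N
  obtain \<phi> where \<phi>: "bij_betw \<phi> (dom V) (dom W)" "strict_mono_on (dom V) \<phi>" "\<forall>i\<in>dom V. W (\<phi> i) = V i"
    using assms(1) unfolding word_equiv_def by blast
  have "level N W = \<phi> ` level N V" using \<phi> by (intro level_word_equiv) auto
  moreover have "ordered_sum (\<lambda>i. letter (the (W i))) (\<phi> ` level N V)
      = ordered_sum (\<lambda>i. letter (the (V i))) (level N V)"
  proof (rule ordered_sum_strict_mono)
    show "strict_mono_on (level N V) \<phi>"
      using \<phi>(2) level_subset_dom by (rule monotone_on_subset)
    show "letter (the (W (\<phi> i))) = letter (the (V i))" if "i \<in> level N V" for i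
      using that \<phi>(3) level_subset_dom[of N V] by (metis subsetD)
  qed (rule finite_level[OF assms(2)])
  ultimately show "val V N = val W N" by (simp add: val_def)
qed

lemma word_equiv_sym:
  assumes "word_equiv V W" shows "word_equiv W V"
proof -
  obtain \<phi> where \<phi>: "bij_betw \<phi> (dom V) (dom W)" "strict_mono_on (dom V) \<phi>" "\<forall>i\<in>dom V. W (\<phi> i) = V i"
    using assms unfolding word_equiv_def by blast
  define \<psi> where "\<psi> = the_inv_into (dom V) \<phi>"
  have inj: "inj_on \<phi> (dom V)" and im: "\<phi> ` dom V = dom W" using \<phi>(1) by (auto simp: bij_betw_def)
  have \<psi>: "\<psi> (\<phi> i) = i" if "i \<in> dom V" for i
    unfolding \<psi>_def by (rule the_inv_into_f_f[OF inj that])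
  have "bij_betw \<psi> (dom W) (dom V)"
    unfolding \<psi>_def by (rule bij_betw_the_inv_into[OF \<phi>(1)])
  moreover have "strict_mono_on (dom W) \<psi>"
  proof (rule strict_mono_onI)
    fix x y assume "x \<in> dom W" "y \<in> dom W" and xy: "x < y"
    then obtain i j where ij: "i \<in> dom V" "j \<in> dom V" "x = \<phi> i" "y = \<phi> j" using im by blast
    have "\<not> j < i" "j \<noteq> i" using \<phi>(2) ij xy by (auto dest: strict_mono_onD)
    then show "\<psi> x < \<psi> y" using ij \<psi> by simp
  qed
  moreover have "V (\<psi> x) = W x" if "x \<in> dom W" for x
    using that im \<phi>(3) \<psi> by force
  ultimately show ?thesis unfolding word_equiv_def by blast
qed

lemma word_equiv_trans:
  assumes "word_equiv U V" "word_equiv V W" shows "word_equiv U W"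
proof -
  obtain \<phi> where \<phi>: "bij_betw \<phi> (dom U) (dom V)" "strict_mono_on (dom U) \<phi>" "\<forall>i\<in>dom U. V (\<phi> i) = U i"
    using assms(1) unfolding word_equiv_def by blast
  obtain \<psi> where \<psi>: "bij_betw \<psi> (dom V) (dom W)" "strict_mono_on (dom V) \<psi>" "\<forall>i\<in>dom V. W (\<psi> i) = V i"
    using assms(2) unfolding word_equiv_def by blast
  have im: "\<phi> i \<in> dom V" if "i \<in> dom U" for i using bij_betwE[OF \<phi>(1)] that by blast
  have "strict_mono_on (dom U) (\<psi> \<circ> \<phi>)"
    by (rule strict_mono_onI) (simp add: im strict_mono_onD[OF \<phi>(2)] strict_mono_onD[OF \<psi>(2)])
  moreover have "\<forall>i\<in>dom U. W ((\<psi> \<circ> \<phi>) i) = U i" using im \<phi>(3) \<psi>(3) by simp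
  ultimately show ?thesis unfolding word_equiv_def using bij_betw_trans[OF \<phi>(1) \<psi>(1)] by blast
qed

text \<open>
  Arches can be deleted from the inside out. Because everything below an arch belongs to arches below it, the
  two ends of an arch with the fewest positions in between are adjacent, and their summands cancel.
\<close>

lemma ordered_sum_delete_arches:
  fixes f :: "'i::linorder \<Rightarrow> 'g::group_add"
  assumes "finite S" "A \<subseteq> S \<times> S"
    and "\<And>i j. (i, j) \<in> A \<Longrightarrow> i < j \<and> f j = - f i"
    and "\<And>i j k l. (i, j) \<in> A \<Longrightarrow> (k, l) \<in> A \<Longrightarrow> (i, j) \<noteq> (k, l) \<Longrightarrow> {i, j} \<inter> {k, l} = {}"
    and "\<And>i j k. (i, j) \<in> A \<Longrightarrow> k \<in> S \<Longrightarrow> i < k \<Longrightarrow> k < j \<Longrightarrow>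
           \<exists>(l, m)\<in>A. k \<in> {l, m} \<and> i < l \<and> m < j"
  shows "ordered_sum f (S - (fst ` A \<union> snd ` A)) = ordered_sum f S"
  using assms
proof (induction "card A" arbitrary: A S rule: less_induct)
  case less
  note fin = less.prems(1) and sub = less.prems(2) and inv = less.prems(3)
    and disj = less.prems(4) and nest = less.prems(5)
  show ?case
  proof (cases "A = {}")
    case True
    then show ?thesis by simp
  next
    case False
    have finA: "finite A" using fin sub by (meson finite_SigmaI finite_subset)
    \<comment> \<open>an arch of minimal width has no position below it\<close>
    define width where "width = (\<lambda>p. card {k\<in>S. fst p < k \<and> k < snd p})"
    obtain p where p: "p \<in> A" "\<And>q. q \<in> A \<Longrightarrow> width p \<le> width q"
      using False ex_has_least_nat[of "\<lambda>p. p \<in> A" _ width] by blast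
    obtain i j where ij: "p = (i, j)" by (cases p)
    have iS: "i \<in> S" "j \<in> S" "i < j" "f j = - f i" using p(1) ij sub inv[of i j] by auto
    have empty: "{k\<in>S. i < k \<and> k < j} = {}"
    proof (rule ccontr)
      assume "{k\<in>S. i < k \<and> k < j} \<noteq> {}"
      then obtain k where k: "k \<in> S" "i < k" "k < j" by blast
      then obtain l m where lm: "(l, m) \<in> A" "i < l" "m < j" using nest[of i j k] p(1) ij by blast
      have "l < m" "l \<in> S" using lm inv sub by auto
      then have "{k\<in>S. l < k \<and> k < m} \<subset> {k\<in>S. i < k \<and> k < j}"
        using lm by force
      then have "width (l, m) < width p"
        unfolding width_def ij using fin by (intro psubset_card_mono) auto
      then show False using p(2)[OF lm(1)] by simp
    qed
    define S' where "S' = S - {i, j}"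
    define A' where "A' = A - {(i, j)}"
    have ijA: "(i, j) \<in> A" using p ij by simp
    have A'S': "A' \<subseteq> S' \<times> S'"
    proof
      fix q assume q: "q \<in> A'"
      obtain k l where kl: "q = (k, l)" by (cases q)
      have "{k, l} \<inter> {i, j} = {}" using disj[of k l i j] q kl ijA by (auto simp: A'_def)
      then show "q \<in> S' \<times> S'" using q kl sub by (auto simp: A'_def S'_def)
    qed
    have "card A' < card A" unfolding A'_def using finA ijA by (meson card_Diff1_less)
    then have "ordered_sum f (S' - (fst ` A' \<union> snd ` A')) = ordered_sum f S'"
    proof (rule less.hyps)
      show "finite S'" using fin by (simp add: S'_def)
      show "k < l \<and> f l = - f k" if "(k, l) \<in> A'" for k l using inv that by (simp add: A'_def)
      show "{k, l} \<inter> {k', l'} = {}" if "(k, l) \<in> A'" "(k', l') \<in> A'" "(k, l) \<noteq> (k', l')" for k l k' l'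
        using disj[of k l k' l'] that unfolding A'_def by blast
      show "\<exists>(l, m)\<in>A'. k \<in> {l, m} \<and> i' < l \<and> m < j'"
        if "(i', j') \<in> A'" "k \<in> S'" "i' < k" "k < j'" for i' j' k
      proof -
        obtain l m where lm: "(l, m) \<in> A" "k \<in> {l, m}" "i' < l" "m < j'"
          using nest[of i' j' k] \<open>(i', j') \<in> A'\<close> \<open>k \<in> S'\<close> \<open>i' < k\<close> \<open>k < j'\<close> by (auto simp: A'_def S'_def)
        then have "(l, m) \<in> A'" using \<open>k \<in> S'\<close> by (auto simp: A'_def S'_def)
        then show ?thesis using lm by blast
      qed
    qed (use A'S' in auto)
    moreover have "S - (fst ` A \<union> snd ` A) = S' - (fst ` A' \<union> snd ` A')"
    proof -
      have "A = insert (i, j) A'" using ijA by (auto simp: A'_def)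
      then show ?thesis by (auto simp: S'_def)
    qed
    moreover have "ordered_sum f S = ordered_sum f S'"
    proof -
      define L R where "L = {k\<in>S. k < i}" and "R = {k\<in>S. j < k}"
      have "k < i \<or> j < k" if "k \<in> S'" for k
      proof -
        have "\<not> (i < k \<and> k < j)" "k \<noteq> i" "k \<noteq> j" using empty that by (auto simp: S'_def)
        then show ?thesis by (metis linorder_cases)
      qed
      then have LR: "finite L" "finite R" "S' = L \<union> R"
        using fin iS by (auto simp: L_def R_def S'_def)
      have "ordered_sum f (insert i L) = ordered_sum f L + f i"
        using LR by (intro ordered_sum_insert_max) (auto simp: L_def)
      moreover have "ordered_sum f (insert j R) = - f i + ordered_sum f R"
        using LR iS by (subst ordered_sum_insert_min) (auto simp: R_def)
      moreover have "ordered_sum f (insert i L \<union> insert j R) = ordered_sum f (insert i L) + ordered_sum f (insert j R)"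
        using LR iS by (intro ordered_sum_Un) (auto simp: L_def R_def)
      moreover have "S = insert i L \<union> insert j R" using LR iS by (auto simp: S'_def)
      moreover have "ordered_sum f (L \<union> R) = ordered_sum f L + ordered_sum f R"
        using LR iS by (intro ordered_sum_Un) (auto simp: L_def R_def)
      ultimately show ?thesis using LR(3) by (simp add: add.assoc)
    qed
    ultimately show ?thesis by simp
  qed
qed

lemma arch_systemD:
  assumes "arch_system W A"
  shows "(i, j) \<in> A \<Longrightarrow> i < j"
    and "(i, j) \<in> A \<Longrightarrow> \<exists>x. W i = Some x \<and> W j = Some (inverse_letter x)"
    and "(i, j) \<in> A \<Longrightarrow> (k, l) \<in> A \<Longrightarrow> (i, j) \<noteq> (k, l) \<Longrightarrow> {i, j} \<inter> {k, l} = {}"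
    and "(i, j) \<in> A \<Longrightarrow> (k, l) \<in> A \<Longrightarrow> i < k \<Longrightarrow> k < j \<Longrightarrow> \<not> j < l"
    and "(i, j) \<in> A \<Longrightarrow> k \<in> dom W \<Longrightarrow> i < k \<Longrightarrow> k < j \<Longrightarrow>
           \<exists>l m. (l, m)\<in>A \<and> k \<in> {l, m} \<and> i < l \<and> m < j"
proof -
  have *: "(\<forall>(i, j)\<in>A. i < j \<and> (\<exists>x. W i = Some x \<and> W j = Some (inverse_letter x)))"
     "(\<forall>(i, j)\<in>A. \<forall>(k, l)\<in>A. (i, j) \<noteq> (k, l) \<longrightarrow> {i, j} \<inter> {k, l} = {})"
     "(\<forall>(i, j)\<in>A. \<forall>(k, l)\<in>A. \<not> (i < k \<and> k < j \<and> j < l))"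
     "(\<forall>(i, j)\<in>A. \<forall>k\<in>dom W. i < k \<and> k < j \<longrightarrow>
        (\<exists>(l, m)\<in>A. k \<in> {l, m} \<and> i < l \<and> m < j))"
    using assms unfolding arch_system_def by - (elim conjE, assumption)+
  show "(i, j) \<in> A \<Longrightarrow> i < j" and "(i, j) \<in> A \<Longrightarrow> \<exists>x. W i = Some x \<and> W j = Some (inverse_letter x)"
    using *(1) by blast+
  show "(i, j) \<in> A \<Longrightarrow> (k, l) \<in> A \<Longrightarrow> (i, j) \<noteq> (k, l) \<Longrightarrow> {i, j} \<inter> {k, l} = {}"
    using *(2) by fast
  show "(i, j) \<in> A \<Longrightarrow> (k, l) \<in> A \<Longrightarrow> i < k \<Longrightarrow> k < j \<Longrightarrow> \<not> j < l" using *(3) by fast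
  show "(i, j) \<in> A \<Longrightarrow> k \<in> dom W \<Longrightarrow> i < k \<Longrightarrow> k < j \<Longrightarrow>
           \<exists>l m. (l, m)\<in>A \<and> k \<in> {l, m} \<and> i < l \<and> m < j" using *(4) by fast
qed

lemma arch_systemI:
  assumes "\<And>i j. (i, j) \<in> A \<Longrightarrow> i < j"
    and "\<And>i j. (i, j) \<in> A \<Longrightarrow> \<exists>x. W i = Some x \<and> W j = Some (inverse_letter x)"
    and "\<And>i j k l. (i, j) \<in> A \<Longrightarrow> (k, l) \<in> A \<Longrightarrow> (i, j) \<noteq> (k, l) \<Longrightarrow> {i, j} \<inter> {k, l} = {}"
    and "\<And>i j k l. (i, j) \<in> A \<Longrightarrow> (k, l) \<in> A \<Longrightarrow> i < k \<Longrightarrow> k < j \<Longrightarrow> \<not> j < l"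
    and "\<And>i j k. (i, j) \<in> A \<Longrightarrow> k \<in> dom W \<Longrightarrow> i < k \<Longrightarrow> k < j \<Longrightarrow>
           \<exists>l m. (l, m)\<in>A \<and> k \<in> {l, m} \<and> i < l \<and> m < j"
  shows "arch_system W A"
proof -
  have "\<forall>(i, j)\<in>A. i < j \<and> (\<exists>x. W i = Some x \<and> W j = Some (inverse_letter x))"
    using assms(1,2) by blast
  moreover have "\<forall>(i, j)\<in>A. \<forall>(k, l)\<in>A. (i, j) \<noteq> (k, l) \<longrightarrow> {i, j} \<inter> {k, l} = {}"
    using assms(3) by fast
  moreover have "\<forall>(i, j)\<in>A. \<forall>(k, l)\<in>A. \<not> (i < k \<and> k < j \<and> j < l)"
    using assms(4) by fast
  moreover have "\<forall>(i, j)\<in>A. \<forall>k\<in>dom W. i < k \<and> k < j \<longrightarrow>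
        (\<exists>(l, m)\<in>A. k \<in> {l, m} \<and> i < l \<and> m < j)"
    using assms(5) by fast
  ultimately show ?thesis unfolding arch_system_def by blast
qed

abbreviation ends :: "('i \<times> 'i) set \<Rightarrow> 'i set" where
  "ends A \<equiv> fst ` A \<union> snd ` A"

lemma arch_system_level:
  assumes "arch_system W A" "(i, j) \<in> A"
  shows "i \<in> level N W \<longleftrightarrow> j \<in> level N W"
  using arch_systemD(2)[OF assms] by (auto simp: level_def)

lemma arch_system_dom:
  assumes "arch_system W A" "(i, j) \<in> A"
  shows "i \<in> dom W" "j \<in> dom W"
  using arch_systemD(2)[OF assms] by auto

lemma restrict_map_dom_restrict: "W |` dom (W |` S) = W |` S"
proof
  fix i show "(W |` dom (W |` S)) i = (W |` S) i"
    by (cases "i \<in> S"; cases "W i") (simp_all add: restrict_map_def domIff)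
qed

lemma ends_level:
  assumes "arch_system W A"
  shows "ends A \<inter> level N W = ends (A \<inter> level N W \<times> level N W)"
proof -
  have "i \<in> level N W \<longleftrightarrow> j \<in> level N W" if "(i, j) \<in> A" for i j
    using arch_system_level[OF assms that] .
  then show ?thesis by (fastforce simp: image_iff)
qed

text \<open>
  The two ends of an arch carry letters of the same index. So an arch system cuts down to an arch system of
  every truncation, where its deletion is a finite cancellation.
\<close>

lemma val_delete_arches:
  assumes "arch_system W A" "restricted W"
  shows "val (W |` (- ends A)) = val W"
proof
  fix N
  define S where "S = level N W"
  define B where "B = A \<inter> S \<times> S"
  have "S \<inter> - ends A = S - ends B"
    using ends_level[OF assms(1), of N] unfolding B_def S_def by blast
  moreover have "ordered_sum (\<lambda>i. letter (the (W i))) (S - ends B) = ordered_sum (\<lambda>i. letter (the (W i))) S"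
  proof (rule ordered_sum_delete_arches)
    show "finite S" unfolding S_def by (rule finite_level[OF assms(2)])
    show "B \<subseteq> S \<times> S" by (simp add: B_def)
    show "i < j \<and> letter (the (W j)) = - letter (the (W i))" if "(i, j) \<in> B" for i j
      using arch_systemD(1,2)[OF assms(1), of i j] that by (auto simp: B_def letter_inverse)
    show "{i, j} \<inter> {k, l} = {}" if "(i, j) \<in> B" "(k, l) \<in> B" "(i, j) \<noteq> (k, l)" for i j k l
      using arch_systemD(3)[OF assms(1), of i j k l] that by (simp add: B_def)
    show "\<exists>(l, m)\<in>B. k \<in> {l, m} \<and> i < l \<and> m < j"
      if k: "(i, j) \<in> B" "k \<in> S" "i < k" "k < j" for i j k
    proof -
      have "k \<in> dom W" "(i, j) \<in> A" using k level_subset_dom[of N W] by (auto simp: S_def B_def)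
      then obtain l m where lm: "(l, m) \<in> A" "k \<in> {l, m}" "i < l" "m < j"
        using arch_systemD(5)[OF assms(1)] k by blast
      then have "(l, m) \<in> B"
        using k(2) arch_system_level[OF assms(1) lm(1), of N] by (auto simp: B_def S_def)
      then show ?thesis using lm by blast
    qed
  qed
  ultimately show "val (W |` (- ends A)) N = val W N"
    unfolding val_restrict_map unfolding S_def val_def by (simp only:)
qed

section \<open>Total arch systems\<close>

definition total_arch_system :: "('i::linorder, 'x) word \<Rightarrow> ('i \<times> 'i) set \<Rightarrow> bool" where
  "total_arch_system W A \<longleftrightarrow> arch_system W A \<and> ends A = dom W"

text \<open>
  The finite case: a Dyck decomposition \<open>x # xs @ inverse_letter x # ys\<close> gives the arch from
  \<open>x\<close> to its inverse, the arches of \<open>xs\<close> below it, and those of \<open>ys\<close> to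
  its right.
\<close>

lemma total_arch_system_if_dyck:
  assumes "dyck xs"
  shows "map (the \<circ> W) L = xs \<Longrightarrow> sorted_wrt (<) L \<Longrightarrow> set L \<subseteq> dom W \<Longrightarrow>
    \<exists>A. total_arch_system (W |` set L) A"
  using assms
proof (induction arbitrary: L rule: dyck.induct)
  case dyck_Nil
  then have "total_arch_system (W |` set L) {}"
    by (simp add: total_arch_system_def arch_system_def)
  then show ?case by blast
next
  case (dyck_arch xs ys x)
  obtain i L1 j L2 where L: "L = i # L1 @ j # L2" "the (W i) = x" "map (the \<circ> W) L1 = xs"
    "the (W j) = inverse_letter x" "map (the \<circ> W) L2 = ys"
    using dyck_arch.prems(1) by (auto simp: map_eq_append_conv map_eq_Cons_conv)
  have ord: "sorted_wrt (<) L1" "sorted_wrt (<) L2" "i < j"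
    "\<And>k. k \<in> set L1 \<Longrightarrow> i < k" "\<And>k. k \<in> set L1 \<Longrightarrow> k < j" "\<And>k. k \<in> set L2 \<Longrightarrow> j < k"
    "\<And>k l. k \<in> set L1 \<Longrightarrow> l \<in> set L2 \<Longrightarrow> k < l"
    using dyck_arch.prems(2) by (auto simp: L sorted_wrt_append)
  have Wij: "W i = Some x" "W j = Some (inverse_letter x)"
    using dyck_arch.prems(3) L by auto
  have dom: "dom (W |` set K) = set K" if "set K \<subseteq> set L" for K
    using that dyck_arch.prems(3) by auto
  have sub: "set L1 \<subseteq> set L" "set L2 \<subseteq> set L" using L(1) by auto
  obtain A1 where "total_arch_system (W |` set L1) A1"
    using dyck_arch.IH(1)[OF L(3) ord(1)] sub dyck_arch.prems(3) by blast
  then have A1: "arch_system (W |` set L1) A1" "ends A1 = set L1"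
    unfolding total_arch_system_def using dom[OF sub(1)] by auto
  obtain A2 where "total_arch_system (W |` set L2) A2"
    using dyck_arch.IH(2)[OF L(5) ord(2)] sub dyck_arch.prems(3) by blast
  then have A2: "arch_system (W |` set L2) A2" "ends A2 = set L2"
    unfolding total_arch_system_def using dom[OF sub(2)] by auto
  have in1: "k \<in> set L1" "l \<in> set L1" if "(k, l) \<in> A1" for k l using A1(2) that by force+
  have in2: "k \<in> set L2" "l \<in> set L2" if "(k, l) \<in> A2" for k l using A2(2) that by force+
  have pos1: "i < k \<and> k < l \<and> l < j" if "(k, l) \<in> A1" for k l
    using ord(4)[OF in1(1)[OF that]] ord(5)[OF in1(2)[OF that]] arch_systemD(1)[OF A1(1) that] by blast
  have pos2: "j < k \<and> k < l" if "(k, l) \<in> A2" for k l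
    using ord(6)[OF in2(1)[OF that]] arch_systemD(1)[OF A2(1) that] by blast
  define A where "A = insert (i, j) (A1 \<union> A2)"
  have ends: "ends A = set L" using A1(2) A2(2) L(1) by (auto simp: A_def)
  have cases: "(k = i \<and> l = j) \<or> (k, l) \<in> A1 \<or> (k, l) \<in> A2" if "(k, l) \<in> A" for k l
    using that by (auto simp: A_def)
  have "arch_system (W |` set L) A"
  proof (rule arch_systemI)
    fix k l assume "(k, l) \<in> A"
    from cases[OF this] show "k < l" using ord(3) pos1[of k l] pos2[of k l] by blast
    from cases[OF \<open>(k, l) \<in> A\<close>]
    show "\<exists>x. (W |` set L) k = Some x \<and> (W |` set L) l = Some (inverse_letter x)"
    proof (elim disjE)
      assume "k = i \<and> l = j"
      then show ?thesis using Wij L(1) by simp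
    next
      assume *: "(k, l) \<in> A1"
      show ?thesis using arch_systemD(2)[OF A1(1) *] in1[OF *] L(1) by (simp add: restrict_map_def)
    next
      assume *: "(k, l) \<in> A2"
      show ?thesis using arch_systemD(2)[OF A2(1) *] in2[OF *] L(1) by (simp add: restrict_map_def)
    qed
  next
    fix k l m n assume kl: "(k, l) \<in> A" and mn: "(m, n) \<in> A"
    note pos = pos1[of k l] pos1[of m n] pos2[of k l] pos2[of m n] ord(3)
    show "{k, l} \<inter> {m, n} = {}" if ne: "(k, l) \<noteq> (m, n)"
    proof (cases "(k, l) \<in> A1 \<and> (m, n) \<in> A1 \<or> (k, l) \<in> A2 \<and> (m, n) \<in> A2")
      case True
      then show ?thesis using arch_systemD(3)[OF A1(1) _ _ ne] arch_systemD(3)[OF A2(1) _ _ ne] by blast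
    next
      case False
      then show ?thesis using cases[OF kl] cases[OF mn] ne pos by auto
    qed
    show "\<not> l < n" if kml: "k < m" "m < l"
    proof (cases "(k, l) \<in> A1 \<and> (m, n) \<in> A1 \<or> (k, l) \<in> A2 \<and> (m, n) \<in> A2")
      case True
      then show ?thesis using arch_systemD(4)[OF A1(1) _ _ kml] arch_systemD(4)[OF A2(1) _ _ kml] by blast
    next
      case False
      then show ?thesis using cases[OF kl] cases[OF mn] kml pos by auto
    qed
  next
    fix k l m assume kl: "(k, l) \<in> A" and "m \<in> dom (W |` set L)" and m: "k < m" "m < l"
    then have mL: "m = i \<or> m \<in> set L1 \<or> m = j \<or> m \<in> set L2" using L(1) by auto
    note pos = ord(3) ord(4,5,6)[of m] pos1[of k l] pos2[of k l]
    show "\<exists>n p. (n, p) \<in> A \<and> m \<in> {n, p} \<and> k < n \<and> p < l"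
      using cases[OF kl]
    proof (elim disjE)
      assume 1: "k = i \<and> l = j"
      then have "m \<in> set L1" using mL m pos by auto
      then obtain n p where np: "(n, p) \<in> A1" "m \<in> {n, p}" using A1(2) by force
      then show ?thesis using pos1[OF np(1)] 1 unfolding A_def by blast
    next
      assume 1: "(k, l) \<in> A1"
      then have "m \<in> dom (W |` set L1)" using mL m pos dom[of L1] L(1) by auto
      then show ?thesis using arch_systemD(5)[OF A1(1) 1 _ m] unfolding A_def by blast
    next
      assume 1: "(k, l) \<in> A2"
      then have "m \<in> dom (W |` set L2)" using mL m pos dom[of L2] L(1) by auto
      then show ?thesis using arch_systemD(5)[OF A2(1) 1 _ m] unfolding A_def by blast
    qed
  qed
  then show ?case using ends dom[of L] unfolding total_arch_system_def by auto
qed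

text \<open>
  A total arch system may be restricted to any set of positions that is a union of arches, since the arches
  below a remaining arch keep covering what remains there.
\<close>

lemma total_arch_system_restrict:
  assumes "total_arch_system W A" "\<And>i j. (i, j) \<in> A \<Longrightarrow> i \<in> S \<longleftrightarrow> j \<in> S"
  shows "total_arch_system (W |` S) (A \<inter> S \<times> S)"
proof -
  have A: "arch_system W A" "ends A = dom W" using assms(1) by (auto simp: total_arch_system_def)
  have "arch_system (W |` S) (A \<inter> S \<times> S)"
  proof (rule arch_systemI)
    fix i j k assume ij: "(i, j) \<in> A \<inter> S \<times> S" and "k \<in> dom (W |` S)" and k: "i < k" "k < j"
    then have kS: "k \<in> dom W" "k \<in> S" by auto
    then obtain l m where "(l, m) \<in> A" "k \<in> {l, m}" "i < l" "m < j"
      using arch_systemD(5)[OF A(1), of i j k] ij k by blast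
    moreover from this have "(l, m) \<in> S \<times> S" using assms(2)[of l m] kS by auto
    ultimately show "\<exists>l m. (l, m) \<in> A \<inter> S \<times> S \<and> k \<in> {l, m} \<and> i < l \<and> m < j" by blast
  next
    fix i j assume "(i, j) \<in> A \<inter> S \<times> S"
    then show "i < j" "\<exists>x. (W |` S) i = Some x \<and> (W |` S) j = Some (inverse_letter x)"
      using arch_systemD(1,2)[OF A(1), of i j] by auto
  next
    fix i j k l assume "(i, j) \<in> A \<inter> S \<times> S" "(k, l) \<in> A \<inter> S \<times> S"
    then show "(i, j) \<noteq> (k, l) \<Longrightarrow> {i, j} \<inter> {k, l} = {}" "i < k \<Longrightarrow> k < j \<Longrightarrow> \<not> j < l"
      using arch_systemD(3,4)[OF A(1), of i j k l] by auto
  qed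
  moreover have "ends (A \<inter> S \<times> S) = dom (W |` S)"
  proof -
    have "ends (A \<inter> S \<times> S) = ends A \<inter> S" using assms(2) by (fastforce simp: image_iff)
    then show ?thesis using A(2) by simp
  qed
  ultimately show ?thesis by (simp add: total_arch_system_def)
qed

lemma total_arch_system_level_if_val_zero:
  assumes "restricted W" "val W N = 0"
  shows "\<exists>A. total_arch_system (W |` level N W) A"
proof -
  define L where "L = sorted_list_of_set (level N W)"
  have fin: "finite (level N W)" using finite_level[OF assms(1)] .
  have "sum_list (map letter (map (the \<circ> W) L)) = 0"
    using assms(2) by (simp add: val_def ordered_sum_def L_def o_def)
  then have "dyck (map (the \<circ> W) L)" by (rule dyck_if_sum_zero)
  then have "\<exists>A. total_arch_system (W |` set L) A"
    using level_subset_dom[of N W] fin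
    by (intro total_arch_system_if_dyck[OF _ refl]) (auto simp: L_def)
  then show ?thesis using fin by (simp add: L_def)
qed

text \<open>
  A compactness argument in the manner of Koenig's lemma. Every truncation has a total arch system by the
  finite case, there are only finitely many on each level, and those of higher levels restrict to lower ones. A
  coherent choice exists, and its union is a total arch system of the whole word.
\<close>

lemma total_arch_system_if_val_zero:
  assumes res: "restricted W" and "val W = 0"
  shows "\<exists>A. total_arch_system W A"
proof -
  define T where "T N = W |` level N W" for N
  define sq where "sq N = level N W \<times> level N W" for N
  have mono: "level K W \<subseteq> level N W" if "K \<le> N" for K N using that by (auto simp: level_def)
  have down: "total_arch_system (T K) (A \<inter> sq K)" if "total_arch_system (T N) A" "K \<le> N" for A K N
  proof -
    have "i \<in> level K W \<longleftrightarrow> j \<in> level K W" if "(i, j) \<in> A" for i j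
    proof -
      have "i \<in> level K (T N) \<longleftrightarrow> j \<in> level K (T N)"
        using \<open>total_arch_system (T N) A\<close> arch_system_level[OF _ that] by (auto simp: total_arch_system_def)
      then show ?thesis using mono[OF \<open>K \<le> N\<close>] by (auto simp: T_def level_restrict_map)
    qed
    then have "total_arch_system (T N |` level K W) (A \<inter> sq K)"
      unfolding sq_def by (intro total_arch_system_restrict that(1))
    moreover have "T N |` level K W = T K" using mono[OF that(2)] by (simp add: T_def Int_absorb1)
    ultimately show ?thesis by simp
  qed
  \<comment> \<open>the finite arch systems that extend to every higher level\<close>
  define good where "good K M \<longleftrightarrow> (\<forall>N\<ge>K. \<exists>A. total_arch_system (T N) A \<and> A \<inter> sq K = M)" for K M
  have "\<exists>M. \<forall>K. good K (M K) \<and> M (Suc K) \<inter> sq K = M K"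
  proof (rule dependent_nat_choice)
    show "\<exists>M. good 0 M"
      using total_arch_system_level_if_val_zero[OF res] assms(2)
      by (auto simp: good_def sq_def level_def T_def)
  next
    fix M K assume "good K M"
    then have "\<forall>N. \<exists>A. N \<ge> K \<longrightarrow> total_arch_system (T N) A \<and> A \<inter> sq K = M"
      by (auto simp: good_def)
    then obtain A where A: "\<And>N. N \<ge> K \<Longrightarrow> total_arch_system (T N) (A N) \<and> A N \<inter> sq K = M" by metis
    have "finite (Pow (sq (Suc K)))" using finite_level[OF res] by (simp add: sq_def)
    then have "finite ((\<lambda>N. A N \<inter> sq (Suc K)) ` {Suc K..})"
      by (rule rev_finite_subset) auto
    then obtain N0 where N0: "infinite {N \<in> {Suc K..}. A N \<inter> sq (Suc K) = A N0 \<inter> sq (Suc K)}"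
      using pigeonhole_infinite[of "{Suc K..}" "\<lambda>N. A N \<inter> sq (Suc K)"] infinite_Ici by blast
    define M' where "M' = A N0 \<inter> sq (Suc K)"
    have inf: "\<exists>N'\<ge>N. N' \<ge> Suc K \<and> A N' \<inter> sq (Suc K) = M'" for N
      using N0 unfolding infinite_nat_iff_unbounded_le M'_def by auto
    have sqle: "sq K \<subseteq> sq N" if "K \<le> N" for K N using mono[OF that] by (auto simp: sq_def)
    have "good (Suc K) M'"
      unfolding good_def
    proof (intro allI impI)
      fix N assume N: "Suc K \<le> N"
      obtain N' where N': "N' \<ge> N" "A N' \<inter> sq (Suc K) = M'" using inf by blast
      have "total_arch_system (T N) (A N' \<inter> sq N)" using A[of N'] N N' by (intro down[of N']) auto
      moreover have "A N' \<inter> sq N \<inter> sq (Suc K) = M'" using N'(2) sqle[OF N] by auto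
      ultimately show "\<exists>A. total_arch_system (T N) A \<and> A \<inter> sq (Suc K) = M'" by blast
    qed
    moreover have "M' \<inter> sq K = M"
    proof -
      obtain N' where N': "N' \<ge> Suc K" "A N' \<inter> sq (Suc K) = M'" using inf by blast
      then show ?thesis using A[of N'] sqle[of K "Suc K"] by auto
    qed
    ultimately show "\<exists>M'. good (Suc K) M' \<and> M' \<inter> sq K = M" by blast
  qed
  then obtain M where M: "\<And>K. good K (M K)" "\<And>K. M (Suc K) \<inter> sq K = M K" by blast
  have tot: "total_arch_system (T K) (M K)" for K
  proof -
    obtain A where A: "total_arch_system (T K) A" "A \<inter> sq K = M K"
      using M(1)[of K] by (auto simp: good_def)
    have "M K = A \<inter> sq K" using A by simp
    then show ?thesis using down[OF A(1), of K] by simp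
  qed
  have arch: "arch_system (T K) (M K)" and ends: "ends (M K) = level K W" for K
  proof -
    show "arch_system (T K) (M K)" using tot[of K] by (simp add: total_arch_system_def)
    have "ends (M K) = dom (T K)" using tot[of K] by (simp add: total_arch_system_def)
    then show "ends (M K) = level K W" using level_subset_dom[of K W] by (auto simp: T_def)
  qed
  have inc: "M K \<subseteq> M N" if "K \<le> N" for K N
    using that by (rule lift_Suc_mono_le[rotated]) (use M(2) in blast)
  define A where "A = (\<Union>K. M K)"
  \<comment> \<open>every instance of an arch axiom concerns finitely many arches and letters, hence takes place on some level\<close>
  have two: "\<exists>K. p \<in> M K \<and> q \<in> M K \<and> k \<in> level K W" if pq: "p \<in> A" "q \<in> A" "k \<in> dom W" for p q k
  proof -
    obtain K1 where K1: "p \<in> M K1" using pq(1) unfolding A_def by blast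
    obtain K2 where K2: "q \<in> M K2" using pq(2) unfolding A_def by blast
    note K = K1 K2
    obtain a where "W k = Some a" using pq by auto
    then have "k \<in> level (Suc (letter_index a)) W" by (simp add: level_def)
    moreover define K3 where "K3 = Max {K1, K2, Suc (letter_index a)}"
    moreover have "K1 \<le> K3" "K2 \<le> K3" "Suc (letter_index a) \<le> K3" by (auto simp: K3_def)
    ultimately show ?thesis using K inc mono by blast
  qed
  have two': "\<exists>K. p \<in> M K \<and> q \<in> M K" if pq: "p \<in> A" "q \<in> A" for p q
  proof -
    obtain K1 where K1: "p \<in> M K1" using pq(1) unfolding A_def by blast
    obtain K2 where K2: "q \<in> M K2" using pq(2) unfolding A_def by blast
    show ?thesis using K1 K2 inc[of K1 "max K1 K2"] inc[of K2 "max K1 K2"] by auto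
  qed
  have "arch_system W A"
  proof (rule arch_systemI)
    fix i j assume "(i, j) \<in> A"
    then obtain K where K: "(i, j) \<in> M K" by (auto simp: A_def)
    show "i < j" by (rule arch_systemD(1)[OF arch K])
    show "\<exists>x. W i = Some x \<and> W j = Some (inverse_letter x)"
      using arch_systemD(2)[OF arch K] by (auto simp: T_def restrict_map_def split: if_splits)
  next
    fix i j k l assume "(i, j) \<in> A" "(k, l) \<in> A"
    then obtain K where K: "(i, j) \<in> M K" "(k, l) \<in> M K" using two' by blast
    show "(i, j) \<noteq> (k, l) \<Longrightarrow> {i, j} \<inter> {k, l} = {}" by (rule arch_systemD(3)[OF arch K])
    show "i < k \<Longrightarrow> k < j \<Longrightarrow> \<not> j < l" by (rule arch_systemD(4)[OF arch K])
  next
    fix i j k assume "(i, j) \<in> A" "k \<in> dom W" and k: "i < k" "k < j"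
    then obtain K where K: "(i, j) \<in> M K" "k \<in> level K W" using two by blast
    then have "k \<in> dom (T K)" using level_subset_dom[of K W] by (auto simp: T_def)
    then obtain l m where "(l, m) \<in> M K" "k \<in> {l, m}" "i < l" "m < j"
      using arch_systemD(5)[OF arch K(1)] k by blast
    then show "\<exists>l m. (l, m) \<in> A \<and> k \<in> {l, m} \<and> i < l \<and> m < j" by (auto simp: A_def)
  qed
  moreover have "ends A = dom W"
  proof -
    have "ends A = (\<Union>K. ends (M K))" by (auto simp: A_def)
    also have "\<dots> = (\<Union>K. level K W)" using ends by simp
    also have "\<dots> = dom W" by (auto simp: level_def)
    finally show ?thesis .
  qed
  ultimately show ?thesis unfolding total_arch_system_def by blast
qed

section \<open>Reduced forms\<close>

lemma maximal_arch_system_exists: "\<exists>A. maximal_arch_system W A"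
proof -
  have "\<exists>M\<in>{A. arch_system W A}. \<forall>X\<in>{A. arch_system W A}. M \<subseteq> X \<longrightarrow> X = M"
  proof (rule subset_Zorn')
    fix C assume C: "subset.chain {A. arch_system W A} C"
    then have arch: "arch_system W A" if "A \<in> C" for A using that by (auto simp: subset.chain_def)
    have two: "\<exists>A\<in>C. p \<in> A \<and> q \<in> A" if "p \<in> \<Union>C" "q \<in> \<Union>C" for p q
      using that C unfolding subset.chain_def by blast
    have "arch_system W (\<Union>C)"
    proof (rule arch_systemI)
      fix i j assume "(i, j) \<in> \<Union>C"
      then obtain A where "A \<in> C" "(i, j) \<in> A" by blast
      then show "i < j" "\<exists>x. W i = Some x \<and> W j = Some (inverse_letter x)"
        using arch_systemD(1,2)[OF arch] by blast+
    next
      fix i j k l assume "(i, j) \<in> \<Union>C" "(k, l) \<in> \<Union>C"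
      then obtain A where A: "A \<in> C" "(i, j) \<in> A" "(k, l) \<in> A" using two by blast
      show "(i, j) \<noteq> (k, l) \<Longrightarrow> {i, j} \<inter> {k, l} = {}" "i < k \<Longrightarrow> k < j \<Longrightarrow> \<not> j < l"
        using arch_systemD(3,4)[OF arch[OF A(1)] A(2,3)] by blast+
    next
      fix i j k assume "(i, j) \<in> \<Union>C" "k \<in> dom W" "i < k" "k < j"
      then obtain A where A: "A \<in> C" "(i, j) \<in> A" by blast
      then show "\<exists>l m. (l, m) \<in> \<Union>C \<and> k \<in> {l, m} \<and> i < l \<and> m < j"
        using arch_systemD(5)[OF arch[OF A(1)] A(2) \<open>k \<in> dom W\<close> \<open>i < k\<close> \<open>k < j\<close>] by blast
    qed
    then show "\<Union>C \<in> {A. arch_system W A}" by simp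
  qed
  then show ?thesis unfolding maximal_arch_system_def by blast
qed

text \<open>
  Two arches cannot cross here because an arch of the first system has only ends of that system below it: it
  contains no letter of the residue, so an arch of the residue either encloses it or is disjoint from it.
\<close>

lemma arch_system_Un_residue:
  assumes A: "arch_system W A" and B: "arch_system (W |` (- ends A)) B"
  shows "arch_system W (A \<union> B)"
proof -
  have inB: "i \<in> dom W" "i \<notin> ends A" "j \<in> dom W" "j \<notin> ends A" if "(i, j) \<in> B" for i j
    using arch_systemD(2)[OF B that] by (auto simp: restrict_map_def split: if_splits)
  have inA: "i \<in> ends A" "j \<in> ends A" "i \<in> dom W" "j \<in> dom W" if "(i, j) \<in> A" for i j
    using that arch_system_dom[OF A that] by force+
  have noAB: False if "(i, j) \<in> A" "k \<in> dom W" "k \<notin> ends A" "i < k" "k < j" for i j k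
    using arch_systemD(5)[OF A that(1,2,4,5)] inA that(3) by blast
  have BA: "\<exists>l m. (l, m) \<in> A \<and> k \<in> {l, m} \<and> i < l \<and> m < j"
    if B': "(i, j) \<in> B" "k \<in> ends A" "i < k" "k < j" for i j k
  proof -
    obtain l m where lm: "(l, m) \<in> A" "k \<in> {l, m}" using B'(2) by force
    have "l < m" "l \<noteq> i" "m \<noteq> j" "l \<noteq> j" "m \<noteq> i" using arch_systemD(1)[OF A lm(1)] inA[OF lm(1)] inB[OF B'(1)] by auto
    moreover have "\<not> (l < i \<and> i < m)" "\<not> (l < j \<and> j < m)" using noAB[OF lm(1)] inB[OF B'(1)] by blast+
    ultimately have "i < l" "m < j" using lm(2) B'(3,4) by auto
    then show ?thesis using lm by blast
  qed
  show ?thesis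
  proof (rule arch_systemI)
    fix i j assume "(i, j) \<in> A \<union> B"
    then show "i < j" using arch_systemD(1)[OF A] arch_systemD(1)[OF B] by blast
    show "\<exists>x. W i = Some x \<and> W j = Some (inverse_letter x)"
      using \<open>(i, j) \<in> A \<union> B\<close> arch_systemD(2)[OF A, of i j] arch_systemD(2)[OF B, of i j]
      by (auto simp: restrict_map_def split: if_splits)
  next
    fix i j k l assume ij: "(i, j) \<in> A \<union> B" and kl: "(k, l) \<in> A \<union> B"
    show "{i, j} \<inter> {k, l} = {}" if "(i, j) \<noteq> (k, l)"
    proof (cases "(i, j) \<in> A \<longleftrightarrow> (k, l) \<in> A")
      case True
      then show ?thesis using ij kl that arch_systemD(3)[OF A] arch_systemD(3)[OF B] by blast
    next
      case False
      then show ?thesis using ij kl inA inB by blast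
    qed
    show "\<not> j < l" if lt: "i < k" "k < j"
    proof
      assume jl: "j < l"
      consider "(i, j) \<in> A" "(k, l) \<in> A" | "(i, j) \<in> B" "(k, l) \<in> B"
        | "(i, j) \<in> A" "(k, l) \<in> B" | "(i, j) \<in> B" "(k, l) \<in> A"
        using ij kl by blast
      then show False
      proof cases
        case 1 then show ?thesis using arch_systemD(4)[OF A] lt jl by blast
      next
        case 2 then show ?thesis using arch_systemD(4)[OF B] lt jl by blast
      next
        case 3
        then show ?thesis using noAB[OF 3(1) inB(1,2)[OF 3(2)] lt] by blast
      next
        case 4
        then show ?thesis using noAB[OF 4(2) inB(3,4)[OF 4(1)] lt(2) jl] by blast
      qed
    qed
  next
    fix i j k assume ij: "(i, j) \<in> A \<union> B" and k: "k \<in> dom W" "i < k" "k < j"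
    show "\<exists>l m. (l, m) \<in> A \<union> B \<and> k \<in> {l, m} \<and> i < l \<and> m < j"
    proof (cases "(i, j) \<in> A")
      case True
      then show ?thesis using arch_systemD(5)[OF A True k] by blast
    next
      case False
      then have ijB: "(i, j) \<in> B" using ij by blast
      show ?thesis
      proof (cases "k \<in> ends A")
        case True
        then show ?thesis using BA[OF ijB True k(2,3)] by blast
      next
        case False
        then have "k \<in> dom (W |` (- ends A))" using k(1) by simp
        then show ?thesis using arch_systemD(5)[OF B ijB _ k(2,3)] by blast
      qed
    qed
  qed
qed

lemma reduced_if_maximal:
  assumes "maximal_arch_system W A" shows "reduced (W |` (- ends A))"
  unfolding reduced_def
proof (intro allI impI)
  fix B assume B: "arch_system (W |` (- ends A)) B"
  have "arch_system W (A \<union> B)" using assms B by (intro arch_system_Un_residue) (auto simp: maximal_arch_system_def)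
  then have "A \<union> B = A" using assms by (auto simp: maximal_arch_system_def)
  moreover have "B \<inter> A = {}"
  proof -
    have "i \<notin> ends A" if "(i, j) \<in> B" for i j
      using arch_systemD(2)[OF B that] by (auto simp: restrict_map_def split: if_splits)
    then show ?thesis by force
  qed
  ultimately show "B = {}" by blast
qed

lemma reduced_form_exists: "\<exists>V. reduced_form W V"
  unfolding reduced_form_def using maximal_arch_system_exists[of W] by blast

lemma reduced_formD:
  assumes "reduced_form W V"
  shows "reduced V" "V = W |` dom V" "restricted W \<Longrightarrow> restricted V"
proof -
  obtain A where A: "maximal_arch_system W A" "V = W |` (- ends A)"
    using assms unfolding reduced_form_def by blast
  show "reduced V" using A reduced_if_maximal by blast
  show "V = W |` dom V" unfolding A(2) by (rule restrict_map_dom_restrict[symmetric])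
  show "restricted W \<Longrightarrow> restricted V" using A(2) restricted_restrict_map by blast
qed

lemma val_reduced_form:
  assumes "reduced_form W V" "restricted W" shows "val V = val W"
  using assms val_delete_arches unfolding reduced_form_def maximal_arch_system_def by blast

(* Membership in the domain of a word is a premise of most rules below and is kept folded. *)
declare domIff [iff del]

lemma level_imp_dom: "i \<in> level N W \<Longrightarrow> i \<in> dom W"
  by (auto simp: level_def domIff)

section \<open>Words indexed by real numbers\<close>

text \<open>
  Give the elements of \<open>I\<close> the lengths 1/2, 1/4, 1/8 and so on along an enumeration, and let each
  interval begin at the total length of its predecessors in the given order.
\<close>

lemma disjoint_intervals_exist:
  fixes I :: "'i::linorder set"
  assumes "countable I"
  shows "\<exists>a b :: 'i \<Rightarrow> real. (\<forall>i\<in>I. 0 \<le> a i \<and> a i < b i \<and> b i \<le> 1) \<and>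
    (\<forall>i\<in>I. \<forall>j\<in>I. i < j \<longrightarrow> b i \<le> a j)"
proof -
  define e where "e = to_nat_on I"
  have e: "inj_on e I" unfolding e_def by (rule inj_on_to_nat_on[OF assms])
  define w :: "nat \<Rightarrow> real" where "w n = (1/2) ^ Suc n" for n
  have w1: "w sums 1" unfolding w_def using power_half_series .
  have wpos: "w n > 0" for n by (simp add: w_def)
  define F where "F S = (\<Sum>n. if n \<in> S then w n else 0)" for S :: "nat set"
  have sm: "summable (\<lambda>n. if n \<in> S then w n else 0)" for S
    by (rule summable_comparison_test'[where g=w and N=0])
      (use w1 wpos in \<open>auto simp: sums_iff less_imp_le\<close>)
  have mono: "F S \<le> F T" if "S \<subseteq> T" for S T
    unfolding F_def by (rule suminf_le[OF _ sm sm]) (use that wpos in \<open>auto simp: less_imp_le\<close>)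
  have F0: "0 \<le> F S" for S
    unfolding F_def by (rule suminf_nonneg[OF sm]) (use wpos in \<open>auto simp: less_imp_le\<close>)
  have F1: "F S \<le> 1" for S
  proof -
    have "F S \<le> F UNIV" by (rule mono) simp
    also have "F UNIV = 1" using w1 by (simp add: F_def sums_iff)
    finally show ?thesis .
  qed
  have Fins: "F (insert m S) = F S + w m" if "m \<notin> S" for m S
  proof -
    have "(\<lambda>n. if n = m then w n else 0) sums w m" by (rule sums_single)
    then have "(\<lambda>n. (if n \<in> S then w n else 0) + (if n = m then w n else 0)) sums (F S + w m)"
      unfolding F_def by (intro sums_add summable_sums sm)
    moreover have "(\<lambda>n. (if n \<in> S then w n else 0) + (if n = m then w n else 0))
        = (\<lambda>n. if n \<in> insert m S then w n else 0)"
      using that by auto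
    ultimately show ?thesis unfolding F_def by (simp add: sums_iff)
  qed
  define a where "a i = F (e ` {k\<in>I. k < i})" for i
  define b where "b i = a i + w (e i)" for i
  have b: "b i = F (insert (e i) (e ` {k\<in>I. k < i}))" if "i \<in> I" for i
  proof -
    have "e i \<notin> e ` {k\<in>I. k < i}" using e that by (auto dest: inj_onD)
    then show ?thesis by (simp add: b_def a_def Fins)
  qed
  show ?thesis
  proof (intro exI conjI ballI impI)
    fix i j assume ij: "i \<in> I" "j \<in> I" "i < j"
    show "b i \<le> a j" unfolding b[OF ij(1)] a_def by (rule mono) (use ij in auto)
  next
    fix i assume i: "i \<in> I"
    show "0 \<le> a i" unfolding a_def by (rule F0)
    show "a i < b i" unfolding b_def using wpos by simp
    show "b i \<le> 1" unfolding b[OF i] by (rule F1)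
  qed
qed

lemma reindex_word:
  fixes W :: "('i::linorder, 'x) word" and \<phi> :: "'i \<Rightarrow> 'j::linorder"
  assumes "strict_mono_on (dom W) \<phi>"
  obtains V where "word_equiv W V" "dom V = \<phi> ` dom W" "\<And>i. i \<in> dom W \<Longrightarrow> V (\<phi> i) = W i"
proof -
  have inj: "inj_on \<phi> (dom W)" using assms by (rule strict_mono_on_imp_inj_on)
  define V where "V y = (if y \<in> \<phi> ` dom W then W (the_inv_into (dom W) \<phi> y) else None)" for y
  have V: "V (\<phi> i) = W i" if "i \<in> dom W" for i
    using that the_inv_into_f_f[OF inj that] by (simp add: V_def)
  have "dom V = \<phi> ` dom W"
  proof (intro equalityI subsetI)
    fix y assume "y \<in> dom V" then show "y \<in> \<phi> ` dom W" by (auto simp: V_def domIff split: if_splits)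
  next
    fix y assume "y \<in> \<phi> ` dom W"
    then obtain i where "i \<in> dom W" "y = \<phi> i" by blast
    then show "y \<in> dom V" using V[of i] by (simp add: domIff)
  qed
  moreover from this have "word_equiv W V"
    unfolding word_equiv_def using assms inj V by (intro exI[of _ \<phi>]) (simp add: bij_betw_def)
  ultimately show thesis using that V by blast
qed

text \<open>
  Every countable word has a copy indexed by reals between 0 and 1. Reversal and concatenation of such words
  are reflection and translation of real numbers.
\<close>

definition unit_word :: "(real, 'x) word \<Rightarrow> bool" where
  "unit_word W \<longleftrightarrow> dom W \<subseteq> {0<..<1}"

lemma unit_word_exists:
  fixes W :: "('i::linorder, 'x) word"
  assumes "countable (dom W)"
  obtains V where "unit_word V" "word_equiv W V"
proof -
  obtain a b :: "'i \<Rightarrow> real" where ab: "\<forall>i\<in>dom W. 0 \<le> a i \<and> a i < b i \<and> b i \<le> 1"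
    "\<forall>i\<in>dom W. \<forall>j\<in>dom W. i < j \<longrightarrow> b i \<le> a j"
    using disjoint_intervals_exist[OF assms] by blast
  define \<phi> where "\<phi> i = (a i + b i) / 2" for i
  have "strict_mono_on (dom W) \<phi>"
  proof (rule strict_mono_onI)
    fix i j assume "i \<in> dom W" "j \<in> dom W" "i < j"
    then have "a i < b i" "b i \<le> a j" "a j < b j" using ab by blast+
    then show "\<phi> i < \<phi> j" by (simp add: \<phi>_def)
  qed
  then obtain V where V: "word_equiv W V" "dom V = \<phi> ` dom W" by (rule reindex_word)
  have "\<phi> i \<in> {0<..<1}" if "i \<in> dom W" for i
  proof -
    have "0 \<le> a i" "a i < b i" "b i \<le> 1" using ab that by blast+
    then show ?thesis by (simp add: \<phi>_def)
  qed
  then have "unit_word V" using V(2) by (auto simp: unit_word_def)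
  then show thesis using that V(1) by blast
qed

definition inverse_word :: "(real, 'x) word \<Rightarrow> (real, 'x) word" where
  "inverse_word W t = map_option inverse_letter (W (1 - t))"

lemma dom_inverse_word: "dom (inverse_word W) = (\<lambda>t. 1 - t) ` dom W"
  by (force simp: inverse_word_def image_iff domIff)

lemma unit_inverse_word: "unit_word W \<Longrightarrow> unit_word (inverse_word W)"
  unfolding unit_word_def dom_inverse_word by auto

lemma level_inverse_word: "level N (inverse_word W) = (\<lambda>t. 1 - t) ` level N W"
proof (intro equalityI subsetI)
  fix t assume "t \<in> level N (inverse_word W)"
  then have "1 - t \<in> level N W" by (auto simp: level_def inverse_word_def)
  then show "t \<in> (\<lambda>t. 1 - t) ` level N W" by (rule rev_image_eqI) simp
qed (auto simp: level_def inverse_word_def)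

lemma restricted_inverse_word:
  fixes W :: "(real, gen) word" shows "restricted W \<Longrightarrow> restricted (inverse_word W)"
  by (intro restricted_if_finite_levels) (simp add: level_inverse_word finite_level)

lemma val_inverse_word:
  assumes "restricted W" shows "val (inverse_word W) = - val W"
proof
  fix N
  have "ordered_sum (\<lambda>i. letter (the (inverse_word W i))) ((\<lambda>t. 1 - t) ` level N W)
      = - ordered_sum (\<lambda>i. letter (the (W i))) (level N W)"
  proof (rule ordered_sum_strict_antimono)
    fix i assume "i \<in> level N W"
    then show "letter (the (inverse_word W (1 - i))) = - letter (the (W i))"
      by (auto simp: level_def inverse_word_def letter_inverse)
  qed (simp_all add: finite_level[OF assms])
  then show "val (inverse_word W) N = (- val W) N"
    by (simp add: val_def level_inverse_word)
qed

text \<open>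
  The \<open>m\<close>-th word of the list occupies the unit interval that begins at \<open>m\<close>.
\<close>

definition cat :: "(real, 'x) word list \<Rightarrow> (real, 'x) word" where
  "cat Ws t = (if 0 \<le> t \<and> nat \<lfloor>t\<rfloor> < length Ws then (Ws ! nat \<lfloor>t\<rfloor>) (frac t) else None)"

lemma cat_eq: "0 \<le> u \<Longrightarrow> u < 1 \<Longrightarrow> m < length Ws \<Longrightarrow> cat Ws (real m + u) = (Ws ! m) u"
proof -
  assume "0 \<le> u" "u < 1" "m < length Ws"
  moreover from this have "\<lfloor>real m + u\<rfloor> = int m" by linarith
  ultimately show ?thesis by (simp add: cat_def frac_def)
qed

lemma dom_cat:
  assumes "\<And>W. W \<in> set Ws \<Longrightarrow> unit_word W"
  shows "dom (cat Ws) = (\<Union>m<length Ws. (\<lambda>u. real m + u) ` dom (Ws ! m))"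
proof (intro equalityI subsetI)
  fix t assume t: "t \<in> dom (cat Ws)"
  define m where "m = nat \<lfloor>t\<rfloor>"
  have "0 \<le> t" "m < length Ws" "frac t \<in> dom (Ws ! m)"
    using t by (auto simp: cat_def m_def domIff split: if_splits)
  moreover from this have "t = real m + frac t" by (simp add: m_def frac_def)
  ultimately show "t \<in> (\<Union>m<length Ws. (\<lambda>u. real m + u) ` dom (Ws ! m))" by blast
next
  fix t assume "t \<in> (\<Union>m<length Ws. (\<lambda>u. real m + u) ` dom (Ws ! m))"
  then obtain m u where m: "m < length Ws" "u \<in> dom (Ws ! m)" "t = real m + u" by blast
  then have "0 \<le> u" "u < 1" using assms[of "Ws ! m"] by (auto simp: unit_word_def)
  then show "t \<in> dom (cat Ws)" using m cat_eq[of u m Ws] by (simp add: domIff)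
qed

lemma level_cat_snoc:
  assumes "\<And>W. W \<in> set Ws \<Longrightarrow> unit_word W" "unit_word W"
  shows "level N (cat (Ws @ [W])) = level N (cat Ws) \<union> (\<lambda>u. real (length Ws) + u) ` level N W"
    and "t \<in> level N (cat Ws) \<Longrightarrow> t < real (length Ws)"
    and "t \<in> level N (cat Ws) \<Longrightarrow> cat (Ws @ [W]) t = cat Ws t"
proof -
  have 1: "cat (Ws @ [W]) t = cat Ws t" "t < real (length Ws)" if t: "t \<in> dom (cat Ws)" for t
  proof -
    have "0 \<le> t" "nat \<lfloor>t\<rfloor> < length Ws" using t by (auto simp: cat_def domIff split: if_splits)
    then show "cat (Ws @ [W]) t = cat Ws t" "t < real (length Ws)"
      by (simp add: cat_def nth_append, linarith)
  qed
  show "t \<in> level N (cat Ws) \<Longrightarrow> t < real (length Ws)"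
    and "t \<in> level N (cat Ws) \<Longrightarrow> cat (Ws @ [W]) t = cat Ws t"
    using 1 level_subset_dom[of N "cat Ws"] by blast+
  have new: "cat (Ws @ [W]) (real (length Ws) + u) = W u" if "u \<in> dom W" for u
    using that assms(2) cat_eq[of u "length Ws" "Ws @ [W]"] by (auto simp: unit_word_def)
  show "level N (cat (Ws @ [W])) = level N (cat Ws) \<union> (\<lambda>u. real (length Ws) + u) ` level N W"
  proof (intro equalityI subsetI)
    fix t assume t: "t \<in> level N (cat (Ws @ [W]))"
    then have "t \<in> dom (cat (Ws @ [W]))" by (rule level_imp_dom)
    then obtain m u where m: "m \<le> length Ws" "u \<in> dom ((Ws @ [W]) ! m)" "t = real m + u"
      using assms by (subst (asm) dom_cat) (auto simp: less_Suc_eq_le)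
    show "t \<in> level N (cat Ws) \<union> (\<lambda>u. real (length Ws) + u) ` level N W"
    proof (cases "m = length Ws")
      case True
      then have "u \<in> dom W" using m(2) by simp
      from new[OF this] have "u \<in> level N W" using t m(3) True by (simp add: level_def)
      then show ?thesis using m(3) True by blast
    next
      case False
      then have "m < length Ws" "u \<in> dom (Ws ! m)" using m by (auto simp: nth_append)
      then have "t \<in> dom (cat Ws)" using m(3) by (subst dom_cat[OF assms(1)]) auto
      from 1(1)[OF this] have "t \<in> level N (cat Ws)" using t by (simp add: level_def)
      then show ?thesis by blast
    qed
  next
    fix t assume "t \<in> level N (cat Ws) \<union> (\<lambda>u. real (length Ws) + u) ` level N W"
    then show "t \<in> level N (cat (Ws @ [W]))"
    proof
      assume *: "t \<in> level N (cat Ws)"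
      then have "t \<in> dom (cat Ws)" by (rule level_imp_dom)
      from 1(1)[OF this] * show ?thesis by (simp add: level_def)
    next
      assume "t \<in> (\<lambda>u. real (length Ws) + u) ` level N W"
      then obtain u where u: "u \<in> level N W" "t = real (length Ws) + u" by blast
      from new[OF level_imp_dom[OF u(1)]] u show ?thesis by (simp add: level_def)
    qed
  qed
qed

lemma cat_Nil [simp]: "cat [] = Map.empty"
  by (rule ext) (simp add: cat_def)

lemma restricted_cat:
  fixes Ws :: "(real, gen) word list"
  assumes "\<And>W. W \<in> set Ws \<Longrightarrow> unit_word W \<and> restricted W"
  shows "restricted (cat Ws)"
proof (rule restricted_if_finite_levels)
  fix N show "finite (level N (cat Ws))"
    using assms
  proof (induction Ws rule: rev_induct)
    case Nil
    then show ?case by (simp add: level_def)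
  next
    case (snoc W Ws)
    then show ?case by (subst level_cat_snoc) (auto intro: finite_level)
  qed
qed

lemma val_cat:
  assumes "\<And>W. W \<in> set Ws \<Longrightarrow> unit_word W \<and> restricted W"
  shows "val (cat Ws) = sum_list (map val Ws)"
  using assms
proof (induction Ws rule: rev_induct)
  case Nil
  then show ?case by simp
next
  case (snoc W Ws)
  have u: "unit_word V" if "V \<in> set Ws" for V using snoc.prems that by simp
  have W: "unit_word W" "restricted W" using snoc.prems by simp_all
  note lev = level_cat_snoc[OF u W(1)]
  have "val (cat (Ws @ [W])) N = (val (cat Ws) + val W) N" for N
  proof -
    let ?U = "cat (Ws @ [W])" let ?f = "\<lambda>i. letter (the (?U i))"
    have "val ?U N = ordered_sum ?f (level N (cat Ws) \<union> (\<lambda>u. real (length Ws) + u) ` level N W)"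
      unfolding val_def by (subst lev(1)) auto
    also have "\<dots> = ordered_sum ?f (level N (cat Ws)) + ordered_sum ?f ((\<lambda>u. real (length Ws) + u) ` level N W)"
    proof (rule ordered_sum_Un)
      show "finite (level N (cat Ws))" using snoc.prems by (intro finite_level restricted_cat) auto
      show "finite ((\<lambda>u. real (length Ws) + u) ` level N W)" using W by (simp add: finite_level)
      fix s t assume s: "s \<in> level N (cat Ws)" "t \<in> (\<lambda>u. real (length Ws) + u) ` level N W"
      then obtain u where "u \<in> level N W" "t = real (length Ws) + u" by blast
      moreover from this have "0 < u" using W(1) level_subset_dom[of N W] by (auto simp: unit_word_def)
      ultimately show "s < t" using lev(2)[OF _ s(1)] by simp
    qed
    also have "ordered_sum ?f (level N (cat Ws)) = val (cat Ws) N"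
      unfolding val_def by (rule ordered_sum_cong) (auto simp: lev(3))
    also have "ordered_sum ?f ((\<lambda>u. real (length Ws) + u) ` level N W) = val W N"
      unfolding val_def
    proof (rule ordered_sum_strict_mono)
      show "strict_mono_on (level N W) (\<lambda>u. real (length Ws) + u)" by (rule strict_mono_onI) simp
      fix i assume "i \<in> level N W"
      then have "0 \<le> i" "i < 1" using W(1) level_subset_dom[of N W] by (auto simp: unit_word_def)
      then show "letter (the (?U (real (length Ws) + i))) = letter (the (W i))"
        using cat_eq[of i "length Ws" "Ws @ [W]"] by simp
    qed (use W in \<open>simp add: finite_level\<close>)
    finally show ?thesis by simp
  qed
  then have "val (cat (Ws @ [W])) = val (cat Ws) + val W" by (rule ext)
  then show ?case using snoc by simp
qed

section \<open>Reduced words with the same value\<close>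

lemma arch_system_restrict_convex:
  assumes A: "arch_system W A" and J: "convex_in (dom W) J"
  shows "arch_system (W |` J) (A \<inter> J \<times> J)"
proof (rule arch_systemI)
  fix i j k assume ij: "(i, j) \<in> A \<inter> J \<times> J" and "k \<in> dom (W |` J)" and k: "i < k" "k < j"
  then obtain l m where lm: "(l, m) \<in> A" "k \<in> {l, m}" "i < l" "m < j"
    using arch_systemD(5)[OF A, of i j k] by auto
  have "l < m" using arch_systemD(1)[OF A lm(1)] .
  then have "l \<in> J" "m \<in> J"
    using J ij lm arch_system_dom[OF A lm(1)] unfolding convex_in_def by (auto intro: less_trans)
  then show "\<exists>l m. (l, m) \<in> A \<inter> J \<times> J \<and> k \<in> {l, m} \<and> i < l \<and> m < j" using lm by blast
next
  fix i j assume "(i, j) \<in> A \<inter> J \<times> J"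
  then show "i < j" "\<exists>x. (W |` J) i = Some x \<and> (W |` J) j = Some (inverse_letter x)"
    using arch_systemD(1,2)[OF A, of i j] by auto
next
  fix i j k l assume "(i, j) \<in> A \<inter> J \<times> J" "(k, l) \<in> A \<inter> J \<times> J"
  then show "(i, j) \<noteq> (k, l) \<Longrightarrow> {i, j} \<inter> {k, l} = {}" "i < k \<Longrightarrow> k < j \<Longrightarrow> \<not> j < l"
    using arch_systemD(3,4)[OF A, of i j k l] by auto
qed

lemma reduced_word_equiv:
  assumes "word_equiv V W" "reduced V" shows "reduced W"
  unfolding reduced_def
proof (intro allI impI)
  fix B assume B: "arch_system W B"
  obtain \<phi> where \<phi>: "bij_betw \<phi> (dom V) (dom W)" "strict_mono_on (dom V) \<phi>" "\<forall>i\<in>dom V. W (\<phi> i) = V i"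
    using assms(1) unfolding word_equiv_def by blast
  have less: "i < j \<longleftrightarrow> \<phi> i < \<phi> j" if "i \<in> dom V" "j \<in> dom V" for i j
    using strict_mono_on_less[OF \<phi>(2)] that by blast
  have eq: "i = j \<longleftrightarrow> \<phi> i = \<phi> j" if "i \<in> dom V" "j \<in> dom V" for i j
    using \<phi>(1) that by (auto simp: bij_betw_def dest: inj_onD)
  have sur: "\<exists>i\<in>dom V. \<phi> i = k" if "k \<in> dom W" for k
    using bij_betw_imp_surj_on[OF \<phi>(1)] that by (metis imageE)
  define A where "A = {(i, j). i \<in> dom V \<and> j \<in> dom V \<and> (\<phi> i, \<phi> j) \<in> B}"
  have "arch_system V A"
  proof (rule arch_systemI)
    fix i j assume "(i, j) \<in> A"
    then have ij: "i \<in> dom V" "j \<in> dom V" "(\<phi> i, \<phi> j) \<in> B" unfolding A_def by blast+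
    show "i < j" using arch_systemD(1)[OF B ij(3)] less ij by blast
    show "\<exists>x. V i = Some x \<and> V j = Some (inverse_letter x)"
      using arch_systemD(2)[OF B ij(3)] \<phi>(3) ij by metis
  next
    fix i j k l assume "(i, j) \<in> A" "(k, l) \<in> A"
    then have ij: "i \<in> dom V" "j \<in> dom V" "(\<phi> i, \<phi> j) \<in> B" and kl: "k \<in> dom V" "l \<in> dom V" "(\<phi> k, \<phi> l) \<in> B"
      unfolding A_def by blast+
    show "{i, j} \<inter> {k, l} = {}" if "(i, j) \<noteq> (k, l)"
    proof -
      have "(\<phi> i, \<phi> j) \<noteq> (\<phi> k, \<phi> l)" using that eq ij kl by blast
      from arch_systemD(3)[OF B ij(3) kl(3) this] show ?thesis by auto
    qed
    show "\<not> j < l" if "i < k" "k < j"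
      using arch_systemD(4)[OF B ij(3) kl(3)] less that ij kl by blast
  next
    fix i j k assume "(i, j) \<in> A" and k: "k \<in> dom V" "i < k" "k < j"
    then have ij: "i \<in> dom V" "j \<in> dom V" "(\<phi> i, \<phi> j) \<in> B" unfolding A_def by blast+
    have "\<phi> k \<in> dom W" using \<phi>(1) k(1) bij_betwE by blast
    then obtain l m where lm: "(l, m) \<in> B" "\<phi> k \<in> {l, m}" "\<phi> i < l" "m < \<phi> j"
      using arch_systemD(5)[OF B ij(3)] less ij k by blast
    obtain l' m' where "l' \<in> dom V" "\<phi> l' = l" "m' \<in> dom V" "\<phi> m' = m"
      using sur arch_system_dom[OF B lm(1)] by blast
    then show "\<exists>l m. (l, m) \<in> A \<and> k \<in> {l, m} \<and> i < l \<and> m < j"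
      using lm less eq ij k unfolding A_def by (intro exI[of _ l'] exI[of _ m']) auto
  qed
  then have "A = {}" using assms(2) by (simp add: reduced_def)
  have "(x, y) \<notin> B" for x y
  proof
    assume xy: "(x, y) \<in> B"
    obtain i j where "i \<in> dom V" "\<phi> i = x" "j \<in> dom V" "\<phi> j = y"
      using sur arch_system_dom[OF B xy] by blast
    then have "(i, j) \<in> A" using xy by (simp add: A_def)
    then show False using \<open>A = {}\<close> by simp
  qed
  then show "B = {}" by auto
qed

lemma reduced_inverse_word:
  assumes "reduced W" shows "reduced (inverse_word W)"
  unfolding reduced_def
proof (intro allI impI)
  fix B assume B: "arch_system (inverse_word W) B"
  define A where "A = {(i, j). (1 - j, 1 - i) \<in> B}"
  have "arch_system W A"
  proof (rule arch_systemI)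
    fix i j assume "(i, j) \<in> A"
    then have ij: "(1 - j, 1 - i) \<in> B" unfolding A_def by blast
    show "i < j" using arch_systemD(1)[OF B ij] by simp
    show "\<exists>x. W i = Some x \<and> W j = Some (inverse_letter x)"
      using arch_systemD(2)[OF B ij] by (auto simp: inverse_word_def)
  next
    fix i j k l assume "(i, j) \<in> A" "(k, l) \<in> A"
    then have ij: "(1 - j, 1 - i) \<in> B" and kl: "(1 - l, 1 - k) \<in> B" unfolding A_def by blast+
    show "{i, j} \<inter> {k, l} = {}" if "(i, j) \<noteq> (k, l)"
      using arch_systemD(3)[OF B ij kl] that by auto
    show "\<not> j < l" if "i < k" "k < j"
      using arch_systemD(4)[OF B kl ij] that by auto
  next
    fix i j k assume "(i, j) \<in> A" and k: "k \<in> dom W" "i < k" "k < j"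
    then have ij: "(1 - j, 1 - i) \<in> B" unfolding A_def by blast
    have "1 - k \<in> dom (inverse_word W)" using k(1) unfolding dom_inverse_word by blast
    then obtain l m where "(l, m) \<in> B" "1 - k \<in> {l, m}" "1 - j < l" "m < 1 - i"
      using arch_systemD(5)[OF B ij] k by force
    then show "\<exists>l m. (l, m) \<in> A \<and> k \<in> {l, m} \<and> i < l \<and> m < j"
      unfolding A_def by (intro exI[of _ "1 - m"] exI[of _ "1 - l"]) auto
  qed
  then have "A = {}" using assms by (simp add: reduced_def)
  then have "(1 - (1 - i), 1 - (1 - j)) \<notin> B" for i j unfolding A_def by blast
  then show "B = {}" by auto
qed

definition block :: "nat \<Rightarrow> real set" where
  "block m = {real m<..<real m + 1}"

text \<open>
  An arch with both ends in the same block, together with all arches below it, would be a nonempty arch system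
  of the reduced word that fills this block.
\<close>

lemma no_arch_in_block:
  assumes Ws: "\<And>W. W \<in> set Ws \<Longrightarrow> unit_word W" and "m < length Ws" "reduced (Ws ! m)"
    and A: "arch_system (cat Ws) A" and ij: "(i, j) \<in> A" "i \<in> block m" "j \<in> block m"
  shows False
proof -
  let ?J = "dom (cat Ws) \<inter> block m"
  have um: "dom (Ws ! m) \<subseteq> {0<..<1}" using Ws[of "Ws ! m"] assms(2) by (simp add: unit_word_def)
  have eq: "cat Ws (real m + u) = (Ws ! m) u" if "0 < u" "u < 1" for u
    using cat_eq[of u m Ws] assms(2) that by simp
  have dom: "dom (cat Ws |` block m) = (\<lambda>u. real m + u) ` dom (Ws ! m)"
  proof (intro equalityI subsetI)
    fix t assume "t \<in> dom (cat Ws |` block m)"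
    then have t: "t \<in> dom (cat Ws)" "0 < t - real m" "t - real m < 1" by (auto simp: block_def)
    then have "t - real m \<in> dom (Ws ! m)" using eq[of "t - real m"] by (simp add: domIff)
    then show "t \<in> (\<lambda>u. real m + u) ` dom (Ws ! m)" by (rule rev_image_eqI) simp
  next
    fix t assume "t \<in> (\<lambda>u. real m + u) ` dom (Ws ! m)"
    then obtain u where u: "u \<in> dom (Ws ! m)" "t = real m + u" by blast
    then have "0 < u" "u < 1" using um by auto
    then show "t \<in> dom (cat Ws |` block m)" using eq[of u] u by (simp add: block_def domIff)
  qed
  have "word_equiv (Ws ! m) (cat Ws |` block m)"
    unfolding word_equiv_def
  proof (intro exI conjI)
    show "bij_betw (\<lambda>u. real m + u) (dom (Ws ! m)) (dom (cat Ws |` block m))"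
      unfolding dom by (simp add: bij_betw_def)
    show "strict_mono_on (dom (Ws ! m)) (\<lambda>u. real m + u)" by (rule strict_mono_onI) simp
    show "\<forall>i\<in>dom (Ws ! m). (cat Ws |` block m) (real m + i) = (Ws ! m) i"
    proof
      fix u assume "u \<in> dom (Ws ! m)"
      then have "0 < u" "u < 1" using um by auto
      then show "(cat Ws |` block m) (real m + u) = (Ws ! m) u" using eq by (simp add: block_def)
    qed
  qed
  then have "reduced (cat Ws |` block m)" using assms(3) by (rule reduced_word_equiv)
  moreover have "cat Ws |` ?J = cat Ws |` block m"
  proof
    fix t show "(cat Ws |` ?J) t = (cat Ws |` block m) t"
      by (cases "t \<in> block m"; cases "cat Ws t") (auto simp: restrict_map_def domIff)
  qed
  moreover have "convex_in (dom (cat Ws)) ?J" by (auto simp: convex_in_def block_def)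
  then have "arch_system (cat Ws |` ?J) (A \<inter> ?J \<times> ?J)" by (rule arch_system_restrict_convex[OF A])
  ultimately have "A \<inter> ?J \<times> ?J = {}" by (simp add: reduced_def)
  then show False using ij arch_system_dom[OF A ij(1)] by blast
qed

text \<open>
  The inverse of \<open>V\<close> followed by \<open>W\<close> has value zero and so a total arch system. As
  both parts are reduced, every arch goes from one part to the other. The arches therefore match the letters of
  \<open>V\<close> with those of \<open>W\<close>, and this matching preserves the order because the arches do
  not cross.
\<close>

lemma word_equiv_if_val_eq_unit:
  assumes V: "unit_word V" "restricted V" "reduced V" and W: "unit_word W" "restricted W" "reduced W"
    and val: "val V = val W"
  shows "word_equiv V W"
proof -
  let ?Ws = "[inverse_word V, W]"
  have u: "unit_word U \<and> restricted U" if "U \<in> set ?Ws" for U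
    using that V W by (auto simp: unit_inverse_word restricted_inverse_word)
  have "val (cat ?Ws) = 0"
    using val_cat[of ?Ws, OF u] val by (simp add: val_inverse_word[OF V(2)])
  then obtain A where "total_arch_system (cat ?Ws) A"
    using total_arch_system_if_val_zero[OF restricted_cat[of ?Ws, OF u]] by blast
  then have A: "arch_system (cat ?Ws) A" "ends A = dom (cat ?Ws)" by (auto simp: total_arch_system_def)
  have dom: "dom (cat ?Ws) = (\<lambda>u. 1 - u) ` dom V \<union> (\<lambda>u. 1 + u) ` dom W"
    using dom_cat[of ?Ws] u by (simp add: lessThan_Suc dom_inverse_word Un_commute)
  have V01: "0 < u" "u < 1" if "u \<in> dom V" for u using that V(1) by (auto simp: unit_word_def)
  have W01: "0 < u" "u < 1" if "u \<in> dom W" for u using that W(1) by (auto simp: unit_word_def)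
  have catV: "cat ?Ws (1 - u) = map_option inverse_letter (V u)" if "u \<in> dom V" for u
    using cat_eq[of "1 - u" 0 ?Ws] V01[OF that] by (simp add: inverse_word_def)
  have catW: "cat ?Ws (1 + u) = W u" if "u \<in> dom W" for u
    using cat_eq[of u 1 ?Ws] W01[OF that] by simp
  have arch: "\<exists>u\<in>dom V. \<exists>v\<in>dom W. x = 1 - u \<and> y = 1 + v" if xy: "(x, y) \<in> A" for x y
  proof -
    have xyd: "x \<in> dom (cat ?Ws)" "y \<in> dom (cat ?Ws)" "x < y"
      using arch_system_dom[OF A(1) xy] arch_systemD(1)[OF A(1) xy] by blast+
    have no: "\<not> (x \<in> block m \<and> y \<in> block m)" if "m < 2" for m
    proof -
      have "reduced (?Ws ! m)" "m < length ?Ws"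
        using that V(3) W(3) reduced_inverse_word by (auto simp: less_Suc_eq numeral_2_eq_2)
      then show ?thesis using no_arch_in_block[of ?Ws m A x y] u A(1) xy by blast
    qed
    have "x \<notin> (\<lambda>u. 1 + u) ` dom W"
    proof
      assume "x \<in> (\<lambda>u. 1 + u) ` dom W"
      then have "x \<in> block 1" "1 < x" using W01 by (auto simp: block_def)
      moreover have "y \<in> block 1" using xyd(2,3) \<open>1 < x\<close> V01 W01 unfolding dom by (force simp: block_def)
      ultimately show False using no[of 1] by simp
    qed
    then obtain u' where u': "u' \<in> dom V" "x = 1 - u'" using xyd(1) unfolding dom by blast
    then have x0: "x \<in> block 0" using V01 by (simp add: block_def)
    have "y \<notin> (\<lambda>u. 1 - u) ` dom V"
    proof
      assume "y \<in> (\<lambda>u. 1 - u) ` dom V"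
      then have "y \<in> block 0" using V01 by (auto simp: block_def)
      then show False using x0 no[of 0] by simp
    qed
    then show ?thesis using xyd(2) u' unfolding dom by blast
  qed
  have ex: "\<exists>v\<in>dom W. (1 - u, 1 + v) \<in> A" if uV: "u \<in> dom V" for u
  proof -
    have "1 - u \<in> ends A" unfolding A(2) dom using uV by blast
    then obtain x y where xy: "(x, y) \<in> A" "1 - u \<in> {x, y}" by force
    obtain u' v where "u' \<in> dom V" "v \<in> dom W" "x = 1 - u'" "y = 1 + v" using arch[OF xy(1)] by blast
    moreover from this have "1 - u \<noteq> y" using V01[OF uV] W01[of v] by auto
    ultimately show ?thesis using xy by auto
  qed
  have ex': "\<exists>u\<in>dom V. (1 - u, 1 + v) \<in> A" if vW: "v \<in> dom W" for v
  proof -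
    have "1 + v \<in> ends A" unfolding A(2) dom using vW by blast
    then obtain x y where xy: "(x, y) \<in> A" "1 + v \<in> {x, y}" by force
    obtain u' v' where "u' \<in> dom V" "v' \<in> dom W" "x = 1 - u'" "y = 1 + v'" using arch[OF xy(1)] by blast
    moreover from this have "1 + v \<noteq> x" using V01[of u'] W01[OF vW] by auto
    ultimately show ?thesis using xy by auto
  qed
  obtain \<phi> where \<phi>: "\<And>u. u \<in> dom V \<Longrightarrow> \<phi> u \<in> dom W \<and> (1 - u, 1 + \<phi> u) \<in> A" using ex by metis
  have mono: "\<phi> u < \<phi> v" if "u \<in> dom V" "v \<in> dom V" "u < v" for u v
  proof -
    note au = \<phi>[OF that(1), THEN conjunct2] and av = \<phi>[OF that(2), THEN conjunct2]
    have "{1 - u, 1 + \<phi> u} \<inter> {1 - v, 1 + \<phi> v} = {}"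
      by (rule arch_systemD(3)[OF A(1) au av]) (use that in simp)
    moreover have "\<not> 1 + \<phi> v < 1 + \<phi> u"
    proof (rule arch_systemD(4)[OF A(1) av au])
      show "1 - v < 1 - u" using that by simp
      show "1 - u < 1 + \<phi> v" using V01[OF that(1)] W01[of "\<phi> v"] \<phi>[OF that(2)] by simp
    qed
    ultimately show ?thesis by auto
  qed
  have sm: "strict_mono_on (dom V) \<phi>" by (rule strict_mono_onI) (rule mono)
  moreover have "\<phi> ` dom V = dom W"
  proof (intro equalityI subsetI)
    fix v assume v: "v \<in> dom W"
    then obtain u where u: "u \<in> dom V" "(1 - u, 1 + v) \<in> A" using ex' by blast
    have "\<phi> u = v"
    proof (rule ccontr)
      assume "\<phi> u \<noteq> v"
      then have "{1 - u, 1 + \<phi> u} \<inter> {1 - u, 1 + v} = {}"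
        using arch_systemD(3)[OF A(1) \<phi>[OF u(1), THEN conjunct2] u(2)] by simp
      then show False by simp
    qed
    then show "v \<in> \<phi> ` dom V" using u(1) by blast
  qed (use \<phi> in blast)
  moreover have "\<forall>u\<in>dom V. W (\<phi> u) = V u"
  proof
    fix u assume u: "u \<in> dom V"
    obtain x where x: "cat ?Ws (1 - u) = Some x" "cat ?Ws (1 + \<phi> u) = Some (inverse_letter x)"
      using arch_systemD(2)[OF A(1)] \<phi>[OF u] by blast
    then show "W (\<phi> u) = V u"
      using catV[OF u] catW[of "\<phi> u"] \<phi>[OF u] u by (auto simp del: catW)
  qed
  ultimately show ?thesis
    unfolding word_equiv_def bij_betw_def using strict_mono_on_imp_inj_on[OF sm] by blast
qed

text \<open>
  Reduced restricted words are determined by their finite truncations.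
\<close>

theorem word_equiv_if_val_eq:
  assumes V: "countable (dom V)" "restricted V" "reduced V"
    and W: "countable (dom W)" "restricted W" "reduced W"
    and val: "val V = val W"
  shows "word_equiv V W"
proof -
  obtain V' where V': "unit_word V'" "word_equiv V V'" by (rule unit_word_exists[OF V(1)])
  obtain W' where W': "unit_word W'" "word_equiv W W'" by (rule unit_word_exists[OF W(1)])
  have "val V' = val W'"
    using val_word_equiv[OF V'(2) V(2)] val_word_equiv[OF W'(2) W(2)] val by simp
  then have "word_equiv V' W'"
    using word_equiv_if_val_eq_unit[OF V'(1) word_equiv_restricted[OF V'(2) V(2)] reduced_word_equiv[OF V'(2) V(3)]
      W'(1) word_equiv_restricted[OF W'(2) W(2)] reduced_word_equiv[OF W'(2) W(3)]] by blast
  then show ?thesis using word_equiv_trans[OF V'(2) word_equiv_trans[OF _ word_equiv_sym[OF W'(2)]]] by blast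
qed

section \<open>Itineraries under two involutions\<close>

text \<open>
  The dynamics behind the main combinatorial step, in abstract form. The set \<open>I\<close> of positions of a
  long word is cut into \<open>m\<close> consecutive blocks. The involution \<open>\<alpha>\<close> exchanges
  the two ends of every arch; it behaves like a piecewise reversal: the positions of one block whose partners
  lie in a given block form a convex set, on which \<open>\<alpha>\<close> is decreasing. The involution
  \<open>\<beta>\<close> is defined on a union \<open>X\<close> of blocks, where it reverses whole blocks and
  exchanges them. Starting in a union \<open>S\<close> of further blocks, a point is moved by
  \<open>\<alpha>\<close> and \<open>\<beta>\<close> in turn for as long as it stays in \<open>X\<close>. This
  is similar to the orbits of an interval exchange.
\<close>

context
  fixes I X S :: "'a::linorder set" and \<alpha> \<beta> :: "'a \<Rightarrow> 'a" and blk :: "'a \<Rightarrow> nat" and m :: nat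
  assumes blk_mono: "\<And>i j. i \<in> I \<Longrightarrow> j \<in> I \<Longrightarrow> i \<le> j \<Longrightarrow> blk i \<le> blk j"
    and blk_less: "\<And>i. i \<in> I \<Longrightarrow> blk i < m"
    and \<alpha>_in: "\<And>i. i \<in> I \<Longrightarrow> \<alpha> i \<in> I"
    and \<alpha>_inv: "\<And>i. i \<in> I \<Longrightarrow> \<alpha> (\<alpha> i) = i"
    and \<alpha>_anti: "\<And>i j. i \<in> I \<Longrightarrow> j \<in> I \<Longrightarrow> i < j \<Longrightarrow> blk i = blk j \<Longrightarrow> blk (\<alpha> i) = blk (\<alpha> j) \<Longrightarrow> \<alpha> j < \<alpha> i"
    and \<alpha>_convex: "\<And>i j k. i \<in> I \<Longrightarrow> j \<in> I \<Longrightarrow> k \<in> I \<Longrightarrow> i < k \<Longrightarrow> k < j \<Longrightarrow> blk i = blk j \<Longrightarrow>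
          blk (\<alpha> i) = blk (\<alpha> j) \<Longrightarrow> blk (\<alpha> k) = blk (\<alpha> i)"
    and X_sub: "X \<subseteq> I"
    and \<beta>_in: "\<And>i. i \<in> X \<Longrightarrow> \<beta> i \<in> X"
    and \<beta>_inv: "\<And>i. i \<in> X \<Longrightarrow> \<beta> (\<beta> i) = i"
    and X_blk: "\<And>i j. i \<in> X \<Longrightarrow> j \<in> I \<Longrightarrow> blk i = blk j \<Longrightarrow> j \<in> X"
    and \<beta>_blk: "\<And>i j. i \<in> X \<Longrightarrow> j \<in> X \<Longrightarrow> blk i = blk j \<Longrightarrow> blk (\<beta> i) = blk (\<beta> j)"
    and \<beta>_anti: "\<And>i j. i \<in> X \<Longrightarrow> j \<in> X \<Longrightarrow> i < j \<Longrightarrow> blk i = blk j \<Longrightarrow> \<beta> j < \<beta> i"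
    and S_sub: "S \<subseteq> I"
    and S_blk: "\<And>i j. i \<in> S \<Longrightarrow> j \<in> I \<Longrightarrow> blk i = blk j \<Longrightarrow> j \<in> S"
    and S_X: "S \<inter> X = {}"
begin

abbreviation (input) step :: "'a \<Rightarrow> 'a" where "step i \<equiv> \<beta> (\<alpha> i)"

text \<open>
  The orbit of \<open>s\<close> can make at least \<open>n\<close> steps.
\<close>

definition alive :: "nat \<Rightarrow> 'a \<Rightarrow> bool" where
  "alive n s \<longleftrightarrow> s \<in> S \<and> (\<forall>k<n. \<alpha> ((step ^^ k) s) \<in> X)"

lemma alive_0: "alive 0 s \<longleftrightarrow> s \<in> S" by (simp add: alive_def)

lemma alive_Suc: "alive (Suc n) s \<longleftrightarrow> alive n s \<and> \<alpha> ((step ^^ n) s) \<in> X"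
  by (auto simp: alive_def less_Suc_eq)

lemma orbit_in: "alive n s \<Longrightarrow> (step ^^ n) s \<in> I"
proof (induction n)
  case 0
  then show ?case using S_sub by (auto simp: alive_0)
next
  case (Suc n)
  then show ?case using \<beta>_in X_sub by (auto simp: alive_Suc)
qed

lemma orbit_Suc_in_X: "alive (Suc n) s \<Longrightarrow> (step ^^ Suc n) s \<in> X"
  using \<beta>_in by (auto simp: alive_Suc)

text \<open>
  Both involutions can be undone, and an orbit starts in \<open>S\<close>, which is disjoint from
  \<open>X\<close>: the way back from a point leads to a unique starting point after a unique number of steps.
\<close>

lemma orbit_inj:
  "alive n s \<Longrightarrow> alive n' s' \<Longrightarrow> (step ^^ n) s = (step ^^ n') s' \<Longrightarrow> n = n' \<and> s = s'"
proof (induction n arbitrary: n')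
  case 0
  show ?case
  proof (cases n')
    case 0
    then show ?thesis using \<open>(step ^^ 0) s = _\<close> by simp
  next
    case (Suc k)
    then have "s \<in> X" using orbit_Suc_in_X[of k s'] 0 by auto
    then show ?thesis using 0(1) S_X by (auto simp: alive_0)
  qed
next
  case (Suc n)
  show ?case
  proof (cases n')
    case 0
    then have "s' \<in> X" using orbit_Suc_in_X[of n s] Suc.prems by auto
    then show ?thesis using Suc.prems 0 S_X by (auto simp: alive_0)
  next
    case (Suc k)
    let ?x = "(step ^^ n) s" and ?y = "(step ^^ k) s'"
    have a: "alive n s" "alive k s'" "\<alpha> ?x \<in> X" "\<alpha> ?y \<in> X"
      using Suc.prems Suc by (auto simp: alive_Suc)
    have "\<beta> (\<alpha> ?x) = \<beta> (\<alpha> ?y)" using Suc.prems(3) Suc by simp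
    then have "\<alpha> ?x = \<alpha> ?y" using \<beta>_inv a by metis
    then have "?x = ?y" using \<alpha>_inv orbit_in a by metis
    then show ?thesis using Suc.IH[of k] a Suc by simp
  qed
qed

text \<open>
  The orbits of \<open>s\<close> and \<open>s'\<close> pass through the same blocks during the first
  \<open>n\<close> steps.
\<close>

definition agree :: "nat \<Rightarrow> 'a \<Rightarrow> 'a \<Rightarrow> bool" where
  "agree n s s' \<longleftrightarrow> alive n s \<and> alive n s' \<and> blk s = blk s' \<and>
     (\<forall>k<n. blk (\<alpha> ((step ^^ k) s)) = blk (\<alpha> ((step ^^ k) s')))"

lemma agree_Suc:
  "agree (Suc n) s s' \<longleftrightarrow> agree n s s' \<and> \<alpha> ((step ^^ n) s) \<in> X \<and> \<alpha> ((step ^^ n) s') \<in> X \<and>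
     blk (\<alpha> ((step ^^ n) s)) = blk (\<alpha> ((step ^^ n) s'))"
  by (auto simp: agree_def alive_Suc less_Suc_eq)

lemma agree_blk: "agree n s s' \<Longrightarrow> blk ((step ^^ n) s) = blk ((step ^^ n) s')"
  by (cases n) (auto simp: agree_Suc \<beta>_blk, simp add: agree_def)

lemma step_less:
  assumes "x \<in> I" "y \<in> I" "x < y" "blk x = blk y" "blk (\<alpha> x) = blk (\<alpha> y)" "\<alpha> x \<in> X"
  shows "step x < step y"
  using assms \<alpha>_anti[of x y] \<beta>_anti[of "\<alpha> y" "\<alpha> x"] X_blk[of "\<alpha> x" "\<alpha> y"] \<alpha>_in by metis

lemma blk_between: "i \<in> I \<Longrightarrow> j \<in> I \<Longrightarrow> k \<in> I \<Longrightarrow> i \<le> k \<Longrightarrow> k \<le> j \<Longrightarrow> blk i = blk j \<Longrightarrow> blk k = blk i"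
  using blk_mono[of i k] blk_mono[of k j] by simp

lemma \<alpha>_convex_le:
  "i \<in> I \<Longrightarrow> j \<in> I \<Longrightarrow> k \<in> I \<Longrightarrow> i \<le> k \<Longrightarrow> k \<le> j \<Longrightarrow> blk i = blk j \<Longrightarrow>
    blk (\<alpha> i) = blk (\<alpha> j) \<Longrightarrow> blk (\<alpha> k) = blk (\<alpha> i)"
  using \<alpha>_convex[of i j k] by (cases "i = k"; cases "k = j") (auto simp: order.order_iff_strict)

text \<open>
  A step reverses the order twice. So as long as the orbits of two points visit the same blocks, the interval
  between them moves rigidly: its image is the full interval between the image points.
\<close>

lemma agree_interval:
  assumes "agree n s s'" "s < s'"
  shows "(step ^^ n) s < (step ^^ n) s'"
    and "\<And>k. k \<in> I \<Longrightarrow> s \<le> k \<Longrightarrow> k \<le> s' \<Longrightarrow>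
           agree n s k \<and> (step ^^ n) s \<le> (step ^^ n) k \<and> (step ^^ n) k \<le> (step ^^ n) s'"
    and "\<And>y. y \<in> I \<Longrightarrow> (step ^^ n) s \<le> y \<Longrightarrow> y \<le> (step ^^ n) s' \<Longrightarrow>
           \<exists>k\<in>I. s \<le> k \<and> k \<le> s' \<and> (step ^^ n) k = y"
proof -
  have "(step ^^ n) s < (step ^^ n) s' \<and>
    (\<forall>k\<in>I. s \<le> k \<longrightarrow> k \<le> s' \<longrightarrow>
           agree n s k \<and> (step ^^ n) s \<le> (step ^^ n) k \<and> (step ^^ n) k \<le> (step ^^ n) s') \<and>
    (\<forall>y\<in>I. (step ^^ n) s \<le> y \<longrightarrow> y \<le> (step ^^ n) s' \<longrightarrow>
           (\<exists>k\<in>I. s \<le> k \<and> k \<le> s' \<and> (step ^^ n) k = y))"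
    using assms(1)
  proof (induction n)
    case 0
    then have s: "s \<in> S" "s' \<in> S" "blk s = blk s'" by (auto simp: agree_def alive_0)
    have "agree 0 s k" if "k \<in> I" "s \<le> k" "k \<le> s'" for k
    proof -
      have "blk k = blk s" using blk_between[of s s' k] s that S_sub by blast
      then show ?thesis using s S_blk[of s k] that by (auto simp: agree_def alive_0)
    qed
    then show ?case using assms(2) by auto
  next
    case (Suc n)
    let ?x = "(step ^^ n) s" and ?x' = "(step ^^ n) s'"
    have ag: "agree n s s'" and X: "\<alpha> ?x \<in> X" "\<alpha> ?x' \<in> X" "blk (\<alpha> ?x) = blk (\<alpha> ?x')"
      using Suc.prems by (auto simp: agree_Suc)
    note IHa = Suc.IH[OF ag, THEN conjunct1]
    note IHb = Suc.IH[OF ag, THEN conjunct2, THEN conjunct1, rule_format]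
    note IHc = Suc.IH[OF ag, THEN conjunct2, THEN conjunct2, rule_format]
    have I: "?x \<in> I" "?x' \<in> I" using ag orbit_in by (auto simp: agree_def)
    have b: "blk ?x = blk ?x'" by (rule agree_blk[OF ag])
    have le: "step y \<le> step z \<and> blk (\<alpha> y) = blk (\<alpha> ?x) \<and> \<alpha> y \<in> X"
      if "y \<in> I" "z \<in> I" "?x \<le> y" "y \<le> z" "z \<le> ?x'" for y z
    proof -
      note ord = that(3) order_trans[OF that(4,5)] order_trans[OF that(3,4)] that(5)
      have 1: "blk (\<alpha> y) = blk (\<alpha> ?x)" "blk (\<alpha> z) = blk (\<alpha> ?x)"
        by (rule \<alpha>_convex_le[OF I(1,2) that(1) ord(1,2) b X(3)])
          (rule \<alpha>_convex_le[OF I(1,2) that(2) ord(3,4) b X(3)])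
      have 2: "\<alpha> y \<in> X" using X_blk[OF X(1) \<alpha>_in[OF that(1)]] 1 by simp
      have "blk y = blk ?x" "blk z = blk ?x"
        by (rule blk_between[OF I(1,2) that(1) ord(1,2) b]) (rule blk_between[OF I(1,2) that(2) ord(3,4) b])
      then have "step y < step z" if "y < z"
        using step_less[OF \<open>y \<in> I\<close> \<open>z \<in> I\<close> that] 1 2 by simp
      then have "step y \<le> step z" using \<open>y \<le> z\<close> by (cases "y = z") (simp_all add: less_imp_le)
      then show ?thesis using 1 2 by blast
    qed
    have A: "(step ^^ Suc n) s < (step ^^ Suc n) s'"
      using step_less[OF I IHa b X(3,1)] by simp
    have B: "agree (Suc n) s k \<and> (step ^^ Suc n) s \<le> (step ^^ Suc n) k \<and> (step ^^ Suc n) k \<le> (step ^^ Suc n) s'"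
      if k: "k \<in> I" "s \<le> k" "k \<le> s'" for k
    proof -
      have k1: "agree n s k" "?x \<le> (step ^^ n) k" "(step ^^ n) k \<le> ?x'" using IHb[OF k] by simp_all
      then have "(step ^^ n) k \<in> I" using orbit_in by (simp add: agree_def)
      then show ?thesis
        using k1 le[of "(step ^^ n) k" ?x'] le[of ?x "(step ^^ n) k"] I X by (auto simp: agree_Suc)
    qed
    \<comment> \<open>surjectivity: pull \<open>y\<close> back through \<open>\<beta>\<close> and \<open>\<alpha>\<close>, both of which reverse the interval\<close>
    have C: "\<exists>k\<in>I. s \<le> k \<and> k \<le> s' \<and> (step ^^ Suc n) k = y"
      if y: "y \<in> I" "step ?x \<le> y" "y \<le> step ?x'" for y
    proof -
      have sI: "step ?x \<in> X" "step ?x' \<in> X" using \<beta>_in X by auto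
      have "blk (step ?x) = blk (step ?x')" using \<beta>_blk X by blast
      then have byb: "blk y = blk (step ?x)" using blk_between[of "step ?x" "step ?x'" y] sI X_sub y by blast
      then have yX: "y \<in> X" using X_blk[OF sI(1) y(1)] by simp
      have "\<beta> y \<le> \<alpha> ?x"
      proof (cases "step ?x = y")
        case True
        then show ?thesis using \<beta>_inv[OF X(1)] by simp
      next
        case False
        then have "\<beta> y < \<beta> (step ?x)"
          using \<beta>_anti[OF sI(1) yX _ byb[symmetric]] y(2) by (simp add: order.not_eq_order_implies_strict)
        then show ?thesis using \<beta>_inv[OF X(1)] by simp
      qed
      moreover have "\<alpha> ?x' \<le> \<beta> y"
      proof (cases "step ?x' = y")
        case True
        then show ?thesis using \<beta>_inv[OF X(2)] by simp
      next
        case False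
        then have "\<beta> (step ?x') < \<beta> y"
          using \<beta>_anti[OF yX sI(2)] byb \<open>blk (step ?x) = blk (step ?x')\<close> y(3)
          by (simp add: order.not_eq_order_implies_strict)
        then show ?thesis using \<beta>_inv[OF X(2)] by simp
      qed
      ultimately have z: "\<alpha> ?x' \<le> \<beta> y" "\<beta> y \<le> \<alpha> ?x" "\<beta> y \<in> I" using \<beta>_in[OF yX] X_sub by auto
      define z where "z = \<alpha> (\<beta> y)"
      have zI: "z \<in> I" "\<alpha> z = \<beta> y" using \<alpha>_in \<alpha>_inv z(3) by (auto simp: z_def)
      have aI: "\<alpha> ?x \<in> I" "\<alpha> ?x' \<in> I" using X X_sub by auto
      have ainv: "\<alpha> (\<alpha> ?x) = ?x" "\<alpha> (\<alpha> ?x') = ?x'" using \<alpha>_inv I by auto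
      have bz: "blk z = blk ?x'"
        unfolding z_def using \<alpha>_convex_le[OF aI(2,1) z(3) z(1,2)] X(3) ainv b by simp
      have bb: "blk (\<beta> y) = blk (\<alpha> ?x')" using blk_between[OF aI(2,1) z(3) z(1,2)] X(3) by simp
      have "?x \<le> z"
      proof (cases "\<beta> y = \<alpha> ?x")
        case True
        then show ?thesis using ainv by (simp add: z_def)
      next
        case False
        then have "\<alpha> (\<alpha> ?x) < \<alpha> (\<beta> y)"
          using \<alpha>_anti[OF z(3) aI(1)] z(2) bb X(3) bz b ainv
          by (simp add: z_def order.not_eq_order_implies_strict)
        then show ?thesis using ainv by (simp add: z_def)
      qed
      moreover have "z \<le> ?x'"
      proof (cases "\<beta> y = \<alpha> ?x'")
        case True
        then show ?thesis using ainv by (simp add: z_def)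
      next
        case False
        then have "\<alpha> (\<beta> y) < \<alpha> (\<alpha> ?x')"
          using \<alpha>_anti[OF aI(2) z(3)] z(1) bb X(3) bz b ainv
          by (simp add: z_def order.not_eq_order_implies_strict)
        then show ?thesis using ainv by (simp add: z_def)
      qed
      ultimately obtain k where k: "k \<in> I" "s \<le> k" "k \<le> s'" "(step ^^ n) k = z" using IHc[OF zI(1)] by blast
      moreover have "step z = y" using zI(2) \<beta>_inv[OF yX] by simp
      ultimately show ?thesis by auto
    qed
    show ?case using A B C by simp
  qed
  note main = this
  show "(step ^^ n) s < (step ^^ n) s'" by (rule main[THEN conjunct1])
  show "\<And>k. k \<in> I \<Longrightarrow> s \<le> k \<Longrightarrow> k \<le> s' \<Longrightarrow>
           agree n s k \<and> (step ^^ n) s \<le> (step ^^ n) k \<and> (step ^^ n) k \<le> (step ^^ n) s'"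
    by (rule main[THEN conjunct2, THEN conjunct1, rule_format])
  show "\<And>y. y \<in> I \<Longrightarrow> (step ^^ n) s \<le> y \<Longrightarrow> y \<le> (step ^^ n) s' \<Longrightarrow>
           \<exists>k\<in>I. s \<le> k \<and> k \<le> s' \<and> (step ^^ n) k = y"
    by (rule main[THEN conjunct2, THEN conjunct2, rule_format])
qed

definition itinerary :: "'a \<Rightarrow> nat \<Rightarrow> nat option" where
  "itinerary s n = (if alive n s then Some (blk (\<alpha> ((step ^^ n) s))) else None)"

lemma agree_if_itinerary_eq:
  assumes "blk s = blk s'" "itinerary s = itinerary s'" "alive n s"
  shows "agree n s s'"
proof -
  have eq: "itinerary s k = itinerary s' k" for k using assms(2) by simp
  have al: "alive k s" if "k \<le> n" for k using assms(3) that by (auto simp: alive_def)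
  have "alive n s'" using eq[of n] assms(3) by (auto simp: itinerary_def split: if_splits)
  moreover have "blk (\<alpha> ((step ^^ k) s)) = blk (\<alpha> ((step ^^ k) s'))" if "k < n" for k
    using eq[of k] al[of k] that by (auto simp: itinerary_def split: if_splits)
  ultimately show ?thesis using assms by (simp add: agree_def)
qed

lemma itineraries_diverge:
  assumes "s \<in> S" "s' \<in> S" "blk s = blk s'" "itinerary s \<noteq> itinerary s'"
  obtains n where "agree n s s'" "blk (\<alpha> ((step ^^ n) s)) \<noteq> blk (\<alpha> ((step ^^ n) s'))"
proof -
  obtain n0 where "itinerary s n0 \<noteq> itinerary s' n0" using assms(4) by blast
  then obtain n where n: "itinerary s n \<noteq> itinerary s' n" "\<And>k. k < n \<Longrightarrow> itinerary s k = itinerary s' k"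
    using exists_least_iff[of "\<lambda>n. itinerary s n \<noteq> itinerary s' n"] by blast
  have "agree k s s'" if "k \<le> n" "alive k s \<or> alive k s'" for k
    using that
  proof (induction k)
    case 0
    then show ?case using assms by (simp add: agree_def alive_0)
  next
    case (Suc k)
    have al: "alive k s \<or> alive k s'" using Suc.prems by (auto simp: alive_Suc)
    then have ag: "agree k s s'" using Suc by simp
    then have "alive k s" "alive k s'" by (auto simp: agree_def)
    then have b: "blk (\<alpha> ((step ^^ k) s)) = blk (\<alpha> ((step ^^ k) s'))"
      using n(2)[of k] Suc.prems by (simp add: itinerary_def)
    moreover have "\<alpha> ((step ^^ k) s) \<in> I" "\<alpha> ((step ^^ k) s') \<in> I"
      using \<open>alive k s\<close> \<open>alive k s'\<close> orbit_in \<alpha>_in by auto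
    ultimately have "\<alpha> ((step ^^ k) s) \<in> X \<longleftrightarrow> \<alpha> ((step ^^ k) s') \<in> X" using X_blk by metis
    then show ?case using ag b Suc.prems(2) by (auto simp: agree_Suc alive_Suc)
  qed
  moreover have "alive n s \<or> alive n s'" using n(1) by (auto simp: itinerary_def split: if_splits)
  ultimately have "agree n s s'" by simp
  then show thesis using that n(1) by (auto simp: itinerary_def agree_def)
qed

text \<open>
  Suppose two pairs diverge in the same way: both split from one block into the same two blocks, in the same
  order. The points of a block that \<open>\<alpha>\<close> sends into a given block are convex, so the two
  moved intervals overlap. A common point would be reached from both original intervals, which share at most an
  end.
\<close>

lemma divergences_separate:
  assumes ag: "agree n s s'" "agree n' t t'" and ord: "s < s'" "s' \<le> t" "t < t'"
    and b: "blk ((step ^^ n) s) = blk ((step ^^ n') t)"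
    and c: "blk (\<alpha> ((step ^^ n) s)) = blk (\<alpha> ((step ^^ n') t))"
    and c': "blk (\<alpha> ((step ^^ n) s')) = blk (\<alpha> ((step ^^ n') t'))"
    and ne: "blk (\<alpha> ((step ^^ n) s)) \<noteq> blk (\<alpha> ((step ^^ n) s'))"
  shows False
proof -
  define y y' z z' where "y = (step ^^ n) s" and "y' = (step ^^ n) s'"
    and "z = (step ^^ n') t" and "z' = (step ^^ n') t'"
  note defs = y_def y'_def z_def z'_def
  have al: "alive n s" "alive n s'" "alive n' t" "alive n' t'" using ag by (auto simp: agree_def)
  have I: "y \<in> I" "y' \<in> I" "z \<in> I" "z' \<in> I" using al orbit_in by (auto simp: defs)
  have bl: "blk y = blk y'" "blk z = blk z'" "blk y = blk z" using agree_blk ag b by (auto simp: defs)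
  have lt: "y < y'" "z < z'" using agree_interval(1) ag ord by (auto simp: defs)
  have zy: "z < y'"
  proof (rule ccontr)
    assume "\<not> z < y'"
    then have "blk (\<alpha> y') = blk (\<alpha> y)"
      using \<alpha>_convex_le[OF I(1,3,2)] lt bl c by (simp add: defs)
    then show False using ne by (simp add: defs)
  qed
  have yz: "y < z'"
  proof (rule ccontr)
    assume "\<not> y < z'"
    then have "blk (\<alpha> z') = blk (\<alpha> z)"
      using \<alpha>_convex_le[OF I(3,1,4)] lt bl c by (simp add: defs)
    then show False using ne c c' by (simp add: defs)
  qed
  show False
  proof (cases "y \<le> z")
    case True
    then obtain k where k: "k \<in> I" "s \<le> k" "k \<le> s'" "(step ^^ n) k = z"
      using agree_interval(3)[OF ag(1) ord(1) I(3)] zy by (auto simp: defs less_imp_le)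
    have "alive n k" using agree_interval(2)[OF ag(1) ord(1) k(1-3)] by (simp add: agree_def)
    then have "n = n' \<and> k = t" using orbit_inj[of n k n' t] al k(4) by (simp add: defs)
    then have "s' = t" "n = n'" using k(3) ord by auto
    then show False using ne c by (simp add: defs)
  next
    case False
    then obtain k where k: "k \<in> I" "t \<le> k" "k \<le> t'" "(step ^^ n') k = y"
      using agree_interval(3)[OF ag(2) ord(3) I(1)] yz by (auto simp: defs less_imp_le)
    have "alive n' k" using agree_interval(2)[OF ag(2) ord(3) k(1-3)] by (simp add: agree_def)
    then have "k = s" using orbit_inj[of n' k n s] al k(4) by (simp add: defs)
    then show False using k(2) ord by auto
  qed
qed

text \<open>
  Choose finitely many points of a block with distinct itineraries and list them in increasing order. Every
  neighbouring pair diverges somewhere, and by the previous lemma distinct pairs diverge at distinct triples of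
  blocks. So there are at most \<open>m ^ 3 + 1\<close> itineraries.
\<close>

lemma finite_itineraries: "finite (itinerary ` {s \<in> S. blk s = b})"
proof (rule ccontr)
  assume "infinite (itinerary ` {s \<in> S. blk s = b})"
  then obtain T0 where T0: "finite T0" "card T0 = m * (m * m) + 2" "T0 \<subseteq> itinerary ` {s \<in> S. blk s = b}"
    using infinite_arbitrarily_large by blast
  then obtain T where T: "T \<subseteq> {s \<in> S. blk s = b}" "inj_on itinerary T" "T0 = itinerary ` T"
    unfolding subset_image_inj by blast
  have finT: "finite T" and cardT: "card T = m * (m * m) + 2"
    using T T0 finite_imageD card_image by metis+
  define nxt where "nxt t = Min {u \<in> T. t < u}" for t
  define T' where "T' = T - {Max T}"
  have ne: "T \<noteq> {}" using cardT by auto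
  have nxt: "nxt t \<in> T" "t < nxt t" "\<And>u. u \<in> T \<Longrightarrow> t < u \<Longrightarrow> nxt t \<le> u" if "t \<in> T'" for t
  proof -
    have "t < Max T" using that finT by (auto simp: T'_def less_le)
    then have "{u \<in> T. t < u} \<noteq> {}" using Max_in[OF finT ne] by blast
    then have "nxt t \<in> {u \<in> T. t < u}" unfolding nxt_def using finT by (intro Min_in) auto
    then show "nxt t \<in> T" "t < nxt t" by auto
    show "nxt t \<le> u" if "u \<in> T" "t < u" for u unfolding nxt_def using that finT by (intro Min_le) auto
  qed
  have "\<exists>n. agree n t (nxt t) \<and> blk (\<alpha> ((step ^^ n) t)) \<noteq> blk (\<alpha> ((step ^^ n) (nxt t)))" if "t \<in> T'" for t
  proof -
    have "t \<in> T" "nxt t \<in> T" "t \<noteq> nxt t" using nxt[OF that] that by (auto simp: T'_def)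
    then have "itinerary t \<noteq> itinerary (nxt t)" using T(2) by (auto dest: inj_onD)
    then show ?thesis using itineraries_diverge[of t "nxt t"] T(1) \<open>t \<in> T\<close> \<open>nxt t \<in> T\<close> by blast
  qed
  then obtain n where n: "\<And>t. t \<in> T' \<Longrightarrow> agree (n t) t (nxt t)"
    "\<And>t. t \<in> T' \<Longrightarrow> blk (\<alpha> ((step ^^ n t) t)) \<noteq> blk (\<alpha> ((step ^^ n t) (nxt t)))" by metis
  define key where "key t = (blk ((step ^^ n t) t), blk (\<alpha> ((step ^^ n t) t)), blk (\<alpha> ((step ^^ n t) (nxt t))))" for t
  have key_ne: "key t \<noteq> key u" if "t \<in> T'" "u \<in> T'" "t < u" for t u
  proof
    assume k: "key t = key u"
    have "nxt t \<le> u" using nxt(3)[OF that(1)] that by (auto simp: T'_def)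
    then show False
      using divergences_separate[OF n(1)[OF that(1)] n(1)[OF that(2)] nxt(2)[OF that(1)] _ nxt(2)[OF that(2)]]
        k n(2)[OF that(1)] by (simp add: key_def)
  qed
  have "inj_on key T'"
    by (rule inj_onI) (metis key_ne linorder_cases)
  moreover have "key ` T' \<subseteq> {..<m} \<times> {..<m} \<times> {..<m}"
  proof
    fix k assume "k \<in> key ` T'"
    then obtain t where t: "t \<in> T'" "k = key t" by blast
    have "(step ^^ n t) t \<in> I" "(step ^^ n t) (nxt t) \<in> I"
      using n(1)[OF t(1)] orbit_in by (auto simp: agree_def)
    then show "k \<in> {..<m} \<times> {..<m} \<times> {..<m}"
      using t(2) blk_less \<alpha>_in by (simp add: key_def)
  qed
  ultimately have "card T' \<le> card ({..<m} \<times> {..<m} \<times> {..<m})"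
    by (intro card_inj_on_le) auto
  then show False using cardT finT Max_in[OF finT ne] by (simp add: T'_def card_Diff_singleton)
qed

text \<open>
  All points met by the orbits that start in \<open>S\<close>.
\<close>

definition traces :: "'a set" where
  "traces = {i. \<exists>n s. alive n s \<and> (i = (step ^^ n) s \<or> i = \<alpha> ((step ^^ n) s))}"

lemma S_subset_traces: "S \<subseteq> traces"
proof
  fix s assume "s \<in> S"
  then have "alive 0 s \<and> s = (step ^^ 0) s" by (simp add: alive_0)
  then show "s \<in> traces" unfolding traces_def by blast
qed

lemma traces_\<alpha>: "i \<in> traces \<Longrightarrow> \<alpha> i \<in> traces"
  unfolding traces_def using \<alpha>_inv orbit_in by force

lemma traces_\<beta>: assumes "i \<in> traces" "i \<in> X" shows "\<beta> i \<in> traces"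
proof -
  obtain n s where n: "alive n s" "i = (step ^^ n) s \<or> i = \<alpha> ((step ^^ n) s)"
    using assms(1) unfolding traces_def by blast
  show ?thesis
  proof (cases "i = \<alpha> ((step ^^ n) s)")
    case True
    then have "alive (Suc n) s \<and> \<beta> i = (step ^^ Suc n) s" using n assms(2) by (simp add: alive_Suc)
    then show ?thesis unfolding traces_def by blast
  next
    case False
    then have i: "i = (step ^^ n) s" using n by blast
    then obtain k where k: "n = Suc k" using n(1) assms(2) S_X by (cases n) (auto simp: alive_0)
    then have "alive k s" "\<alpha> ((step ^^ k) s) \<in> X" using n(1) by (auto simp: alive_Suc)
    moreover from this have "\<beta> i = \<alpha> ((step ^^ k) s)" using \<beta>_inv i k by simp
    ultimately show ?thesis unfolding traces_def by blast
  qed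
qed

text \<open>
  In a block where all orbits stop, the end points with a given itinerary form a convex set: the whole interval
  between two such points is carried back to \<open>S\<close> by the interval lemma, and inherits their
  itinerary. There are finitely many itineraries.
\<close>

theorem traces_in_terminal_block:
  assumes terminal: "\<And>i. i \<in> I \<Longrightarrow> blk i = b0 \<Longrightarrow> i \<notin> X \<and> i \<notin> S"
  shows "\<exists>\<J>. finite \<J> \<and> \<Union>\<J> = {i \<in> I. blk i = b0 \<and> i \<in> traces} \<and>
    (\<forall>J\<in>\<J>. convex_in I J \<and>
      (\<exists>b. \<forall>j\<in>J. \<exists>n s. alive n s \<and> blk s = b \<and> j = \<alpha> ((step ^^ n) s)))"
proof -
  define piece where "piece = (\<lambda>(b, \<tau>). {j. blk j = b0 \<and>
     (\<exists>n s. alive n s \<and> blk s = b \<and> itinerary s = \<tau> \<and> j = \<alpha> ((step ^^ n) s))})"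
  define \<J> where "\<J> = piece ` (SIGMA b:{..<m}. itinerary ` {s \<in> S. blk s = b})"
  have "finite \<J>" unfolding \<J>_def by (intro finite_imageI finite_SigmaI finite_itineraries) auto
  moreover have "\<Union>\<J> = {i \<in> I. blk i = b0 \<and> i \<in> traces}"
  proof (intro equalityI subsetI)
    fix i assume "i \<in> \<Union>\<J>"
    then obtain n s where n: "blk i = b0" "alive n s" "i = \<alpha> ((step ^^ n) s)"
      by (auto simp: \<J>_def piece_def)
    then show "i \<in> {i \<in> I. blk i = b0 \<and> i \<in> traces}"
      using orbit_in[OF n(2)] \<alpha>_in unfolding traces_def by blast
  next
    fix i assume "i \<in> {i \<in> I. blk i = b0 \<and> i \<in> traces}"
    then have i: "i \<in> I" "blk i = b0" "i \<in> traces" by auto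
    obtain n s where n: "alive n s" "i = (step ^^ n) s \<or> i = \<alpha> ((step ^^ n) s)"
      using i(3) unfolding traces_def by blast
    have "i \<noteq> (step ^^ n) s"
    proof
      assume *: "i = (step ^^ n) s"
      show False
      proof (cases n)
        case 0
        then show ?thesis using * n(1) terminal[OF i(1,2)] by (simp add: alive_0)
      next
        case (Suc k)
        then show ?thesis using * n(1) terminal[OF i(1,2)] orbit_Suc_in_X[of k s] by simp
      qed
    qed
    then have ia: "i = \<alpha> ((step ^^ n) s)" using n(2) by blast
    have s: "s \<in> S" using n(1) by (simp add: alive_def)
    then have "(blk s, itinerary s) \<in> (SIGMA b:{..<m}. itinerary ` {s \<in> S. blk s = b})"
      using blk_less S_sub by auto
    moreover have "i \<in> piece (blk s, itinerary s)" using n(1) ia i(2) by (auto simp: piece_def)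
    ultimately show "i \<in> \<Union>\<J>" unfolding \<J>_def by blast
  qed
  moreover have "\<forall>J\<in>\<J>. convex_in I J \<and>
      (\<exists>b. \<forall>j\<in>J. \<exists>n s. alive n s \<and> blk s = b \<and> j = \<alpha> ((step ^^ n) s))"
  proof
    fix J assume "J \<in> \<J>"
    then obtain b \<tau> where J: "J = piece (b, \<tau>)" by (auto simp: \<J>_def)
    have "convex_in I J"
      unfolding convex_in_def
    proof (intro conjI subsetI ballI impI)
      fix i assume "i \<in> J"
      then obtain n s where n: "alive n s" "i = \<alpha> ((step ^^ n) s)" by (auto simp: J piece_def)
      then show "i \<in> I" using orbit_in[OF n(1)] \<alpha>_in by blast
    next
      fix i j k assume "i \<in> J" "j \<in> J" and k: "k \<in> I" "i < k \<and> k < j"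
      then obtain n s n' s' where n: "alive n s" "blk s = b" "itinerary s = \<tau>" "i = \<alpha> ((step ^^ n) s)"
        "alive n' s'" "blk s' = b" "itinerary s' = \<tau>" "j = \<alpha> ((step ^^ n') s')" and ij: "blk i = b0" "blk j = b0"
        by (auto simp: J piece_def)
      let ?x = "(step ^^ n) s" and ?x' = "(step ^^ n) s'"
      have I: "i \<in> I" "j \<in> I" using n orbit_in \<alpha>_in by auto
      have alive_eq: "alive k s \<longleftrightarrow> alive k s'" for k
      proof -
        have "itinerary s k = itinerary s' k" using n by simp
        then show ?thesis by (auto simp: itinerary_def split: if_splits)
      qed
      \<comment> \<open>orbits that stop in the same block with the same itinerary make the same number of steps\<close>
      have dead: "\<not> alive (Suc n) s" "\<not> alive (Suc n') s'"
        using terminal I ij n by (auto simp: alive_Suc)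
      have mono: "alive k s" if "alive l s" "k \<le> l" for k l s using that by (auto simp: alive_def)
      have "n = n'"
      proof (rule ccontr)
        assume "n \<noteq> n'"
        then consider "Suc n \<le> n'" | "Suc n' \<le> n" by linarith
        then show False
        proof cases
          case 1
          then show False using mono[OF n(5) 1] alive_eq dead by blast
        next
          case 2
          then show False using mono[OF n(1) 2] alive_eq dead by blast
        qed
      qed
      then have jx: "j = \<alpha> ?x'" using n(8) by simp
      have ag: "agree l s' s" if "alive l s'" for l by (rule agree_if_itinerary_eq) (use n that in auto)
      have agn: "agree n s' s" using ag n(5) \<open>n = n'\<close> by simp
      have xI: "?x \<in> I" "?x' \<in> I" "\<alpha> i = ?x" "\<alpha> j = ?x'"
        using agn orbit_in \<alpha>_inv n(4) jx by (auto simp: agree_def)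
      have bx: "blk ?x' = blk ?x" by (rule agree_blk[OF agn])
      have bak: "blk (\<alpha> k) = blk (\<alpha> i)" using \<alpha>_convex[OF I k(1)] k ij xI bx by simp
      have bk: "blk k = b0" using blk_between[OF I k(1)] k ij by (simp add: less_imp_le)
      have lt: "?x' < \<alpha> k" "\<alpha> k < ?x"
        using \<alpha>_anti[OF I(1) k(1)] \<alpha>_anti[OF k(1) I(2)] k bk ij bak xI bx by auto
      have "s' < s"
      proof (rule ccontr)
        assume "\<not> s' < s"
        moreover have "s \<noteq> s'" using lt by auto
        ultimately have "s < s'" by simp
        moreover have "agree n s s'" by (rule agree_if_itinerary_eq) (use n in auto)
        ultimately have "?x < ?x'" using agree_interval(1) by blast
        then show False using lt by simp
      qed
      obtain k' where k': "k' \<in> I" "s' \<le> k'" "k' \<le> s" "(step ^^ n) k' = \<alpha> k"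
        using agree_interval(3)[OF agn \<open>s' < s\<close> \<alpha>_in[OF k(1)]] lt by (auto simp: less_imp_le)
      have k'S: "k' \<in> S" "blk k' = b"
        using agree_interval(2)[OF agn \<open>s' < s\<close> k'(1-3)] n(6) by (auto simp: agree_def alive_def)
      have same: "blk (\<alpha> ((step ^^ l) k')) = blk (\<alpha> ((step ^^ l) s'))" "alive l k'" if "alive l s'" for l
      proof -
        have a: "agree l s' s" by (rule ag[OF that])
        have "itinerary s' l = itinerary s l" using n by simp
        then have "blk (\<alpha> ((step ^^ l) s')) = blk (\<alpha> ((step ^^ l) s))"
          using a by (simp add: itinerary_def agree_def)
        moreover have "(step ^^ l) k' \<in> I" "(step ^^ l) s' \<in> I" "(step ^^ l) s \<in> I"
          using a agree_interval(2)[OF a \<open>s' < s\<close> k'(1-3)] orbit_in by (auto simp: agree_def)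
        ultimately show "blk (\<alpha> ((step ^^ l) k')) = blk (\<alpha> ((step ^^ l) s'))"
          using \<alpha>_convex_le agree_interval(2)[OF a \<open>s' < s\<close> k'(1-3)] agree_blk[OF a] by metis
        show "alive l k'" using agree_interval(2)[OF a \<open>s' < s\<close> k'(1-3)] by (simp add: agree_def)
      qed
      have "alive l k' \<longleftrightarrow> alive l s'" for l
      proof (induction l)
        case 0
        then show ?case using k'S n(5) by (auto simp: alive_def)
      next
        case (Suc l)
        show ?case
        proof (cases "alive l s'")
          case True
          then have "\<alpha> ((step ^^ l) k') \<in> I" "\<alpha> ((step ^^ l) s') \<in> I"
            using same(2) orbit_in \<alpha>_in by auto
          then have "\<alpha> ((step ^^ l) k') \<in> X \<longleftrightarrow> \<alpha> ((step ^^ l) s') \<in> X"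
            using same(1)[OF True] X_blk by metis
          then show ?thesis using True same(2) by (simp add: alive_Suc)
        next
          case False
          then show ?thesis using Suc by (simp add: alive_Suc)
        qed
      qed
      then have "itinerary k' = itinerary s'" using same by (auto simp: itinerary_def)
      moreover have "alive n k'" using same n(5) \<open>n = n'\<close> by simp
      moreover have "k = \<alpha> ((step ^^ n) k')" using k'(4) \<alpha>_inv[OF k(1)] by simp
      ultimately show "k \<in> J" unfolding J piece_def using k'S bk n(7) by auto
    qed
    then show "convex_in I J \<and>
      (\<exists>b. \<forall>j\<in>J. \<exists>n s. alive n s \<and> blk s = b \<and> j = \<alpha> ((step ^^ n) s))"
      by (auto simp: J piece_def)
  qed
  ultimately show ?thesis by blast
qed

text \<open>
  The trace of \<open>S\<close> is closed under both involutions, and its part in a terminal block is a finite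
  union of convex sets. Each of these sets is reached from a single block of \<open>S\<close>. Properties that
  do not change along the orbits, here called \<open>kind\<close> and later the distinction between
  \<open>p\<close>-letters and \<open>q\<close>-letters, are inherited from that block.
\<close>

theorem trace_set_exists:
  fixes kind :: "'a \<Rightarrow> 'k"
  assumes kind_\<alpha>: "\<And>i. i \<in> I \<Longrightarrow> kind (\<alpha> i) = kind i" and kind_\<beta>: "\<And>i. i \<in> X \<Longrightarrow> kind (\<beta> i) = kind i"
  shows "\<exists>K\<subseteq>I. S \<subseteq> K \<and> (\<forall>i\<in>K. \<alpha> i \<in> K) \<and> (\<forall>i\<in>K \<inter> X. \<beta> i \<in> K) \<and>
    (\<forall>b0. (\<forall>i\<in>I. blk i = b0 \<longrightarrow> i \<notin> X \<and> i \<notin> S) \<longrightarrow>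
      (\<exists>\<J>. finite \<J> \<and> \<Union>\<J> = {i \<in> K. blk i = b0} \<and>
        (\<forall>J\<in>\<J>. convex_in I J \<and> (\<exists>b. \<forall>j\<in>J. \<exists>s\<in>S. blk s = b \<and> kind j = kind s))))"
proof (intro exI[of _ traces] conjI allI impI ballI)
  show sub: "traces \<subseteq> I"
  proof
    fix i assume "i \<in> traces"
    then obtain n s where "alive n s" "i = (step ^^ n) s \<or> i = \<alpha> ((step ^^ n) s)"
      unfolding traces_def by (elim CollectE exE conjE)
    then show "i \<in> I" using orbit_in[of n s] \<alpha>_in[of "(step ^^ n) s"] by (elim disjE) simp_all
  qed
  show "S \<subseteq> traces" by (rule S_subset_traces)
  show "\<alpha> i \<in> traces" if "i \<in> traces" for i using that by (rule traces_\<alpha>)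
  show "\<beta> i \<in> traces" if "i \<in> traces \<inter> X" for i using that traces_\<beta> by blast
  fix b0 assume b0: "\<forall>i\<in>I. blk i = b0 \<longrightarrow> i \<notin> X \<and> i \<notin> S"
  have kind: "kind ((step ^^ n) s) = kind s" if "alive n s" for n s
    using that
  proof (induction n)
    case (Suc n)
    then have "alive n s" "\<alpha> ((step ^^ n) s) \<in> X" "(step ^^ n) s \<in> I"
      using orbit_in by (auto simp: alive_Suc)
    then show ?case using Suc.IH kind_\<alpha> kind_\<beta> by simp
  qed simp
  have b0': "i \<notin> X \<and> i \<notin> S" if "i \<in> I" "blk i = b0" for i using b0 that by blast
  have "\<exists>\<J>. finite \<J> \<and> \<Union>\<J> = {i \<in> I. blk i = b0 \<and> i \<in> traces} \<and>
    (\<forall>J\<in>\<J>. convex_in I J \<and>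
      (\<exists>b. \<forall>j\<in>J. \<exists>n s. alive n s \<and> blk s = b \<and> j = \<alpha> ((step ^^ n) s)))"
    by (rule traces_in_terminal_block) (rule b0')
  then obtain \<J> where J: "finite \<J>" "\<Union>\<J> = {i \<in> I. blk i = b0 \<and> i \<in> traces}"
    "\<forall>J\<in>\<J>. convex_in I J \<and> (\<exists>b. \<forall>j\<in>J. \<exists>n s. alive n s \<and> blk s = b \<and> j = \<alpha> ((step ^^ n) s))"
    by (elim exE conjE)
  have "\<exists>s\<in>S. blk s = b \<and> kind j = kind s" if "alive n s" "blk s = b" "j = \<alpha> ((step ^^ n) s)" for n s b j
  proof
    show "s \<in> S" using that(1) by (simp add: alive_def)
    show "blk s = b \<and> kind j = kind s"
      using that kind[OF that(1)] kind_\<alpha>[OF orbit_in[OF that(1)]] by simp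
  qed
  note source = this
  have "\<forall>J\<in>\<J>. convex_in I J \<and> (\<exists>b. \<forall>j\<in>J. \<exists>s\<in>S. blk s = b \<and> kind j = kind s)"
  proof
    fix J assume "J \<in> \<J>"
    from bspec[OF J(3) this] obtain b
      where b: "convex_in I J" "\<forall>j\<in>J. \<exists>n s. alive n s \<and> blk s = b \<and> j = \<alpha> ((step ^^ n) s)"
      by (elim exE conjE)
    have "\<exists>s\<in>S. blk s = b \<and> kind j = kind s" if "j \<in> J" for j
    proof -
      from b(2) \<open>j \<in> J\<close> have "\<exists>n s. alive n s \<and> blk s = b \<and> j = \<alpha> ((step ^^ n) s)" by (rule bspec)
      then obtain n s where "alive n s" "blk s = b" "j = \<alpha> ((step ^^ n) s)" by (elim exE conjE)
      then show ?thesis by (rule source)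
    qed
    then show "convex_in I J \<and> (\<exists>b. \<forall>j\<in>J. \<exists>s\<in>S. blk s = b \<and> kind j = kind s)" using b(1) by blast
  qed
  moreover have "\<Union>\<J> = {i \<in> traces. blk i = b0}" unfolding J(2) using sub by blast
  ultimately show "\<exists>\<J>. finite \<J> \<and> \<Union>\<J> = {i \<in> traces. blk i = b0} \<and>
        (\<forall>J\<in>\<J>. convex_in I J \<and> (\<exists>b. \<forall>j\<in>J. \<exists>s\<in>S. blk s = b \<and> kind j = kind s))"
    using J(1) by (intro exI[of _ \<J>] conjI)
qed

end

section \<open>Deleting a product of conjugates of pure words\<close>

lemma restrict_cat:
  assumes "\<And>W. W \<in> set Ws \<Longrightarrow> unit_word W"
  shows "cat Ws |` S = cat (map (\<lambda>m. (Ws ! m) |` {u. real m + u \<in> S}) [0..<length Ws])"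
proof
  fix t
  show "(cat Ws |` S) t = cat (map (\<lambda>m. (Ws ! m) |` {u. real m + u \<in> S}) [0..<length Ws]) t"
  proof (cases "0 \<le> t \<and> nat \<lfloor>t\<rfloor> < length Ws")
    case True
    then have "real (nat \<lfloor>t\<rfloor>) + frac t = t" by (simp add: frac_def)
    then show ?thesis using True by (simp add: cat_def restrict_map_def)
  next
    case False
    then show ?thesis by (auto simp: cat_def restrict_map_def)
  qed
qed

definition partner :: "('i \<times> 'i) set \<Rightarrow> 'i \<Rightarrow> 'i" where
  "partner A i = (SOME j. (i, j) \<in> A \<or> (j, i) \<in> A)"

lemma partner_eq:
  assumes "arch_system W A" "(i, j) \<in> A \<or> (j, i) \<in> A"
  shows "partner A i = j"
  unfolding partner_def
proof (rule some_equality)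
  fix k assume k: "(i, k) \<in> A \<or> (k, i) \<in> A"
  have ne: "i \<noteq> j" "i \<noteq> k" using assms(2) k arch_systemD(1)[OF assms(1)] by auto
  have disj: "(a, b) = (c, d)" if "(a, b) \<in> A" "(c, d) \<in> A" "i \<in> {a, b}" "i \<in> {c, d}" for a b c d
    using arch_systemD(3)[OF assms(1) that(1,2)] that(3,4) by blast
  show "k = j"
    using assms(2) k ne disj[of i j i k] disj[of i j k i] disj[of j i i k] disj[of j i k i] by auto
qed (fact assms(2))

lemma partner:
  assumes "total_arch_system W A" "i \<in> dom W"
  shows "(i, partner A i) \<in> A \<or> (partner A i, i) \<in> A" and "partner A i \<in> dom W"
    and "partner A (partner A i) = i"
    and "\<exists>x. W i = Some x \<and> W (partner A i) = Some (inverse_letter x)"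
proof -
  have A: "arch_system W A" "ends A = dom W" using assms(1) by (auto simp: total_arch_system_def)
  have "i \<in> ends A" using A(2) assms(2) by simp
  then obtain j where j: "(i, j) \<in> A \<or> (j, i) \<in> A" by force
  have p: "partner A i = j" by (rule partner_eq[OF A(1) j])
  then show "(i, partner A i) \<in> A \<or> (partner A i, i) \<in> A" using j by simp
  show "partner A i \<in> dom W" unfolding p using j arch_system_dom[OF A(1)] by blast
  show "partner A (partner A i) = i" unfolding p using j by (intro partner_eq[OF A(1)]) blast
  show "\<exists>x. W i = Some x \<and> W (partner A i) = Some (inverse_letter x)"
    unfolding p using j arch_systemD(2)[OF A(1), of i j] arch_systemD(2)[OF A(1), of j i] by auto
qed

definition pure :: "('i, gen) word \<Rightarrow> bool" where
  "pure U \<longleftrightarrow> only_p U \<or> only_q U"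

definition is_P :: "gen signed \<Rightarrow> bool" where
  "is_P a \<longleftrightarrow> (\<exists>n. base a = P n)"

lemma is_P_inverse_letter [simp]: "is_P (inverse_letter a) = is_P a"
  by (simp add: is_P_def)

lemma only_p_iff: "only_p U \<longleftrightarrow> (\<forall>i a. U i = Some a \<longrightarrow> is_P a)"
proof -
  have "a \<in> range (Pos \<circ> P) \<union> range (Neg \<circ> P) \<longleftrightarrow> is_P a" for a
    by (cases a) (auto simp: is_P_def)
  then show ?thesis unfolding only_p_def ran_def by blast
qed

lemma only_q_iff: "only_q U \<longleftrightarrow> (\<forall>i a. U i = Some a \<longrightarrow> \<not> is_P a)"
proof -
  have "a \<in> range (Pos \<circ> Q) \<union> range (Neg \<circ> Q) \<longleftrightarrow> \<not> is_P a" for a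
  proof (cases a)
    case (Pos x)
    then show ?thesis by (cases x) (auto simp: is_P_def)
  next
    case (Neg x)
    then show ?thesis by (cases x) (auto simp: is_P_def)
  qed
  then show ?thesis unfolding only_q_def ran_def by blast
qed

lemma sum_list_conjugates:
  fixes v :: "nat \<Rightarrow> 'g::group_add"
  shows "sum_list (map (\<lambda>m. v m) [0..<3 * n + 1]) = v 0 + (\<Sum>k\<leftarrow>[0..<n]. v (3*k+1) + v (3*k+2) + v (3*k+3))"
proof (induction n)
  case 0
  then show ?case by simp
next
  case (Suc n)
  have "[0..<3 * Suc n + 1] = [0..<3 * n + 1] @ [3*n+1, 3*n+2, 3*n+3]"
  proof -
    have e: "3 * Suc n + 1 = Suc (Suc (Suc (3 * n + 1)))" by simp
    show ?thesis unfolding e upt_Suc by simp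
  qed
  then have "sum_list (map v [0..<3 * Suc n + 1])
      = sum_list (map v [0..<3 * n + 1]) + (v (3*n+1) + v (3*n+2) + v (3*n+3))"
    by (simp only: map_append sum_list_append) (simp add: add.assoc)
  also have "\<dots> = v 0 + ((\<Sum>k\<leftarrow>[0..<n]. v (3*k+1) + v (3*k+2) + v (3*k+3)) + (v (3*n+1) + v (3*n+2) + v (3*n+3)))"
    unfolding Suc.IH by (rule add.assoc)
  also have "(\<Sum>k\<leftarrow>[0..<n]. v (3*k+1) + v (3*k+2) + v (3*k+3)) + (v (3*n+1) + v (3*n+2) + v (3*n+3))
      = (\<Sum>k\<leftarrow>[0..<Suc n]. v (3*k+1) + v (3*k+2) + v (3*k+3))"
    by simp
  finally show ?case .
qed

text \<open>
  Form the long word \<open>w2\<inverse> x\<^sub>0 s\<^sub>0 x\<^sub>0\<inverse> \<dots> w1\<close>. It has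
  value zero, hence a total arch system, whose partner map is \<open>\<alpha>\<close>. Let
  \<open>\<beta>\<close> exchange each letter of an \<open>x\<^sub>k\<close> with its inverse in
  \<open>x\<^sub>k\<inverse>\<close>, and delete the trace of the letters of all \<open>s\<^sub>k\<close> under
  \<open>\<alpha>\<close> and \<open>\<beta>\<close>. What remains still has a total arch system, since whole
  arches are deleted; the blocks \<open>s\<^sub>k\<close> are gone; and the remaining parts of
  \<open>x\<^sub>k\<close> and \<open>x\<^sub>k\<inverse>\<close> are inverse to each other, so their values
  cancel. Hence the remaining parts of \<open>w1\<close> and \<open>w2\<close> have the same value. The deleted
  parts of \<open>w1\<close> and \<open>w2\<close> are finite unions of pure subwords because
  the orbits stop when they reach these two blocks.
\<close>

theorem normal_closure_deletion:
  fixes w1 w2 :: "(real, gen) word" and x s :: "nat \<Rightarrow> (real, gen) word"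
  assumes w1: "unit_word w1" "restricted w1" "reduced w1"
    and w2: "unit_word w2" "restricted w2" "reduced w2"
    and x: "\<And>k. k < n \<Longrightarrow> unit_word (x k) \<and> restricted (x k) \<and> reduced (x k)"
    and s: "\<And>k. k < n \<Longrightarrow> unit_word (s k) \<and> restricted (s k) \<and> reduced (s k) \<and> pure (s k)"
    and val: "val w2 = (\<Sum>k\<leftarrow>[0..<n]. val (x k) + val (s k) - val (x k)) + val w1"
  shows "\<exists>\<J>1 \<J>2. finite \<J>1 \<and> finite \<J>2 \<and>
    (\<forall>J\<in>\<J>1. convex_in (dom w1) J \<and> pure (w1 |` J)) \<and>
    (\<forall>J\<in>\<J>2. convex_in (dom w2) J \<and> pure (w2 |` J)) \<and>
    val (w1 |` (- \<Union>\<J>1)) = val (w2 |` (- \<Union>\<J>2))"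
proof -
  \<comment> \<open>block 0 is \<open>w2\<inverse>\<close>, blocks 3k+1, 3k+2 and 3k+3 are \<open>x\<^sub>k\<close>, \<open>s\<^sub>k\<close> and \<open>x\<^sub>k\<inverse>\<close>, and the last block is \<open>w1\<close>\<close>
  define B where "B m = (if m = 0 then inverse_word w2 else if m = 3*n+1 then w1
    else if m mod 3 = 1 then x (m div 3) else if m mod 3 = 2 then s (m div 3)
    else inverse_word (x (m div 3 - 1)))" for m
  define N where "N = 3*n+2"
  have B0: "B 0 = inverse_word w2" and B_last: "B (3*n+1) = w1" by (simp_all add: B_def)
  have B1: "B (3*k+1) = x k" if "k < n" for k
  proof -
    have "(3*k+1) mod 3 = 1" "(3*k+1) div 3 = k" by presburger+
    then show ?thesis using that by (simp add: B_def)
  qed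
  have B2: "B (3*k+2) = s k" if "k < n" for k
  proof -
    have "(3*k+2) mod 3 = 2" "(3*k+2) div 3 = k" "3*k+2 \<noteq> 3*n+1" by presburger+
    then show ?thesis using that by (simp add: B_def)
  qed
  have B3: "B (3*k+3) = inverse_word (x k)" if "k < n" for k
  proof -
    have "(3*k+3) mod 3 = 0" "(3*k+3) div 3 = Suc k" "3*k+3 \<noteq> 3*n+1" by presburger+
    then show ?thesis using that by (simp add: B_def)
  qed
  have cases: "m = 0 \<or> m = 3*n+1 \<or> (\<exists>k<n. m = 3*k+1) \<or> (\<exists>k<n. m = 3*k+2) \<or> (\<exists>k<n. m = 3*k+3)"
    if "m < N" for m
    using that unfolding N_def by presburger
  have Bgood: "unit_word (B m) \<and> restricted (B m) \<and> reduced (B m)" if "m < N" for m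
    using cases[OF that] B0 B_last B1 B2 B3 w1 w2 x s
    by (auto simp: unit_inverse_word restricted_inverse_word reduced_inverse_word)
  define Ws where "Ws = map B [0..<N]"
  have len: "length Ws = N" and nth: "m < N \<Longrightarrow> Ws ! m = B m" for m by (simp_all add: Ws_def)
  have good: "unit_word W \<and> restricted W" if "W \<in> set Ws" for W
    using that Bgood by (auto simp: Ws_def)
  then have unit: "unit_word W" if "W \<in> set Ws" for W using that by blast
  define U where "U = cat Ws"
  have sumN: "sum_list (map v [0..<N]) = v 0 + (\<Sum>k\<leftarrow>[0..<n]. v (3*k+1) + v (3*k+2) + v (3*k+3)) + v (3*n+1)"
    for v :: "nat \<Rightarrow> free_limit"
  proof -
    have "[0..<N] = [0..<3*n+1] @ [3*n+1]" by (simp add: N_def)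
    then have "sum_list (map v [0..<N]) = sum_list (map v [0..<3*n+1]) + v (3*n+1)"
      by (simp only: map_append sum_list_append) simp
    then show ?thesis by (simp only: sum_list_conjugates)
  qed
  have resU: "restricted U" unfolding U_def using good by (rule restricted_cat)
  have "val U = sum_list (map (\<lambda>m. val (B m)) [0..<N])"
    unfolding U_def using val_cat[of Ws] good by (simp add: Ws_def o_def)
  also have "\<dots> = - val w2 + (\<Sum>k\<leftarrow>[0..<n]. val (x k) + val (s k) - val (x k)) + val w1"
  proof -
    have "(\<Sum>k\<leftarrow>[0..<n]. val (B (3*k+1)) + val (B (3*k+2)) + val (B (3*k+3)))
        = (\<Sum>k\<leftarrow>[0..<n]. val (x k) + val (s k) - val (x k))"
    proof (intro arg_cong[of _ _ sum_list] map_cong refl)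
      fix k assume "k \<in> set [0..<n]"
      then have k: "k < n" by simp
      show "val (B (3*k+1)) + val (B (3*k+2)) + val (B (3*k+3)) = val (x k) + val (s k) - val (x k)"
        unfolding B1[OF k] B2[OF k] B3[OF k] using x[OF k] by (simp add: val_inverse_word)
    qed
    then show ?thesis unfolding sumN B0 B_last using w2 by (simp add: val_inverse_word)
  qed
  also have "\<dots> = 0" using val by (simp add: add.assoc)
  finally obtain A where A: "total_arch_system U A" using total_arch_system_if_val_zero[OF resU] by blast
  then have arch: "arch_system U A" by (simp add: total_arch_system_def)
  define I where "I = dom U"
  have I_iff: "t \<in> I \<longleftrightarrow> (\<exists>m<N. \<exists>u\<in>dom (B m). t = real m + u)" for t
    unfolding I_def U_def using dom_cat[of Ws, OF unit] nth by (auto simp: len)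
  have u01: "0 < u" "u < 1" if "u \<in> dom (B m)" "m < N" for u m
    using Bgood[OF that(2)] that(1) by (auto simp: unit_word_def)
  have Ueq: "U (real m + u) = B m u" if "0 \<le> u" "u < 1" "m < N" for m u
    unfolding U_def using cat_eq[of u m Ws] that len nth by simp
  define blk where "blk t = nat \<lfloor>t\<rfloor>" for t :: real
  have blk_eq: "blk (real m + u) = m" if "0 < u" "u < 1" for m u
  proof -
    have "\<lfloor>real m + u\<rfloor> = int m" using that by linarith
    then show ?thesis by (simp add: blk_def)
  qed
  have Iblk: "blk t < N" "t - real (blk t) \<in> dom (B (blk t))" "t \<in> block (blk t)" "0 < t - real (blk t)" "t - real (blk t) < 1"
    if t: "t \<in> I" for t
  proof -
    obtain m u where m: "m < N" "u \<in> dom (B m)" "t = real m + u" using t I_iff by blast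
    note u = u01[OF m(2,1)]
    have b: "blk t = m" using blk_eq[OF u] m(3) by simp
    then show "blk t < N" "t - real (blk t) \<in> dom (B (blk t))" "t \<in> block (blk t)" "0 < t - real (blk t)" "t - real (blk t) < 1"
      using m u by (simp_all add: block_def)
  qed
  have inI: "real m + u \<in> I" if "u \<in> dom (B m)" "m < N" for m u using I_iff that by blast
  have no_arch: "blk (partner A i) \<noteq> blk i" if i: "i \<in> I" for i
  proof
    assume eq: "blk (partner A i) = blk i"
    have pI: "partner A i \<in> I" using partner(2)[OF A] i by (simp add: I_def)
    have "i \<in> block (blk i)" "partner A i \<in> block (blk i)" using Iblk(3)[OF i] Iblk(3)[OF pI] eq by simp_all
    moreover have "blk i < length Ws" "reduced (Ws ! blk i)" using Iblk(1)[OF i] len nth Bgood by simp_all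
    ultimately have "(i, partner A i) \<notin> A" "(partner A i, i) \<notin> A"
      using no_arch_in_block[of Ws "blk i" A] unit arch unfolding U_def by metis+
    then show False using partner(1)[OF A, of i] i unfolding I_def by blast
  qed
  have blk_mono: "blk i \<le> blk j" if "i \<le> j" for i j
    unfolding blk_def using that by (intro nat_mono floor_mono)
  have blk_less_imp: "i < j" if "blk i < blk j" for i j
    using blk_mono[of j i] that by (meson not_less)
  have pin: "partner A i \<in> I" if "i \<in> I" for i using partner(2)[OF A] that by (simp add: I_def)
  have parch: "(i, partner A i) \<in> A \<and> i < partner A i" if "i \<in> I" "blk i < blk (partner A i)" for i
    using partner(1)[OF A, of i] that blk_less_imp[OF that(2)] arch_systemD(1)[OF arch, of "partner A i" i]
    by (auto simp: I_def)
  have parch': "(partner A i, i) \<in> A \<and> partner A i < i" if "i \<in> I" "blk (partner A i) < blk i" for i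
    using partner(1)[OF A, of i] that blk_less_imp[OF that(2)] arch_systemD(1)[OF arch, of i "partner A i"]
    by (auto simp: I_def)
  have pinj: "partner A i \<noteq> partner A j" if "i \<in> I" "j \<in> I" "i \<noteq> j" for i j
    using partner(3)[OF A] that unfolding I_def by metis
  have \<alpha>_anti: "partner A j < partner A i"
    if ij: "i \<in> I" "j \<in> I" "i < j" "blk i = blk j" "blk (partner A i) = blk (partner A j)" for i j
  proof (cases "blk i < blk (partner A i)")
    case True
    have a: "(i, partner A i) \<in> A" "(j, partner A j) \<in> A" using parch ij True by auto
    have "j < partner A i" using blk_less_imp ij True by simp
    then have "\<not> partner A i < partner A j" using arch_systemD(4)[OF arch a] ij by blast
    then show ?thesis using pinj[OF ij(1,2)] ij(3) by auto
  next
    case False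
    then have lt: "blk (partner A i) < blk i" using no_arch[OF ij(1)] by simp
    then have a: "(partner A i, i) \<in> A" "(partner A j, j) \<in> A" using parch' ij by auto
    have "partner A j < i" using blk_less_imp ij lt by simp
    then have "\<not> partner A i < partner A j" using arch_systemD(4)[OF arch a] ij by blast
    then show ?thesis using pinj[OF ij(1,2)] ij(3) by auto
  qed
  have \<alpha>_convex: "blk (partner A k) = blk (partner A i)"
    if ijk: "i \<in> I" "j \<in> I" "k \<in> I" "i < k" "k < j" "blk i = blk j" "blk (partner A i) = blk (partner A j)" for i j k
  proof -
    have bk: "blk k = blk i" using blk_mono[of i k] blk_mono[of k j] ijk by simp
    have nk: "blk (partner A k) \<noteq> blk i" using no_arch[OF ijk(3)] bk by simp
    have "partner A j \<le> partner A k \<and> partner A k \<le> partner A i"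
    proof (cases "blk i < blk (partner A i)")
      case True
      have a: "(i, partner A i) \<in> A" "(j, partner A j) \<in> A" using parch ijk True by auto
      have jpi: "j < partner A i" "k < partner A i" using blk_less_imp ijk bk True by auto
      obtain l m where lm: "(l, m) \<in> A" "k \<in> {l, m}" "i < l" "m < partner A i"
        using arch_systemD(5)[OF arch a(1), of k] ijk jpi unfolding I_def by blast
      then have "(k = l \<and> partner A k = m) \<or> (k = m \<and> partner A k = l)"
        using partner_eq[OF arch, of l m] partner_eq[OF arch, of m l] by blast
      moreover have "\<not> (k = m \<and> partner A k = l)"
      proof
        assume "k = m \<and> partner A k = l"
        then have "i < partner A k" "partner A k < k" using lm arch_systemD(1)[OF arch lm(1)] by auto
        then have "blk (partner A k) = blk i" using blk_mono[of i "partner A k"] blk_mono[of "partner A k" k] bk by simp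
        then show False using nk by simp
      qed
      ultimately have kl: "(k, partner A k) \<in> A" "partner A k < partner A i" using lm by auto
      have "\<not> partner A k < partner A j"
      proof
        assume "partner A k < partner A j"
        then have "\<not> j < partner A k" using arch_systemD(4)[OF arch kl(1) a(2)] ijk by blast
        moreover have "k < partner A k" using arch_systemD(1)[OF arch kl(1)] .
        ultimately have "blk (partner A k) = blk i"
          using blk_mono[of k "partner A k"] blk_mono[of "partner A k" j] bk ijk by simp
        then show False using nk by simp
      qed
      then show ?thesis using kl(2) by simp
    next
      case False
      then have lt: "blk (partner A i) < blk i" using no_arch[OF ijk(1)] by simp
      then have a: "(partner A i, i) \<in> A" "(partner A j, j) \<in> A" using parch' ijk by auto
      have pji: "partner A j < i" "partner A j < k" using blk_less_imp ijk bk lt by auto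
      obtain l m where lm: "(l, m) \<in> A" "k \<in> {l, m}" "partner A j < l" "m < j"
        using arch_systemD(5)[OF arch a(2), of k] ijk pji unfolding I_def by blast
      then have "(k = l \<and> partner A k = m) \<or> (k = m \<and> partner A k = l)"
        using partner_eq[OF arch, of l m] partner_eq[OF arch, of m l] by blast
      moreover have "\<not> (k = l \<and> partner A k = m)"
      proof
        assume "k = l \<and> partner A k = m"
        then have "k < partner A k" "partner A k < j" using lm arch_systemD(1)[OF arch lm(1)] by auto
        then have "blk (partner A k) = blk i" using blk_mono[of k "partner A k"] blk_mono[of "partner A k" j] bk ijk by simp
        then show False using nk by simp
      qed
      ultimately have kl: "(partner A k, k) \<in> A" "partner A j < partner A k" using lm by auto
      have "\<not> partner A i < partner A k"
      proof
        assume "partner A i < partner A k"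
        then have "\<not> partner A k < i" using arch_systemD(4)[OF arch a(1) kl(1)] ijk by blast
        moreover have "partner A k < k" using arch_systemD(1)[OF arch kl(1)] .
        ultimately have "blk (partner A k) = blk i"
          using blk_mono[of i "partner A k"] blk_mono[of "partner A k" k] bk by simp
        then show False using nk by simp
      qed
      then show ?thesis using kl(2) by simp
    qed
    then show ?thesis using blk_mono[of "partner A j" "partner A k"] blk_mono[of "partner A k" "partner A i"] ijk(7) by simp
  qed
  \<comment> \<open>the two occurrences of each conjugator, and the pure blocks\<close>
  define X where "X = {t \<in> I. \<exists>k<n. blk t = 3*k+1 \<or> blk t = 3*k+3}"
  define S where "S = {t \<in> I. \<exists>k<n. blk t = 3*k+2}"
  \<comment> \<open>the reflection that exchanges the unit intervals at 3k+1 and 3k+3 is \<open>t \<mapsto> (3k+1) + (3k+3) + 1 - t\<close>\<close>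
  define c where "c m = (if m mod 3 = 1 then 6 * (m div 3) + 5 else 6 * (m div 3) - 1)" for m :: nat
  define \<beta> where "\<beta> t = real (c (blk t)) - t" for t
  have c1: "c (3*k+1) = 6*k+5" and c3: "c (3*k+3) = 6*k+5" for k :: nat
  proof -
    have "(3*k+1) mod 3 = 1" "(3*k+1) div 3 = k" by presburger+
    then show "c (3*k+1) = 6*k+5" by (simp add: c_def)
    have "(3*k+3) mod 3 = 0" "(3*k+3) div 3 = Suc k" by presburger+
    then show "c (3*k+3) = 6*k+5" by (simp add: c_def)
  qed
  have \<beta>1: "real (3*k+3) + (1 - u) \<in> I \<and> \<beta> (real (3*k+1) + u) = real (3*k+3) + (1 - u)
      \<and> blk (real (3*k+3) + (1 - u)) = 3*k+3 \<and> U (real (3*k+3) + (1 - u)) = map_option inverse_letter (U (real (3*k+1) + u))"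
    if u: "u \<in> dom (x k)" "k < n" for u k
  proof -
    have uB: "u \<in> dom (B (3*k+1))" and lt: "3*k+1 < N" "3*k+3 < N" using u B1[OF u(2)] by (auto simp: N_def)
    note u0 = u01[OF uB lt(1)]
    have "1 - u \<in> dom (B (3*k+3))" using u by (simp add: B3 dom_inverse_word)
    then have "real (3*k+3) + (1 - u) \<in> I" using lt by (intro inI)
    moreover have "blk (real (3*k+1) + u) = 3*k+1" by (rule blk_eq[OF u0])
    then have "\<beta> (real (3*k+1) + u) = real (3*k+3) + (1 - u)"
      using c1[of k] unfolding \<beta>_def by simp
    moreover have "blk (real (3*k+3) + (1 - u)) = 3*k+3" by (rule blk_eq) (use u0 in auto)
    moreover have "U (real (3*k+3) + (1 - u)) = map_option inverse_letter (U (real (3*k+1) + u))"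
      using Ueq[of "1 - u" "3*k+3"] Ueq[of u "3*k+1"] u0 lt B1[OF u(2)] B3[OF u(2)] by (simp add: inverse_word_def)
    ultimately show ?thesis by blast
  qed
  have \<beta>3: "real (3*k+1) + (1 - u) \<in> I \<and> \<beta> (real (3*k+3) + u) = real (3*k+1) + (1 - u)
      \<and> blk (real (3*k+1) + (1 - u)) = 3*k+1 \<and> U (real (3*k+1) + (1 - u)) = map_option inverse_letter (U (real (3*k+3) + u))"
    if u: "u \<in> dom (inverse_word (x k))" "k < n" for u k
  proof -
    have uB: "u \<in> dom (B (3*k+3))" and lt: "3*k+1 < N" "3*k+3 < N" using u B3[OF u(2)] by (auto simp: N_def)
    note u0 = u01[OF uB lt(2)]
    have "1 - u \<in> dom (B (3*k+1))" unfolding B1[OF u(2)] using u by (auto simp: dom_inverse_word)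
    then have "real (3*k+1) + (1 - u) \<in> I" using lt by (intro inI)
    moreover have "blk (real (3*k+3) + u) = 3*k+3" by (rule blk_eq[OF u0])
    then have "\<beta> (real (3*k+3) + u) = real (3*k+1) + (1 - u)"
      using c3[of k] unfolding \<beta>_def by simp
    moreover have "blk (real (3*k+1) + (1 - u)) = 3*k+1" by (rule blk_eq) (use u0 in auto)
    moreover have "U (real (3*k+1) + (1 - u)) = map_option inverse_letter (U (real (3*k+3) + u))"
      using Ueq[of "1 - u" "3*k+1"] Ueq[of u "3*k+3"] u0 lt B1[OF u(2)] B3[OF u(2)]
      by (simp add: inverse_word_def option.map_comp o_def option.map_ident)
    ultimately show ?thesis by blast
  qed
  have X_cases: "(\<exists>k<n. \<exists>u\<in>dom (x k). t = real (3*k+1) + u \<and> blk t = 3*k+1) \<or>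
      (\<exists>k<n. \<exists>u\<in>dom (inverse_word (x k)). t = real (3*k+3) + u \<and> blk t = 3*k+3)" if t: "t \<in> X" for t
  proof -
    obtain k where k: "t \<in> I" "k < n" "blk t = 3*k+1 \<or> blk t = 3*k+3" using t by (auto simp: X_def)
    have "t = real (blk t) + (t - real (blk t))" by simp
    then show ?thesis using k Iblk(2)[OF k(1)] B1[OF k(2)] B3[OF k(2)] by metis
  qed
  have \<beta>_X: "\<beta> t \<in> X \<and> \<beta> (\<beta> t) = t \<and> U (\<beta> t) = map_option inverse_letter (U t) \<and> c (blk (\<beta> t)) = c (blk t) \<and>
      (\<forall>k. blk t = 3*k+1 \<longrightarrow> blk (\<beta> t) = 3*k+3) \<and> (\<forall>k. blk t = 3*k+3 \<longrightarrow> blk (\<beta> t) = 3*k+1)" if t: "t \<in> X" for t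
    using X_cases[OF t]
  proof (elim disjE exE conjE bexE)
    fix k u assume k: "k < n" "u \<in> dom (x k)" "t = real (3*k+1) + u" "blk t = 3*k+1"
    note b = \<beta>1[OF k(2,1)]
    have bt: "\<beta> t = real (3*k+3) + (1 - u)" "blk (\<beta> t) = 3*k+3" "\<beta> t \<in> I" using b k(3) by auto
    have cc: "c (blk (\<beta> t)) = c (blk t)" using bt(2) k(4) c1 c3 by simp
    then have "\<beta> (\<beta> t) = t" by (simp add: \<beta>_def)
    moreover have "\<beta> t \<in> X" using bt k(1) by (auto simp: X_def)
    moreover have "U (\<beta> t) = map_option inverse_letter (U t)" using b k(3) bt by simp
    moreover have "(\<forall>k'. blk t = 3*k'+1 \<longrightarrow> blk (\<beta> t) = 3*k'+3)" using bt(2) k(4) by auto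
    moreover have "(\<forall>k'. blk t \<noteq> 3*k'+3)" using k(4) by presburger
    ultimately show ?thesis using cc by blast
  next
    fix k u assume k: "k < n" "u \<in> dom (inverse_word (x k))" "t = real (3*k+3) + u" "blk t = 3*k+3"
    note b = \<beta>3[OF k(2,1)]
    have bt: "\<beta> t = real (3*k+1) + (1 - u)" "blk (\<beta> t) = 3*k+1" "\<beta> t \<in> I" using b k(3) by auto
    have cc: "c (blk (\<beta> t)) = c (blk t)" using bt(2) k(4) c1 c3 by simp
    then have "\<beta> (\<beta> t) = t" by (simp add: \<beta>_def)
    moreover have "\<beta> t \<in> X" using bt k(1) by (auto simp: X_def)
    moreover have "U (\<beta> t) = map_option inverse_letter (U t)" using b k(3) bt by simp
    moreover have "(\<forall>k'. blk t = 3*k'+3 \<longrightarrow> blk (\<beta> t) = 3*k'+1)" using bt(2) k(4) by auto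
    moreover have "(\<forall>k'. blk t \<noteq> 3*k'+1)" using k(4) by presburger
    ultimately show ?thesis using cc by blast
  qed
  define kind where "kind t = is_P (the (U t))" for t
  have "\<exists>K\<subseteq>I. S \<subseteq> K \<and> (\<forall>i\<in>K. partner A i \<in> K) \<and> (\<forall>i\<in>K \<inter> X. \<beta> i \<in> K) \<and>
    (\<forall>b0. (\<forall>i\<in>I. blk i = b0 \<longrightarrow> i \<notin> X \<and> i \<notin> S) \<longrightarrow>
      (\<exists>\<J>. finite \<J> \<and> \<Union>\<J> = {i \<in> K. blk i = b0} \<and>
        (\<forall>J\<in>\<J>. convex_in I J \<and> (\<exists>b. \<forall>j\<in>J. \<exists>s\<in>S. blk s = b \<and> kind j = kind s))))"
  proof (rule trace_set_exists)
    show "blk i \<le> blk j" if "i \<le> j" for i j by (rule blk_mono[OF that])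
    show "blk i < N" if "i \<in> I" for i by (rule Iblk(1)[OF that])
    show "partner A i \<in> I" if "i \<in> I" for i by (rule pin[OF that])
    show "partner A (partner A i) = i" if "i \<in> I" for i using partner(3)[OF A] that by (simp add: I_def)
    show "partner A j < partner A i"
      if "i \<in> I" "j \<in> I" "i < j" "blk i = blk j" "blk (partner A i) = blk (partner A j)" for i j
      by (rule \<alpha>_anti[OF that])
    show "blk (partner A k) = blk (partner A i)"
      if "i \<in> I" "j \<in> I" "k \<in> I" "i < k" "k < j" "blk i = blk j" "blk (partner A i) = blk (partner A j)" for i j k
      by (rule \<alpha>_convex[OF that])
    show "X \<subseteq> I" "S \<subseteq> I" by (auto simp: X_def S_def)
    show "\<beta> i \<in> X" "\<beta> (\<beta> i) = i" if "i \<in> X" for i using \<beta>_X[OF that] by blast+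
    show "j \<in> X" if "i \<in> X" "j \<in> I" "blk i = blk j" for i j using that by (auto simp: X_def)
    show "j \<in> S" if "i \<in> S" "j \<in> I" "blk i = blk j" for i j using that by (auto simp: S_def)
    show "blk (\<beta> i) = blk (\<beta> j)" if ij: "i \<in> X" "j \<in> X" "blk i = blk j" for i j
    proof -
      obtain k where "blk i = 3*k+1 \<or> blk i = 3*k+3" using ij(1) unfolding X_def by blast
      then show ?thesis using \<beta>_X[OF ij(1)] \<beta>_X[OF ij(2)] ij(3) by metis
    qed
    show "\<beta> j < \<beta> i" if "i \<in> X" "j \<in> X" "i < j" "blk i = blk j" for i j
      using that by (simp add: \<beta>_def)
    show "S \<inter> X = {}"
    proof -
      have "3*k+2 \<noteq> 3*l+1" "3*k+2 \<noteq> 3*l+3" for k l :: nat by presburger+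
      then show ?thesis by (auto simp: X_def S_def)
    qed
    show "kind (partner A i) = kind i" if "i \<in> I" for i
      using partner(4)[OF A, of i] that by (auto simp: kind_def I_def)
    show "kind (\<beta> i) = kind i" if i: "i \<in> X" for i
    proof -
      have "i \<in> dom U" using i by (simp add: X_def I_def)
      then show ?thesis using \<beta>_X[OF i] by (auto simp: kind_def domIff)
    qed
  qed
  then obtain K where K12: "K \<subseteq> I" "S \<subseteq> K" and K3: "\<forall>i\<in>K. partner A i \<in> K" and K4: "\<forall>i\<in>K \<inter> X. \<beta> i \<in> K"
    and KJ: "\<forall>b0. (\<forall>i\<in>I. blk i = b0 \<longrightarrow> i \<notin> X \<and> i \<notin> S) \<longrightarrow>
      (\<exists>\<J>. finite \<J> \<and> \<Union>\<J> = {i \<in> K. blk i = b0} \<and>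
        (\<forall>J\<in>\<J>. convex_in I J \<and> (\<exists>b. \<forall>j\<in>J. \<exists>s\<in>S. blk s = b \<and> kind j = kind s)))"
    by (elim exE conjE)
  have K: "K \<subseteq> I" "S \<subseteq> K" "\<And>i. i \<in> K \<Longrightarrow> partner A i \<in> K" "\<And>i. i \<in> K \<Longrightarrow> i \<in> X \<Longrightarrow> \<beta> i \<in> K"
    using K12 K3 K4 by simp_all
  have pure: "\<exists>v. \<forall>j\<in>J. kind j = v" if J: "\<forall>j\<in>J. \<exists>s\<in>S. blk s = b \<and> kind j = kind s" for J b
  proof (cases "J = {}")
    case False
    then obtain s0 where s0: "s0 \<in> S" "blk s0 = b" using J by blast
    then obtain k where k: "k < n" "b = 3*k+2" by (auto simp: S_def)
    have kind: "kind t = is_P (the (s k (t - real b))) \<and> t - real b \<in> dom (s k)" if "t \<in> S" "blk t = b" for t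
    proof -
      have tI: "t \<in> I" using that by (simp add: S_def)
      have "U (real b + (t - real b)) = B b (t - real b)"
        using Ueq[of "t - real b" b] Iblk[OF tI] that by simp
      then show ?thesis using B2[OF k(1)] k(2) Iblk(2)[OF tI] that by (simp add: kind_def)
    qed
    have "pure (s k)" using s[OF k(1)] by blast
    then have "\<exists>v. \<forall>u\<in>dom (s k). is_P (the (s k u)) = v"
      unfolding pure_def only_p_iff only_q_iff by (auto simp: domIff)
    then obtain v where "\<forall>u\<in>dom (s k). is_P (the (s k u)) = v" by blast
    then have "\<forall>j\<in>J. kind j = v" using J kind by metis
    then show ?thesis by blast
  qed simp
  \<comment> \<open>what is left of the blocks; only the first and the last contribute to the value\<close>
  define B' where "B' m = B m |` {u. real m + u \<in> - K}" for m
  have "U |` (- K) = cat (map (\<lambda>m. (Ws ! m) |` {u. real m + u \<in> - K}) [0..<length Ws])"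
    unfolding U_def by (rule restrict_cat) (rule unit)
  also have "map (\<lambda>m. (Ws ! m) |` {u. real m + u \<in> - K}) [0..<length Ws] = map B' [0..<N]"
    by (rule map_cong) (simp_all add: len nth B'_def)
  finally have "U |` (- K) = cat (map B' [0..<N])" .
  moreover have "unit_word (B' m) \<and> restricted (B' m)" if "m < N" for m
    using Bgood[OF that] by (auto simp: B'_def unit_word_def restricted_restrict_map)
  then have "unit_word W \<and> restricted W" if "W \<in> set (map B' [0..<N])" for W using that by auto
  from val_cat[of "map B' [0..<N]", OF this]
  have "val (cat (map B' [0..<N])) = sum_list (map (\<lambda>m. val (B' m)) [0..<N])" by (simp add: o_def)
  ultimately have "val (U |` (- K)) = sum_list (map (\<lambda>m. val (B' m)) [0..<N])" by simp
  also have "\<dots> = val (B' 0) + val (B' (3*n+1))"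
  proof -
    have "val (B' (3*k+1)) + val (B' (3*k+2)) + val (B' (3*k+3)) = 0" if k: "k < n" for k
    proof -
      have "B' (3*k+2) = Map.empty"
      proof
        fix u show "B' (3*k+2) u = None"
        proof (cases "u \<in> dom (s k)")
          case True
          then have "u \<in> dom (B (3*k+2))" "3*k+2 < N" using B2[OF k] k by (auto simp: N_def)
          then have "real (3*k+2) + u \<in> I" "blk (real (3*k+2) + u) = 3*k+2"
            using inI blk_eq u01 by blast+
          then have "real (3*k+2) + u \<in> S" using k by (auto simp: S_def)
          then show ?thesis using K(2) by (auto simp: B'_def)
        next
          case False
          then show ?thesis using B2[OF k] by (simp add: B'_def restrict_map_def domIff)
        qed
      qed
      moreover have "B' (3*k+3) = inverse_word (B' (3*k+1))"
      proof
        fix u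
        show "B' (3*k+3) u = inverse_word (B' (3*k+1)) u"
        proof (cases "u \<in> dom (inverse_word (x k))")
          case True
          then have v: "1 - u \<in> dom (x k)" by (auto simp: dom_inverse_word)
          have X1: "real (3*k+1) + (1 - u) \<in> X" "\<beta> (real (3*k+3) + u) = real (3*k+1) + (1 - u)"
            using \<beta>3[OF True k] k by (auto simp: X_def)
          have X3: "real (3*k+3) + u \<in> X" "\<beta> (real (3*k+1) + (1 - u)) = real (3*k+3) + u"
            using \<beta>1[OF v k] k by (auto simp: X_def)
          have "real (3*k+3) + u \<in> K \<longleftrightarrow> real (3*k+1) + (1 - u) \<in> K"
            using K(4)[OF _ X1(1)] K(4)[OF _ X3(1)] X1(2) X3(2) by auto
          then show ?thesis
            unfolding B'_def B3[OF k] B1[OF k] by (simp add: inverse_word_def restrict_map_def)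
        next
          case False
          then have "inverse_word (x k) u = None" "x k (1 - u) = None"
            by (auto simp: domIff inverse_word_def)
          then show ?thesis
            unfolding B'_def B3[OF k] B1[OF k] by (simp add: inverse_word_def restrict_map_def)
        qed
      qed
      moreover have "restricted (B' (3*k+1))"
        unfolding B'_def B1[OF k] using x[OF k] restricted_restrict_map by blast
      ultimately show ?thesis by (simp add: val_inverse_word)
    qed
    then have "(\<Sum>k\<leftarrow>[0..<n]. val (B' (3*k+1)) + val (B' (3*k+2)) + val (B' (3*k+3))) = (\<Sum>k\<leftarrow>[0..<n]. 0)"
      by (intro arg_cong[of _ _ sum_list] map_cong refl) simp
    then show ?thesis unfolding sumN by simp
  qed
  finally have val': "val (U |` (- K)) = val (B' 0) + val (B' (3*n+1))" .
  have "total_arch_system (U |` (- K)) (A \<inter> (- K) \<times> (- K))"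
  proof (rule total_arch_system_restrict[OF A])
    fix i j assume ij: "(i, j) \<in> A"
    have "partner A i = j" "partner A j = i" using partner_eq[OF arch] ij by blast+
    then show "i \<in> - K \<longleftrightarrow> j \<in> - K" using K(3)[of i] K(3)[of j] by auto
  qed
  then have "val (U |` (- K) |` (- dom (U |` (- K)))) = val (U |` (- K))"
    using val_delete_arches[of "U |` (- K)" "A \<inter> (- K) \<times> (- K)"] restricted_restrict_map[OF resU]
    unfolding total_arch_system_def by metis
  moreover have "U |` (- K) |` (- dom (U |` (- K))) = Map.empty"
    by (rule ext) (simp add: restrict_map_def domIff)
  ultimately have zero: "val (B' 0) + val (B' (3*n+1)) = 0" using val' by simp
  have b_free: "\<forall>i\<in>I. blk i = b0 \<longrightarrow> i \<notin> X \<and> i \<notin> S" if b0: "b0 = 0 \<or> b0 = 3*n+1" for b0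
  proof -
    have ne: "3*k+1 \<noteq> b0" "3*k+2 \<noteq> b0" "3*k+3 \<noteq> b0" if "k < n" for k
      using b0 that by presburger+
    show ?thesis
    proof (intro ballI impI conjI)
      fix i assume i: "blk i = b0"
      show "i \<notin> X"
      proof
        assume "i \<in> X"
        then obtain k where "k < n" "blk i = 3*k+1 \<or> blk i = 3*k+3" unfolding X_def by auto
        then show False using ne[of k] i by metis
      qed
      show "i \<notin> S"
      proof
        assume "i \<in> S"
        then obtain k where "k < n" "blk i = 3*k+2" unfolding S_def by auto
        then show False using ne[of k] i by metis
      qed
    qed
  qed
  obtain \<K>1 where K1: "finite \<K>1" "\<Union>\<K>1 = {i \<in> K. blk i = 3*n+1}"
    and K1': "\<forall>J\<in>\<K>1. convex_in I J \<and> (\<exists>b. \<forall>j\<in>J. \<exists>s\<in>S. blk s = b \<and> kind j = kind s)"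
    using KJ[THEN spec, THEN mp, OF b_free[OF disjI2[OF refl]]] by (elim exE conjE)
  obtain \<K>2 where K2: "finite \<K>2" "\<Union>\<K>2 = {i \<in> K. blk i = 0}"
    and K2': "\<forall>J\<in>\<K>2. convex_in I J \<and> (\<exists>b. \<forall>j\<in>J. \<exists>s\<in>S. blk s = b \<and> kind j = kind s)"
    using KJ[THEN spec, THEN mp, OF b_free[OF disjI1[OF refl]]] by (elim exE conjE)
  have bN: "3*n+1 < N" "0 < N" by (simp_all add: N_def)
  have pureI: "pure W" if "\<And>u. u \<in> dom W \<Longrightarrow> is_P (the (W u)) = v" for W :: "(real, gen) word" and v
  proof (cases v)
    case True
    then have "only_p W" unfolding only_p_iff using that by (fastforce simp: domIff)
    then show ?thesis by (simp add: pure_def)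
  next
    case False
    then have "only_q W" unfolding only_q_iff using that by (fastforce simp: domIff)
    then show ?thesis by (simp add: pure_def)
  qed
  have w1I: "real (3*n+1) + u \<in> I" "blk (real (3*n+1) + u) = 3*n+1" "U (real (3*n+1) + u) = w1 u" if "u \<in> dom w1" for u
  proof -
    have uB: "u \<in> dom (B (3*n+1))" using that B_last by simp
    note u0 = u01[OF uB bN(1)]
    show "real (3*n+1) + u \<in> I" by (rule inI[OF uB bN(1)])
    show "blk (real (3*n+1) + u) = 3*n+1" by (rule blk_eq[OF u0])
    show "U (real (3*n+1) + u) = w1 u" using Ueq[of u "3*n+1"] u0 bN B_last by simp
  qed
  have w2I: "1 - u \<in> I" "blk (1 - u) = 0" "U (1 - u) = map_option inverse_letter (w2 u)" if "u \<in> dom w2" for u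
  proof -
    have uB: "1 - u \<in> dom (B 0)" using that B0 by (simp add: dom_inverse_word)
    note u0 = u01[OF uB bN(2)]
    show "1 - u \<in> I" using inI[OF uB bN(2)] by simp
    show "blk (1 - u) = 0" using blk_eq[OF u0, of 0] by simp
    show "U (1 - u) = map_option inverse_letter (w2 u)"
      using Ueq[of "1 - u" 0] u0 bN B0 by (simp add: inverse_word_def)
  qed
  define \<J>1 where "\<J>1 = (\<lambda>J. {u \<in> dom w1. real (3*n+1) + u \<in> J}) ` \<K>1"
  define \<J>2 where "\<J>2 = (\<lambda>J. {u \<in> dom w2. 1 - u \<in> J}) ` \<K>2"
  have J1K: "v \<in> \<Union>\<J>1 \<longleftrightarrow> real (3*n+1) + v \<in> K" if "v \<in> dom w1" for v
  proof -
    have "v \<in> \<Union>\<J>1 \<longleftrightarrow> v \<in> dom w1 \<and> real (3*n+1) + v \<in> \<Union>\<K>1" unfolding \<J>1_def by simp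
    then show ?thesis unfolding K1(2) using that w1I(2)[OF that] by blast
  qed
  have J2K: "v \<in> \<Union>\<J>2 \<longleftrightarrow> 1 - v \<in> K" if "v \<in> dom w2" for v
  proof -
    have "v \<in> \<Union>\<J>2 \<longleftrightarrow> v \<in> dom w2 \<and> 1 - v \<in> \<Union>\<K>2" unfolding \<J>2_def by simp
    then show ?thesis unfolding K2(2) using that w2I(2)[OF that] by blast
  qed
  have J1: "convex_in (dom w1) J \<and> pure (w1 |` J)" if J: "J \<in> \<J>1" for J
  proof -
    obtain J' where J': "J' \<in> \<K>1" "J = {u \<in> dom w1. real (3*n+1) + u \<in> J'}" using J by (auto simp: \<J>1_def)
    have conv: "convex_in I J'" using bspec[OF K1' J'(1)] by (rule conjunct1)
    have "k \<in> J" if "i \<in> J" "j \<in> J" "k \<in> dom w1" "i < k" "k < j" for i j k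
    proof -
      have "real (3*n+1) + i < real (3*n+1) + k" "real (3*n+1) + k < real (3*n+1) + j" using that by auto
      then have "real (3*n+1) + k \<in> J'"
        using conv that w1I(1)[OF that(3)] unfolding convex_in_def J'(2) by blast
      then show ?thesis using that J'(2) by blast
    qed
    then have "convex_in (dom w1) J" unfolding convex_in_def using J'(2) by blast
    moreover obtain v where v: "\<forall>j\<in>J'. kind j = v"
      using bspec[OF K1' J'(1), THEN conjunct2] pure by (elim exE) (metis (no_types))
    have "pure (w1 |` J)"
    proof (rule pureI)
      fix u assume "u \<in> dom (w1 |` J)"
      then have u: "u \<in> dom w1" "u \<in> J" by (auto simp: domIff restrict_map_def split: if_splits)
      then have "kind (real (3*n+1) + u) = v" using v J'(2) by blast
      then show "is_P (the ((w1 |` J) u)) = v" using u w1I(3)[OF u(1)] by (simp add: kind_def)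
    qed
    ultimately show ?thesis by blast
  qed
  have J2: "convex_in (dom w2) J \<and> pure (w2 |` J)" if J: "J \<in> \<J>2" for J
  proof -
    obtain J' where J': "J' \<in> \<K>2" "J = {u \<in> dom w2. 1 - u \<in> J'}" using J by (auto simp: \<J>2_def)
    have conv: "convex_in I J'" using bspec[OF K2' J'(1)] by (rule conjunct1)
    have "k \<in> J" if "i \<in> J" "j \<in> J" "k \<in> dom w2" "i < k" "k < j" for i j k
    proof -
      have "1 - j < 1 - k" "1 - k < 1 - i" using that by auto
      then have "1 - k \<in> J'"
        using conv that w2I(1)[OF that(3)] unfolding convex_in_def J'(2) by blast
      then show ?thesis using that J'(2) by blast
    qed
    then have "convex_in (dom w2) J" unfolding convex_in_def using J'(2) by blast
    moreover obtain v where v: "\<forall>j\<in>J'. kind j = v"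
      using bspec[OF K2' J'(1), THEN conjunct2] pure by (elim exE) (metis (no_types))
    have "pure (w2 |` J)"
    proof (rule pureI)
      fix u assume "u \<in> dom (w2 |` J)"
      then have u: "u \<in> dom w2" "u \<in> J" by (auto simp: domIff restrict_map_def split: if_splits)
      then have "kind (1 - u) = v" using v J'(2) by blast
      then show "is_P (the ((w2 |` J) u)) = v" using u w2I(3)[OF u(1)] by (auto simp: kind_def domIff)
    qed
    ultimately show ?thesis by blast
  qed
  have eq1: "B' (3*n+1) = w1 |` (- \<Union>\<J>1)"
  proof
    fix u
    show "B' (3*n+1) u = (w1 |` (- \<Union>\<J>1)) u"
    proof (cases "u \<in> dom w1")
      case True
      then have "u \<in> \<Union>\<J>1 \<longleftrightarrow> real (3*n+1) + u \<in> K" by (rule J1K)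
      then show ?thesis unfolding B'_def B_last restrict_map_def by (simp only: mem_Collect_eq Compl_iff)
    next
      case False
      then show ?thesis unfolding B'_def B_last by (simp add: restrict_map_def domIff)
    qed
  qed
  have eq2: "B' 0 = inverse_word (w2 |` (- \<Union>\<J>2))"
  proof
    fix u
    show "B' 0 u = inverse_word (w2 |` (- \<Union>\<J>2)) u"
    proof (cases "1 - u \<in> dom w2")
      case True
      have e: "1 - (1 - u) = u" by simp
      have "1 - u \<in> \<Union>\<J>2 \<longleftrightarrow> u \<in> K" using J2K[OF True] unfolding e .
      then show ?thesis unfolding B'_def B0 inverse_word_def restrict_map_def
        by (simp only: mem_Collect_eq Compl_iff of_nat_0 add_0) (simp split: if_splits)
    next
      case False
      then show ?thesis unfolding B'_def B0 by (simp add: restrict_map_def inverse_word_def domIff)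
    qed
  qed
  have cancel: "b = a" if "- a + b = 0" for a b :: free_limit
  proof -
    have "a + (- a + b) = a" unfolding that by simp
    then show ?thesis by (simp only: add_minus_cancel)
  qed
  have val_eq: "val (w1 |` (- \<Union>\<J>1)) = val (w2 |` (- \<Union>\<J>2))"
  proof (rule cancel)
    have "val (inverse_word (w2 |` (- \<Union>\<J>2))) = - val (w2 |` (- \<Union>\<J>2))"
      by (rule val_inverse_word[OF restricted_restrict_map[OF w2(2)]])
    then show "- val (w2 |` (- \<Union>\<J>2)) + val (w1 |` (- \<Union>\<J>1)) = 0"
      using zero unfolding eq1 eq2 by (simp only:)
  qed
  show ?thesis
  proof (rule exI[of _ \<J>1], rule exI[of _ \<J>2], intro conjI)
    show "finite \<J>1" "finite \<J>2" using K1(1) K2(1) by (simp_all add: \<J>1_def \<J>2_def)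
    show "\<forall>J\<in>\<J>1. convex_in (dom w1) J \<and> pure (w1 |` J)" by (rule ballI) (rule J1)
    show "\<forall>J\<in>\<J>2. convex_in (dom w2) J \<and> pure (w2 |` J)" by (rule ballI) (rule J2)
    show "val (w1 |` (- \<Union>\<J>1)) = val (w2 |` (- \<Union>\<J>2))" by (rule val_eq)
  qed
qed

section \<open>Maps glued from shrinking pieces\<close>

text \<open>
  A map glued from continuous pieces with disjoint supports is continuous when the pieces shrink: it is the
  uniform limit of the maps glued from finitely many of them.
\<close>

lemma continuous_on_disjoint_family:
  fixes \<Phi> :: "'p \<Rightarrow> 'a::topological_space \<Rightarrow> 'b::real_normed_vector" and l :: "'p \<Rightarrow> nat"
  assumes cont: "\<And>p. p \<in> A \<Longrightarrow> continuous_on T (\<Phi> p)"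
    and fin: "\<And>n. finite {p\<in>A. l p < n}"
    and bound: "\<And>p x. p \<in> A \<Longrightarrow> x \<in> T \<Longrightarrow> norm (\<Phi> p x) \<le> C / real (Suc (l p))"
    and disj: "\<And>p q x. p \<in> A \<Longrightarrow> q \<in> A \<Longrightarrow> x \<in> T \<Longrightarrow> \<Phi> p x \<noteq> 0 \<Longrightarrow> \<Phi> q x \<noteq> 0 \<Longrightarrow> p = q"
    and h: "\<And>p x. p \<in> A \<Longrightarrow> x \<in> T \<Longrightarrow> \<Phi> p x \<noteq> 0 \<Longrightarrow> h x = \<Phi> p x"
    and h0: "\<And>x. x \<in> T \<Longrightarrow> (\<And>p. p \<in> A \<Longrightarrow> \<Phi> p x = 0) \<Longrightarrow> h x = 0"
  shows "continuous_on T h"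
proof (rule uniform_limit_theorem)
  let ?f = "\<lambda>n x. \<Sum>p\<in>{p\<in>A. l p < n}. \<Phi> p x"
  show "\<forall>\<^sub>F n in sequentially. continuous_on T (?f n)"
    by (intro always_eventually allI continuous_on_sum cont) auto
  show "uniform_limit T ?f h sequentially"
  proof (rule uniform_limitI)
    fix e :: real assume "e > 0"
    obtain N where N: "\<bar>C\<bar> / e < real N" using reals_Archimedean2 by blast
    have small: "C / real (Suc m) < e" if "N \<le> m" for m
    proof -
      have "\<bar>C\<bar> < e * real N" using N \<open>e > 0\<close> by (simp add: field_simps)
      also have "\<dots> \<le> e * real (Suc m)" using that \<open>e > 0\<close> by (intro mult_left_mono) auto
      finally have "C < e * real (Suc m)" by linarith
      then show ?thesis by (simp add: field_simps)
    qed
    have "dist (?f n x) (h x) < e" if "N \<le> n" "x \<in> T" for n x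
    proof (cases "\<exists>p\<in>A. \<Phi> p x \<noteq> 0")
      case False
      then have "?f n x = 0" "h x = 0" using h0[OF that(2)] by auto
      then show ?thesis using \<open>e > 0\<close> by simp
    next
      case True
      then obtain p where p: "p \<in> A" "\<Phi> p x \<noteq> 0" by blast
      have others: "\<Phi> q x = 0" if "q \<in> A" "q \<noteq> p" for q
        using disj[OF p(1) that(1) \<open>x \<in> T\<close> p(2)] that(2) by blast
      show ?thesis
      proof (cases "l p < n")
        case True
        have "?f n x = (\<Sum>q\<in>{p}. \<Phi> q x)"
          by (rule sum.mono_neutral_right) (use fin p True others in auto)
        then show ?thesis using h[OF p(1) that(2) p(2)] \<open>e > 0\<close> by simp
      next
        case False
        then have "?f n x = 0" by (intro sum.neutral) (use others in auto)
        moreover have "norm (\<Phi> p x) < e"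
          using bound[OF p(1) that(2)] small[of "l p"] False that(1) by linarith
        ultimately show ?thesis using h[OF p(1) that(2) p(2)] by (simp add: dist_norm)
      qed
    qed
    then show "\<forall>\<^sub>F n in sequentially. \<forall>x\<in>T. dist (?f n x) (h x) < e"
      unfolding eventually_sequentially by blast
  qed
qed simp

section \<open>Loops of letters\<close>

definition earring :: "complex set" where
  "earring = earring_P \<union> earring_Q"

lemma gen_loop_ends [simp]: "gen_loop x 0 = 0" "gen_loop x 1 = 0"
  by (cases x; simp)+

lemma letter_loop_ends [simp]: "letter_loop a 0 = 0" "letter_loop a 1 = 0"
  by (cases a; simp add: reversepath_def zero_prod_def)+

lemma continuous_gen_loop: "continuous_on S (gen_loop x)"
  unfolding cis_conv_exp by (cases x; simp only: gen_loop.simps cis_conv_exp; intro continuous_intros)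

lemma continuous_letter_loop: "continuous_on S (letter_loop a)"
proof (cases a)
  case (Pos x)
  then show ?thesis by (auto intro!: continuous_intros continuous_gen_loop)
next
  case (Neg x)
  have "continuous_on S (\<lambda>t. gen_loop x (1 - t))"
    by (rule continuous_on_compose2[OF continuous_gen_loop[of UNIV]]) (auto intro!: continuous_intros)
  then show ?thesis using Neg by (auto intro!: continuous_intros simp: reversepath_def)
qed

lemma letter_loop_inverse: "letter_loop (inverse_letter a) u = letter_loop a (1 - u)"
  by (cases a) (auto simp: reversepath_def)

lemma gen_loop_in: "gen_loop (P n) t \<in> earring_P" "gen_loop (Q n) t \<in> earring_Q"
proof -
  let ?r = "1 / real (Suc n)"
  have *: "norm (of_real ?r * cis s :: complex) = ?r" for s by (simp only: norm_mult norm_cis norm_of_real) simp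
  have "gen_loop (P n) t \<in> sphere (of_real ?r) ?r" using *[of "2 * pi * t"] by (simp add: dist_norm)
  then show "gen_loop (P n) t \<in> earring_P" unfolding earring_P_def by blast
  have "gen_loop (Q n) t \<in> sphere (- of_real ?r) ?r" using *[of "2 * pi * t"] by (simp add: dist_norm norm_minus_commute)
  then show "gen_loop (Q n) t \<in> earring_Q" unfolding earring_Q_def by blast
qed

lemma norm_gen_loop: "norm (gen_loop x t) \<le> 2 / real (Suc (gen_index x))"
proof -
  let ?r = "1 / real (Suc (gen_index x))"
  let ?A = "of_real ?r :: complex" and ?B = "of_real ?r * cis (2 * pi * t) :: complex"
  have AB: "norm ?A = ?r" "norm ?B = ?r"
    by (simp only: norm_mult norm_cis norm_of_real, simp)+
  have "gen_loop x t = ?A - ?B \<or> gen_loop x t = ?B - ?A" by (cases x) simp_all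
  then have "norm (gen_loop x t) = norm (?A - ?B)" by (auto simp only: norm_minus_commute)
  also have "\<dots> \<le> norm ?A + norm ?B" by (rule norm_triangle_ineq4)
  also have "\<dots> = 2 / real (Suc (gen_index x))" unfolding AB by simp
  finally show ?thesis .
qed

lemma norm_letter_loop: "norm (letter_loop a t) \<le> 2 / real (Suc (letter_index a))"
proof (cases a)
  case (Pos x)
  then show ?thesis using norm_gen_loop[of x t] by (simp add: letter_index_def norm_Pair)
next
  case (Neg x)
  then show ?thesis using norm_gen_loop[of x "1 - t"] by (simp add: letter_index_def reversepath_def norm_Pair)
qed

lemma letter_loop_in:
  "letter_loop a t \<in> (if \<exists>n. base a = P n then earring_P else earring_Q) \<times> {0}"
proof -
  have "gen_loop x t \<in> (if \<exists>n. x = P n then earring_P else earring_Q)" for x t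
    using gen_loop_in by (cases x) auto
  then show ?thesis by (cases a) (auto simp: reversepath_def)
qed

lemma letter_loop_in_earring: "letter_loop a t \<in> earring \<times> {0}"
  using letter_loop_in[of a t] unfolding earring_def by (auto split: if_splits)

lemma zero_in_earrings: "0 \<in> earring_P" "0 \<in> earring_Q" "0 \<in> earring"
proof -
  show "0 \<in> earring_P" "0 \<in> earring_Q"
    using gen_loop_in(1)[of 0 0] gen_loop_in(2)[of 0 0] gen_loop_ends(1)[of "P 0"] gen_loop_ends(1)[of "Q 0"]
    by metis+
  then show "0 \<in> earring" by (simp add: earring_def)
qed

section \<open>Loops of words\<close>

text \<open>
  The condition in the definition of the loop of a word, for a given choice of the intervals.
\<close>

definition word_loop :: "('i::linorder, gen) word \<Rightarrow> ('i \<Rightarrow> real) \<Rightarrow> ('i \<Rightarrow> real) \<Rightarrow> (real \<Rightarrow> complex \<times> real) \<Rightarrow> bool" where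
  "word_loop W a b f \<longleftrightarrow>
        (\<forall>i\<in>dom W. 0 \<le> a i \<and> a i < b i \<and> b i \<le> 1) \<and>
        (\<forall>i\<in>dom W. \<forall>j\<in>dom W. i < j \<longrightarrow> b i \<le> a j) \<and>
        (\<forall>i x. W i = Some x \<longrightarrow>
           (\<forall>t\<in>{a i<..<b i}. f t = letter_loop x ((t - a i) / (b i - a i)))) \<and>
        (\<forall>t\<in>{0..1} - (\<Union>i\<in>dom W. {a i<..<b i}). f t = 0)"

lemma loop_of_word_iff: "loop_of_word W f \<longleftrightarrow> (\<exists>a b. word_loop W a b f)"
  unfolding loop_of_word_def word_loop_def ..

lemma word_loopD:
  assumes "word_loop W a b f"
  shows "i \<in> dom W \<Longrightarrow> 0 \<le> a i" "i \<in> dom W \<Longrightarrow> a i < b i" "i \<in> dom W \<Longrightarrow> b i \<le> 1"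
    and "i \<in> dom W \<Longrightarrow> j \<in> dom W \<Longrightarrow> i < j \<Longrightarrow> b i \<le> a j"
    and "i \<in> dom W \<Longrightarrow> a i < t \<Longrightarrow> t < b i \<Longrightarrow> f t = letter_loop (the (W i)) ((t - a i) / (b i - a i))"
    and "0 \<le> t \<Longrightarrow> t \<le> 1 \<Longrightarrow> (\<And>i. i \<in> dom W \<Longrightarrow> \<not> (a i < t \<and> t < b i)) \<Longrightarrow> f t = 0"
  using assms unfolding word_loop_def by (auto simp: domIff)

lemma word_loopI:
  assumes "\<And>i. i \<in> dom W \<Longrightarrow> 0 \<le> a i \<and> a i < b i \<and> b i \<le> 1"
    and "\<And>i j. i \<in> dom W \<Longrightarrow> j \<in> dom W \<Longrightarrow> i < j \<Longrightarrow> b i \<le> a j"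
    and "\<And>i t. i \<in> dom W \<Longrightarrow> a i < t \<Longrightarrow> t < b i \<Longrightarrow> f t = letter_loop (the (W i)) ((t - a i) / (b i - a i))"
    and "\<And>t. 0 \<le> t \<Longrightarrow> t \<le> 1 \<Longrightarrow> (\<And>i. i \<in> dom W \<Longrightarrow> \<not> (a i < t \<and> t < b i)) \<Longrightarrow> f t = 0"
  shows "word_loop W a b f"
  unfolding word_loop_def
proof (intro conjI ballI allI impI)
  fix i x t assume "W i = Some x" "t \<in> {a i<..<b i}"
  then show "f t = letter_loop x ((t - a i) / (b i - a i))" using assms(3)[of i t] by (simp add: domIff)
next
  fix t assume "t \<in> {0..1} - (\<Union>i\<in>dom W. {a i<..<b i})"
  then show "f t = 0" by (intro assms(4)) auto
qed (use assms in blast)+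

lemma word_loop_intervals_disjoint:
  assumes "word_loop W a b f" "i \<in> dom W" "j \<in> dom W" "a i < t" "t < b i" "a j < t" "t < b j"
  shows "i = j"
  using word_loopD(4)[OF assms(1), of i j] word_loopD(4)[OF assms(1), of j i] assms(2-)
  by (cases i j rule: linorder_cases) auto

lemma word_loop_ends:
  assumes "word_loop W a b f" shows "f 0 = 0" "f 1 = 0"
  using word_loopD(6)[OF assms, of 0] word_loopD(6)[OF assms, of 1] word_loopD(1,3)[OF assms] by force+

definition clamp01 :: "real \<Rightarrow> real" where
  "clamp01 u = max 0 (min 1 u)"

lemma continuous_clamp01: "continuous_on S clamp01"
  unfolding clamp01_def by (intro continuous_intros)

lemma clamp01_simps: "u \<le> 0 \<Longrightarrow> clamp01 u = 0" "1 \<le> u \<Longrightarrow> clamp01 u = 1"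
  "0 \<le> u \<Longrightarrow> u \<le> 1 \<Longrightarrow> clamp01 u = u"
  by (auto simp: clamp01_def)

lemma continuous_letter_clamp:
  assumes "continuous_on T g" shows "continuous_on T (\<lambda>x. letter_loop a (g x))"
  by (rule continuous_on_compose2[OF continuous_letter_loop assms]) auto

lemma loop_of_word_continuous:
  assumes "loop_of_word W f" "restricted W"
  shows "continuous_on {0..1} f"
proof -
  obtain a b where wl: "word_loop W a b f" using assms(1) loop_of_word_iff by blast
  note D = word_loopD[OF wl]
  let ?\<Phi> = "\<lambda>i t. letter_loop (the (W i)) (clamp01 ((t - a i) / (b i - a i)))"
  have val: "?\<Phi> i t = f t" if "i \<in> dom W" "a i < t" "t < b i" for i t
  proof -
    have "0 \<le> (t - a i) / (b i - a i)" "(t - a i) / (b i - a i) \<le> 1" using that by (auto simp: field_simps)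
    then show ?thesis using D(5)[OF that] by (simp add: clamp01_simps)
  qed
  have supp: "a i < t \<and> t < b i" if "i \<in> dom W" "?\<Phi> i t \<noteq> 0" for i t
  proof (rule ccontr)
    assume *: "\<not> (a i < t \<and> t < b i)"
    have "a i < b i" using D(2) that(1) .
    then have "(t - a i) / (b i - a i) \<le> 0 \<or> 1 \<le> (t - a i) / (b i - a i)"
      using * by (auto simp: field_simps)
    then show False using that(2) by (auto simp: clamp01_simps)
  qed
  show ?thesis
  proof (rule continuous_on_disjoint_family[where A = "dom W" and \<Phi> = ?\<Phi> and C = 2 and l = "\<lambda>i. letter_index (the (W i))"])
    show "continuous_on {0..1} (?\<Phi> i)" if "i \<in> dom W" for i
      using D(2)[OF that]
      by (intro continuous_letter_clamp continuous_on_compose2[OF continuous_clamp01[of UNIV]] continuous_intros) auto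
    show "finite {i \<in> dom W. letter_index (the (W i)) < n}" for n
      by (rule finite_subset[OF _ finite_level[OF assms(2), of n]]) (auto simp: level_def domIff)
    show "norm (?\<Phi> i x) \<le> 2 / real (Suc (letter_index (the (W i))))" for i x by (rule norm_letter_loop)
    show "i = j" if "i \<in> dom W" "j \<in> dom W" "?\<Phi> i x \<noteq> 0" "?\<Phi> j x \<noteq> 0" for i j x
      using word_loop_intervals_disjoint[OF wl that(1,2)] supp that by blast
    show "f x = ?\<Phi> i x" if "i \<in> dom W" "?\<Phi> i x \<noteq> 0" for i x
      using val[OF that(1)] supp[OF that] by simp
    show "f x = 0" if x: "x \<in> {0..1}" "\<And>i. i \<in> dom W \<Longrightarrow> ?\<Phi> i x = 0" for x
    proof (cases "\<exists>i\<in>dom W. a i < x \<and> x < b i")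
      case True
      then obtain i where i: "i \<in> dom W" "a i < x" "x < b i" by blast
      then show ?thesis using val[OF i] x(2)[OF i(1)] by simp
    next
      case False
      then show ?thesis using D(6)[of x] x(1) by auto
    qed
  qed
qed

lemma word_loop_in:
  assumes "word_loop W a b f" "0 \<le> t" "t \<le> 1"
  shows "f t \<in> earring \<times> {0}"
proof (cases "\<exists>i\<in>dom W. a i < t \<and> t < b i")
  case True
  then show ?thesis using word_loopD(5)[OF assms(1)] letter_loop_in_earring by metis
next
  case False
  then have "f t = 0" using word_loopD(6)[OF assms(1)] assms by blast
  then show ?thesis using zero_in_earrings by (simp add: zero_prod_def)
qed

lemma loop_of_word_path:
  assumes "loop_of_word W f" "restricted W"
  shows "path f" "path_image f \<subseteq> earring \<times> {0}" "pathstart f = 0" "pathfinish f = 0"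
proof -
  obtain a b where wl: "word_loop W a b f" using assms(1) loop_of_word_iff by blast
  show "path f" unfolding path_def by (rule loop_of_word_continuous[OF assms])
  show "path_image f \<subseteq> earring \<times> {0}"
    unfolding path_image_def using word_loop_in[OF wl] by (intro image_subsetI) simp
  show "pathstart f = 0" "pathfinish f = 0"
    using word_loop_ends[OF wl] by (simp_all add: pathstart_def pathfinish_def)
qed

lemma loop_of_word_exists:
  assumes "countable (dom W)"
  shows "\<exists>f. loop_of_word W f"
proof -
  obtain a b where ab: "\<forall>i\<in>dom W. 0 \<le> a i \<and> a i < b i \<and> b i \<le> (1::real)"
    "\<forall>i\<in>dom W. \<forall>j\<in>dom W. i < j \<longrightarrow> b i \<le> a j" using disjoint_intervals_exist[OF assms] by blast
  define f where "f t = (if \<exists>i\<in>dom W. a i < t \<and> t < b i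
    then (let i = (SOME i. i \<in> dom W \<and> a i < t \<and> t < b i) in letter_loop (the (W i)) ((t - a i) / (b i - a i)))
    else 0)" for t
  have "word_loop W a b f"
  proof (rule word_loopI)
    fix i t assume i: "i \<in> dom W" "a i < t" "t < b i"
    define j where "j = (SOME i. i \<in> dom W \<and> a i < t \<and> t < b i)"
    have j: "j \<in> dom W \<and> a j < t \<and> t < b j"
      unfolding j_def by (rule someI[of _ i]) (use i in blast)
    have "i = j"
    proof (cases i j rule: linorder_cases)
      case less
      then have "b i \<le> a j" using ab(2) i j by blast
      then show ?thesis using i j by linarith
    next
      case greater
      then have "b j \<le> a i" using ab(2) i j by blast
      then show ?thesis using i j by linarith
    qed
    moreover have "f t = letter_loop (the (W j)) ((t - a j) / (b j - a j))"
      using i unfolding f_def j_def[symmetric] Let_def by auto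
    ultimately show "f t = letter_loop (the (W i)) ((t - a i) / (b i - a i))" by simp
  next
    fix t :: real assume "\<And>i. i \<in> dom W \<Longrightarrow> \<not> (a i < t \<and> t < b i)"
    then show "f t = 0" unfolding f_def by (subst if_not_P) auto
  qed (use ab in blast)+
  then show ?thesis unfolding loop_of_word_iff by blast
qed

section \<open>Null-homotopy along a total arch system\<close>

text \<open>
  Extend the loop from the diagonal to the triangle \<open>0 \<le> x \<le> y \<le> 1\<close>. Every arch
  \<open>(i, j)\<close> is given an L-shaped strip that leads from the interval of \<open>i\<close> on the
  diagonal up to the height of the interval of \<open>j\<close> and then across to it; it is mapped by the
  letter at \<open>i\<close>, constantly along the strip. Arches that are nested or side by side have disjoint
  strips. Outside of the strips the map is the base point, in particular on the two legs of the triangle, and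
  it is continuous since the circles shrink.
\<close>

theorem null_homotopic_if_total_arch_system:
  assumes "loop_of_word W f" "restricted W" "total_arch_system W A"
  shows "homotopic_paths (earring \<times> {0}) f (linepath 0 0)"
proof -
  obtain a b where wl: "word_loop W a b f" using assms(1) loop_of_word_iff by blast
  note D = word_loopD[OF wl]
  have A: "arch_system W A" "ends A = dom W" using assms(3) by (auto simp: total_arch_system_def)
  define u where "u i x = clamp01 ((x - a i) / (b i - a i))" for i x
  define v where "v j y = clamp01 ((b j - y) / (b j - a j))" for j y
  \<comment> \<open>\<open>u\<close> and \<open>v\<close> are coordinates across the vertical and the horizontal part of the strip; their minimum turns the corner\<close>
  define \<Phi> where "\<Phi> = (\<lambda>(i, j) (x, y). letter_loop (the (W i)) (min (u i x) (v j y)))"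
  have in_dom: "i \<in> dom W" "j \<in> dom W" "i < j" if "(i, j) \<in> A" for i j
    using arch_system_dom[OF A(1) that] arch_systemD(1)[OF A(1) that] by blast+
  have supp: "a i < x \<and> y < b j \<and> (x < b i \<or> a j < y)" if ij: "(i, j) \<in> A" "\<Phi> (i, j) (x, y) \<noteq> 0" for i j x y
  proof -
    have len: "a i < b i" "a j < b j" using D(2) in_dom[OF ij(1)] by blast+
    have "min (u i x) (v j y) \<noteq> 0" "min (u i x) (v j y) \<noteq> 1" using ij(2) by (auto simp: \<Phi>_def)
    then have 1: "u i x \<noteq> 0" "v j y \<noteq> 0" "\<not> (u i x = 1 \<and> v j y = 1)"
      by (auto simp: min_def u_def v_def clamp01_def split: if_splits)
    have "\<not> x \<le> a i"
    proof
      assume "x \<le> a i"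
      then have "(x - a i) / (b i - a i) \<le> 0" using len by (simp add: field_simps)
      then show False using 1 by (simp add: u_def clamp01_simps)
    qed
    moreover have "\<not> b j \<le> y"
    proof
      assume "b j \<le> y"
      then have "(b j - y) / (b j - a j) \<le> 0" using len by (simp add: field_simps)
      then show False using 1 by (simp add: v_def clamp01_simps)
    qed
    moreover have "\<not> (b i \<le> x \<and> y \<le> a j)"
    proof
      assume "b i \<le> x \<and> y \<le> a j"
      then have "1 \<le> (x - a i) / (b i - a i)" "1 \<le> (b j - y) / (b j - a j)" using len by (simp_all add: field_simps)
      then show False using 1 by (simp add: u_def v_def clamp01_simps)
    qed
    ultimately show ?thesis by auto
  qed
  define T where "T = {z :: real \<times> real. 0 \<le> fst z \<and> fst z \<le> snd z \<and> snd z \<le> 1}"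
  have no_overlap: False
    if p: "(i, j) \<in> A" "\<Phi> (i, j) (x, y) \<noteq> 0" and q: "(k, l) \<in> A" "\<Phi> (k, l) (x, y) \<noteq> 0" and "x \<le> y" "i < k" for i j k l x y
  proof -
    note sp = supp[OF p] and sq = supp[OF q]
    have bik: "b i \<le> a k" using D(4) in_dom[OF p(1)] in_dom[OF q(1)] \<open>i < k\<close> by blast
    then have aj: "a j < y" using sp sq by linarith
    have "(i, j) \<noteq> (k, l)" using \<open>i < k\<close> by auto
    from arch_systemD(3)[OF A(1) p(1) q(1) this] have ne: "j \<noteq> k" "j \<noteq> l" by auto
    show False
    proof (cases "j < k")
      case True
      then have "b j \<le> a k" using D(4) in_dom[OF p(1)] in_dom[OF q(1)] by blast
      then show False using sp sq \<open>x \<le> y\<close> by linarith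
    next
      case False
      then have "k < j" using ne by simp
      then have "l < j" using arch_systemD(4)[OF A(1) p(1) q(1) \<open>i < k\<close>] ne by auto
      then have "b l \<le> a j" using D(4) in_dom[OF p(1)] in_dom[OF q(1)] by blast
      then show False using sq aj by linarith
    qed
  qed
  have unique: "p = q" if "p \<in> A" "q \<in> A" "z \<in> T" "\<Phi> p z \<noteq> 0" "\<Phi> q z \<noteq> 0" for p q z
  proof -
    obtain i j k l x y where eq: "p = (i, j)" "q = (k, l)" "z = (x, y)" by (cases p; cases q; cases z)
    have xy: "x \<le> y" using that(3) eq by (simp add: T_def)
    have "\<not> i < k" "\<not> k < i"
      using no_overlap[of i j x y k l] no_overlap[of k l x y i j] that xy unfolding eq by blast+
    then have "i = k" by simp
    then show ?thesis
      using arch_systemD(3)[OF A(1), of i j k l] that unfolding eq by auto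
  qed
  define h where "h z = (if \<exists>p\<in>A. \<Phi> p z \<noteq> 0 then \<Phi> (SOME p. p \<in> A \<and> \<Phi> p z \<noteq> 0) z else 0)" for z
  have h1: "h z = \<Phi> p z" if p: "p \<in> A" "z \<in> T" "\<Phi> p z \<noteq> 0" for p z
  proof -
    define q where "q = (SOME p. p \<in> A \<and> \<Phi> p z \<noteq> 0)"
    have "q \<in> A \<and> \<Phi> q z \<noteq> 0" unfolding q_def by (rule someI[of _ p]) (use p in blast)
    then have "q = p" using unique[of q p z] p by blast
    moreover have "h z = \<Phi> q z" unfolding h_def q_def using p by auto
    ultimately show ?thesis by simp
  qed
  have h0: "h z = 0" if "\<And>p. p \<in> A \<Longrightarrow> \<Phi> p z = 0" for z using that by (simp add: h_def)
  have cont: "continuous_on T h"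
  proof (rule continuous_on_disjoint_family[where A = A and \<Phi> = \<Phi> and C = 2 and l = "\<lambda>p. letter_index (the (W (fst p)))"])
    fix p assume p: "p \<in> A"
    obtain i j where ij: "p = (i, j)" by (cases p)
    have len: "a i < b i" "a j < b j" using D(2) in_dom[of i j] p ij by blast+
    have "continuous_on T (\<lambda>z. letter_loop (the (W i)) (min (u i (fst z)) (v j (snd z))))"
      unfolding u_def v_def using len
      by (intro continuous_letter_clamp continuous_on_min continuous_on_compose2[OF continuous_clamp01[of UNIV]] continuous_intros) auto
    then show "continuous_on T (\<Phi> p)" by (simp add: \<Phi>_def ij case_prod_unfold)
    show "norm (\<Phi> p z) \<le> 2 / real (Suc (letter_index (the (W (fst p)))))" for z
      unfolding \<Phi>_def case_prod_unfold by (rule norm_letter_loop)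
  next
    fix n
    have "{p \<in> A. letter_index (the (W (fst p))) < n} \<subseteq> level n W \<times> level n W"
    proof
      fix p assume p: "p \<in> {p \<in> A. letter_index (the (W (fst p))) < n}"
      obtain i j where ij: "p = (i, j)" by (cases p)
      have "i \<in> level n W" using in_dom[of i j] p ij by (auto simp: level_def domIff)
      then show "p \<in> level n W \<times> level n W" using arch_system_level[OF A(1), of i j] p ij by simp
    qed
    then show "finite {p \<in> A. letter_index (the (W (fst p))) < n}"
      using finite_level[OF assms(2), of n] by (meson finite_SigmaI finite_subset)
  next
    show "p = q" if "p \<in> A" "q \<in> A" "z \<in> T" "\<Phi> p z \<noteq> 0" "\<Phi> q z \<noteq> 0" for p q z by (rule unique[OF that])
    show "h z = \<Phi> p z" if "p \<in> A" "z \<in> T" "\<Phi> p z \<noteq> 0" for p z by (rule h1[OF that])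
    show "h z = 0" if "\<And>p. p \<in> A \<Longrightarrow> \<Phi> p z = 0" for z by (rule h0[OF that])
  qed
  have h_in: "h z \<in> earring \<times> {0}" for z
  proof (cases "\<exists>p\<in>A. \<Phi> p z \<noteq> 0")
    case True
    then have "h z = \<Phi> (SOME p. p \<in> A \<and> \<Phi> p z \<noteq> 0) z" by (simp add: h_def)
    then show ?thesis using letter_loop_in_earring by (simp add: \<Phi>_def case_prod_unfold)
  next
    case False
    then show ?thesis using h0[of z] zero_in_earrings by (auto simp: zero_prod_def)
  qed
  have diag1: "\<Phi> (k, l) (t, t) = f t" if kl: "(k, l) \<in> A" "a k < t" "t < b k" for k l t
  proof -
    note d = in_dom[OF kl(1)]
    have len: "a k < b k" "a l < b l" "b k \<le> a l" using D(2,4) d by blast+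
    have "1 \<le> (b l - t) / (b l - a l)" using len kl by (simp add: field_simps)
    then have v1: "v l t = 1" by (simp add: v_def clamp01_simps)
    have "0 \<le> (t - a k) / (b k - a k)" "(t - a k) / (b k - a k) \<le> 1" using kl by (auto simp: field_simps)
    then have "u k t = (t - a k) / (b k - a k)" "u k t \<le> 1" by (simp_all add: u_def clamp01_simps)
    then show ?thesis using D(5)[OF d(1) kl(2,3)] v1 by (simp add: \<Phi>_def min_def)
  qed
  have diag2: "\<Phi> (k, l) (t, t) = f t" if kl: "(k, l) \<in> A" "a l < t" "t < b l" for k l t
  proof -
    note d = in_dom[OF kl(1)]
    have len: "a k < b k" "a l < b l" "b k \<le> a l" using D(2,4) d by blast+
    have "1 \<le> (t - a k) / (b k - a k)" using len kl by (simp add: field_simps)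
    then have u1: "u k t = 1" by (simp add: u_def clamp01_simps)
    have "0 \<le> (b l - t) / (b l - a l)" "(b l - t) / (b l - a l) \<le> 1" using kl by (auto simp: field_simps)
    then have v1: "v l t = (b l - t) / (b l - a l)" "v l t \<le> 1" by (simp_all add: v_def clamp01_simps)
    obtain x where x: "W k = Some x" "W l = Some (inverse_letter x)" using arch_systemD(2)[OF A(1) kl(1)] by blast
    have "1 - (t - a l) / (b l - a l) = (b l - t) / (b l - a l)" using len by (simp add: field_simps)
    then have "f t = letter_loop x ((b l - t) / (b l - a l))"
      using D(5)[OF d(2) kl(2,3)] x by (simp add: letter_loop_inverse)
    then show ?thesis using u1 v1 x by (simp add: \<Phi>_def min_def)
  qed
  have h_diag: "h (t, t) = f t" if t: "0 \<le> t" "t \<le> 1" for t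
  proof (cases "\<exists>p\<in>A. \<Phi> p (t, t) \<noteq> 0")
    case True
    then obtain k l where kl: "(k, l) \<in> A" "\<Phi> (k, l) (t, t) \<noteq> 0" by force
    have "h (t, t) = \<Phi> (k, l) (t, t)" using h1[OF kl(1) _ kl(2)] t by (simp add: T_def)
    moreover have "a k < t \<and> t < b k \<or> a l < t \<and> t < b l" using supp[OF kl] by auto
    ultimately show ?thesis using diag1[OF kl(1)] diag2[OF kl(1)] by auto
  next
    case False
    then have zero: "\<Phi> p (t, t) = 0" if "p \<in> A" for p using that by blast
    have "f t = 0"
    proof (cases "\<exists>i\<in>dom W. a i < t \<and> t < b i")
      case True
      then obtain i where i: "i \<in> dom W" "a i < t" "t < b i" by blast
      then have "i \<in> ends A" using A(2) by simp
      then obtain k l where "(k, l) \<in> A" "i = k \<or> i = l" by force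
      then show ?thesis using diag1[of k l t] diag2[of k l t] zero[of "(k, l)"] i by auto
    next
      case False
      then show ?thesis using D(6)[of t] t by auto
    qed
    then show ?thesis using h0[of "(t, t)"] zero by simp
  qed
  have h_left: "h (0, y) = 0" if "0 \<le> y" "y \<le> 1" for y
  proof (rule h0)
    fix p assume p: "p \<in> A"
    obtain i j where ij: "p = (i, j)" by (cases p)
    show "\<Phi> p (0, y) = 0"
    proof (rule ccontr)
      assume "\<Phi> p (0, y) \<noteq> 0"
      then have "a i < 0" using supp[of i j 0 y] p ij by auto
      then show False using D(1)[of i] in_dom[of i j] p ij by auto
    qed
  qed
  have h_right: "h (x, 1) = 0" if "0 \<le> x" "x \<le> 1" for x
  proof (rule h0)
    fix p assume p: "p \<in> A"
    obtain i j where ij: "p = (i, j)" by (cases p)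
    show "\<Phi> p (x, 1) = 0"
    proof (rule ccontr)
      assume "\<Phi> p (x, 1) \<noteq> 0"
      then have "1 < b j" using supp[of i j x 1] p ij by auto
      then show False using D(3)[of j] in_dom[of i j] p ij by auto
    qed
  qed
  \<comment> \<open>a parametrisation of the triangle: the segment \<open>fst z = 0\<close> is the diagonal, the other three sides go to the legs\<close>
  define g where "g = (\<lambda>z :: real \<times> real. ((1 - fst z) * snd z, (1 - fst z) * snd z + fst z))"
  have gT: "g z \<in> T" if z: "z \<in> {0..1} \<times> {0..1}" for z
  proof -
    have "0 \<le> (1 - fst z) * snd z" using z by auto
    moreover have "(1 - fst z) * snd z \<le> (1 - fst z) * 1" using z by (intro mult_left_mono) auto
    ultimately show ?thesis using z by (auto simp: g_def T_def)
  qed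
  have "continuous_on ({0..1} \<times> {0..1}) g" unfolding g_def by (intro continuous_intros)
  then have cont': "continuous_on ({0..1} \<times> {0..1}) (h \<circ> g)"
    using gT by (intro continuous_on_compose continuous_on_subset[OF cont]) auto
  show ?thesis
    unfolding homotopic_paths
  proof (intro exI[of _ "h \<circ> g"] conjI ballI)
    show "continuous_on ({0..1} \<times> {0..1}) (h \<circ> g)" by (rule cont')
    show "h \<circ> g \<in> {0..1} \<times> {0..1} \<rightarrow> earring \<times> {0}" using h_in by auto
    show "(h \<circ> g) (0, t) = f t" if "t \<in> {0..1}" for t using h_diag[of t] that by (simp add: g_def)
    show "(h \<circ> g) (1, t) = linepath 0 0 t" if "t \<in> {0..1}" for t
      using h_left[of 1] by (simp add: g_def linepath_def)
    show "pathstart (h \<circ> g \<circ> Pair t) = pathstart f" if "t \<in> {0..1}" for t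
      using h_left[of t] that word_loop_ends[OF wl] by (simp add: g_def pathstart_def)
    show "pathfinish (h \<circ> g \<circ> Pair t) = pathfinish f" if "t \<in> {0..1}" for t
      using h_right[of "1 - t"] that word_loop_ends[OF wl] by (simp add: g_def pathfinish_def)
  qed
qed

section \<open>Equal values give homotopic loops\<close>

lemma loop_of_word_equiv:
  assumes "word_equiv W V" "loop_of_word W f" shows "loop_of_word V f"
proof -
  obtain \<phi> where \<phi>: "bij_betw \<phi> (dom V) (dom W)" "strict_mono_on (dom V) \<phi>" "\<forall>i\<in>dom V. W (\<phi> i) = V i"
    using word_equiv_sym[OF assms(1)] unfolding word_equiv_def by blast
  obtain a b where wl: "word_loop W a b f" using assms(2) loop_of_word_iff by blast
  note D = word_loopD[OF wl]
  have in_W: "\<phi> i \<in> dom W" if "i \<in> dom V" for i using bij_betwE[OF \<phi>(1)] that by blast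
  have "word_loop V (a \<circ> \<phi>) (b \<circ> \<phi>) f"
  proof (rule word_loopI)
    fix i assume i: "i \<in> dom V"
    show "0 \<le> (a \<circ> \<phi>) i \<and> (a \<circ> \<phi>) i < (b \<circ> \<phi>) i \<and> (b \<circ> \<phi>) i \<le> 1"
      using D(1-3)[OF in_W[OF i]] by simp
    show "f t = letter_loop (the (V i)) ((t - (a \<circ> \<phi>) i) / ((b \<circ> \<phi>) i - (a \<circ> \<phi>) i))"
      if "(a \<circ> \<phi>) i < t" "t < (b \<circ> \<phi>) i" for t
      using D(5)[OF in_W[OF i], of t] that \<phi>(3) i by simp
  next
    fix i j assume ij: "i \<in> dom V" "j \<in> dom V" "i < j"
    then show "(b \<circ> \<phi>) i \<le> (a \<circ> \<phi>) j"
      using D(4)[OF in_W[OF ij(1)] in_W[OF ij(2)]] strict_mono_onD[OF \<phi>(2) ij] by simp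
  next
    fix t assume t: "0 \<le> t" "t \<le> 1" "\<And>i. i \<in> dom V \<Longrightarrow> \<not> ((a \<circ> \<phi>) i < t \<and> t < (b \<circ> \<phi>) i)"
    show "f t = 0"
    proof (rule D(6)[OF t(1,2)])
      fix j assume "j \<in> dom W"
      then obtain i where "i \<in> dom V" "j = \<phi> i" using bij_betw_imp_surj_on[OF \<phi>(1)] by blast
      then show "\<not> (a j < t \<and> t < b j)" using t(3)[of i] by simp
    qed
  qed
  then show ?thesis unfolding loop_of_word_iff by blast
qed

text \<open>
  Reversing a path moves the interval of the letter at \<open>u\<close> to the place of the letter at \<open>1
  - u\<close> in the inverse word and runs through it backwards; joining two paths halves the intervals.
\<close>

lemma loop_of_cat_inverse:
  assumes V: "unit_word V" "loop_of_word V f" and W: "unit_word W" "loop_of_word W g"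
  shows "loop_of_word (cat [V, inverse_word W]) (f +++ reversepath g)"
proof -
  obtain a b where wf: "word_loop V a b f" using V(2) loop_of_word_iff by blast
  obtain c d where wg: "word_loop W c d g" using W(2) loop_of_word_iff by blast
  note F = word_loopD[OF wf] and G = word_loopD[OF wg]
  let ?U = "cat [V, inverse_word W]"
  define A where "A t = (if t < 1 then a t / 2 else 1 - d (2 - t) / 2)" for t :: real
  define B where "B t = (if t < 1 then b t / 2 else 1 - c (2 - t) / 2)" for t :: real
  have unit: "unit_word X" if "X \<in> set [V, inverse_word W]" for X
    using that V(1) unit_inverse_word[OF W(1)] by auto
  have dom: "t \<in> dom ?U \<longleftrightarrow> t \<in> dom V \<or> (2 - t \<in> dom W)" for t
  proof -
    have "dom ?U = dom V \<union> (\<lambda>u. 1 + (1 - u)) ` dom W"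
      using dom_cat[of "[V, inverse_word W]", OF unit]
      by (auto simp: lessThan_Suc dom_inverse_word image_image)
    moreover have "t \<in> (\<lambda>u. 1 + (1 - u)) ` dom W \<longleftrightarrow> 2 - t \<in> dom W"
    proof
      assume "2 - t \<in> dom W"
      then show "t \<in> (\<lambda>u. 1 + (1 - u)) ` dom W" by (rule rev_image_eqI) simp
    qed auto
    ultimately show ?thesis by blast
  qed
  have V01: "0 < t" "t < 1" if "t \<in> dom V" for t using V(1) that by (auto simp: unit_word_def)
  have W01: "0 < t" "t < 1" if "t \<in> dom W" for t using W(1) that by (auto simp: unit_word_def)
  have UV: "?U t = V t" if "t \<in> dom V" for t using cat_eq[of t 0 "[V, inverse_word W]"] V01[OF that] by simp
  have UW: "?U t = map_option inverse_letter (W (2 - t))" if "2 - t \<in> dom W" for t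
  proof -
    have "t = real 1 + (t - 1)" "0 \<le> t - 1" "t - 1 < 1" "1 - (t - 1) = 2 - t" using W01[OF that] by auto
    then show ?thesis using cat_eq[of "t - 1" 1 "[V, inverse_word W]"] by (simp add: inverse_word_def)
  qed
  have "word_loop ?U A B (f +++ reversepath g)"
  proof (rule word_loopI)
    fix t assume t: "t \<in> dom ?U"
    show "0 \<le> A t \<and> A t < B t \<and> B t \<le> 1"
    proof (cases "t \<in> dom V")
      case True
      then show ?thesis using F(1-3)[OF True] V01[OF True] by (simp add: A_def B_def)
    next
      case False
      then have w: "2 - t \<in> dom W" using t dom by blast
      then show ?thesis using G(1-3)[OF w] W01[OF w] by (simp add: A_def B_def)
    qed
    fix s assume s: "A t < s" "s < B t"
    show "(f +++ reversepath g) s = letter_loop (the (?U t)) ((s - A t) / (B t - A t))"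
    proof (cases "t \<in> dom V")
      case True
      have AB: "A t = a t / 2" "B t = b t / 2" using V01[OF True] by (simp_all add: A_def B_def)
      have s2: "a t < 2 * s" "2 * s < b t" "2 * s \<le> 1" using s AB F(3)[OF True] by auto
      have "(s - A t) / (B t - A t) = (2 * s - a t) / (b t - a t)"
        using s2 unfolding AB by (simp add: field_simps)
      then show ?thesis using F(5)[OF True s2(1,2)] s2 UV[OF True] by (simp add: joinpaths_def)
    next
      case False
      then have w: "2 - t \<in> dom W" using t dom by blast
      obtain x where x: "W (2 - t) = Some x" using w by (auto simp: domIff)
      have AB: "A t = 1 - d (2 - t) / 2" "B t = 1 - c (2 - t) / 2" using W01[OF w] by (simp_all add: A_def B_def)
      have s2: "c (2 - t) < 2 - 2 * s" "2 - 2 * s < d (2 - t)" "\<not> s \<le> 1 / 2"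
        using s AB G(3)[OF w] by auto
      have "1 - (s - A t) / (B t - A t) = (2 - 2 * s - c (2 - t)) / (d (2 - t) - c (2 - t))"
        using s2 unfolding AB by (simp add: field_simps)
      then have "letter_loop (inverse_letter x) ((s - A t) / (B t - A t)) = g (2 - 2 * s)"
        using G(5)[OF w s2(1,2)] x by (simp add: letter_loop_inverse)
      moreover have "(f +++ reversepath g) s = g (2 - 2 * s)"
        using s2(3) by (simp add: joinpaths_def reversepath_def)
      ultimately show ?thesis using UW[OF w] x by simp
    qed
  next
    fix t s assume ts: "t \<in> dom ?U" "s \<in> dom ?U" "t < s"
    show "B t \<le> A s"
    proof (cases "t \<in> dom V")
      case t: True
      show ?thesis
      proof (cases "s \<in> dom V")
        case True
        then show ?thesis using F(4)[OF t True ts(3)] V01[OF t] V01[OF True] by (simp add: A_def B_def)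
      next
        case False
        then have w: "2 - s \<in> dom W" using ts dom by blast
        then show ?thesis using F(3)[OF t] G(3)[OF w] V01[OF t] W01[OF w] by (simp add: A_def B_def)
      qed
    next
      case False
      then have w: "2 - t \<in> dom W" using ts dom by blast
      have "s \<notin> dom V" using W01[OF w] V01[of s] ts(3) by auto
      then have ws: "2 - s \<in> dom W" using ts dom by blast
      then show ?thesis using G(4)[OF ws w] ts(3) W01[OF w] W01[OF ws] by (simp add: A_def B_def)
    qed
  next
    fix s :: real assume s: "0 \<le> s" "s \<le> 1" "\<And>t. t \<in> dom ?U \<Longrightarrow> \<not> (A t < s \<and> s < B t)"
    show "(f +++ reversepath g) s = 0"
    proof (cases "s \<le> 1 / 2")
      case True
      have "f (2 * s) = 0"
      proof (rule F(6))
        fix t assume t: "t \<in> dom V"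
        then have "\<not> (A t < s \<and> s < B t)" using s(3) dom by blast
        then show "\<not> (a t < 2 * s \<and> 2 * s < b t)" using V01[OF t] by (auto simp: A_def B_def)
      qed (use s True in auto)
      then show ?thesis using True by (simp add: joinpaths_def)
    next
      case False
      have "g (2 - 2 * s) = 0"
      proof (rule G(6))
        fix t assume t: "t \<in> dom W"
        then have "\<not> (A (2 - t) < s \<and> s < B (2 - t))" using s(3)[of "2 - t"] dom[of "2 - t"] by simp
        then show "\<not> (c t < 2 - 2 * s \<and> 2 - 2 * s < d t)" using W01[OF t] by (auto simp: A_def B_def)
      qed (use s False in auto)
      then show ?thesis using False by (simp add: joinpaths_def reversepath_def)
    qed
  qed
  then show ?thesis unfolding loop_of_word_iff by blast
qed

text \<open>
  The loop of \<open>V\<close> followed by the reversed loop of \<open>W\<close> is the loop of a word of value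
  zero, which contracts along a total arch system.
\<close>

theorem homotopic_if_val_eq:
  assumes V: "countable (dom V)" "restricted V" "loop_of_word V f"
    and W: "countable (dom W)" "restricted W" "loop_of_word W g"
    and val: "val V = val W"
  shows "homotopic_paths (earring \<times> {0}) f g"
proof -
  obtain V' where V': "unit_word V'" "word_equiv V V'" by (rule unit_word_exists[OF V(1)])
  obtain W' where W': "unit_word W'" "word_equiv W W'" by (rule unit_word_exists[OF W(1)])
  have rV: "restricted V'" and rW: "restricted W'"
    by (rule word_equiv_restricted[OF V'(2) V(2)], rule word_equiv_restricted[OF W'(2) W(2)])
  let ?Ws = "[V', inverse_word W']"
  have u: "unit_word U \<and> restricted U" if "U \<in> set ?Ws" for U
    using that V'(1) W'(1) rV rW by (auto simp: unit_inverse_word restricted_inverse_word)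
  have "val V' = val W'" using val_word_equiv[OF V'(2) V(2)] val_word_equiv[OF W'(2) W(2)] val by simp
  then have "val (cat ?Ws) = 0"
    using val_cat[of ?Ws, OF u] by (simp add: val_inverse_word[OF rW])
  moreover have res: "restricted (cat ?Ws)" by (rule restricted_cat) (rule u)
  ultimately obtain A where A: "total_arch_system (cat ?Ws) A" using total_arch_system_if_val_zero by blast
  have "loop_of_word (cat ?Ws) (f +++ reversepath g)"
    using loop_of_cat_inverse V' W' loop_of_word_equiv[OF V'(2) V(3)] loop_of_word_equiv[OF W'(2) W(3)] by blast
  from null_homotopic_if_total_arch_system[OF this res A]
  have "homotopic_loops (earring \<times> {0}) (f +++ reversepath g) (linepath 0 0)"
    using homotopic_paths_imp_homotopic_loops loop_of_word_path[OF V(3,2)] loop_of_word_path[OF W(3,2)] by fastforce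
  then show ?thesis
    using homotopic_paths_loop_parts loop_of_word_path[OF W(3,2)] by blast
qed

section \<open>Deletions\<close>

lemma starlike_cone_over:
  assumes "H \<noteq> {}" shows "starlike (cone_over a H)"
proof -
  obtain z0 where "z0 \<in> H" using assms by blast
  then have "cone_map a (z0, 1) \<in> cone_over a H" unfolding cone_over_def by (intro imageI) auto
  moreover have "cone_map a (z0, 1) = a" by (cases a) (simp add: cone_map_def)
  ultimately have a: "a \<in> cone_over a H" by simp
  have "closed_segment a x \<subseteq> cone_over a H" if x: "x \<in> cone_over a H" for x
  proof
    fix y assume "y \<in> closed_segment a x"
    then obtain u where u: "0 \<le> u" "u \<le> 1" "y = (1 - u) *\<^sub>R a + u *\<^sub>R x" by (auto simp: closed_segment_def)
    obtain z t where z: "z \<in> H" "0 \<le> t" "t \<le> 1" "x = cone_map a (z, t)" using x by (auto simp: cone_over_def)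
    have "y = cone_map a (z, 1 - u * (1 - t))"
      unfolding u(3) z(4) cone_map_def by (simp add: algebra_simps)
    moreover have "0 \<le> u * (1 - t)" "u * (1 - t) \<le> 1" using u z by (auto intro: mult_le_one)
    ultimately show "y \<in> cone_over a H" using z(1) unfolding cone_over_def by (intro image_eqI[of _ _ "(z, 1 - u * (1 - t))"]) auto
  qed
  then show ?thesis unfolding starlike_def using a by blast
qed

lemma base_subset_cone_over: "H \<times> {0} \<subseteq> cone_over a H"
proof
  fix x :: "complex \<times> real" assume "x \<in> H \<times> {0}"
  then obtain z where "z \<in> H" "x = (z, 0)" by auto
  then have "x = cone_map a (z, 0)" by (simp add: cone_map_def)
  then show "x \<in> cone_over a H" using \<open>z \<in> H\<close> unfolding cone_over_def by (intro image_eqI) auto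
qed

lemma earring_subset_griffiths: "earring \<times> {0} \<subseteq> griffiths_space"
  using base_subset_cone_over unfolding earring_def griffiths_space_def by blast

lemma null_homotopic_pure:
  assumes "path g" "path_image g \<subseteq> earring_P \<times> {0} \<or> path_image g \<subseteq> earring_Q \<times> {0}" "pathstart g = 0" "pathfinish g = 0"
  shows "homotopic_paths griffiths_space g (linepath 0 0)"
proof -
  obtain a H where aH: "path_image g \<subseteq> H \<times> {0}" "cone_over a H \<subseteq> griffiths_space" "0 \<in> H"
    using assms(2) zero_in_earrings unfolding griffiths_space_def by blast
  have "simply_connected (cone_over a H)"
    using aH(3) by (intro starlike_imp_simply_connected starlike_cone_over) auto
  moreover have "path_image g \<subseteq> cone_over a H" using aH(1) base_subset_cone_over by blast
  moreover have "path_image (linepath 0 0 :: real \<Rightarrow> complex \<times> real) \<subseteq> cone_over a H"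
    using aH(3) base_subset_cone_over[of H a] by (auto simp: zero_prod_def)
  ultimately have "homotopic_paths (cone_over a H) g (linepath 0 0)"
    unfolding simply_connected_eq_homotopic_paths using assms by auto
  then show ?thesis using aH(2) homotopic_paths_subset by blast
qed

text \<open>
  A homotopy of the middle part, joined with constant homotopies of the outer parts.
\<close>

lemma homotopic_paths_replace_subpath:
  fixes f g :: "real \<Rightarrow> 'a::real_normed_vector"
  assumes f: "path f" "path_image f \<subseteq> S" and g: "path g" "path_image g \<subseteq> S"
    and u: "0 \<le> u" "u \<le> v" "v \<le> 1"
    and eq: "\<And>t. 0 \<le> t \<Longrightarrow> t \<le> u \<Longrightarrow> f t = g t" "\<And>t. v \<le> t \<Longrightarrow> t \<le> 1 \<Longrightarrow> f t = g t"
    and mid: "homotopic_paths S (subpath u v f) (subpath u v g)"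
  shows "homotopic_paths S f g"
proof -
  have sub: "path (subpath s t h)" "path_image (subpath s t h) \<subseteq> S"
    if h: "path h" "path_image h \<subseteq> S" "0 \<le> s" "s \<le> 1" "0 \<le> t" "t \<le> 1" for h :: "real \<Rightarrow> 'a" and s t
  proof -
    have st: "s \<in> {0..1}" "t \<in> {0..1}" using h by auto
    show "path (subpath s t h)" by (rule path_subpath[OF h(1) st])
    show "path_image (subpath s t h) \<subseteq> S" using path_image_subpath_subset[OF st, of h] h(2) by blast
  qed
  have split: "homotopic_paths S (subpath 0 u h +++ (subpath u v h +++ subpath v 1 h)) h"
    if h: "path h" "path_image h \<subseteq> S" for h :: "real \<Rightarrow> 'a"
  proof -
    have ends: "path (subpath 0 u h)" "path_image (subpath 0 u h) \<subseteq> S"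
      using sub[OF h, of 0 u] u by auto
    have "homotopic_paths S (subpath u v h +++ subpath v 1 h) (subpath u 1 h)"
      using homotopic_join_subpaths1[OF h, of u v 1] u by auto
    then have "homotopic_paths S (subpath 0 u h +++ (subpath u v h +++ subpath v 1 h)) (subpath 0 u h +++ subpath u 1 h)"
      using ends by (intro homotopic_paths_join) auto
    also have "homotopic_paths S (subpath 0 u h +++ subpath u 1 h) (subpath 0 1 h)"
      using homotopic_join_subpaths1[OF h, of 0 u 1] u by auto
    finally (homotopic_paths_trans) show ?thesis by simp
  qed
  have "homotopic_paths S (subpath 0 u f) (subpath 0 u g)"
  proof (rule homotopic_paths_eq)
    show "subpath 0 u f t = subpath 0 u g t" if "t \<in> {0..1}" for t
      unfolding subpath_def using eq(1)[of "u * t"] that u by (simp add: mult_left_le)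
  qed (use sub[OF f] u in auto)
  moreover have "homotopic_paths S (subpath v 1 f) (subpath v 1 g)"
  proof (rule homotopic_paths_eq)
    show "subpath v 1 f t = subpath v 1 g t" if t: "t \<in> {0..1}" for t
    proof -
      have "0 \<le> (1 - v) * t" "(1 - v) * t \<le> (1 - v) * 1" 
        using t u mult_left_mono[of t 1 "1 - v"] by auto
      then show ?thesis unfolding subpath_def using eq(2)[of "(1 - v) * t + v"] by simp
    qed
  qed (use sub[OF f] u in auto)
  ultimately have "homotopic_paths S (subpath 0 u f +++ (subpath u v f +++ subpath v 1 f))
      (subpath 0 u g +++ (subpath u v g +++ subpath v 1 g))"
    using mid by (intro homotopic_paths_join) auto
  then show ?thesis using split[OF f] split[OF g] homotopic_paths_trans homotopic_paths_sym by blast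
qed

text \<open>
  On the interval spanned by the letters of the deleted convex subword the loop stays in one of the two
  earrings. This part of the loop is a closed path in a cone, which is contractible.
\<close>

theorem deletion_homotopic:
  assumes del: "deletion W W'" and res: "restricted W" and f: "loop_of_word W f"
  obtains f' where "loop_of_word W' f'" "homotopic_paths griffiths_space f f'"
proof -
  obtain J where J: "convex_in (dom W) J" "only_p (W |` J) \<or> only_q (W |` J)" "W' = W |` (- J)"
    using del unfolding deletion_def by blast
  obtain a b where wl: "word_loop W a b f" using f loop_of_word_iff by blast
  note D = word_loopD[OF wl]
  have JW: "J \<subseteq> dom W" using J(1) by (simp add: convex_in_def)
  have domW': "dom W' = dom W - J" unfolding J(3) by auto
  have eqW': "W' i = W i" if "i \<in> dom W'" for i using that unfolding domW' unfolding J(3) by simp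
  define f' where "f' t = (if \<exists>i\<in>J. a i < t \<and> t < b i then 0 else f t)" for t
  have wl': "word_loop W' a b f'"
  proof (rule word_loopI)
    fix i assume i: "i \<in> dom W'"
    then have iW: "i \<in> dom W" "i \<notin> J" using domW' by auto
    show "0 \<le> a i \<and> a i < b i \<and> b i \<le> 1" using D(1-3)[OF iW(1)] by blast
    fix t assume t: "a i < t" "t < b i"
    have "\<not> (\<exists>j\<in>J. a j < t \<and> t < b j)"
      using word_loop_intervals_disjoint[OF wl iW(1) _ t] iW(2) JW by blast
    then have "f' t = f t" unfolding f'_def by (rule if_not_P)
    then show "f' t = letter_loop (the (W' i)) ((t - a i) / (b i - a i))"
      using D(5)[OF iW(1) t] eqW'[OF i] by simp
  next
    fix i j assume "i \<in> dom W'" "j \<in> dom W'" "i < j"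
    then show "b i \<le> a j" using D(4) domW' by auto
  next
    fix t assume t: "0 \<le> t" "t \<le> 1" "\<And>i. i \<in> dom W' \<Longrightarrow> \<not> (a i < t \<and> t < b i)"
    show "f' t = 0"
    proof (cases "\<exists>i\<in>J. a i < t \<and> t < b i")
      case True
      then show ?thesis by (simp add: f'_def)
    next
      case False
      have "f t = 0"
        by (rule D(6)[OF t(1,2)]) (use t(3) False domW' in blast)
      then show ?thesis by (simp add: f'_def)
    qed
  qed
  then have loop': "loop_of_word W' f'" unfolding loop_of_word_iff by blast
  have res': "restricted W'" unfolding J(3) by (rule restricted_restrict_map[OF res])
  note pf = loop_of_word_path[OF f res] and pf' = loop_of_word_path[OF loop' res']
  have sub: "path_image f \<subseteq> griffiths_space" "path_image f' \<subseteq> griffiths_space"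
    using pf(2) pf'(2) earring_subset_griffiths by blast+
  have "homotopic_paths griffiths_space f f'"
  proof (cases "J = {}")
    case True
    then have "f' = f" by (auto simp: f'_def)
    then show ?thesis using pf(1) sub by simp
  next
    case False
    define u v where "u = Inf (a ` J)" and "v = Sup (b ` J)"
    have J01: "0 \<le> a i" "a i < b i" "b i \<le> 1" if "i \<in> J" for i using D(1-3) JW that by blast+
    have bd: "bdd_below (a ` J)" "bdd_above (b ` J)"
      using J01 by (auto intro!: bdd_belowI[of _ 0] bdd_aboveI[of _ 1])
    have uv: "u \<le> a i" "b i \<le> v" if "i \<in> J" for i
      unfolding u_def v_def using that bd by (auto intro: cInf_lower cSup_upper)
    have u0: "0 \<le> u" unfolding u_def using False J01 by (intro cInf_greatest) auto
    have v1: "v \<le> 1" unfolding v_def using False J01 by (intro cSup_least) auto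
    have uv_le: "u \<le> v"
    proof -
      obtain i where "i \<in> J" using False by blast
      then show ?thesis using uv[of i] J01[of i] by linarith
    qed
    have ex_a: "\<exists>i\<in>J. a i < t" if "u < t" for t
      using that False bd unfolding u_def by (subst (asm) cInf_less_iff) auto
    have ex_b: "\<exists>i\<in>J. t < b i" if "t < v" for t
      using that False bd unfolding v_def by (subst (asm) less_cSup_iff) auto
    have inside: "k \<in> J" if k: "k \<in> dom W" "a k < t" "t < b k" "u \<le> t" "t \<le> v" for k t
    proof -
      obtain s where s: "a k < s" "s < b k" "u < s" "s < v"
      proof -
        have "\<exists>i\<in>J. a i < b k" using ex_a[of "b k"] k by auto
        then obtain i where i: "i \<in> J" "a i < b k" by blast
        have "\<exists>j\<in>J. a k < b j" using ex_b[of "a k"] k by auto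
        then obtain j where j: "j \<in> J" "a k < b j" by blast
        have "max (a k) u < min (b k) v"
          using i j k uv[OF i(1)] uv[OF j(1)] J01[OF i(1)] J01[OF j(1)] by auto
        then obtain s where "max (a k) u < s" "s < min (b k) v" using dense by blast
        then show thesis using that[of s] by simp
      qed
      obtain i j where ij: "i \<in> J" "a i < s" "j \<in> J" "s < b j" using ex_a[OF s(3)] ex_b[OF s(4)] by blast
      have "i \<in> dom W" "j \<in> dom W" using ij JW by auto
      have "\<not> k < i" using D(4)[OF k(1) \<open>i \<in> dom W\<close>] ij s by linarith
      moreover have "\<not> j < k" using D(4)[OF \<open>j \<in> dom W\<close> k(1)] ij s by linarith
      ultimately consider "k = i" | "k = j" | "i < k" "k < j" by (metis linorder_cases)
      then show ?thesis
      proof cases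
        case 3
        then show ?thesis using J(1) ij k(1) unfolding convex_in_def by blast
      qed (use ij in simp_all)
    qed
    have out: "f t = f' t" if "t \<le> u \<or> v \<le> t" for t
    proof -
      have "\<not> (\<exists>i\<in>J. a i < t \<and> t < b i)" using uv that by force
      then have "f' t = f t" unfolding f'_def by (rule if_not_P)
      then show ?thesis ..
    qed
    have end0: "f t = 0" if t: "t = u \<or> t = v" for t
    proof (rule ccontr)
      assume "f t \<noteq> 0"
      moreover have "0 \<le> t" "t \<le> 1" using t u0 v1 uv_le by auto
      ultimately obtain k where k: "k \<in> dom W" "a k < t" "t < b k" using D(6)[of t] by blast
      then have "k \<in> J" using inside[OF k] t uv_le by auto
      then show False using uv[of k] k t by auto
    qed
    have f'0: "f' t = 0" if t: "u \<le> t" "t \<le> v" for t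
    proof (cases "\<exists>i\<in>J. a i < t \<and> t < b i")
      case True
      then show ?thesis by (simp add: f'_def)
    next
      case False
      have "f t = 0"
        by (rule D(6)) (use inside t False u0 v1 in force)+
      then show ?thesis by (simp add: f'_def)
    qed
    have mem: "subpath u v h t = h (u + (v - u) * t)" "u \<le> u + (v - u) * t" "u + (v - u) * t \<le> v"
      if "t \<in> {0..1}" for t and h :: "real \<Rightarrow> complex \<times> real"
    proof -
      have "0 \<le> (v - u) * t" "(v - u) * t \<le> (v - u) * 1"
        using that uv_le mult_left_mono[of t 1 "v - u"] by auto
      then show "subpath u v h t = h (u + (v - u) * t)" "u \<le> u + (v - u) * t" "u + (v - u) * t \<le> v"
        by (auto simp: subpath_def add.commute)
    qed
    define E where "E = (if only_p (W |` J) then earring_P else earring_Q)"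
    have fE: "f t \<in> E \<times> {0}" if t: "u \<le> t" "t \<le> v" for t
    proof (cases "\<exists>i\<in>dom W. a i < t \<and> t < b i")
      case True
      then obtain i where i: "i \<in> dom W" "a i < t" "t < b i" by blast
      then have iJ: "i \<in> J" using inside t by blast
      obtain x where x: "W i = Some x" using i(1) by (auto simp: domIff)
      then have "x \<in> ran (W |` J)" using iJ by (auto simp: ran_def restrict_map_def)
      then have "(\<exists>n. base x = P n) \<longleftrightarrow> only_p (W |` J)"
        using J(2) unfolding only_p_def only_q_def by (cases "only_p (W |` J)") (auto simp: only_p_def)
      then show ?thesis using D(5)[OF i] letter_loop_in[of x] x by (simp add: E_def)
    next
      case False
      then have "f t = 0" using D(6)[of t] t u0 v1 by force
      then show ?thesis using zero_in_earrings by (simp add: E_def zero_prod_def)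
    qed
    show ?thesis
    proof (rule homotopic_paths_replace_subpath[where u = u and v = v])
      show "f t = f' t" if "t \<le> u" for t using out that by blast
      show "f t = f' t" if "v \<le> t" for t using out that by blast
      have p1: "path (subpath u v f)" using pf(1) u0 v1 uv_le by (intro path_subpath) auto
      have "homotopic_paths griffiths_space (subpath u v f) (linepath 0 0)"
      proof (rule null_homotopic_pure[OF p1])
        have "path_image (subpath u v f) \<subseteq> E \<times> {0}"
          unfolding path_image_def
        proof (rule image_subsetI)
          fix t :: real assume t: "t \<in> {0..1}"
          show "subpath u v f t \<in> E \<times> {0}" unfolding mem(1)[OF t] by (rule fE[OF mem(2,3)[OF t]])
        qed
        then show "path_image (subpath u v f) \<subseteq> earring_P \<times> {0} \<or> path_image (subpath u v f) \<subseteq> earring_Q \<times> {0}"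
          unfolding E_def by presburger
      qed (use end0 in \<open>simp_all\<close>)
      moreover have "homotopic_paths griffiths_space (linepath 0 0) (subpath u v f')"
      proof (rule homotopic_paths_eq)
        show "path (linepath 0 0 :: real \<Rightarrow> complex \<times> real)" by simp
        show "path_image (linepath 0 0 :: real \<Rightarrow> complex \<times> real) \<subseteq> griffiths_space"
          using earring_subset_griffiths zero_in_earrings by (auto simp: zero_prod_def)
        show "linepath 0 0 t = subpath u v f' t" if "t \<in> {0..1}" for t
          using mem(1)[OF that, of f'] mem(2,3)[OF that] f'0 by (simp add: linepath_def)
      qed
      ultimately show "homotopic_paths griffiths_space (subpath u v f) (subpath u v f')"
        by (rule homotopic_paths_trans)
    qed (use pf pf' sub u0 v1 uv_le in auto)
  qed
  then show thesis using that loop' by blast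
qed

section \<open>Crossings\<close>

primrec side_sign :: "gen \<Rightarrow> real" where
  "side_sign (P n) = 1"
| "side_sign (Q n) = -1"

lemma side_sign_abs: "side_sign x = 1 \<or> side_sign x = -1"
  by (cases x) auto

definition rad :: "gen \<Rightarrow> real" where
  "rad x = 1 / real (Suc (gen_index x))"

lemma rad_pos: "0 < rad x" by (simp add: rad_def)

text \<open>
  Inversion \<open>z \<mapsto> 1/z\<close> turns the circles, which all touch the imaginary axis at 0, into
  vertical lines. The circle of radius \<open>r\<close> becomes the line with real part \<open>1/(2r)\<close>
  or \<open>-1/(2r)\<close>; distinct lines have distance at least 1/2, which separates the circles uniformly
  although they accumulate at 0.
\<close>

definition inv_re :: "gen \<Rightarrow> real" where
  "inv_re x = side_sign x * real (Suc (gen_index x)) / 2"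

definition circ :: "gen \<Rightarrow> complex set" where
  "circ x = {z. z \<noteq> 0 \<and> Re (inverse z) = inv_re x}"

lemma inv_re_apart: "x \<noteq> y \<Longrightarrow> 1 / 2 \<le> \<bar>inv_re x - inv_re y\<bar>"
proof (cases x; cases y)
  fix m n assume "x \<noteq> y" "x = P m" "y = P n"
  then have "m \<noteq> n" by auto
  then have "1 \<le> \<bar>real m - real n\<bar>" by linarith
  then show ?thesis using \<open>x = P m\<close> \<open>y = P n\<close> by (simp add: inv_re_def field_simps abs_if split: if_splits)
next
  fix m n assume "x \<noteq> y" "x = Q m" "y = Q n"
  then have "m \<noteq> n" by auto
  then have "1 \<le> \<bar>real m - real n\<bar>" by linarith
  then show ?thesis using \<open>x = Q m\<close> \<open>y = Q n\<close> by (simp add: inv_re_def field_simps abs_if split: if_splits)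
qed (simp_all add: inv_re_def field_simps)

lemma circ_unique: "z \<in> circ x \<Longrightarrow> z \<in> circ y \<Longrightarrow> x = y"
proof (rule ccontr)
  assume z: "z \<in> circ x" "z \<in> circ y" and "x \<noteq> y"
  then have "Re (inverse z) = inv_re x" "Re (inverse z) = inv_re y" unfolding circ_def by blast+
  then have "inv_re x - inv_re y = 0" by linarith
  then show False using inv_re_apart[OF \<open>x \<noteq> y\<close>] by simp
qed

lemma circ_iff: "z \<in> circ x \<longleftrightarrow> z \<noteq> 0 \<and> (Re z)\<^sup>2 + (Im z)\<^sup>2 = 2 * rad x * (side_sign x * Re z)"
proof (cases "z = 0")
  case False
  define q where "q = (Re z)\<^sup>2 + (Im z)\<^sup>2"
  have q: "q > 0" using False by (simp add: q_def complex_neq_0)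
  have "Re (inverse z) = Re z / q" by (simp add: q_def)
  moreover have "Re z / q = side_sign x * real (Suc (gen_index x)) / 2 \<longleftrightarrow> q = 2 * rad x * (side_sign x * Re z)"
    using q side_sign_abs[of x] by (auto simp: rad_def field_simps)
  ultimately show ?thesis using False by (simp add: circ_def inv_re_def q_def)
qed (simp add: circ_def)

lemma circ_if_sphere:
  assumes "norm (of_real (side_sign x * rad x) - z) = rad x" "z \<noteq> 0"
  shows "z \<in> circ x"
proof -
  have "(norm (of_real (side_sign x * rad x) - z))\<^sup>2 = (rad x)\<^sup>2" using assms(1) by simp
  then have "(side_sign x * rad x - Re z)\<^sup>2 + (Im z)\<^sup>2 = (rad x)\<^sup>2" by (simp add: cmod_power2)
  then show ?thesis using assms(2) side_sign_abs[of x] unfolding circ_iff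
    by (auto simp: power2_eq_square algebra_simps)
qed

lemma earring_P_circ: assumes "z \<in> earring_P" "z \<noteq> 0" shows "\<exists>n. z \<in> circ (P n)"
proof -
  obtain n where "z \<in> sphere (of_real (1 / real (Suc n))) (1 / real (Suc n))"
    using assms(1) unfolding earring_P_def by blast
  then have "z \<in> circ (P n)" using assms(2) by (intro circ_if_sphere) (simp_all add: rad_def dist_norm)
  then show ?thesis by blast
qed

lemma earring_Q_circ: assumes "z \<in> earring_Q" "z \<noteq> 0" shows "\<exists>n. z \<in> circ (Q n)"
proof -
  obtain n where "z \<in> sphere (- of_real (1 / real (Suc n))) (1 / real (Suc n))"
    using assms(1) unfolding earring_Q_def by blast
  then have "z \<in> circ (Q n)" using assms(2) by (intro circ_if_sphere) (simp_all add: rad_def dist_norm)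
  then show ?thesis by blast
qed

lemma earring_circ: assumes "z \<in> earring" "z \<noteq> 0" shows "\<exists>x. z \<in> circ x"
  using assms earring_P_circ earring_Q_circ unfolding earring_def by blast

text \<open>
  The open half of the circle \<open>x\<close> that lies away from the base point. Passing its midpoint, the
  point of the circle opposite to 0, is what counts as one occurrence of the letter \<open>x\<close>.
\<close>

definition near :: "gen \<Rightarrow> complex \<Rightarrow> bool" where
  "near x z \<longleftrightarrow> z \<in> circ x \<and> rad x < side_sign x * Re z"

text \<open>
  The loop of the letter \<open>x\<close> is past the far point of its circle at times from 1/2 on.
\<close>

definition past :: "gen \<Rightarrow> complex \<Rightarrow> bool" where
  "past x z \<longleftrightarrow> 0 \<le> side_sign x * Im z"

definition pot :: "gen \<Rightarrow> complex \<Rightarrow> gen signed list bijection" where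
  "pot x z = (if past x z then letter (Pos x) else 0)"

text \<open>
  A tent function of \<open>Re (1/z)\<close> with support of radius 1/4 around the line of \<open>x\<close>,
  multiplied by \<open>z\<close>: a continuous map that is the identity on the circle \<open>x\<close> and
  collapses all other circles.
\<close>

definition project :: "gen \<Rightarrow> complex \<Rightarrow> complex" where
  "project x z = of_real (max 0 (1 - 4 * \<bar>Re (inverse z) - inv_re x\<bar>)) * z"

lemma project_circ: "z \<in> circ x \<Longrightarrow> project x z = z"
  by (simp add: project_def circ_def)

lemma project_other: assumes "z \<in> earring" "z \<notin> circ x" shows "project x z = 0"
proof (cases "z = 0")
  case False
  then obtain y where y: "z \<in> circ y" using earring_circ assms(1) by blast
  then have "x \<noteq> y" using assms(2) by blast
  have "Re (inverse z) = inv_re y" using y unfolding circ_def by blast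
  then have "1 - 4 * \<bar>Re (inverse z) - inv_re x\<bar> \<le> 0"
    using inv_re_apart[OF \<open>x \<noteq> y\<close>] abs_minus_commute[of "inv_re x" "inv_re y"] by simp
  then show ?thesis unfolding project_def by (simp only: max_absorb1 of_real_0 mult_zero_left)
qed (simp add: project_def)

lemma continuous_project: "continuous_on S (project x)"
proof -
  have "isCont (project x) z" for z
  proof (cases "z = 0")
    case True
    have "\<bar>max 0 (1 - 4 * \<bar>Re (inverse w) - inv_re x\<bar>)\<bar> \<le> 1" for w by auto
    then have le: "norm (project x w) \<le> norm w" for w
      unfolding project_def norm_mult norm_of_real by (simp add: mult_left_le_one_le)
    have "(project x \<longlongrightarrow> 0) (at 0)"
      by (rule Lim_null_comparison[of _ norm]) (use le in \<open>auto intro!: tendsto_eq_intros\<close>)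
    then show ?thesis using True by (simp add: isCont_def project_def)
  next
    case False
    then show ?thesis unfolding project_def isCont_def by (intro tendsto_intros) simp_all
  qed
  then show ?thesis by (intro continuous_at_imp_continuous_on) blast
qed

definition close :: "nat \<Rightarrow> complex \<Rightarrow> complex \<Rightarrow> bool" where
  "close N z w \<longleftrightarrow> (\<forall>x. gen_index x < N \<longrightarrow> dist (project x z) (project x w) < rad x / 4)"

lemma close_sym: "close N z w \<longleftrightarrow> close N w z"
  by (simp add: close_def dist_commute)

text \<open>
  Two points at distance less than a quarter of the radius that lie on opposite sides of the far point are
  close to the far point. So a third point that is equally close to them is still in the outer half.
\<close>

lemma near_if_crossing:
  assumes zw: "near x z" "near x w" "past x z \<noteq> past x w" "dist z w < rad x / 4"
    and v: "v \<in> earring" "dist (project x z) (project x v) < rad x / 4"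
  shows "near x v"
proof -
  let ?r = "rad x" and ?s = "side_sign x"
  have zc: "z \<in> circ x" and zr: "?r < ?s * Re z" using zw(1) by (auto simp: near_def)
  have "\<bar>Im z\<bar> \<le> \<bar>Im z - Im w\<bar>"
    using zw(3) side_sign_abs[of x] by (auto simp: past_def)
  also have "\<bar>Im z - Im w\<bar> \<le> dist z w" using abs_Im_le_cmod[of "z - w"] by (simp add: dist_norm)
  finally have im: "\<bar>Im z\<bar> < ?r / 4" using zw(4) by simp
  then have "\<bar>Im z\<bar>\<^sup>2 < (?r / 4)\<^sup>2" by (intro power_strict_mono) auto
  then have "(Im z)\<^sup>2 < (?r / 4)\<^sup>2" unfolding power2_abs .
  moreover have "(?s * Re z - ?r)\<^sup>2 + (Im z)\<^sup>2 = ?r\<^sup>2"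
  proof -
    have "?s\<^sup>2 = 1" using side_sign_abs[of x] by auto
    then have "(?s * Re z - ?r)\<^sup>2 = (Re z)\<^sup>2 - 2 * ?r * (?s * Re z) + ?r\<^sup>2"
      by (simp add: power2_diff power_mult_distrib)
    moreover have "(Re z)\<^sup>2 + (Im z)\<^sup>2 = 2 * ?r * (?s * Re z)" using zc unfolding circ_iff by blast
    ultimately show ?thesis by linarith
  qed
  moreover have "(?r / 4)\<^sup>2 = ?r\<^sup>2 / 16" "(3 / 4 * ?r)\<^sup>2 = 9 / 16 * ?r\<^sup>2" "0 < ?r\<^sup>2"
    using rad_pos[of x] by (simp_all add: power2_eq_square)
  ultimately have "(3 / 4 * ?r)\<^sup>2 < (?s * Re z - ?r)\<^sup>2" by linarith
  then have big: "3 / 4 * ?r < ?s * Re z - ?r" by (rule power2_less_imp_less) (use zr in simp)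
  have d: "norm (z - project x v) < ?r / 4" using v(2) unfolding project_circ[OF zc] dist_norm .
  define p where "p = project x v"
  have "\<bar>Re (z - p)\<bar> < ?r / 4" using le_less_trans[OF abs_Re_le_cmod d] unfolding p_def .
  then have p: "Re z - Re p < ?r / 4" "Re p - Re z < ?r / 4" unfolding minus_complex.sel(1) abs_less_iff by linarith+
  have "?r < ?s * Re p"
  proof (cases "?s = 1")
    case True
    then show ?thesis using big p(1) rad_pos[of x] unfolding True by linarith
  next
    case False
    then have s: "?s = -1" using side_sign_abs[of x] by blast
    then show ?thesis using big p(2) rad_pos[of x] unfolding s by linarith
  qed
  then have re: "?r < ?s * Re (project x v)" unfolding p_def .
  then have "project x v \<noteq> 0" using rad_pos[of x] by auto
  then have vc: "v \<in> circ x" using project_other[OF v(1)] by blast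
  then show ?thesis using re project_circ[OF vc] by (simp add: near_def)
qed

lemma near_unique: "near x z \<Longrightarrow> near y z \<Longrightarrow> x = y"
  using circ_unique by (auto simp: near_def)

text \<open>
  The letter crossed by a short move from \<open>z\<close> to \<open>w\<close>, as a difference of potentials.
\<close>

definition cross :: "nat \<Rightarrow> complex \<Rightarrow> complex \<Rightarrow> gen signed list bijection" where
  "cross N z w = (if \<exists>x. gen_index x < N \<and> near x z \<and> near x w
     then - pot (THE x. near x z) z + pot (THE x. near x z) w else 0)"

lemma cross_near:
  assumes "gen_index x < N" "near x z" "near x w" shows "cross N z w = - pot x z + pot x w"
proof -
  have "(THE x. near x z) = x" using assms(2) near_unique by (intro the_equality) auto
  then show ?thesis using assms by (auto simp: cross_def)
qed

lemma cross_refl [simp]: "cross N z z = 0"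
  by (simp add: cross_def)

lemma cross_nonzeroE:
  assumes "cross N z w \<noteq> 0"
  obtains x where "gen_index x < N" "near x z" "near x w" "past x z \<noteq> past x w"
proof -
  obtain x where x: "gen_index x < N" "near x z" "near x w" using assms by (auto simp: cross_def split: if_splits)
  moreover have "past x z \<noteq> past x w"
  proof
    assume "past x z = past x w"
    then have "pot x z = pot x w" by (simp add: pot_def)
    then show False using cross_near[OF x] assms by simp
  qed
  ultimately show thesis using that by blast
qed

lemma cross_antisym: "cross N w z = - cross N z w"
proof (cases "\<exists>x. gen_index x < N \<and> near x z \<and> near x w")
  case True
  then obtain x where "gen_index x < N" "near x z" "near x w" by blast
  then show ?thesis by (simp add: cross_near minus_add)
next
  case False
  then have "cross N z w = 0" "cross N w z = 0" by (auto simp: cross_def)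
  then show ?thesis by simp
qed

lemma near_dist: "near x z \<Longrightarrow> near x w \<Longrightarrow> dist (project x z) (project x w) = dist z w"
  by (simp add: project_circ near_def)

text \<open>
  If one of the three moves crosses the far point of the circle \<open>x\<close>, then all three points lie in
  the outer half of that circle, where crossings are differences of the potential of \<open>x\<close>.
  Otherwise all terms vanish.
\<close>

lemma cross_cocycle:
  assumes E: "z \<in> earring" "w \<in> earring" "v \<in> earring" and cl: "close N z w" "close N w v" "close N z v"
  shows "cross N z w + cross N w v = cross N z v"
proof (cases "\<exists>x. gen_index x < N \<and> near x z \<and> near x w \<and> near x v")
  case True
  then obtain x where x: "gen_index x < N" "near x z" "near x w" "near x v" by blast
  then show ?thesis by (simp add: cross_near add.assoc)
next
  case False
  have third: "near x c" if "gen_index x < N" "near x a" "near x b" "past x a \<noteq> past x b" "close N a b" "close N a c" "c \<in> earring"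
    for x a b c
  proof (rule near_if_crossing[OF that(2,3,4)])
    show "dist a b < rad x / 4" using that(1,5) unfolding near_dist[OF that(2,3), symmetric] close_def by blast
    show "dist (project x a) (project x c) < rad x / 4" using that(1,6) unfolding close_def by blast
  qed (fact that(7))
  have "cross N z w = 0"
  proof (rule ccontr)
    assume "cross N z w \<noteq> 0"
    then obtain x where x: "gen_index x < N" "near x z" "near x w" "past x z \<noteq> past x w" by (rule cross_nonzeroE)
    then have "near x v" using third[OF x cl(1,3) E(3)] by blast
    then show False using False x by blast
  qed
  moreover have "cross N w v = 0"
  proof (rule ccontr)
    assume "cross N w v \<noteq> 0"
    then obtain x where x: "gen_index x < N" "near x w" "near x v" "past x w \<noteq> past x v" by (rule cross_nonzeroE)
    have "near x z" using third[OF x cl(2) _ E(1)] cl(1) close_sym by blast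
    then show False using False x by blast
  qed
  moreover have "cross N z v = 0"
  proof (rule ccontr)
    assume "cross N z v \<noteq> 0"
    then obtain x where x: "gen_index x < N" "near x z" "near x v" "past x z \<noteq> past x v" by (rule cross_nonzeroE)
    have "near x w" using third[OF x cl(3,1) E(2)] by blast
    then show False using False x by blast
  qed
  ultimately show ?thesis by simp
qed

section \<open>Developing maps and holonomy\<close>

text \<open>
  An analogue of a developing map for the local cocycle of crossings: a function whose differences are the
  crossings on small scales.
\<close>

definition develops :: "nat \<Rightarrow> ('a::metric_space \<Rightarrow> complex) \<Rightarrow> 'a set \<Rightarrow> ('a \<Rightarrow> gen signed list bijection) \<Rightarrow> bool" where
  "develops N \<phi> K D \<longleftrightarrow> (\<exists>\<delta>>0. \<forall>a\<in>K. \<forall>b\<in>K. dist a b < \<delta> \<longrightarrow> - D a + D b = cross N (\<phi> a) (\<phi> b))"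

lemma uniformly_close_gen:
  fixes \<phi> :: "'a::metric_space \<Rightarrow> complex"
  assumes "compact K" "continuous_on K \<phi>" "e > 0"
  shows "\<exists>\<delta>>0. \<forall>a\<in>K. \<forall>b\<in>K. dist a b < \<delta> \<longrightarrow> dist (project x (\<phi> a)) (project x (\<phi> b)) < e"
proof -
  have "continuous_on K (\<lambda>a. project x (\<phi> a))"
    by (rule continuous_on_compose2[OF continuous_project[of UNIV] assms(2)]) auto
  then have "uniformly_continuous_on K (\<lambda>a. project x (\<phi> a))"
    using assms(1) by (rule compact_uniformly_continuous)
  then show ?thesis using \<open>e > 0\<close> unfolding uniformly_continuous_on_def by (metis dist_commute)
qed

lemma uniformly_close:
  fixes \<phi> :: "'a::metric_space \<Rightarrow> complex"
  assumes "compact K" "continuous_on K \<phi>"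
  shows "\<exists>\<delta>>0. \<forall>a\<in>K. \<forall>b\<in>K. dist a b < \<delta> \<longrightarrow> close N (\<phi> a) (\<phi> b)"
proof -
  have "\<exists>\<delta>>0. \<forall>a\<in>K. \<forall>b\<in>K. dist a b < \<delta> \<longrightarrow> dist (project x (\<phi> a)) (project x (\<phi> b)) < rad x / 4" for x
    by (rule uniformly_close_gen[OF assms]) (simp add: rad_pos)
  then obtain d where d: "\<And>x. d x > 0" "\<And>x a b. a \<in> K \<Longrightarrow> b \<in> K \<Longrightarrow> dist a b < d x \<Longrightarrow>
      dist (project x (\<phi> a)) (project x (\<phi> b)) < rad x / 4" by metis
  define \<delta> where "\<delta> = Min (insert 1 (d ` {x. gen_index x < N}))"
  have fin: "finite (insert 1 (d ` {x. gen_index x < N}))" using finite_gen_index_less by simp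
  have "\<delta> > 0" unfolding \<delta>_def using d(1) fin by (subst Min_gr_iff) auto
  moreover have "\<delta> \<le> d x" if "gen_index x < N" for x
    unfolding \<delta>_def by (rule Min_le[OF fin]) (use that in auto)
  ultimately show ?thesis using d(2) unfolding close_def by (meson less_le_trans)
qed

text \<open>
  Add up the crossings along the segment from a fixed point to \<open>a\<close>, in \<open>n\<close> equal
  short steps. Moving \<open>a\<close> slightly moves all intermediate points slightly, and the cocycle
  identity on the thin triangles between the two segments shows that the sums differ by the crossing between
  the end points.
\<close>

lemma developing_map_exists:
  fixes \<phi> :: "'a::real_normed_vector \<Rightarrow> complex"
  assumes K: "convex K" "compact K" and \<phi>: "continuous_on K \<phi>" "\<And>a. a \<in> K \<Longrightarrow> \<phi> a \<in> earring"
  shows "\<exists>D. develops N \<phi> K D"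
proof (cases "K = {}")
  case True
  then show ?thesis unfolding develops_def using zero_less_one by blast
next
  case False
  then obtain p where p: "p \<in> K" by blast
  obtain \<delta> where \<delta>: "\<delta> > 0" "\<And>a b. a \<in> K \<Longrightarrow> b \<in> K \<Longrightarrow> dist a b < \<delta> \<Longrightarrow> close N (\<phi> a) (\<phi> b)"
    using uniformly_close[OF K(2) \<phi>(1)] by blast
  obtain M where M: "\<And>a. a \<in> K \<Longrightarrow> norm (a - p) \<le> M"
    using compact_imp_bounded[OF K(2)] unfolding bounded_any_center[where a = p]
    by (metis dist_norm norm_minus_commute)
  have M0: "0 \<le> M" using M[OF p] by simp
  obtain n where n: "2 * M / \<delta> < real n" using reals_Archimedean2 by blast
  have n0: "0 < n" using n M0 \<delta>(1) by (cases n) (auto simp: field_simps)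
  define q where "q k x = p + (real k / real n) *\<^sub>R (x - p)" for k x
  have qK: "q k x \<in> K" if "k \<le> n" "x \<in> K" for k x
  proof -
    have "q k x = (1 - real k / real n) *\<^sub>R p + (real k / real n) *\<^sub>R x"
      by (simp add: q_def algebra_simps)
    also have "\<dots> \<in> K" using K(1) p that n0 by (intro convexD) (auto simp: field_simps)
    finally show ?thesis .
  qed
  have q1: "dist (q k x) (q (Suc k) x) < \<delta> / 2" if "x \<in> K" for k x
  proof -
    have "q (Suc k) x - q k x = (1 / real n) *\<^sub>R (x - p)"
      unfolding q_def by (simp add: scaleR_left_diff_distrib[symmetric] diff_divide_distrib[symmetric])
    then have "dist (q (Suc k) x) (q k x) = norm (x - p) / real n" by (simp add: dist_norm)
    then have "dist (q k x) (q (Suc k) x) = norm (x - p) / real n" by (simp only: dist_commute)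
    also have "\<dots> \<le> M / real n" using M[OF that] by (intro divide_right_mono) auto
    also have "\<dots> < \<delta> / 2" using n n0 \<delta>(1) by (simp add: field_simps)
    finally show ?thesis .
  qed
  have q2: "dist (q k x) (q k y) \<le> dist x y" if "k \<le> n" for k x y
  proof -
    have "q k x - q k y = (real k / real n) *\<^sub>R (x - y)" by (simp add: q_def algebra_simps)
    then have "dist (q k x) (q k y) = (real k / real n) * dist x y" by (simp add: dist_norm)
    also have "\<dots> \<le> 1 * dist x y" using that n0 by (intro mult_right_mono) auto
    finally show ?thesis by simp
  qed
  define D where "D m x = sum_list (map (\<lambda>k. cross N (\<phi> (q k x)) (\<phi> (q (Suc k) x))) [0..<m])" for m x
  have co: "cross N (\<phi> a) (\<phi> b) + cross N (\<phi> b) (\<phi> c) = cross N (\<phi> a) (\<phi> c)"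
    if "a \<in> K" "b \<in> K" "c \<in> K" "dist a b < \<delta>" "dist b c < \<delta>" "dist a c < \<delta>" for a b c
    using that \<delta>(2) \<phi>(2) by (intro cross_cocycle) auto
  have "D m x + cross N (\<phi> (q m x)) (\<phi> (q m y)) = D m y"
    if xy: "x \<in> K" "y \<in> K" "dist x y < \<delta> / 2" and "m \<le> n" for x y m
    using \<open>m \<le> n\<close>
  proof (induction m)
    case 0
    then show ?case by (simp add: D_def q_def)
  next
    case (Suc m)
    let ?a = "q m x" and ?b = "q (Suc m) x" and ?c = "q (Suc m) y" and ?d = "q m y"
    have inK: "?a \<in> K" "?b \<in> K" "?c \<in> K" "?d \<in> K" using qK xy Suc.prems by auto
    have d: "dist ?a ?b < \<delta> / 2" "dist ?d ?c < \<delta> / 2" "dist ?b ?c < \<delta> / 2" "dist ?a ?d < \<delta> / 2"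
      using q1[OF xy(1)] q1[OF xy(2)] q2[of "Suc m" x y] q2[of m x y] Suc.prems xy(3) by (auto intro: le_less_trans)
    have ac: "dist ?a ?c < \<delta>" using dist_triangle[of ?a ?c ?b] d by simp
    have "D (Suc m) x + cross N (\<phi> ?b) (\<phi> ?c) = D m x + (cross N (\<phi> ?a) (\<phi> ?b) + cross N (\<phi> ?b) (\<phi> ?c))"
      by (simp add: D_def add.assoc)
    also have "\<dots> = D m x + cross N (\<phi> ?a) (\<phi> ?c)" using co[of ?a ?b ?c] inK d ac \<delta>(1) by simp
    also have "\<dots> = D m x + (cross N (\<phi> ?a) (\<phi> ?d) + cross N (\<phi> ?d) (\<phi> ?c))"
      using co[of ?a ?d ?c] inK d ac \<delta>(1) by simp
    also have "\<dots> = D m y + cross N (\<phi> ?d) (\<phi> ?c)" using Suc by (simp add: add.assoc[symmetric])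
    also have "\<dots> = D (Suc m) y" by (simp add: D_def)
    finally show ?case .
  qed
  moreover have "q n x = x" for x using n0 by (simp add: q_def)
  ultimately have eq: "D n x + cross N (\<phi> x) (\<phi> y) = D n y" if "x \<in> K" "y \<in> K" "dist x y < \<delta> / 2" for x y
    using that by (metis order_refl)
  have "- D n x + D n y = cross N (\<phi> x) (\<phi> y)" if "x \<in> K" "y \<in> K" "dist x y < \<delta> / 2" for x y
    unfolding eq[OF that, symmetric] by (simp add: add.assoc[symmetric])
  then have "develops N \<phi> K (D n)"
    unfolding develops_def using \<delta>(1) by (intro exI[of _ "\<delta> / 2"]) auto
  then show ?thesis by blast
qed

text \<open>
  Two developing maps on the interval have the same increments on a fine mesh, so they differ by a constant
  left factor.
\<close>

lemma developing_map_unique: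
  assumes "develops N g {0..1::real} D" "develops N g {0..1} E"
  shows "- D 0 + D 1 = - E 0 + E 1"
proof -
  obtain d where d: "d > 0" "\<And>a b. a \<in> {0..1} \<Longrightarrow> b \<in> {0..1} \<Longrightarrow> dist a b < d \<Longrightarrow> - D a + D b = cross N (g a) (g b)"
    using assms(1) unfolding develops_def by blast
  obtain e where e: "e > 0" "\<And>a b. a \<in> {0..1} \<Longrightarrow> b \<in> {0..1} \<Longrightarrow> dist a b < e \<Longrightarrow> - E a + E b = cross N (g a) (g b)"
    using assms(2) unfolding develops_def by blast
  obtain n where n: "n > 0" "1 / real n < min d e"
    using real_arch_inverse[of "min d e"] d(1) e(1) by (auto simp: inverse_eq_divide)
  have "k \<le> n \<Longrightarrow> E (real k / real n) - D (real k / real n) = E 0 - D 0" for k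
  proof (induction k)
    case (Suc k)
    let ?a = "real k / real n" and ?b = "real (Suc k) / real n"
    have ab: "?a \<in> {0..1}" "?b \<in> {0..1}" using Suc.prems n(1) by auto
    have "?b - ?a = 1 / real n" by (simp add: diff_divide_distrib[symmetric])
    moreover have "0 < 1 / real n" using n(1) by simp
    ultimately have "dist ?a ?b = 1 / real n" unfolding dist_real_def by linarith
    then have "dist ?a ?b < d" "dist ?a ?b < e" using n(2) by auto
    then have eq: "- D ?a + D ?b = - E ?a + E ?b" using d(2)[OF ab] e(2)[OF ab] by simp
    have "E ?b - D ?b = E ?a + (- E ?a + E ?b) - D ?b" by (simp add: add.assoc[symmetric])
    also have "\<dots> = E ?a + (- D ?a + D ?b) - D ?b" unfolding eq ..
    also have "\<dots> = E ?a - D ?a" by (simp add: diff_conv_add_uminus add.assoc del: add_uminus_conv_diff)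
    finally show ?case using Suc by simp
  qed simp
  from this[of n] have "E 1 - D 1 = E 0 - D 0" using n(1) by simp
  then have "E 1 = E 0 - D 0 + D 1" by (simp add: diff_eq_eq)
  then have "- E 0 + E 1 = - E 0 + (E 0 - D 0 + D 1)" by simp
  also have "\<dots> = - D 0 + D 1" by (simp add: diff_conv_add_uminus add.assoc[symmetric] del: add_uminus_conv_diff)
  finally show ?thesis ..
qed

text \<open>
  All developing maps on the interval give the same value.
\<close>

definition hol :: "(real \<Rightarrow> complex) \<Rightarrow> free_limit" where
  "hol g N = (SOME v. \<exists>D. develops N g {0..1} D \<and> v = - D 0 + D 1)"

lemma hol_eq:
  assumes "develops N g {0..1} D" shows "hol g N = - D 0 + D 1"
proof -
  have "\<exists>D'. develops N g {0..1} D' \<and> hol g N = - D' 0 + D' 1"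
    unfolding hol_def by (rule someI[of _ "- D 0 + D 1"]) (use assms in blast)
  then show ?thesis using developing_map_unique assms by metis
qed

lemma hol_segment:
  fixes \<phi> :: "'a::real_normed_vector \<Rightarrow> complex"
  assumes "develops N \<phi> K D" "convex K" "p \<in> K" "q \<in> K"
  shows "hol (\<phi> \<circ> linepath p q) N = - D p + D q"
proof -
  obtain d where d: "d > 0" "\<And>a b. a \<in> K \<Longrightarrow> b \<in> K \<Longrightarrow> dist a b < d \<Longrightarrow> - D a + D b = cross N (\<phi> a) (\<phi> b)"
    using assms(1) unfolding develops_def by blast
  have inK: "linepath p q t \<in> K" if "t \<in> {0..1}" for t
    using assms(2-4) that by (auto simp: linepath_def intro!: convexD)
  have dist: "dist (linepath p q s) (linepath p q t) = dist s t * dist p q" for s t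
  proof -
    have "linepath p q s - linepath p q t = (t - s) *\<^sub>R (p - q)" by (simp add: linepath_def algebra_simps)
    then show ?thesis by (simp add: dist_norm abs_minus_commute)
  qed
  have pos: "0 < dist p q + 1" using zero_le_dist[of p q] by linarith
  have "develops N (\<phi> \<circ> linepath p q) {0..1} (D \<circ> linepath p q)"
    unfolding develops_def
  proof (intro exI[of _ "d / (dist p q + 1)"] conjI ballI impI)
    show "0 < d / (dist p q + 1)" using d(1) pos by simp
    fix s t :: real assume st: "s \<in> {0..1}" "t \<in> {0..1}" "dist s t < d / (dist p q + 1)"
    have "dist s t * dist p q \<le> dist s t * (dist p q + 1)" by (intro mult_left_mono) auto
    also have "\<dots> < d" using st(3) pos by (simp add: pos_less_divide_eq)
    finally show "- (D \<circ> linepath p q) s + (D \<circ> linepath p q) t = cross N ((\<phi> \<circ> linepath p q) s) ((\<phi> \<circ> linepath p q) t)"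
      using d(2)[OF inK[OF st(1)] inK[OF st(2)]] dist by simp
  qed
  from hol_eq[OF this] show ?thesis by (simp add: linepath_def)
qed

section \<open>The holonomy of the loop of a word\<close>

lemma gen_loop_eq: "gen_loop x t = of_real (side_sign x * rad x) * (1 - cis (2 * pi * t))"
  by (cases x) (simp_all add: rad_def algebra_simps)

lemma gen_loop_coords:
  "side_sign x * Re (gen_loop x t) = rad x * (1 - cos (2 * pi * t))"
  "side_sign x * Im (gen_loop x t) = - rad x * sin (2 * pi * t)"
  using side_sign_abs[of x] by (auto simp: gen_loop_eq)

lemma gen_loop_circ:
  assumes "gen_loop x t \<noteq> 0" shows "gen_loop x t \<in> circ x"
  unfolding circ_iff
proof (intro conjI)
  have "(Re (gen_loop x t))\<^sup>2 + (Im (gen_loop x t))\<^sup>2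
    = (side_sign x * Re (gen_loop x t))\<^sup>2 + (side_sign x * Im (gen_loop x t))\<^sup>2"
    using side_sign_abs[of x] by (auto simp: power2_eq_square)
  also have "\<dots> = (rad x)\<^sup>2 * ((1 - cos (2 * pi * t))\<^sup>2 + (sin (2 * pi * t))\<^sup>2)"
    unfolding gen_loop_coords by (simp only: power_mult_distrib power2_minus distrib_left mult_minus_left)
  also have "(1 - cos (2 * pi * t))\<^sup>2 + (sin (2 * pi * t))\<^sup>2 = 2 * (1 - cos (2 * pi * t))"
    using sin_cos_squared_add[of "2 * pi * t"] by (simp add: power2_eq_square algebra_simps)
  also have "(rad x)\<^sup>2 * (2 * (1 - cos (2 * pi * t))) = 2 * rad x * (side_sign x * Re (gen_loop x t))"
    unfolding gen_loop_coords by (simp add: power2_eq_square)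
  finally show "(Re (gen_loop x t))\<^sup>2 + (Im (gen_loop x t))\<^sup>2 = 2 * rad x * (side_sign x * Re (gen_loop x t))" .
qed (fact assms)

lemma near_gen_loop_iff:
  assumes "0 < t" "t < 1" shows "near x (gen_loop x t) \<longleftrightarrow> 1/4 < t \<and> t < 3/4"
proof -
  have cos: "cos (2 * pi * t) < 0 \<longleftrightarrow> 1/4 < t \<and> t < 3/4"
  proof (cases "t \<le> 1/2")
    case True
    have "2 * pi * t \<le> pi" using True by simp
    then have "cos (2 * pi * t) < cos (pi / 2) \<longleftrightarrow> pi / 2 < 2 * pi * t"
      using assms by (intro cos_mono_less_eq) auto
    also have "\<dots> \<longleftrightarrow> 1/4 < t" using pi_gt_zero by (auto simp: field_simps)
    finally show ?thesis using True by auto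
  next
    case False
    have "cos (2 * pi * t) = cos (2 * pi * (1 - t))" by (simp add: algebra_simps cos_diff)
    moreover have "cos (2 * pi * (1 - t)) < cos (pi / 2) \<longleftrightarrow> pi / 2 < 2 * pi * (1 - t)"
      using assms False by (intro cos_mono_less_eq) auto
    moreover have "pi / 2 < 2 * pi * (1 - t) \<longleftrightarrow> 1/4 < 1 - t" using pi_gt_zero by (auto simp: field_simps)
    ultimately show ?thesis using False by auto
  qed
  have "rad x < side_sign x * Re (gen_loop x t) \<longleftrightarrow> cos (2 * pi * t) < 0"
    unfolding gen_loop_coords using rad_pos[of x] by (auto simp: algebra_simps mult_less_0_iff)
  moreover have "gen_loop x t \<in> circ x" if "rad x < side_sign x * Re (gen_loop x t)"
  proof (rule gen_loop_circ)
    show "gen_loop x t \<noteq> 0" using that rad_pos[of x] by (auto simp: less_le)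
  qed
  ultimately show ?thesis using cos by (auto simp: near_def)
qed

lemma past_gen_loop_iff:
  assumes "1/4 < t" "t < 3/4" shows "past x (gen_loop x t) \<longleftrightarrow> 1/2 \<le> t"
proof -
  have "past x (gen_loop x t) \<longleftrightarrow> sin (2 * pi * t) \<le> 0"
    unfolding past_def gen_loop_coords using rad_pos[of x] by (auto simp: mult_le_0_iff)
  also have "\<dots> \<longleftrightarrow> 1/2 \<le> t"
  proof (cases "t < 1/2")
    case True
    then have "0 < 2 * pi * t" "2 * pi * t < pi" using assms by auto
    then show ?thesis using sin_gt_zero[of "2 * pi * t"] True by simp
  next
    case False
    have "0 \<le> 2 * pi * t - pi" "2 * pi * t - pi \<le> pi" using False assms by (auto simp: field_simps)
    then have "0 \<le> sin (2 * pi * t - pi)" by (rule sin_ge_zero)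
    then show ?thesis using False by (simp add: sin_diff)
  qed
  finally show ?thesis .
qed

text \<open>
  The set \<open>past\<close> is closed, so the moment 1/2 itself counts as past the far point for a loop but,
  seen in reversed time, as not yet past it for the inverse loop.
\<close>

definition letter_past :: "gen signed \<Rightarrow> real \<Rightarrow> bool" where
  "letter_past c u \<longleftrightarrow> (case c of Pos _ \<Rightarrow> 1/2 \<le> u | Neg _ \<Rightarrow> 1/2 < u)"

lemma near_letter_loop_iff:
  assumes "0 < u" "u < 1" shows "near x (fst (letter_loop c u)) \<longleftrightarrow> x = base c \<and> 1/4 < u \<and> u < 3/4"
proof -
  obtain y v where y: "fst (letter_loop c u) = gen_loop y v" "y = base c" "0 < v" "v < 1"
    "(1/4 < v \<and> v < 3/4) \<longleftrightarrow> (1/4 < u \<and> u < 3/4)"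
  proof (cases c)
    case (Pos y)
    show thesis by (rule that[of y u]) (use Pos assms in simp_all)
  next
    case (Neg y)
    show thesis by (rule that[of y "1 - u"]) (use Neg assms in \<open>auto simp: reversepath_def\<close>)
  qed
  have "x = y" if "near x (gen_loop y v)"
  proof -
    have "gen_loop y v \<in> circ x" using that by (simp add: near_def)
    moreover from this have "gen_loop y v \<in> circ y" by (intro gen_loop_circ) (simp add: circ_def)
    ultimately show ?thesis by (rule circ_unique)
  qed
  then show ?thesis unfolding y(1) using near_gen_loop_iff[OF y(3,4)] y(2,5) by blast
qed

lemma pot_letter_loop:
  assumes "1/4 < u" "u < 3/4" "1/4 < v" "v < 3/4"
  shows "- pot (base c) (fst (letter_loop c u)) + pot (base c) (fst (letter_loop c v)) =
    (if letter_past c u = letter_past c v then 0 else if letter_past c v then letter c else - letter c)"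
proof (cases c)
  case (Pos y)
  then show ?thesis using past_gen_loop_iff[OF assms(1,2)] past_gen_loop_iff[OF assms(3,4)]
    by (simp add: pot_def letter_past_def)
next
  case (Neg y)
  have "letter (Neg y) = - letter (Pos y)" using letter_inverse[of "Pos y"] by simp
  then show ?thesis
    using Neg past_gen_loop_iff[of "1 - u"] past_gen_loop_iff[of "1 - v"] assms
    by (auto simp: pot_def letter_past_def reversepath_def)
qed

text \<open>
  The ordered product of the letters of index below \<open>N\<close> whose midpoints have been passed by time
  \<open>t\<close> is a developing map, as it jumps exactly when the loop crosses the far point of a circle. It
  goes from 0 to the value of the word.
\<close>

theorem hol_loop_of_word:
  assumes "loop_of_word W f" "restricted W"
  shows "hol (fst \<circ> f) = val W"
proof
  fix N
  obtain a b where wl: "word_loop W a b f" using assms(1) loop_of_word_iff by blast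
  note D = word_loopD[OF wl]
  define S where "S = level N W"
  have finS: "finite S" unfolding S_def by (rule finite_level[OF assms(2)])
  have SW: "i \<in> dom W" if "i \<in> S" for i using that level_imp_dom by (auto simp: S_def)
  define L where "L i = letter (the (W i))" for i
  define pr where "pr i t = (t - a i) / (b i - a i)" for i t
  define passed where "passed i t \<longleftrightarrow> letter_past (the (W i)) (pr i t)" for i t
  define E where "E t = ordered_sum L {i \<in> S. passed i t}" for t
  define m where "m i = (a i + b i) / 2" for i
  have pr_half: "1/2 \<le> pr i t \<longleftrightarrow> m i \<le> t" "1/2 < pr i t \<longleftrightarrow> m i < t" if "i \<in> dom W" for i t
    using D(2)[OF that] by (auto simp: pr_def m_def field_simps)
  have passed1: "m i \<le> t" if "passed i t" "i \<in> dom W" for i t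
    using that pr_half[OF that(2)] by (auto simp: passed_def letter_past_def split: signed.splits)
  have passed2: "t \<le> m i" if "\<not> passed i t" "i \<in> dom W" for i t
    using that pr_half[OF that(2)] by (auto simp: passed_def letter_past_def not_le not_less less_imp_le split: signed.splits)
  have passed3: "passed i t" if "m i < t" "i \<in> dom W" for i t
    using that passed2[of i t] by fastforce
  have passed_mono: "passed i t" if "passed i s" "s \<le> t" "i \<in> dom W" for i s t
  proof -
    have "pr i s \<le> pr i t" using that(2) D(2)[OF that(3)] by (simp add: pr_def divide_right_mono)
    then show ?thesis using that(1) by (auto simp: passed_def letter_past_def split: signed.splits)
  qed
  \<comment> \<open>the times spent in outer halves by different letters are more than \<open>\<delta>\<close> apart\<close>
  define \<delta> where "\<delta> = Min (insert 1 ((\<lambda>i. (b i - a i) / 8) ` S))"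
  have fin: "finite (insert 1 ((\<lambda>i. (b i - a i) / 8) ` S))" using finS by simp
  have \<delta>0: "\<delta> > 0" unfolding \<delta>_def using D(2) SW fin by (subst Min_gr_iff) auto
  have \<delta>: "\<delta> \<le> (b i - a i) / 8" if "i \<in> S" for i
    unfolding \<delta>_def by (rule Min_le[OF fin]) (use that in auto)
  have nearE: "\<exists>i\<in>S. x = base (the (W i)) \<and> a i < t \<and> t < b i \<and> 1/4 < pr i t \<and> pr i t < 3/4"
    if t: "0 \<le> t" "t \<le> 1" and x: "gen_index x < N" "near x (fst (f t))" for t x
  proof -
    have "fst (f t) \<noteq> 0" using x(2) by (auto simp: near_def circ_def)
    then have "f t \<noteq> 0" by auto
    then obtain i where i: "i \<in> dom W" "a i < t" "t < b i" using D(6)[OF t] by blast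
    have "0 < pr i t" "pr i t < 1" using i by (auto simp: pr_def field_simps)
    moreover have "f t = letter_loop (the (W i)) (pr i t)" using D(5)[OF i] by (simp add: pr_def)
    ultimately have "x = base (the (W i)) \<and> 1/4 < pr i t \<and> pr i t < 3/4" using near_letter_loop_iff x(2) by metis
    moreover from this have "i \<in> S" using x(1) i(1) by (auto simp: S_def level_def domIff letter_index_def)
    ultimately show ?thesis using i by blast
  qed
  have nearI: "near (base (the (W i))) (fst (f t)) \<and> f t = letter_loop (the (W i)) (pr i t)"
    if "i \<in> dom W" "1/4 < pr i t" "pr i t < 3/4" for i t
  proof -
    have "0 < pr i t" "pr i t < 1" using that by auto
    moreover from this have i: "a i < t" "t < b i" using D(2)[OF that(1)] by (auto simp: pr_def field_simps)
    then have "f t = letter_loop (the (W i)) (pr i t)" using D(5)[OF that(1)] by (simp add: pr_def)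
    ultimately show ?thesis using near_letter_loop_iff that by metis
  qed
  have far: "\<not> dist s t < \<delta>" if st: "i \<in> S" "j \<in> S" "i < j" and "s < b i" "a j < t"
    "pr i s < 3/4 \<or> 1/4 < pr j t" for i j s t
  proof -
    have ij: "a i < b i" "a j < b j" "b i \<le> a j" using D(2,4) SW st by blast+
    from that(6) have "s < b i - (b i - a i) / 4 \<or> a j + (b j - a j) / 4 < t"
      using ij by (auto simp: pr_def field_simps)
    note disj = this
    show ?thesis
    proof
      assume "dist s t < \<delta>"
      then have ts: "t - s < \<delta>" by (simp add: dist_real_def)
      note facts = ts \<delta>[OF st(1)] \<delta>[OF st(2)] that(4,5) ij \<delta>0
      from disj show False
      proof
        assume "s < b i - (b i - a i) / 4" then show False using facts by linarith
      next
        assume "a j + (b j - a j) / 4 < t" then show False using facts by linarith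
      qed
    qed
  qed
  have main: "- E s + E t = cross N (fst (f s)) (fst (f t))"
    if st: "0 \<le> s" "s \<le> t" "t \<le> 1" "dist s t < \<delta>" for s t
  proof -
    define new where "new = {i \<in> S. passed i t \<and> \<not> passed i s}"
    have newD: "i \<in> S" "s \<le> m i" "m i \<le> t" "i \<in> dom W" if "i \<in> new" for i
      using that passed1[of i t] passed2[of i s] SW by (auto simp: new_def)
    have split: "{i \<in> S. passed i t} = {i \<in> S. passed i s} \<union> new"
      using passed_mono[OF _ st(2)] SW by (auto simp: new_def)
    have ts: "t - s < \<delta>" using st(2,4) by (simp add: dist_real_def)
    show ?thesis
    proof (cases "new = {}")
      case True
      have "cross N (fst (f s)) (fst (f t)) = 0"
      proof (rule ccontr)
        assume "cross N (fst (f s)) (fst (f t)) \<noteq> 0"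
        then obtain x where x: "gen_index x < N" "near x (fst (f s))" "near x (fst (f t))"
          "past x (fst (f s)) \<noteq> past x (fst (f t))" by (rule cross_nonzeroE)
        obtain i where i: "i \<in> S" "x = base (the (W i))" "a i < s" "s < b i" "1/4 < pr i s" "pr i s < 3/4"
          using nearE[OF st(1) _ x(1,2)] st by auto
        obtain j where j: "j \<in> S" "x = base (the (W j))" "a j < t" "t < b j" "1/4 < pr j t" "pr j t < 3/4"
          using nearE[OF _ st(3) x(1,3)] st by auto
        have "\<not> i < j" using far[OF i(1) j(1), of s t] i j st(4) by auto
        moreover have "\<not> j < i"
        proof
          assume "j < i"
          then have "b j \<le> a i" using D(4) SW i j by blast
          then show False using i j st(2) by linarith
        qed
        ultimately have "i = j" by simp
        have "passed i s = passed i t" using True passed_mono[OF _ st(2) SW[OF i(1)]] i(1) by (auto simp: new_def)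
        then have "- pot x (fst (f s)) + pot x (fst (f t)) = 0"
          using pot_letter_loop[OF i(5,6) j(5,6)[folded \<open>i = j\<close>], of "the (W i)"]
            nearI[OF SW[OF i(1)] i(5,6)] nearI[OF SW[OF i(1)] j(5,6)[folded \<open>i = j\<close>]] i(2)
          by (simp add: passed_def)
        then show False using cross_near[OF x(1,2,3)] \<open>cross N _ _ \<noteq> 0\<close> by simp
      qed
      then show ?thesis using split True by (simp add: E_def)
    next
      case False
      then obtain i where i: "i \<in> new" by blast
      note iD = newD[OF i]
      have len: "a i < b i" "\<delta> \<le> (b i - a i) / 8" using D(2)[OF iD(4)] \<delta>[OF iD(1)] by auto
      have only: "j = i" if j: "j \<in> new" for j
      proof (rule ccontr)
        assume "j \<noteq> i"
        have "m i + (b i - a i) / 2 \<le> m j \<or> m j + (b i - a i) / 2 \<le> m i"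
        proof (cases "i < j")
          case True
          then have "b i \<le> a j" "a j < b j" using D(2,4) newD[OF j] iD by blast+
          then show ?thesis by (simp add: m_def field_simps)
        next
          case False
          then have "b j \<le> a i" "a j < b j" using D(2,4) newD[OF j] iD \<open>j \<noteq> i\<close> by (metis linorder_cases)+
          then show ?thesis by (simp add: m_def field_simps)
        qed
        then show False using newD[OF j] iD ts len by linarith
      qed
      then have new: "new = {i}" using i by blast
      have "m i - (b i - a i) / 8 < s" "s \<le> m i" "m i \<le> t" "t < m i + (b i - a i) / 8" using iD ts len by linarith+
      then have p: "1/4 < pr i s" "pr i s < 3/4" "1/4 < pr i t" "pr i t < 3/4"
        using len by (auto simp: pr_def m_def field_simps)
      have "passed i t" "\<not> passed i s" using i by (auto simp: new_def)
      then have "- pot (base (the (W i))) (fst (f s)) + pot (base (the (W i))) (fst (f t)) = L i"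
        using pot_letter_loop[OF p, of "the (W i)"] nearI[OF iD(4) p(1,2)] nearI[OF iD(4) p(3,4)]
        by (simp add: passed_def L_def)
      moreover have "gen_index (base (the (W i))) < N"
        using iD(1) by (auto simp: S_def level_def letter_index_def)
      ultimately have cr: "cross N (fst (f s)) (fst (f t)) = L i"
        using cross_near nearI[OF iD(4) p(1,2)] nearI[OF iD(4) p(3,4)] by metis
      have "E t = ordered_sum L (insert i {i \<in> S. passed i s})"
        unfolding E_def split new by simp
      also have "\<dots> = E s + L i"
        unfolding E_def
      proof (rule ordered_sum_insert_max)
        fix j assume j: "j \<in> {i \<in> S. passed i s}"
        then have jW: "j \<in> dom W" "m j \<le> m i" "j \<noteq> i" using passed1[of j s] SW iD \<open>\<not> passed i s\<close> by force+
        show "j < i"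
        proof (rule ccontr)
          assume "\<not> j < i"
          then have "b i \<le> a j" "a j < b j" using D(2,4) jW iD by (metis linorder_cases)+
          then show False using jW(2) len by (simp add: m_def)
        qed
      qed (use finS in simp)
      finally show ?thesis using cr by (simp add: add.assoc[symmetric])
    qed
  qed
  have "develops N (fst \<circ> f) {0..1} E"
    unfolding develops_def
  proof (intro exI[of _ \<delta>] conjI ballI impI)
    fix s t :: real assume st: "s \<in> {0..1}" "t \<in> {0..1}" "dist s t < \<delta>"
    show "- E s + E t = cross N ((fst \<circ> f) s) ((fst \<circ> f) t)"
    proof (cases "s \<le> t")
      case True
      then show ?thesis using main[of s t] st by simp
    next
      case False
      then have "- E t + E s = cross N (fst (f t)) (fst (f s))" using main[of t s] st by (simp add: dist_commute)
      then have "- (- E t + E s) = cross N (fst (f s)) (fst (f t))" using cross_antisym[of N "fst (f s)"] by simp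
      then show ?thesis by (simp add: minus_add)
    qed
  qed (rule \<delta>0)
  from hol_eq[OF this] have "hol (fst \<circ> f) N = - E 0 + E 1" .
  moreover have "E 0 = 0"
  proof -
    have "{i \<in> S. passed i 0} = {}"
      using passed1[of _ 0] D(1,2) SW by (force simp: m_def)
    then show ?thesis by (simp only: E_def ordered_sum_empty)
  qed
  moreover have "E 1 = val W N"
  proof -
    have "m i < 1" if "i \<in> S" for i using D(2,3)[OF SW[OF that]] by (simp add: m_def)
    then have "{i \<in> S. passed i 1} = S" using passed3[of _ 1] SW by auto
    then show ?thesis unfolding E_def val_def L_def by (simp only: S_def)
  qed
  ultimately show "hol (fst \<circ> f) N = val W N" by simp
qed

section \<open>Every path in the earrings has the holonomy of a word\<close>

lemma ordered_sum_grid: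
  fixes f :: "real \<Rightarrow> 'g::monoid_add"
  assumes "K > 0"
  shows "ordered_sum f {t \<in> S. \<exists>m<n. t = real m / real K} =
    sum_list (map (\<lambda>m. if real m / real K \<in> S then f (real m / real K) else 0) [0..<n])"
proof (induction n)
  case 0
  have "{t \<in> S. \<exists>m<0::nat. t = real m / real K} = {}" by simp
  then show ?case by (simp only: ordered_sum_empty) simp
next
  case (Suc n)
  let ?t = "real n / real K" and ?A = "{t \<in> S. \<exists>m<n. t = real m / real K}"
  have fin: "finite ?A"
    by (rule finite_subset[of _ "(\<lambda>m. real m / real K) ` {..<n}"]) auto
  have less: "t < ?t" if "t \<in> ?A" for t using that assms by (auto simp: divide_strict_right_mono)
  show ?case
  proof (cases "?t \<in> S")
    case True
    then have "{t \<in> S. \<exists>m<Suc n. t = real m / real K} = insert ?t ?A" by (auto simp: less_Suc_eq)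
    then show ?thesis using ordered_sum_insert_max[OF fin less, of f] Suc True by simp
  next
    case False
    then have "{t \<in> S. \<exists>m<Suc n. t = real m / real K} = ?A" by (auto simp: less_Suc_eq)
    then show ?thesis using Suc False by simp
  qed
qed

lemma sum_list_telescope:
  fixes D :: "nat \<Rightarrow> 'g::group_add"
  shows "sum_list (map (\<lambda>m. - D m + D (Suc m)) [0..<n]) = - D 0 + D n"
  by (induction n) (simp_all add: add.assoc)

text \<open>
  For every circle \<open>x\<close> take a dyadic mesh on which the path moves by less than a quarter of the
  radius, as seen by the projection to that circle. A letter is placed at the left end of a mesh interval when
  the ends of the interval lie in the outer half on different sides of the far point. This gives finitely many
  letters for each circle, so a restricted word.

  For a fixed \<open>N\<close> all meshes of index below \<open>N\<close> have a common dyadic refinement with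
  \<open>K\<close> intervals, on which the holonomy is the sum of the crossings \<open>c m\<close>. A mesh
  interval of \<open>x\<close> in which something of \<open>x\<close> is crossed lies entirely in the outer
  half of \<open>x\<close>, so no other letters or crossings interfere there. The letter recorded at its left
  end is the total of its crossings.
\<close>

lemma word_of_path_exists:
  assumes g: "path g" "path_image g \<subseteq> earring"
  shows "\<exists>W :: (real, gen) word. countable (dom W) \<and> restricted W \<and> val W = hol g \<and>
    (\<forall>t a. W t = Some a \<longrightarrow> (\<exists>s\<in>{0..1}. g s \<in> circ (base a)))"
proof -
  have gE: "g t \<in> earring" if "t \<in> {0..1}" for t using g(2) that by (auto simp: path_image_def)
  have cont: "continuous_on {0..1} g" using g(1) by (simp add: path_def)
  have "\<exists>e::nat. \<forall>a\<in>{0..1}. \<forall>b\<in>{0..1}. dist a b \<le> 1 / 2 ^ e \<longrightarrow> dist (project x (g a)) (project x (g b)) < rad x / 4" for x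
  proof -
    obtain d where d: "d > 0" "\<forall>a\<in>{0..1}. \<forall>b\<in>{0..1}. dist a b < d \<longrightarrow> dist (project x (g a)) (project x (g b)) < rad x / 4"
      using uniformly_close_gen[OF compact_Icc cont, of "rad x / 4" x] rad_pos[of x] by auto
    obtain e where "(1 / 2 :: real) ^ e < d" using real_arch_pow_inv[OF d(1), of "1 / 2"] by auto
    then have "1 / 2 ^ e < d" by (simp add: power_one_over)
    then show ?thesis using d(2) by (intro exI[of _ e]) fastforce
  qed
  then obtain e :: "gen \<Rightarrow> nat" where e: "\<And>x a b. a \<in> {0..1} \<Longrightarrow> b \<in> {0..1} \<Longrightarrow> dist a b \<le> 1 / 2 ^ e x \<Longrightarrow>
      dist (project x (g a)) (project x (g b)) < rad x / 4" by metis
  \<comment> \<open>the mesh of \<open>x\<close> has width \<open>1 / 2 ^ e x\<close>\<close>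
  define event where "event x t \<longleftrightarrow> (\<exists>j<2 ^ e x. t = real j / 2 ^ e x) \<and> near x (g t) \<and> near x (g (t + 1 / 2 ^ e x)) \<and>
      past x (g t) \<noteq> past x (g (t + 1 / 2 ^ e x))" for x t
  define W where "W t = (if \<exists>x. event x t
      then Some (let x = THE x. event x t in if past x (g t) then Neg x else Pos x) else None)" for t
  have W: "W t = Some (if past x (g t) then Neg x else Pos x)" if "event x t" for x t
  proof -
    have "(THE x. event x t) = x"
      by (rule the_equality[where P = "\<lambda>x. event x t", OF that]) (use that near_unique in \<open>auto simp: event_def\<close>)
    then show ?thesis using that unfolding W_def by (auto simp: Let_def)
  qed
  have WD: "event (base a) t" if Wa: "W t = Some a" for t a
  proof -
    obtain x where x: "event x t" using Wa by (auto simp: W_def split: if_splits)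
    then have "a = (if past x (g t) then Neg x else Pos x)" using W[OF x] Wa by simp
    then show ?thesis using x by (auto split: if_splits)
  qed
  have fin: "finite {t. event x t}" for x
    by (rule finite_subset[of _ "(\<lambda>j. real j / 2 ^ e x) ` {..<2 ^ e x}"]) (auto simp: event_def)
  have res: "restricted W"
    unfolding restricted_def
  proof
    fix a
    have "{t. W t = Some a} \<subseteq> {t. event (base a) t}" using WD by blast
    then show "finite {t. W t = Some a}" using fin finite_subset by blast
  qed
  have "dom W = (\<Union>N. level N W)" by (auto simp: level_def domIff gt_ex)
  then have count: "countable (dom W)"
    using finite_level[OF res] by (simp add: countable_finite)
  have in01: "real j / 2 ^ k \<in> {0..1}" if "j \<le> 2 ^ k" for j k :: nat
  proof -
    have "real j \<le> real (2 ^ k)" using that by (rule of_nat_mono)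
    then show ?thesis by simp
  qed
  have circ: "\<exists>s\<in>{0..1}. g s \<in> circ (base a)" if "W t = Some a" for t a
  proof -
    have ev: "event (base a) t" using WD[OF that] .
    then obtain j where "j < 2 ^ e (base a)" "t = real j / 2 ^ e (base a)" by (auto simp: event_def)
    then have "t \<in> {0..1}" using in01[of j] by simp
    then show ?thesis using ev by (auto simp: event_def near_def)
  qed
  have "val W N = hol g N" for N
  proof -
    obtain D where D: "develops N g {0..1} D"
      using developing_map_exists[OF _ compact_Icc cont gE] by (metis convex_real_interval(5))
    then obtain \<delta> where \<delta>: "\<delta> > 0" "\<And>a b. a \<in> {0..1} \<Longrightarrow> b \<in> {0..1} \<Longrightarrow> dist a b < \<delta> \<Longrightarrow> - D a + D b = cross N (g a) (g b)"
      unfolding develops_def by blast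
    obtain e0 where e0: "(1 / 2 :: real) ^ e0 < \<delta>" using real_arch_pow_inv[OF \<delta>(1), of "1 / 2"] by auto
    define M where "M = Max (insert e0 (e ` {x. gen_index x < N}))"
    have finM: "finite (insert e0 (e ` {x. gen_index x < N}))" using finite_gen_index_less by simp
    have M: "e0 \<le> M" "\<And>x. gen_index x < N \<Longrightarrow> e x \<le> M"
      unfolding M_def using finM by (auto intro: Max_ge)
    define K :: nat where "K = 2 ^ M"
    have K0: "K > 0" by (simp add: K_def)
    define p where "p m = real m / real K" for m
    have p01: "p m \<in> {0..1}" if "m \<le> K" for m using that K0 by (simp add: p_def)
    have "1 / real K \<le> (1 / 2) ^ e0" unfolding K_def using M(1) by (simp add: power_one_over[symmetric] power_decreasing)
    then have Kd: "1 / real K < \<delta>" using e0 by simp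
    define c where "c m = cross N (g (p m)) (g (p (Suc m)))" for m
    have pstep: "p (Suc m) - p m = 1 / real K" for m by (simp add: p_def diff_divide_distrib[symmetric])
    have "c m = - D (p m) + D (p (Suc m))" if "m < K" for m
    proof -
      have "0 < 1 / real K" using K0 by simp
      then have "dist (p m) (p (Suc m)) < \<delta>" using pstep[of m] Kd unfolding dist_real_def by linarith
      then show ?thesis unfolding c_def using \<delta>(2)[of "p m" "p (Suc m)"] p01 that by simp
    qed
    then have "sum_list (map c [0..<K]) = sum_list (map (\<lambda>m. - D (p m) + D (p (Suc m))) [0..<K])"
      by (intro arg_cong[of _ _ sum_list] map_cong refl) simp
    also have "\<dots> = - D (p 0) + D (p K)" using sum_list_telescope[of "\<lambda>m. D (p m)" K] by simp
    also have "\<dots> = hol g N" using hol_eq[OF D] K0 by (simp add: p_def)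
    finally have sum_c: "sum_list (map c [0..<K]) = hol g N" .
    define w where "w m = (if p m \<in> level N W then letter (the (W (p m))) else 0)" for m
    \<comment> \<open>the number of fine intervals in a mesh interval of \<open>x\<close>\<close>
    define L where "L x = (2::nat) ^ (M - e x)" for x
    have L0: "L x > 0" for x by (simp add: L_def)
    have KL: "K = 2 ^ e x * L x" if "gen_index x < N" for x
      using M(2)[OF that] by (simp add: K_def L_def power_add[symmetric])
    have pL: "p (j * L x) = real j / 2 ^ e x" if "gen_index x < N" for j x
      using KL[OF that] L0[of x] by (simp add: p_def)
    have pL1: "p (j * L x) + 1 / 2 ^ e x = p (j * L x + L x)" if "gen_index x < N" for j x
    proof -
      have "p (j * L x + L x) = p (Suc j * L x)" by (simp add: add.commute)
      then show ?thesis unfolding pL[OF that] by (simp add: add_divide_distrib add.commute)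
    qed
    have ev_iff: "event x (p m) \<longleftrightarrow> m mod L x = 0 \<and> near x (g (p m)) \<and> near x (g (p (m + L x))) \<and>
        past x (g (p m)) \<noteq> past x (g (p (m + L x)))" if x: "gen_index x < N" and "m < K" for x m
    proof -
      have 1: "(\<exists>j<2 ^ e x. p m = real j / 2 ^ e x) \<longleftrightarrow> m mod L x = 0"
      proof
        assume "\<exists>j<2 ^ e x. p m = real j / 2 ^ e x"
        then obtain j where "p m = p (j * L x)" using pL[OF x] by auto
        then have "m = j * L x" using K0 by (simp add: p_def field_simps flip: of_nat_mult)
        then show "m mod L x = 0" by simp
      next
        assume "m mod L x = 0"
        then obtain j where j: "m = j * L x" by (metis mod_0_imp_dvd dvd_def mult.commute)
        then have "j < 2 ^ e x" using \<open>m < K\<close> KL[OF x] L0[of x] by simp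
        then show "\<exists>j<2 ^ e x. p m = real j / 2 ^ e x" using pL[OF x, of j] j by auto
      qed
      show ?thesis
      proof (cases "m mod L x = 0")
        case True
        then obtain j where j: "m = j * L x" by (metis mod_0_imp_dvd dvd_def mult.commute)
        then have "p m + 1 / 2 ^ e x = p (m + L x)" using pL1[OF x] by simp
        then show ?thesis using 1 True unfolding event_def by simp
      next
        case False
        then have "\<not> (\<exists>j<2 ^ e x. p m = real j / 2 ^ e x)" using 1 by simp
        then show ?thesis using False unfolding event_def by (simp only: simp_thms)
      qed
    qed
    have w_event: "w m = - pot x (g (p m)) + pot x (g (p (m + L x)))" if "event x (p m)" "gen_index x < N" "m < K" for x m
    proof -
      have "p m \<in> level N W" using W[OF that(1)] that(2) by (auto simp: level_def letter_index_def)
      moreover have "past x (g (p m)) \<noteq> past x (g (p (m + L x)))" using that ev_iff by blast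
      moreover have "letter (Neg x) = - letter (Pos x)" using letter_inverse[of "Pos x"] by simp
      ultimately show ?thesis using W[OF that(1)] by (auto simp: w_def pot_def)
    qed
    have w_0: "w m = 0" if "\<And>x. gen_index x < N \<Longrightarrow> \<not> event x (p m)" for m
    proof -
      have "p m \<notin> level N W"
      proof
        assume "p m \<in> level N W"
        then obtain a where "W (p m) = Some a" "letter_index a < N" by (auto simp: level_def)
        then show False using WD that[of "base a"] by (auto simp: letter_index_def)
      qed
      then show ?thesis by (simp add: w_def)
    qed
    define start where "start x m = m div L x * L x" for x m
    \<comment> \<open>the mesh interval of \<open>x\<close> around the fine interval \<open>m\<close> stays in the outer half of \<open>x\<close>\<close>
    define active where "active x m \<longleftrightarrow> gen_index x < N \<and>
      (\<forall>k. start x m \<le> k \<and> k \<le> start x m + L x \<longrightarrow> near x (g (p k)))" for x m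
    have start: "start x m \<le> m" "m < start x m + L x" "start x m mod L x = 0" "m mod L x = m - start x m" for x m
    proof -
      show "start x m \<le> m" by (simp add: start_def)
      have "m = start x m + m mod L x" by (simp add: start_def)
      then show "m < start x m + L x" "m mod L x = m - start x m" using mod_less_divisor[OF L0, of m x] by linarith+
      show "start x m mod L x = 0" by (simp add: start_def)
    qed
    have start_eq: "start x k = start x m" if "start x m \<le> k" "k < start x m + L x" for x m k
    proof -
      have "k div L x = m div L x"
        using that by (intro div_nat_eqI) (auto simp: start_def algebra_simps)
      then show ?thesis by (simp add: start_def)
    qed
    have startK: "start x m + L x \<le> K" if "gen_index x < N" "m < K" for x m
    proof -
      have "m div L x < 2 ^ e x" using that KL[OF that(1)] by (intro less_mult_imp_div_less) simp
      then have "Suc (m div L x) * L x \<le> 2 ^ e x * L x" by (intro mult_le_mono1) simp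
      then show ?thesis using KL[OF that(1)] by (simp add: start_def)
    qed
    have active_near: "near x (g (p m))" "near x (g (p (Suc m)))" if "active x m" for x m
      using that start[where x = x and m = m] by (auto simp: active_def)
    have near_piece: "near x (g (p k))"
      if x: "gen_index x < N" and a: "a \<le> K" "near x (g (p a))" and b: "b \<le> K" "near x (g (p b))"
        and "past x (g (p a)) \<noteq> past x (g (p b))" and k: "k \<le> K"
        and d: "\<bar>real a - real b\<bar> \<le> real (L x)" "\<bar>real a - real k\<bar> \<le> real (L x)" for x a b k
    proof -
      have LK: "real (L x) / real K = 1 / 2 ^ e x" using KL[OF x] L0[of x] by simp
      have dp: "dist (p i) (p j) \<le> 1 / 2 ^ e x" if "\<bar>real i - real j\<bar> \<le> real (L x)" for i j
      proof -
        have "dist (p i) (p j) = \<bar>real i - real j\<bar> / real K"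
          using K0 by (simp add: p_def dist_real_def diff_divide_distrib[symmetric] abs_divide)
        also have "\<dots> \<le> real (L x) / real K" using that by (intro divide_right_mono) auto
        finally show ?thesis using LK by simp
      qed
      have "dist (g (p a)) (g (p b)) < rad x / 4"
        using e[OF p01[OF a(1)] p01[OF b(1)] dp[OF d(1)]] near_dist[OF a(2) b(2)] by simp
      from near_if_crossing[OF a(2) b(2) that(6) this gE[OF p01[OF k]] e[OF p01[OF a(1)] p01[OF k] dp[OF d(2)]]]
      show ?thesis .
    qed
    have active_cross: "active x m"
      if x: "gen_index x < N" "m < K" and ab: "start x m \<le> a" "a \<le> start x m + L x" "start x m \<le> b" "b \<le> start x m + L x"
        "near x (g (p a))" "near x (g (p b))" "past x (g (p a)) \<noteq> past x (g (p b))" for x m a b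
      unfolding active_def
    proof (intro conjI allI impI)
      fix k assume k: "start x m \<le> k \<and> k \<le> start x m + L x"
      have le: "a \<le> K" "b \<le> K" "k \<le> K" using startK[OF x] ab k by auto
      have "\<bar>real a - real b\<bar> \<le> real (L x)" "\<bar>real a - real k\<bar> \<le> real (L x)" using ab k by linarith+
      then show "near x (g (p k))" using near_piece[OF x(1) le(1) ab(5) le(2) ab(6,7) le(3)] by blast
    qed (fact x(1))
    \<comment> \<open>inside a mesh interval the letters of the word are ahead of the crossings; this is the difference\<close>
    define corr where "corr m = (if \<exists>x. active x m \<and> m mod L x \<noteq> 0
       then (let x = THE x. active x m in - w (start x m) + (- pot x (g (p (start x m))) + pot x (g (p m)))) else 0)" for m
    have active_unique: "x = y" if "active x m" "active y m" for x y m
      using near_unique active_near that by blast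
    have corr_active: "corr m = - w (start x m) + (- pot x (g (p (start x m))) + pot x (g (p m)))"
      if "active x m" "m mod L x \<noteq> 0" for x m
    proof -
      have "(THE x. active x m) = x" using that active_unique by (intro the_equality) blast+
      then show ?thesis using that unfolding corr_def by (auto simp: Let_def)
    qed
    have corr_0: "corr m = 0" if "\<And>x. active x m \<Longrightarrow> m mod L x = 0" for m
      using that unfolding corr_def by auto
    have step: "corr m + c m = w m + corr (Suc m)" if "m < K" for m
    proof (cases "\<exists>x. active x m")
      case True
      then obtain x where x: "active x m" by blast
      have xN: "gen_index x < N" using x by (simp add: active_def)
      define s where "s = start x m"
      have s: "s \<le> m" "m < s + L x" using start[where x = x and m = m] by (auto simp: s_def)
      have near: "near x (g (p k))" if "s \<le> k" "k \<le> s + L x" for k using x that by (auto simp: active_def s_def)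
      have cm: "c m = - pot x (g (p m)) + pot x (g (p (Suc m)))"
        unfolding c_def by (rule cross_near[OF xN active_near[OF x]])
      have sK: "s < K" using s \<open>m < K\<close> by simp
      have ws: "w s = - pot x (g (p s)) + pot x (g (p (s + L x)))"
      proof (cases "past x (g (p s)) = past x (g (p (s + L x)))")
        case False
        then have "event x (p s)" using ev_iff[OF xN sK] near start(3) by (simp add: s_def)
        then show ?thesis using w_event xN sK by blast
      next
        case True
        have "w s = 0"
        proof (rule w_0)
          fix y assume y: "gen_index y < N"
          show "\<not> event y (p s)"
          proof
            assume ev: "event y (p s)"
            then have "near y (g (p s))" by (simp add: event_def)
            then have "y = x" using near_unique near[of s] by auto
            then show False using ev ev_iff[OF xN sK] True by simp
          qed
        qed
        then show ?thesis using True by (simp add: pot_def)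
      qed
      have end0: "corr (Suc m) = 0" if "Suc m = s + L x"
      proof (rule corr_0)
        fix y assume y: "active y (Suc m)"
        have "y = x" using near_unique active_near(1)[OF y] near[of "Suc m"] that by auto
        moreover have "Suc m mod L x = 0" using that start(3)[of x m] by (simp add: s_def)
        ultimately show "Suc m mod L y = 0" by simp
      qed
      have mid: "corr (Suc m) = - w s + (- pot x (g (p s)) + pot x (g (p (Suc m))))" if "Suc m < s + L x"
      proof -
        have st: "start x (Suc m) = s" using start_eq[of x m "Suc m"] s that by (simp add: s_def)
        then have "active x (Suc m)" using x by (simp add: active_def s_def)
        moreover have "Suc m mod L x \<noteq> 0" using start(4)[of "Suc m" x] st s by simp
        ultimately show ?thesis using corr_active st by blast
      qed
      have next_eq: "w s + corr (Suc m) = - pot x (g (p s)) + pot x (g (p (Suc m)))"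
      proof (cases "Suc m = s + L x")
        case True
        then show ?thesis using end0 ws by simp
      next
        case False
        then have "Suc m < s + L x" using s by simp
        show ?thesis unfolding mid[OF \<open>Suc m < s + L x\<close>] by (rule add_minus_cancel)
      qed
      show ?thesis
      proof (cases "m = s")
        case True
        have "corr m = 0"
        proof (rule corr_0)
          fix y assume "active y m"
          then have "y = x" using active_unique x by blast
          then show "m mod L y = 0" using True start(3)[of x m] by (simp add: s_def)
        qed
        then show ?thesis using next_eq cm True by simp
      next
        case False
        then have mod: "m mod L x \<noteq> 0" using start(4)[of m x] s by (simp add: s_def)
        have "w m = 0"
        proof (rule w_0)
          fix y assume y: "gen_index y < N"
          show "\<not> event y (p m)"
          proof
            assume ev: "event y (p m)"
            then have "near y (g (p m))" by (simp add: event_def)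
            then have "y = x" using near_unique active_near(1)[OF x] by auto
            then show False using ev ev_iff[OF xN \<open>m < K\<close>] mod by simp
          qed
        qed
        moreover have "corr m = - w s + (- pot x (g (p s)) + pot x (g (p m)))"
          using corr_active[OF x mod] by (simp add: s_def)
        then have "corr m + c m = - w s + (- pot x (g (p s)) + pot x (g (p (Suc m))))"
          unfolding cm by (simp add: add.assoc)
        then have "corr m + c m = - w s + (w s + corr (Suc m))" unfolding next_eq .
        ultimately show ?thesis by simp
      qed
    next
      case False
      have "corr m = 0" using False corr_0 by blast
      moreover have "c m = 0"
      proof (rule ccontr)
        assume "c m \<noteq> 0"
        then obtain x where x: "gen_index x < N" "near x (g (p m))" "near x (g (p (Suc m)))"
          "past x (g (p m)) \<noteq> past x (g (p (Suc m)))" unfolding c_def by (rule cross_nonzeroE)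
        have "active x m"
          using active_cross[OF x(1) \<open>m < K\<close>, of m "Suc m"] start[where x = x and m = m] x by simp
        then show False using False by blast
      qed
      moreover have "w m = 0"
      proof (rule w_0)
        fix x assume x: "gen_index x < N"
        show "\<not> event x (p m)"
        proof
          assume "event x (p m)"
          then have ev: "m mod L x = 0" "near x (g (p m))" "near x (g (p (m + L x)))" "past x (g (p m)) \<noteq> past x (g (p (m + L x)))"
            using ev_iff[OF x \<open>m < K\<close>] by blast+
          have "start x m = m" using ev(1) start[where x = x and m = m] by simp
          then have "active x m" using active_cross[OF x \<open>m < K\<close>, of m "m + L x"] ev by simp
          then show False using False by blast
        qed
      qed
      moreover have "corr (Suc m) = 0"
      proof (rule corr_0, rule ccontr)
        fix x assume x: "active x (Suc m)" "Suc m mod L x \<noteq> 0"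
        have "start x (Suc m) \<le> m" "m < start x (Suc m) + L x" using x(2) start[where x = x and m = "Suc m"] by linarith+
        then have "start x m = start x (Suc m)" by (rule start_eq)
        then have "active x m" using x(1) by (simp add: active_def)
        then show False using False by blast
      qed
      ultimately show ?thesis by simp
    qed
    have "m \<le> K \<Longrightarrow> sum_list (map c [0..<m]) = sum_list (map w [0..<m]) + corr m" for m
    proof (induction m)
      case 0
      have "corr 0 = 0" by (rule corr_0) simp
      then show ?case by simp
    next
      case (Suc m)
      then have "sum_list (map c [0..<Suc m]) = sum_list (map w [0..<m]) + (corr m + c m)"
        by (simp add: add.assoc)
      also have "\<dots> = sum_list (map w [0..<Suc m]) + corr (Suc m)"
        using step[of m] Suc.prems by (simp add: add.assoc)
      finally show ?case .
    qed
    from this[of K] have "sum_list (map c [0..<K]) = sum_list (map w [0..<K]) + corr K" by simp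
    moreover have "corr K = 0" using KL by (intro corr_0) (auto simp: active_def)
    moreover have "sum_list (map w [0..<K]) = val W N"
    proof -
      have "{t \<in> level N W. \<exists>m<K. t = real m / real K} = level N W"
      proof (intro equalityI subsetI)
        fix t assume t: "t \<in> level N W"
        then obtain a where a: "W t = Some a" "letter_index a < N" by (auto simp: level_def)
        then have x: "gen_index (base a) < N" by (simp add: letter_index_def)
        obtain j where j: "j < 2 ^ e (base a)" "t = real j / 2 ^ e (base a)"
          using WD[OF a(1)] by (auto simp: event_def)
        have "t = p (j * L (base a))" using pL[OF x] j by simp
        moreover have "j * L (base a) < K" using KL[OF x] j L0[of "base a"] by simp
        ultimately show "t \<in> {t \<in> level N W. \<exists>m<K. t = real m / real K}" using t by (auto simp: p_def)
      qed blast
      then show ?thesis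
        using ordered_sum_grid[OF K0, of "\<lambda>i. letter (the (W i))" "level N W" K]
        unfolding val_def w_def p_def by (simp only:)
    qed
    ultimately show ?thesis using sum_c by simp
  qed
  then have "val W = hol g" by (rule ext)
  then show ?thesis using count res circ by blast
qed

lemma pure_word_equiv:
  assumes "word_equiv V W"
  shows "only_p V \<Longrightarrow> only_p W" "only_q V \<Longrightarrow> only_q W"
proof -
  obtain \<phi> where \<phi>: "bij_betw \<phi> (dom V) (dom W)" "\<forall>i\<in>dom V. W (\<phi> i) = V i"
    using assms unfolding word_equiv_def by blast
  have "ran W \<subseteq> ran V"
  proof
    fix a assume "a \<in> ran W"
    then obtain j where j: "W j = Some a" by (auto simp: ran_def)
    then have "j \<in> \<phi> ` dom V" using bij_betw_imp_surj_on[OF \<phi>(1)] by (simp add: domIff)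
    then show "a \<in> ran V" using j \<phi>(2) by (auto intro: ranI)
  qed
  then show "only_p V \<Longrightarrow> only_p W" "only_q V \<Longrightarrow> only_q W" unfolding only_p_def only_q_def by blast+
qed

theorem reduced_word_of_path_exists:
  assumes g: "path g" "path_image g \<subseteq> earring"
  shows "\<exists>W. unit_word W \<and> restricted W \<and> reduced W \<and> val W = hol g \<and>
    (path_image g \<subseteq> earring_P \<longrightarrow> only_p W) \<and> (path_image g \<subseteq> earring_Q \<longrightarrow> only_q W)"
proof -
  obtain W :: "(real, gen) word" where W: "countable (dom W)" "restricted W" "val W = hol g"
    "\<forall>t a. W t = Some a \<longrightarrow> (\<exists>s\<in>{0..1}. g s \<in> circ (base a))"
    using word_of_path_exists[OF g] by (elim exE conjE)
  have P: "only_p W" if "path_image g \<subseteq> earring_P"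
  proof -
    have "a \<in> range (Pos \<circ> P) \<union> range (Neg \<circ> P)" if a: "a \<in> ran W" for a
    proof -
      obtain t where "W t = Some a" using a by (auto simp: ran_def)
      then obtain s where s: "s \<in> {0..1}" "g s \<in> circ (base a)" using W(4) by blast
      then have "g s \<in> earring_P" "g s \<noteq> 0"
        using \<open>path_image g \<subseteq> earring_P\<close> by (auto simp: path_image_def circ_def)
      then obtain n where "g s \<in> circ (P n)" using earring_P_circ by blast
      then have "base a = P n" using s(2) circ_unique by blast
      then show ?thesis by (cases a) auto
    qed
    then show ?thesis unfolding only_p_def by blast
  qed
  have Q: "only_q W" if "path_image g \<subseteq> earring_Q"
  proof -
    have "a \<in> range (Pos \<circ> Q) \<union> range (Neg \<circ> Q)" if a: "a \<in> ran W" for a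
    proof -
      obtain t where "W t = Some a" using a by (auto simp: ran_def)
      then obtain s where s: "s \<in> {0..1}" "g s \<in> circ (base a)" using W(4) by blast
      then have "g s \<in> earring_Q" "g s \<noteq> 0"
        using \<open>path_image g \<subseteq> earring_Q\<close> by (auto simp: path_image_def circ_def)
      then obtain n where "g s \<in> circ (Q n)" using earring_Q_circ by blast
      then have "base a = Q n" using s(2) circ_unique by blast
      then show ?thesis by (cases a) auto
    qed
    then show ?thesis unfolding only_q_def by blast
  qed
  obtain U where U: "unit_word U" "word_equiv W U" by (rule unit_word_exists[OF W(1)])
  have resU: "restricted U" by (rule word_equiv_restricted[OF U(2) W(2)])
  obtain V where V: "reduced_form U V" using reduced_form_exists by blast
  have "dom V \<subseteq> dom U" "ran V \<subseteq> ran U"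
  proof -
    have eq: "V = U |` dom V" by (rule reduced_formD(2)[OF V])
    show "dom V \<subseteq> dom U" by (subst eq) auto
    show "ran V \<subseteq> ran U" by (subst eq) (auto simp: ran_def restrict_map_def split: if_splits)
  qed
  then have "unit_word V" "only_p U \<Longrightarrow> only_p V" "only_q U \<Longrightarrow> only_q V"
    using U(1) unfolding unit_word_def only_p_def only_q_def by blast+
  moreover have "val V = hol g"
    using val_reduced_form[OF V resU] val_word_equiv[OF U(2) W(2)] W(3) by simp
  ultimately show ?thesis
    using reduced_formD(1)[OF V] reduced_formD(3)[OF V resU] P Q pure_word_equiv[OF U(2)] by blast
qed

section \<open>Retracting Griffiths' space minus the apexes\<close>

text \<open>
  The inverse of the cone parametrisations followed by the projection to the base: every point but the apexes
  is moved along its line through the apex \<open>(1, 1)\<close> or \<open>(-1, 1)\<close> to height 0. The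
  sign of the real part tells the two cones apart.
\<close>

definition ret :: "complex \<times> real \<Rightarrow> complex" where
  "ret y = (if Re (fst y) \<le> 0 then (fst y + of_real (snd y)) /\<^sub>R (1 - snd y)
     else (fst y - of_real (snd y)) /\<^sub>R (1 - snd y))"

lemma griffiths_cases:
  assumes "y \<in> griffiths_space"
  obtains w t where "w \<in> earring_P" "0 \<le> t" "t \<le> 1" "fst y = (1 - t) *\<^sub>R w + of_real t" "snd y = t"
  | w t where "w \<in> earring_Q" "0 \<le> t" "t \<le> 1" "fst y = (1 - t) *\<^sub>R w - of_real t" "snd y = t"
proof -
  consider "y \<in> cone_over (1, 1) earring_P" | "y \<in> cone_over (-1, 1) earring_Q"
    using assms unfolding griffiths_space_def by blast
  then show thesis
  proof cases
    case 1
    then obtain w t where "w \<in> earring_P" "0 \<le> t" "t \<le> 1" "y = cone_map (1, 1) (w, t)"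
      unfolding cone_over_def by auto
    then show thesis by (intro that(1)[of w t]) (auto simp: cone_map_def scaleR_conv_of_real)
  next
    case 2
    then obtain w t where "w \<in> earring_Q" "0 \<le> t" "t \<le> 1" "y = cone_map (-1, 1) (w, t)"
      unfolding cone_over_def by auto
    then show thesis by (intro that(2)[of w t]) (auto simp: cone_map_def scaleR_conv_of_real)
  qed
qed

lemma earring_Q_left:
  assumes "z \<in> earring_Q" shows "Re z \<le> 0" and "Re z = 0 \<Longrightarrow> z = 0"
  using assms earring_P_right unfolding earring_Q_eq by fastforce+

lemma griffiths_point:
  assumes "y \<in> griffiths_space"
  shows "0 \<le> snd y" "snd y \<le> 1" "snd y = 1 \<Longrightarrow> Re (fst y) = 1 \<or> Re (fst y) = -1"
    and "snd y < 1 \<Longrightarrow> ret y \<in> earring"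
    and "snd y < 1 \<Longrightarrow> 0 < Re (fst y) \<Longrightarrow> ret y \<in> earring_P"
    and "snd y < 1 \<Longrightarrow> Re (fst y) < 0 \<Longrightarrow> ret y \<in> earring_Q"
    and "Re (fst y) = 0 \<Longrightarrow> y = 0"
proof -
  have "0 \<le> snd y \<and> snd y \<le> 1 \<and> (snd y = 1 \<longrightarrow> Re (fst y) = 1 \<or> Re (fst y) = -1) \<and>
    (snd y < 1 \<longrightarrow> ret y \<in> earring) \<and> (snd y < 1 \<longrightarrow> 0 < Re (fst y) \<longrightarrow> ret y \<in> earring_P) \<and>
    (snd y < 1 \<longrightarrow> Re (fst y) < 0 \<longrightarrow> ret y \<in> earring_Q) \<and> (Re (fst y) = 0 \<longrightarrow> y = 0)"
    using assms
  proof (cases rule: griffiths_cases)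
    case (1 w t)
    have re: "Re (fst y) = (1 - t) * Re w + t" using 1 by simp
    have nn: "0 \<le> (1 - t) * Re w" using 1 earring_P_right(1)[OF 1(1)] by simp
    have zero: "t = 0 \<and> w = 0" if "Re (fst y) \<le> 0"
    proof -
      have "t = 0" "(1 - t) * Re w = 0" using that re nn 1(2) by linarith+
      then show ?thesis using earring_P_right(2)[OF 1(1)] by simp
    qed
    have ret: "ret y = w" if "t < 1"
    proof (cases "Re (fst y) \<le> 0")
      case True
      then have z: "t = 0" "w = 0" using zero by simp_all
      have "fst y = 0" "snd y = 0" unfolding 1(4,5) z by simp_all
      then show ?thesis unfolding ret_def z by simp
    next
      case False
      have "fst y - of_real (snd y) = (1 - t) *\<^sub>R w" unfolding 1(4,5) by simp
      then have "ret y = ((1 - t) *\<^sub>R w) /\<^sub>R (1 - t)" unfolding ret_def if_not_P[OF False] 1(5)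
        by (simp only:)
      also have "\<dots> = w" using that by simp
      finally show ?thesis .
    qed
    have "y = 0" if "Re (fst y) = 0" using zero that 1 by (intro prod_eqI) auto
    moreover have "0 \<le> Re (fst y)" using re nn 1(2) by linarith
    moreover have "Re (fst y) = 1" if "t = 1" using re that by simp
    ultimately show ?thesis using ret 1 by (auto simp: earring_def)
  next
    case (2 w t)
    have re: "Re (fst y) = (1 - t) * Re w - t" using 2 by simp
    have nn: "(1 - t) * Re w \<le> 0" using 2 earring_Q_left(1)[OF 2(1)] by (simp add: mult_nonneg_nonpos)
    then have le: "Re (fst y) \<le> 0" using re 2(2) by linarith
    have "y = 0" if "Re (fst y) = 0"
    proof -
      have "t = 0" "(1 - t) * Re w = 0" using that re nn 2(2) by linarith+
      then have "w = 0" using earring_Q_left(2)[OF 2(1)] by simp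
      then show ?thesis using 2 \<open>t = 0\<close> by (intro prod_eqI) auto
    qed
    moreover have "ret y = w" if "t < 1"
    proof -
      have "fst y + of_real (snd y) = (1 - t) *\<^sub>R w" unfolding 2(4,5) by simp
      then have "ret y = ((1 - t) *\<^sub>R w) /\<^sub>R (1 - t)" unfolding ret_def if_P[OF le] 2(5)
        by (simp only:)
      also have "\<dots> = w" using that by simp
      finally show ?thesis .
    qed
    moreover have "Re (fst y) = -1" if "t = 1" using re that by simp
    ultimately show ?thesis using 2 le by (auto simp: earring_def)
  qed
  then show "0 \<le> snd y" "snd y \<le> 1" "snd y = 1 \<Longrightarrow> Re (fst y) = 1 \<or> Re (fst y) = -1"
    and "snd y < 1 \<Longrightarrow> ret y \<in> earring"
    and "snd y < 1 \<Longrightarrow> 0 < Re (fst y) \<Longrightarrow> ret y \<in> earring_P"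
    and "snd y < 1 \<Longrightarrow> Re (fst y) < 0 \<Longrightarrow> ret y \<in> earring_Q"
    and "Re (fst y) = 0 \<Longrightarrow> y = 0" by simp_all
qed

lemma ret_base: "snd y = 0 \<Longrightarrow> ret y = fst y"
  by (simp add: ret_def)

lemma continuous_ret: "continuous_on {y \<in> griffiths_space. snd y < 1} ret"
proof -
  let ?S = "{y \<in> griffiths_space. snd y < 1}"
  have "continuous_on ?S (\<lambda>y. if Re (fst y) \<le> 0 then (fst y + of_real (snd y)) /\<^sub>R (1 - snd y)
     else (fst y - of_real (snd y)) /\<^sub>R (1 - snd y))"
  proof (rule continuous_on_cases_le)
    show "(fst y + of_real (snd y)) /\<^sub>R (1 - snd y) = (fst y - of_real (snd y)) /\<^sub>R (1 - snd y)"
      if "y \<in> ?S" "Re (fst y) = 0" for y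
      using griffiths_point(7)[of y] that by simp
  qed (intro continuous_intros; auto)+
  then show ?thesis by (simp add: ret_def[abs_def])
qed

section \<open>Values of words with letters in a given set\<close>

text \<open>
  The elements represented by words over \<open>A\<close>. Restricting to reduced words indexed by the unit
  interval loses nothing, since every restricted word has a reduced form and a copy on the unit interval.
\<close>

definition vals :: "gen signed set \<Rightarrow> free_limit set" where
  "vals A = {val W | W :: (real, gen) word. unit_word W \<and> restricted W \<and> reduced W \<and> ran W \<subseteq> A}"

definition inverse_closed :: "gen signed set \<Rightarrow> bool" where
  "inverse_closed A \<longleftrightarrow> (\<forall>a\<in>A. inverse_letter a \<in> A)"

lemma restricted_imp_countable: "restricted (W :: ('i, gen) word) \<Longrightarrow> countable (dom W)"
proof -
  assume "restricted W"
  moreover have "dom W = (\<Union>N. level N W)" by (auto simp: level_def domIff gt_ex)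
  ultimately show ?thesis by (simp add: countable_finite finite_level)
qed

lemma ran_word_equiv: assumes "word_equiv V W" shows "ran W \<subseteq> ran V"
proof
  obtain \<phi> where \<phi>: "bij_betw \<phi> (dom V) (dom W)" "\<forall>i\<in>dom V. W (\<phi> i) = V i"
    using assms unfolding word_equiv_def by blast
  fix a assume "a \<in> ran W"
  then obtain j where j: "W j = Some a" by (auto simp: ran_def)
  then have "j \<in> \<phi> ` dom V" using bij_betw_imp_surj_on[OF \<phi>(1)] by (simp add: domIff)
  then show "a \<in> ran V" using j \<phi>(2) by (auto intro: ranI)
qed

lemma val_in_vals:
  fixes W :: "(real, gen) word"
  assumes "restricted W" "ran W \<subseteq> A" shows "val W \<in> vals A"
proof -
  obtain U where U: "unit_word U" "word_equiv W U" by (rule unit_word_exists[OF restricted_imp_countable[OF assms(1)]])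
  have resU: "restricted U" by (rule word_equiv_restricted[OF U(2) assms(1)])
  obtain V where V: "reduced_form U V" using reduced_form_exists by blast
  have eq: "V = U |` dom V" by (rule reduced_formD(2)[OF V])
  have "dom V \<subseteq> dom U" by (subst eq) auto
  then have "unit_word V" using U(1) unfolding unit_word_def by blast
  moreover have "ran V \<subseteq> ran U" by (subst eq) (auto simp: ran_def restrict_map_def split: if_splits)
  then have "ran V \<subseteq> A" using ran_word_equiv[OF U(2)] assms(2) by blast
  moreover have "val V = val W"
    using val_reduced_form[OF V resU] val_word_equiv[OF U(2) assms(1)] by simp
  moreover have "reduced V" "restricted V"
    by (rule reduced_formD(1)[OF V], rule reduced_formD(3)[OF V resU])
  ultimately show ?thesis
    unfolding vals_def by (intro CollectI exI[of _ V] conjI) simp_all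
qed

lemma vals_zero: "0 \<in> vals A"
proof -
  have "restricted (Map.empty :: (real, gen) word)" by (simp add: restricted_def)
  then have "val (Map.empty :: (real, gen) word) \<in> vals A" by (rule val_in_vals) simp
  then show ?thesis by simp
qed

lemma vals_add:
  assumes "g \<in> vals A" "h \<in> vals A" shows "g + h \<in> vals A"
proof -
  obtain V W :: "(real, gen) word" where V: "g = val V" "unit_word V" "restricted V" "ran V \<subseteq> A"
    and W: "h = val W" "unit_word W" "restricted W" "ran W \<subseteq> A"
    using assms unfolding vals_def by blast
  have u: "unit_word U \<and> restricted U" if "U \<in> set [V, W]" for U using that V W by auto
  have "ran (cat [V, W]) \<subseteq> A"
  proof
    fix a assume "a \<in> ran (cat [V, W])"
    then obtain t where "cat [V, W] t = Some a" by (auto simp: ran_def)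
    then have "a \<in> ran ([V, W] ! nat \<lfloor>t\<rfloor>)" "nat \<lfloor>t\<rfloor> < 2" by (auto simp: cat_def ran_def split: if_splits)
    then show "a \<in> A" using V(4) W(4) by (auto simp: less_2_cases_iff)
  qed
  then have "val (cat [V, W]) \<in> vals A" by (intro val_in_vals restricted_cat u)
  moreover have "val (cat [V, W]) = g + h" using val_cat[of "[V, W]", OF u] V W by simp
  ultimately show ?thesis by simp
qed

lemma vals_uminus:
  assumes "g \<in> vals A" "inverse_closed A" shows "- g \<in> vals A"
proof -
  obtain W :: "(real, gen) word" where W: "g = val W" "restricted W" "ran W \<subseteq> A"
    using assms unfolding vals_def by blast
  have "ran (inverse_word W) \<subseteq> A"
  proof
    fix a assume "a \<in> ran (inverse_word W)"
    then obtain t where "map_option inverse_letter (W (1 - t)) = Some a" by (auto simp: ran_def inverse_word_def)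
    then obtain b where "W (1 - t) = Some b" "a = inverse_letter b" by auto
    then show "a \<in> A" using W(3) assms(2) by (auto simp: inverse_closed_def intro: ranI)
  qed
  then have "val (inverse_word W) \<in> vals A" by (intro val_in_vals restricted_inverse_word W(2))
  then show ?thesis using W by (simp add: val_inverse_word)
qed

abbreviation p_letters :: "gen signed set" where
  "p_letters \<equiv> range (Pos \<circ> P) \<union> range (Neg \<circ> P)"

abbreviation q_letters :: "gen signed set" where
  "q_letters \<equiv> range (Pos \<circ> Q) \<union> range (Neg \<circ> Q)"

lemma inverse_closed_simps: "inverse_closed UNIV" "inverse_closed p_letters" "inverse_closed q_letters"
  by (auto simp: inverse_closed_def)

text \<open>
  Products of conjugates of elements of the two earring groups. With arbitrary conjugators from the values of
  words, this is the subgroup normally generated by the words that die in the cones.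
\<close>

inductive_set pure_closure :: "free_limit set" where
  pure_closure_zero: "0 \<in> pure_closure"
| pure_closure_add: "g \<in> pure_closure \<Longrightarrow> x \<in> vals UNIV \<Longrightarrow> s \<in> vals p_letters \<union> vals q_letters \<Longrightarrow>
    g + (x + s - x) \<in> pure_closure"

lemma pure_closure_plus:
  assumes "h \<in> pure_closure" "g \<in> pure_closure" shows "g + h \<in> pure_closure"
  using assms(1)
proof induction
  case pure_closure_zero
  then show ?case using assms(2) by simp
next
  case (pure_closure_add h x s)
  then have "g + h + (x + s - x) \<in> pure_closure" by (intro pure_closure.pure_closure_add)
  then show ?case by (simp only: add.assoc)
qed

lemma pure_closure_list:
  assumes "g \<in> pure_closure"
  shows "\<exists>n x s. (\<forall>k<n. unit_word (x k) \<and> restricted (x k) \<and> reduced (x k)) \<and>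
    (\<forall>k<n. unit_word (s k) \<and> restricted (s k) \<and> reduced (s k) \<and> pure (s k)) \<and>
    g = (\<Sum>k\<leftarrow>[0..<n]. val (x k) + val (s k) - val (x k :: (real, gen) word))"
  using assms
proof induction
  case pure_closure_zero
  show ?case by (rule exI[of _ 0]) simp
next
  case (pure_closure_add g x0 s0)
  obtain n and x s :: "nat \<Rightarrow> (real, gen) word" where x: "\<forall>k<n. unit_word (x k) \<and> restricted (x k) \<and> reduced (x k)"
    and s: "\<forall>k<n. unit_word (s k) \<and> restricted (s k) \<and> reduced (s k) \<and> pure (s k)"
    and g: "g = (\<Sum>k\<leftarrow>[0..<n]. val (x k) + val (s k) - val (x k))"
    using pure_closure_add.IH by (elim exE conjE)
  obtain X :: "(real, gen) word" where X: "x0 = val X" "unit_word X" "restricted X" "reduced X"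
    using pure_closure_add.hyps(2) unfolding vals_def by blast
  obtain Y :: "(real, gen) word" where Y: "s0 = val Y" "unit_word Y" "restricted Y" "reduced Y" "pure Y"
    using pure_closure_add.hyps(3) unfolding vals_def pure_def only_p_def only_q_def by blast
  define x' s' where "x' = x(n := X)" and "s' = s(n := Y)"
  have "(\<Sum>k\<leftarrow>[0..<n]. val (x' k) + val (s' k) - val (x' k)) = g"
    unfolding g x'_def s'_def by (intro arg_cong[of _ _ sum_list] map_cong refl) simp
  then have "g + (x0 + s0 - x0) = (\<Sum>k\<leftarrow>[0..<Suc n]. val (x' k) + val (s' k) - val (x' k))"
    using X(1) Y(1) by (simp add: x'_def s'_def)
  moreover have "\<forall>k<Suc n. unit_word (x' k) \<and> restricted (x' k) \<and> reduced (x' k)"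
    using x X by (simp add: x'_def less_Suc_eq)
  moreover have "\<forall>k<Suc n. unit_word (s' k) \<and> restricted (s' k) \<and> reduced (s' k) \<and> pure (s' k)"
    using s Y by (simp add: s'_def less_Suc_eq)
  ultimately show ?case by (intro exI[of _ "Suc n"] exI[of _ x'] exI[of _ s'] conjI)
qed

section \<open>Homotopic loops in Griffiths' space\<close>

lemma hol_cong:
  assumes "\<And>t. t \<in> {0..1} \<Longrightarrow> g t = g' t" shows "hol g = hol g'"
proof
  fix N
  have "develops N g {0..1} = develops N g' {0..1}" by (rule ext) (simp add: develops_def assms)
  then show "hol g N = hol g' N" by (simp add: hol_def)
qed

lemma hol_zero: "hol (\<lambda>t. 0) = 0"
proof
  fix N
  have "develops N (\<lambda>t. 0) {0..1::real} (\<lambda>t. 0)" unfolding develops_def by (auto intro!: exI[of _ 1])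
  from hol_eq[OF this] show "hol (\<lambda>t. 0) N = 0 N" by simp
qed

lemma hol_in_vals:
  assumes "path g" "path_image g \<subseteq> earring"
  shows "hol g \<in> vals UNIV" "path_image g \<subseteq> earring_P \<Longrightarrow> hol g \<in> vals p_letters"
    "path_image g \<subseteq> earring_Q \<Longrightarrow> hol g \<in> vals q_letters"
proof -
  obtain W where W: "unit_word W" "restricted W" "reduced W" "val W = hol g"
    "path_image g \<subseteq> earring_P \<longrightarrow> only_p W" "path_image g \<subseteq> earring_Q \<longrightarrow> only_q W"
    using reduced_word_of_path_exists[OF assms] by (elim exE conjE)
  then show "hol g \<in> vals UNIV" "path_image g \<subseteq> earring_P \<Longrightarrow> hol g \<in> vals p_letters"
    "path_image g \<subseteq> earring_Q \<Longrightarrow> hol g \<in> vals q_letters"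
    unfolding vals_def only_p_def only_q_def by (auto intro!: exI[of _ W])
qed

text \<open>
  The holonomy of the retracted image of an edge. An edge through an apex gets the value 0; this is harmless
  since the squares at such an edge are mapped into one cone, where only the membership of the value in the
  group of that cone matters.
\<close>

definition edge_val :: "(real \<times> real \<Rightarrow> complex \<times> real) \<Rightarrow> real \<times> real \<Rightarrow> real \<times> real \<Rightarrow> free_limit" where
  "edge_val h p q = (if \<forall>t\<in>{0..1}. snd (h (linepath p q t)) < 1 then hol (ret \<circ> h \<circ> linepath p q) else 0)"

lemma edge_val_in_vals:
  assumes h: "continuous_on R h" "h ` R \<subseteq> griffiths_space" and R: "convex R" "p \<in> R" "q \<in> R"
  shows "edge_val h p q \<in> vals UNIV"
    and "(\<And>y. y \<in> R \<Longrightarrow> 0 < Re (fst (h y))) \<Longrightarrow> edge_val h p q \<in> vals p_letters"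
    and "(\<And>y. y \<in> R \<Longrightarrow> Re (fst (h y)) < 0) \<Longrightarrow> edge_val h p q \<in> vals q_letters"
proof -
  have *: "edge_val h p q \<in> vals UNIV \<and>
    ((\<forall>y\<in>R. 0 < Re (fst (h y))) \<longrightarrow> edge_val h p q \<in> vals p_letters) \<and>
    ((\<forall>y\<in>R. Re (fst (h y)) < 0) \<longrightarrow> edge_val h p q \<in> vals q_letters)"
  proof (cases "\<forall>t\<in>{0..1}. snd (h (linepath p q t)) < 1")
    case True
    let ?g = "ret \<circ> h \<circ> linepath p q"
    have inR: "linepath p q t \<in> R" if "t \<in> {0..1}" for t
      using R that by (auto simp: linepath_def intro!: convexD)
    then have inS: "h (linepath p q t) \<in> {y \<in> griffiths_space. snd y < 1}" if "t \<in> {0..1}" for t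
      using h(2) True that by blast
    have "path ?g"
      unfolding path_def o_def
      by (rule continuous_on_compose2[OF continuous_ret continuous_on_compose2[OF h(1)]])
        (use inR inS in \<open>auto intro: continuous_on_linepath\<close>)
    moreover have "path_image ?g \<subseteq> earring"
    proof (unfold path_image_def, intro image_subsetI)
      fix t :: real assume "t \<in> {0..1}"
      from inS[OF this] show "?g t \<in> earring" using griffiths_point(4)[of "h (linepath p q t)"] by simp
    qed
    moreover have "path_image ?g \<subseteq> earring_P" if pos: "\<forall>y\<in>R. 0 < Re (fst (h y))"
    proof (unfold path_image_def, intro image_subsetI)
      fix t :: real assume t: "t \<in> {0..1}"
      from inS[OF t] bspec[OF pos inR[OF t]] show "?g t \<in> earring_P"
        using griffiths_point(5)[of "h (linepath p q t)"] by simp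
    qed
    moreover have "path_image ?g \<subseteq> earring_Q" if neg: "\<forall>y\<in>R. Re (fst (h y)) < 0"
    proof (unfold path_image_def, intro image_subsetI)
      fix t :: real assume t: "t \<in> {0..1}"
      from inS[OF t] bspec[OF neg inR[OF t]] show "?g t \<in> earring_Q"
        using griffiths_point(6)[of "h (linepath p q t)"] by simp
    qed
    moreover have "edge_val h p q = hol ?g" unfolding edge_val_def using True by (rule if_P)
    ultimately show ?thesis using hol_in_vals by metis
  next
    case False
    then have "edge_val h p q = 0" unfolding edge_val_def by (rule if_not_P)
    then show ?thesis using vals_zero by simp
  qed
  then show "edge_val h p q \<in> vals UNIV"
    and "(\<And>y. y \<in> R \<Longrightarrow> 0 < Re (fst (h y))) \<Longrightarrow> edge_val h p q \<in> vals p_letters"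
    and "(\<And>y. y \<in> R \<Longrightarrow> Re (fst (h y)) < 0) \<Longrightarrow> edge_val h p q \<in> vals q_letters" by blast+
qed

text \<open>
  Either the image of the square avoids both apexes, and then a developing map of the retracted square shows
  that the boundary has trivial holonomy. Or it meets an apex; being small it then stays in the open cone of
  that apex, and all four edges have values in letters of one kind.
\<close>

lemma small_square_val:
  assumes h: "continuous_on R h" "h ` R \<subseteq> griffiths_space" and R: "convex R" "compact R"
    and abcd: "a \<in> R" "b \<in> R" "c \<in> R" "d \<in> R"
    and small: "\<And>x y. x \<in> R \<Longrightarrow> y \<in> R \<Longrightarrow> dist (h x) (h y) < 1 / 2"
  shows "edge_val h a c + edge_val h c d - edge_val h b d - edge_val h a b \<in> vals p_letters \<union> vals q_letters"
proof (cases "\<forall>y\<in>R. snd (h y) < 1")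
  case True
  have inS: "h y \<in> {y \<in> griffiths_space. snd y < 1}" if "y \<in> R" for y using h(2) True that by blast
  have cont: "continuous_on R (ret \<circ> h)"
    unfolding o_def by (rule continuous_on_compose2[OF continuous_ret h(1)]) (use inS in blast)
  have earr: "(ret \<circ> h) y \<in> earring" if "y \<in> R" for y using inS[OF that] griffiths_point(4) by simp
  have "edge_val h a c + edge_val h c d - edge_val h b d - edge_val h a b = 0"
  proof
    fix N
    obtain D where D: "develops N (ret \<circ> h) R D" using developing_map_exists[OF R cont earr] by blast
    have edge: "edge_val h p q N = - D p + D q" if "p \<in> R" "q \<in> R" for p q
    proof -
      have "linepath p q t \<in> R" if "t \<in> {0..1}" for t
        using R(1) \<open>p \<in> R\<close> \<open>q \<in> R\<close> that by (auto simp: linepath_def intro!: convexD)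
      then have "\<forall>t\<in>{0..1}. snd (h (linepath p q t)) < 1" using True by blast
      then have "edge_val h p q = hol (ret \<circ> h \<circ> linepath p q)" unfolding edge_val_def by (rule if_P)
      then show ?thesis using hol_segment[OF D R(1) that] by simp
    qed
    show "(edge_val h a c + edge_val h c d - edge_val h b d - edge_val h a b) N = 0 N"
      using edge abcd by (simp add: diff_conv_add_uminus minus_add add.assoc del: add_uminus_conv_diff)
  qed
  then show ?thesis using vals_zero by simp
next
  case False
  then obtain y where y: "y \<in> R" "\<not> snd (h y) < 1" by blast
  have hy: "h y \<in> griffiths_space" using h(2) y(1) by blast
  have re: "Re (fst (h y)) = 1 \<or> Re (fst (h y)) = -1"
    using griffiths_point(2,3)[OF hy] y(2) by simp
  \<comment> \<open>the real part is 1 or -1 at the apexes and 0 at the base point, which the square cannot reach from an apex\<close>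
  have d: "\<bar>Re (fst (h x)) - Re (fst (h y))\<bar> < 1 / 2" if "x \<in> R" for x
  proof -
    have "\<bar>Re (fst (h x) - fst (h y))\<bar> \<le> norm (fst (h x) - fst (h y))" by (rule abs_Re_le_cmod)
    also have "\<dots> \<le> dist (h x) (h y)" using dist_fst_le[of "h x" "h y"] by (simp add: dist_norm)
    also have "\<dots> < 1 / 2" by (rule small[OF that y(1)])
    finally show ?thesis by simp
  qed
  have closed: "e1 + e2 - e3 - e4 \<in> vals A"
    if "e1 \<in> vals A" "e2 \<in> vals A" "e3 \<in> vals A" "e4 \<in> vals A" "inverse_closed A" for e1 e2 e3 e4 A
    unfolding diff_conv_add_uminus by (intro vals_add vals_uminus that)
  from re show ?thesis
  proof
    assume "Re (fst (h y)) = 1"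
    then have pos: "0 < Re (fst (h x))" if "x \<in> R" for x using d[OF that] by linarith
    note e = edge_val_in_vals(2)[OF h R(1) _ _ pos]
    have "edge_val h a c + edge_val h c d - edge_val h b d - edge_val h a b \<in> vals p_letters"
      using abcd by (intro closed e inverse_closed_simps)
    then show ?thesis by blast
  next
    assume "Re (fst (h y)) = -1"
    then have neg: "Re (fst (h x)) < 0" if "x \<in> R" for x using d[OF that] by linarith
    note e = edge_val_in_vals(3)[OF h R(1) _ _ neg]
    have "edge_val h a c + edge_val h c d - edge_val h b d - edge_val h a b \<in> vals q_letters"
      using abcd by (intro closed e inverse_closed_simps)
    then show ?thesis by blast
  qed
qed

lemma sum_list_in_vals: "(\<And>i. i < n \<Longrightarrow> v i \<in> vals A) \<Longrightarrow> sum_list (map v [0..<n]) \<in> vals A"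
  by (induction n) (auto intro: vals_add vals_zero)

text \<open>
  Cut the square of a homotopy into \<open>k\<^sup>2\<close> small squares. Replacing one row of horizontal
  edges by the next, one square at a time, changes the product of the edge values by a conjugate of a pure
  value for every square. The vertical sides of the big square are mapped to the base point, and the first and
  last rows give the values of the two words.
\<close>

theorem homotopic_imp_pure_closure:
  assumes w1: "restricted w1" "loop_of_word w1 f1" and w2: "restricted w2" "loop_of_word w2 f2"
    and hom: "homotopic_paths griffiths_space f1 f2"
  shows "\<exists>g\<in>pure_closure. val w2 = g + val w1"
proof -
  let ?Q = "{0..1::real} \<times> {0..1::real}"
  obtain h where cont: "continuous_on ?Q h" and hG: "h ` ?Q \<subseteq> griffiths_space"
    and h0: "\<And>x. x \<in> {0..1} \<Longrightarrow> h (0, x) = f1 x" and h1: "\<And>x. x \<in> {0..1} \<Longrightarrow> h (1, x) = f2 x"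
    and ends: "\<And>t. t \<in> {0..1} \<Longrightarrow> pathstart (h \<circ> Pair t) = pathstart f1 \<and> pathfinish (h \<circ> Pair t) = pathfinish f1"
    using hom unfolding homotopic_paths by (auto simp: image_subset_iff_funcset)
  have left: "h (s, 0) = 0" and right: "h (s, 1) = 0" if "s \<in> {0..1}" for s
    using ends[OF that] loop_of_word_path(3,4)[OF w1(2,1)] by (simp_all add: pathstart_def pathfinish_def)
  have "compact ?Q" by (intro compact_Times compact_Icc)
  then have "uniformly_continuous_on ?Q h" using cont by (intro compact_uniformly_continuous)
  then obtain d where d: "d > 0" "\<And>x y. x \<in> ?Q \<Longrightarrow> y \<in> ?Q \<Longrightarrow> dist x y < d \<Longrightarrow> dist (h x) (h y) < 1 / 2"
    unfolding uniformly_continuous_on_def by (metis dist_commute half_gt_zero zero_less_one)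
  obtain k :: nat where k: "k > 0" "1 / real k < d / 2"
    using real_arch_inverse[of "d / 2"] d(1) by (auto simp: inverse_eq_divide)
  define c where "c i = real i / real k" for i
  have c01: "c i \<in> {0..1}" if "i \<le> k" for i using that k by (simp add: c_def)
  have c_le: "c i \<le> c (Suc i)" "c (Suc i) - c i = 1 / real k" for i
    by (simp_all add: c_def divide_right_mono diff_divide_distrib[symmetric])
  \<comment> \<open>the edges along which the homotopy parameter varies, and those along which the path parameter varies\<close>
  define v where "v j i = edge_val h (c j, c i) (c (Suc j), c i)" for j i
  define b where "b j i = edge_val h (c j, c i) (c j, c (Suc i))" for j i
  have square: "v j i + b (Suc j) i - v j (Suc i) - b j i \<in> vals p_letters \<union> vals q_letters"
    if ji: "j < k" "i < k" for j i
  proof -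
    define R where "R = {c j..c (Suc j)} \<times> {c i..c (Suc i)}"
    have RQ: "R \<subseteq> ?Q" using c01[of j] c01[of "Suc j"] c01[of i] c01[of "Suc i"] ji by (auto simp: R_def)
    have "continuous_on R h" using cont RQ by (rule continuous_on_subset)
    moreover have "h ` R \<subseteq> griffiths_space" using hG RQ by blast
    moreover have "convex R" "compact R" unfolding R_def by (auto intro!: convex_Times compact_Times)
    moreover have "(c j, c i) \<in> R" "(c j, c (Suc i)) \<in> R" "(c (Suc j), c i) \<in> R" "(c (Suc j), c (Suc i)) \<in> R"
      using c_le by (auto simp: R_def)
    moreover have "dist (h x) (h y) < 1 / 2" if "x \<in> R" "y \<in> R" for x y
    proof (rule d(2))
      have "dist (fst x) (fst y) \<le> 1 / real k" "dist (snd x) (snd y) \<le> 1 / real k"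
        using that c_le(2)[of i] c_le(2)[of j] unfolding R_def mem_Times_iff atLeastAtMost_iff dist_real_def by linarith+
      moreover have "dist x y \<le> dist (fst x) (fst y) + dist (snd x) (snd y)"
        by (cases x; cases y) (simp add: dist_Pair_Pair sqrt_sum_squares_le_sum)
      ultimately show "dist x y < d" using k(2) by linarith
    qed (use that RQ in auto)
    ultimately show ?thesis unfolding v_def b_def by (rule small_square_val)
  qed
  have zero_edge: "edge_val h p q = 0" if "\<And>t. t \<in> {0..1} \<Longrightarrow> h (linepath p q t) = 0" for p q
  proof -
    have "edge_val h p q = hol (ret \<circ> h \<circ> linepath p q)"
      unfolding edge_val_def by (rule if_P) (simp add: that)
    also have "\<dots> = hol (\<lambda>t. 0)" by (rule hol_cong) (simp add: that ret_base)
    finally show ?thesis using hol_zero by simp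
  qed
  have lp01: "linepath (x::real) y t \<in> {0..1}" if "x \<in> {0..1}" "y \<in> {0..1}" "t \<in> {0..1}" for x y t
    using that convexD[of "{0..1::real}" x y "1 - t" t] by (simp add: linepath_def)
  have lp: "linepath (x, y) (x', y') t = (linepath x x' t, linepath y y' t)" for x y x' y' t :: real
    by (simp add: linepath_def)
  have v0: "v j 0 = 0" and vk: "v j k = 0" if "j < k" for j
  proof -
    have "h (linepath (c j, c 0) (c (Suc j), c 0) t) = 0" "h (linepath (c j, c k) (c (Suc j), c k) t) = 0"
      if t: "t \<in> {0..1}" for t
    proof -
      have "linepath (c j) (c (Suc j)) t \<in> {0..1}" using lp01 c01[of j] c01[of "Suc j"] \<open>j < k\<close> t by simp
      moreover have "linepath (c 0) (c 0) t = 0" "linepath (c k) (c k) t = 1"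
        using k by (simp_all add: linepath_def c_def)
      ultimately show "h (linepath (c j, c 0) (c (Suc j), c 0) t) = 0" "h (linepath (c j, c k) (c (Suc j), c k) t) = 0"
        using left right by (simp_all only: lp)
    qed
    then show "v j 0 = 0" "v j k = 0" unfolding v_def by (intro zero_edge; blast)+
  qed
  define row where "row j = sum_list (map (b j) [0..<k])" for j
  have b_vals: "b j i \<in> vals UNIV" if "j \<le> k" "i < k" for j i
    unfolding b_def using c01[of j] c01[of i] c01[of "Suc i"] that
    by (intro edge_val_in_vals(1)[OF cont hG]) (auto intro!: convex_Times)
  have row_step: "\<exists>g\<in>pure_closure. row (Suc j) = g + row j" if j: "j < k" for j
  proof -
    have "m \<le> k \<Longrightarrow> \<exists>g\<in>pure_closure. sum_list (map (b (Suc j)) [0..<m]) - v j m = g + sum_list (map (b j) [0..<m])" for m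
    proof (induction m)
      case 0
      show ?case using v0[OF j] by (intro bexI[OF _ pure_closure_zero]) simp
    next
      case (Suc m)
      let ?B = "sum_list (map (b j) [0..<m])" and ?T = "sum_list (map (b (Suc j)) [0..<m])"
      obtain g where g: "g \<in> pure_closure" "?T - v j m = g + ?B"
        using Suc.IH Suc.prems Suc_leD by blast
      define s where "s = v j m + b (Suc j) m - v j (Suc m) - b j m"
      have s: "s \<in> vals p_letters \<union> vals q_letters" unfolding s_def using square[of j m] j Suc.prems by simp
      have B: "?B \<in> vals UNIV" using b_vals j Suc.prems by (intro sum_list_in_vals) auto
      have "sum_list (map (b (Suc j)) [0..<Suc m]) - v j (Suc m) = (?T - v j m) + (s + b j m)"
        by (simp add: s_def diff_conv_add_uminus minus_add add.assoc del: add_uminus_conv_diff)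
      also have "\<dots> = g + (?B + s - ?B) + sum_list (map (b j) [0..<Suc m])"
        unfolding g(2) by (simp add: diff_conv_add_uminus minus_add add.assoc del: add_uminus_conv_diff)
      finally show ?case using pure_closure_add[OF g(1) B s] by blast
    qed
    from this[of k] show ?thesis unfolding row_def using vk[OF j] by simp
  qed
  have "j \<le> k \<Longrightarrow> \<exists>g\<in>pure_closure. row j = g + row 0" for j
  proof (induction j)
    case 0
    show ?case by (intro bexI[OF _ pure_closure_zero]) simp
  next
    case (Suc j)
    obtain g where g: "g \<in> pure_closure" "row j = g + row 0"
      using Suc.IH[OF Suc_leD[OF Suc.prems]] by blast
    obtain g' where g': "g' \<in> pure_closure" "row (Suc j) = g' + row j"
      using row_step[OF Suc_le_lessD[OF Suc.prems]] by blast
    have "row (Suc j) = (g' + g) + row 0" unfolding g'(2) g(2) by (rule add.assoc[symmetric])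
    then show ?case using pure_closure_plus[OF g(1) g'(1)] by blast
  qed
  then obtain g where g: "g \<in> pure_closure" "row k = g + row 0" by blast
  have row_val: "row j = val w"
    if w: "restricted w" "loop_of_word w f" and j: "j = 0 \<or> j = k" and hf: "\<And>x. x \<in> {0..1} \<Longrightarrow> h (c j, x) = f x"
    for w :: "('x::linorder, gen) word" and f j
  proof
    fix N
    note pf = loop_of_word_path[OF w(2,1)]
    have f0: "f t \<in> earring \<times> {0}" if "t \<in> {0..1}" for t using pf(2) that by (auto simp: path_image_def)
    have "continuous_on {0..1} (fst \<circ> f)"
      unfolding o_def using pf(1) by (intro continuous_on_fst) (simp add: path_def)
    moreover have "(fst \<circ> f) t \<in> earring" if "t \<in> {0..1}" for t using f0[OF that] by auto
    ultimately obtain D where D: "develops N (fst \<circ> f) {0..1} D"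
      using developing_map_exists[OF convex_real_interval(5) compact_Icc] by metis
    have "b j i N = - D (c i) + D (c (Suc i))" if i: "i < k" for i
    proof -
      have ci: "c i \<in> {0..1}" "c (Suc i) \<in> {0..1}" using c01 i by auto
      have eq: "h (linepath (c j, c i) (c j, c (Suc i)) t) = f (linepath (c i) (c (Suc i)) t)" if "t \<in> {0..1}" for t
      proof -
        have "linepath (c j) (c j) t = c j" by (simp add: linepath_def algebra_simps)
        then show ?thesis using hf[OF lp01[OF ci that]] by (simp only: lp)
      qed
      have snd0: "snd (f (linepath (c i) (c (Suc i)) t)) = 0" if "t \<in> {0..1}" for t
        using f0[OF lp01[OF ci that]] by auto
      have "b j i = hol (ret \<circ> h \<circ> linepath (c j, c i) (c j, c (Suc i)))"
        unfolding b_def edge_val_def by (rule if_P) (simp add: eq snd0)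
      also have "\<dots> = hol ((fst \<circ> f) \<circ> linepath (c i) (c (Suc i)))"
        by (rule hol_cong) (simp add: eq snd0 ret_base)
      finally show ?thesis using hol_segment[OF D convex_real_interval(5) ci] by simp
    qed
    then have "sum_list (map (\<lambda>i. b j i N) [0..<k]) = sum_list (map (\<lambda>i. - D (c i) + D (c (Suc i))) [0..<k])"
      by (intro arg_cong[of _ _ sum_list] map_cong refl) simp
    also have "\<dots> = - D (c 0) + D (c k)" using sum_list_telescope[of "\<lambda>i. D (c i)"] by simp
    also have "\<dots> = hol (fst \<circ> f) N" using hol_eq[OF D] k by (simp add: c_def)
    also have "\<dots> = val w N" using hol_loop_of_word[OF w(2,1)] by simp
    finally have "sum_list (map (\<lambda>i. b j i N) [0..<k]) = val w N" .
    moreover have "sum_list (map (b j) [0..<m]) N = sum_list (map (\<lambda>i. b j i N) [0..<m])" for m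
      by (induction m) simp_all
    ultimately show "row j N = val w N" by (simp add: row_def)
  qed
  have "row 0 = val w1" using h0 by (intro row_val[OF w1]) (auto simp: c_def)
  moreover have "row k = val w2" using h1 k by (intro row_val[OF w2]) (auto simp: c_def)
  ultimately show ?thesis using g by (intro bexI[of _ g]) simp_all
qed

section \<open>Homotopy classes and common reducts\<close>

text \<open>
  The convex sets may overlap. They are deleted one after the other, each time deleting what is left of the
  next set; this is still convex in the remaining word.
\<close>

lemma deletions_of_pure_family:
  assumes "finite \<J>" "countable (dom W)" "\<And>J. J \<in> \<J> \<Longrightarrow> convex_in (dom W) J \<and> pure (W |` J)"
  shows "deletion\<^sup>*\<^sup>* W (W |` (- \<Union>\<J>))"
  using assms(1,3)
proof (induction \<J>)
  case empty
  have "W |` (- \<Union>{}) = W" by (rule ext) (simp add: restrict_map_def)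
  then show ?case by simp
next
  case (insert J \<J>)
  let ?V = "W |` (- \<Union>\<J>)"
  have J: "convex_in (dom W) J" "pure (W |` J)" using insert.prems by auto
  have ran: "ran (?V |` (J - \<Union>\<J>)) \<subseteq> ran (W |` J)"
    by (auto simp: ran_def restrict_map_def split: if_splits)
  have "deletion ?V (?V |` (- (J - \<Union>\<J>)))"
    unfolding deletion_def
  proof (intro exI[of _ "J - \<Union>\<J>"] conjI refl)
    have dom: "dom ?V = dom W - \<Union>\<J>" by auto
    show "convex_in (dom ?V) (J - \<Union>\<J>)"
      using J(1) unfolding convex_in_def dom by blast
    have "J \<subseteq> dom W" using J(1) by (simp add: convex_in_def)
    then show "countable (J - \<Union>\<J>)" using assms(2) countable_subset by blast
    show "only_p (?V |` (J - \<Union>\<J>)) \<or> only_q (?V |` (J - \<Union>\<J>))"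
      using J(2) ran unfolding pure_def only_p_def only_q_def by blast
  qed
  moreover have "?V |` (- (J - \<Union>\<J>)) = W |` (- \<Union>(insert J \<J>))"
    by (rule ext) (auto simp: restrict_map_def)
  ultimately have "deletion ?V (W |` (- \<Union>(insert J \<J>)))" by (simp only:)
  moreover have "deletion\<^sup>*\<^sup>* W ?V" using insert.IH insert.prems by blast
  ultimately show ?case by (rule rtranclp.rtrancl_into_rtrancl[rotated])
qed

text \<open>
  Convex sets of positions and their deletion can be pulled back along an isomorphism of words.
\<close>

lemma transfer_pure_family:
  assumes equiv: "word_equiv W V" and res: "restricted W"
    and \<J>: "finite \<J>" "\<forall>J\<in>\<J>. convex_in (dom V) J \<and> pure (V |` J)"
  shows "\<exists>\<K>. finite \<K> \<and> (\<forall>J\<in>\<K>. convex_in (dom W) J \<and> pure (W |` J)) \<and> val (W |` (- \<Union>\<K>)) = val (V |` (- \<Union>\<J>))"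
proof -
  obtain \<phi> where \<phi>: "bij_betw \<phi> (dom W) (dom V)" "strict_mono_on (dom W) \<phi>" "\<forall>i\<in>dom W. V (\<phi> i) = W i"
    using equiv unfolding word_equiv_def by blast
  define pull where "pull J = {i \<in> dom W. \<phi> i \<in> J}" for J
  have im: "\<phi> i \<in> dom V" if "i \<in> dom W" for i using bij_betwE[OF \<phi>(1)] that by blast
  have pulled: "convex_in (dom W) (pull J) \<and> pure (W |` pull J)" if J: "J \<in> \<J>" for J
  proof
    have conv: "convex_in (dom V) J" by (rule conjunct1[OF bspec[OF \<J>(2) J]])
    show "convex_in (dom W) (pull J)"
      unfolding convex_in_def
    proof (intro conjI ballI impI)
      fix i j l assume i: "i \<in> pull J" and j: "j \<in> pull J" and l: "l \<in> dom W" "i < l \<and> l < j"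
      have d: "i \<in> dom W" "\<phi> i \<in> J" "j \<in> dom W" "\<phi> j \<in> J" using i j by (simp_all add: pull_def)
      have "\<phi> i < \<phi> l" "\<phi> l < \<phi> j"
        using strict_mono_onD[OF \<phi>(2) d(1) l(1)] strict_mono_onD[OF \<phi>(2) l(1) d(3)] l(2) by blast+
      then have "\<phi> l \<in> J" using conv d im[OF l(1)] unfolding convex_in_def by blast
      then show "l \<in> pull J" using l(1) by (simp add: pull_def)
    qed (simp add: pull_def)
    have "ran (W |` pull J) \<subseteq> ran (V |` J)"
    proof
      fix a assume "a \<in> ran (W |` pull J)"
      then obtain i where "i \<in> pull J" "W i = Some a" by (auto simp: ran_def restrict_map_def split: if_splits)
      then have "(V |` J) (\<phi> i) = Some a" using \<phi>(3) by (auto simp: pull_def)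
      then show "a \<in> ran (V |` J)" by (rule ranI)
    qed
    then show "pure (W |` pull J)" using bspec[OF \<J>(2) J] unfolding pure_def only_p_def only_q_def by blast
  qed
  have mem: "i \<in> \<Union>(pull ` \<J>) \<longleftrightarrow> \<phi> i \<in> \<Union>\<J>" if "i \<in> dom W" for i using that by (auto simp: pull_def)
  have "word_equiv (W |` (- \<Union>(pull ` \<J>))) (V |` (- \<Union>\<J>))"
    unfolding word_equiv_def
  proof (intro exI[of _ \<phi>] conjI ballI)
    have domW: "dom (W |` (- \<Union>(pull ` \<J>))) = {i \<in> dom W. \<phi> i \<notin> \<Union>\<J>}" using mem by auto
    have domV: "dom (V |` (- \<Union>\<J>)) = {j \<in> dom V. j \<notin> \<Union>\<J>}" by auto
    have "\<phi> ` {i \<in> dom W. \<phi> i \<notin> \<Union>\<J>} = {j \<in> dom V. j \<notin> \<Union>\<J>}"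
    proof (rule subset_antisym; rule subsetI)
      fix j assume "j \<in> \<phi> ` {i \<in> dom W. \<phi> i \<notin> \<Union>\<J>}"
      then obtain i where i: "j = \<phi> i" "i \<in> dom W" "\<phi> i \<notin> \<Union>\<J>" by (elim imageE CollectE conjE)
      show "j \<in> {j \<in> dom V. j \<notin> \<Union>\<J>}" unfolding i(1) by (intro CollectI conjI im i(2,3))
    next
      fix j assume "j \<in> {j \<in> dom V. j \<notin> \<Union>\<J>}"
      then have c: "j \<in> dom V \<and> j \<notin> \<Union>\<J>" by (rule CollectD)
      note j = conjunct1[OF c] conjunct2[OF c]
      obtain i where i: "i \<in> dom W" "j = \<phi> i"
        using j(1) unfolding bij_betw_imp_surj_on[OF \<phi>(1), symmetric] by (elim imageE)
      show "j \<in> \<phi> ` {i \<in> dom W. \<phi> i \<notin> \<Union>\<J>}"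
        unfolding i(2) by (intro imageI CollectI conjI i(1) j(2)[unfolded i(2)])
    qed
    moreover have "inj_on \<phi> {i \<in> dom W. \<phi> i \<notin> \<Union>\<J>}"
      by (rule inj_on_subset[OF bij_betw_imp_inj_on[OF \<phi>(1)]]) (rule Collect_subset)
    ultimately show "bij_betw \<phi> (dom (W |` (- \<Union>(pull ` \<J>)))) (dom (V |` (- \<Union>\<J>)))"
      unfolding domW domV bij_betw_def by (intro conjI)
    show "strict_mono_on (dom (W |` (- \<Union>(pull ` \<J>)))) \<phi>"
      unfolding domW by (rule monotone_on_subset[OF \<phi>(2)]) (rule Collect_subset)
    fix i assume "i \<in> dom (W |` (- \<Union>(pull ` \<J>)))"
    then have c: "i \<in> dom W \<and> \<phi> i \<notin> \<Union>\<J>" unfolding domW by (rule CollectD)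
    note i = conjunct1[OF c] conjunct2[OF c]
    show "(V |` (- \<Union>\<J>)) (\<phi> i) = (W |` (- \<Union>(pull ` \<J>))) i"
      using mem[OF i(1)] bspec[OF \<phi>(3) i(1)] unfolding restrict_map_def Compl_iff
      by (simp only: i(2) if_True not_False_eq_True)
  qed
  from val_word_equiv[OF this restricted_restrict_map[OF res]]
  have "val (W |` (- \<Union>(pull ` \<J>))) = val (V |` (- \<Union>\<J>))" .
  moreover have "finite (pull ` \<J>)" using \<J>(1) by simp
  moreover have "\<forall>J\<in>pull ` \<J>. convex_in (dom W) J \<and> pure (W |` J)"
    by (rule ballI, erule imageE) (simp add: pulled)
  ultimately show ?thesis by (intro exI[of _ "pull ` \<J>"] conjI)
qed

text \<open>
  A homotopy turns the value of one word into that of the other by a product of conjugates of pure values.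
  After finitely many deletions in both words the values agree, and then so do the reduced forms.
\<close>

lemma homotopic_imp_common_reduct:
  fixes w1 :: "('i::linorder, gen) word" and w2 :: "('j::linorder, gen) word"
  assumes w1: "reduced_tame w1" "loop_of_word w1 f1" and w2: "reduced_tame w2" "loop_of_word w2 f2"
    and hom: "homotopic_paths griffiths_space f1 f2"
  shows "\<exists>v1 v2. reduced_tame v1 \<and> reduced_tame v2 \<and> word_equiv v1 v2 \<and>
                  transforms_to w1 v1 \<and> transforms_to w2 v2"
proof -
  have t1: "countable (dom w1)" "restricted w1" "reduced w1" and t2: "countable (dom w2)" "restricted w2" "reduced w2"
    using w1(1) w2(1) by (simp_all add: reduced_tame_def)
  obtain u1 where u1: "unit_word u1" "word_equiv w1 u1" by (rule unit_word_exists[OF t1(1)])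
  obtain u2 where u2: "unit_word u2" "word_equiv w2 u2" by (rule unit_word_exists[OF t2(1)])
  obtain g where g: "g \<in> pure_closure" "val w2 = g + val w1"
    using homotopic_imp_pure_closure[OF t1(2) w1(2) t2(2) w2(2) hom] by blast
  have veq: "val u2 = g + val u1"
    using g(2) val_word_equiv[OF u1(2) t1(2)] val_word_equiv[OF u2(2) t2(2)] by simp
  obtain n x s where x: "\<forall>k<n. unit_word (x k) \<and> restricted (x k) \<and> reduced (x k)"
    and s: "\<forall>k<n. unit_word (s k) \<and> restricted (s k) \<and> reduced (s k) \<and> pure (s k)"
    and gsum: "g = (\<Sum>k\<leftarrow>[0..<n]. val (x k) + val (s k) - val (x k :: (real, gen) word))"
    using pure_closure_list[OF g(1)] by (elim exE conjE)
  have "\<exists>\<J>1 \<J>2. finite \<J>1 \<and> finite \<J>2 \<and>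
    (\<forall>J\<in>\<J>1. convex_in (dom u1) J \<and> pure (u1 |` J)) \<and>
    (\<forall>J\<in>\<J>2. convex_in (dom u2) J \<and> pure (u2 |` J)) \<and>
    val (u1 |` (- \<Union>\<J>1)) = val (u2 |` (- \<Union>\<J>2))"
  proof (rule normal_closure_deletion)
    show "unit_word u1" "restricted u1" "reduced u1"
      using u1 word_equiv_restricted[OF u1(2) t1(2)] reduced_word_equiv[OF u1(2) t1(3)] by blast+
    show "unit_word u2" "restricted u2" "reduced u2"
      using u2 word_equiv_restricted[OF u2(2) t2(2)] reduced_word_equiv[OF u2(2) t2(3)] by blast+
    show "unit_word (x k) \<and> restricted (x k) \<and> reduced (x k)" if "k < n" for k using x that by blast
    show "unit_word (s k) \<and> restricted (s k) \<and> reduced (s k) \<and> pure (s k)" if "k < n" for k using s that by blast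
    show "val u2 = (\<Sum>k\<leftarrow>[0..<n]. val (x k) + val (s k) - val (x k)) + val u1"
      using veq gsum by simp
  qed
  then obtain \<J>1 \<J>2 where J: "finite \<J>1" "finite \<J>2"
    "\<forall>J\<in>\<J>1. convex_in (dom u1) J \<and> pure (u1 |` J)" "\<forall>J\<in>\<J>2. convex_in (dom u2) J \<and> pure (u2 |` J)"
    "val (u1 |` (- \<Union>\<J>1)) = val (u2 |` (- \<Union>\<J>2))" by (elim exE conjE)
  obtain \<K>1 where K1: "finite \<K>1" "\<forall>J\<in>\<K>1. convex_in (dom w1) J \<and> pure (w1 |` J)"
    "val (w1 |` (- \<Union>\<K>1)) = val (u1 |` (- \<Union>\<J>1))"
    using transfer_pure_family[OF u1(2) t1(2) J(1) J(3)] by (elim exE conjE)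
  obtain \<K>2 where K2: "finite \<K>2" "\<forall>J\<in>\<K>2. convex_in (dom w2) J \<and> pure (w2 |` J)"
    "val (w2 |` (- \<Union>\<K>2)) = val (u2 |` (- \<Union>\<J>2))"
    using transfer_pure_family[OF u2(2) t2(2) J(2) J(4)] by (elim exE conjE)
  have d1: "deletion\<^sup>*\<^sup>* w1 (w1 |` (- \<Union>\<K>1))"
    by (rule deletions_of_pure_family[OF K1(1) t1(1) bspec[OF K1(2)]])
  have d2: "deletion\<^sup>*\<^sup>* w2 (w2 |` (- \<Union>\<K>2))"
    by (rule deletions_of_pure_family[OF K2(1) t2(1) bspec[OF K2(2)]])
  have r1: "restricted (w1 |` (- \<Union>\<K>1))" and r2: "restricted (w2 |` (- \<Union>\<K>2))"
    using t1(2) t2(2) by (simp_all add: restricted_restrict_map)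
  obtain v1 where v1: "reduced_form (w1 |` (- \<Union>\<K>1)) v1" using reduced_form_exists by blast
  obtain v2 where v2: "reduced_form (w2 |` (- \<Union>\<K>2)) v2" using reduced_form_exists by blast
  have rv: "restricted v1" "restricted v2" "reduced v1" "reduced v2"
    using reduced_formD(1,3)[OF v1] reduced_formD(1,3)[OF v2] r1 r2 by blast+
  note cv = restricted_imp_countable[OF rv(1)] restricted_imp_countable[OF rv(2)]
  have "val v1 = val v2"
    using val_reduced_form[OF v1 r1] val_reduced_form[OF v2 r2] K1(3) K2(3) J(5) by simp
  then have "word_equiv v1 v2" using word_equiv_if_val_eq cv rv by blast
  moreover have "reduced_tame v1" "reduced_tame v2" using cv rv by (simp_all add: reduced_tame_def)
  moreover have "transforms_to w1 v1" "transforms_to w2 v2"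
    unfolding transforms_to_def using d1 d2 v1 v2 by blast+
  ultimately show ?thesis by blast
qed

lemma deletions_homotopic:
  assumes "deletion\<^sup>*\<^sup>* W W'" "restricted W" "loop_of_word W f"
  shows "\<exists>f'. restricted W' \<and> loop_of_word W' f' \<and> homotopic_paths griffiths_space f f'"
  using assms(1)
proof induction
  case base
  have "homotopic_paths griffiths_space f f"
    using loop_of_word_path[OF assms(3,2)] earring_subset_griffiths by (intro homotopic_paths_refl[THEN iffD2]) auto
  then show ?case using assms by blast
next
  case (step V V')
  obtain f1 where f1: "restricted V" "loop_of_word V f1" "homotopic_paths griffiths_space f f1" using step.IH by blast
  obtain f2 where f2: "loop_of_word V' f2" "homotopic_paths griffiths_space f1 f2"
    by (rule deletion_homotopic[OF step.hyps(2) f1(1,2)])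
  have "restricted V'" using step.hyps(2) f1(1) restricted_restrict_map unfolding deletion_def by blast
  then show ?case using f2 homotopic_paths_trans[OF f1(3) f2(2)] by blast
qed

lemma common_reduct_imp_homotopic:
  fixes w1 :: "('i::linorder, gen) word" and w2 :: "('j::linorder, gen) word"
  assumes w1: "restricted w1" "loop_of_word w1 f1" and w2: "restricted w2" "loop_of_word w2 f2"
    and v: "word_equiv v1 v2" "transforms_to w1 v1" "transforms_to w2 v2"
  shows "homotopic_paths griffiths_space f1 f2"
proof -
  obtain W1 where W1: "deletion\<^sup>*\<^sup>* w1 W1" "reduced_form W1 v1" using v(2) unfolding transforms_to_def by blast
  obtain W2 where W2: "deletion\<^sup>*\<^sup>* w2 W2" "reduced_form W2 v2" using v(3) unfolding transforms_to_def by blast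
  obtain g1 where g1: "restricted W1" "loop_of_word W1 g1" "homotopic_paths griffiths_space f1 g1"
    using deletions_homotopic[OF W1(1) w1] by blast
  obtain g2 where g2: "restricted W2" "loop_of_word W2 g2" "homotopic_paths griffiths_space f2 g2"
    using deletions_homotopic[OF W2(1) w2] by blast
  have "val W1 = val W2"
    using val_reduced_form[OF W1(2) g1(1)] val_reduced_form[OF W2(2) g2(1)]
      val_word_equiv[OF v(1) reduced_formD(3)[OF W1(2) g1(1)]] by simp
  then have "homotopic_paths (earring \<times> {0}) g1 g2"
    using homotopic_if_val_eq[OF restricted_imp_countable g1(1,2) restricted_imp_countable g2(1,2)] g1(1) g2(1) by blast
  then have "homotopic_paths griffiths_space g1 g2"
    using homotopic_paths_subset earring_subset_griffiths by blast
  then show ?thesis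
    using homotopic_paths_trans homotopic_paths_sym g1(3) g2(3) by blast
qed

theorem theorem8p1:
  fixes w1 :: "('i::linorder, gen) word" and w2 :: "('j::linorder, gen) word"
  assumes "reduced_tame w1" and "reduced_tame w2"
  shows "(\<exists>c \<in> pi1 griffiths_space 0. represents w1 c \<and> represents w2 c) \<longleftrightarrow>
         (\<exists>v1 v2. reduced_tame v1 \<and> reduced_tame v2 \<and> word_equiv v1 v2 \<and>
                  transforms_to w1 v1 \<and> transforms_to w2 v2)"
proof
  assume "\<exists>c \<in> pi1 griffiths_space 0. represents w1 c \<and> represents w2 c"
  then obtain c f1 f2 where c: "c \<in> pi1 griffiths_space 0" "f1 \<in> c" "loop_of_word w1 f1" "f2 \<in> c" "loop_of_word w2 f2"
    unfolding represents_def by blast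
  obtain f where "c = homotopy_class griffiths_space f" using c(1) unfolding pi1_def by blast
  then have "homotopic_paths griffiths_space f f1" "homotopic_paths griffiths_space f f2"
    using c(2,4) by (simp_all add: homotopy_class_def)
  then have "homotopic_paths griffiths_space f1 f2" using homotopic_paths_sym homotopic_paths_trans by blast
  then show "\<exists>v1 v2. reduced_tame v1 \<and> reduced_tame v2 \<and> word_equiv v1 v2 \<and>
                  transforms_to w1 v1 \<and> transforms_to w2 v2"
    by (rule homotopic_imp_common_reduct[OF assms(1) c(3) assms(2) c(5)])
next
  assume "\<exists>v1 v2. reduced_tame v1 \<and> reduced_tame v2 \<and> word_equiv v1 v2 \<and>
                  transforms_to w1 v1 \<and> transforms_to w2 v2"
  then obtain v1 :: "('i, gen) word" and v2 :: "('j, gen) word"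
    where v: "word_equiv v1 v2" "transforms_to w1 v1" "transforms_to w2 v2" by blast
  have t: "countable (dom w1)" "restricted w1" "countable (dom w2)" "restricted w2"
    using assms by (simp_all add: reduced_tame_def)
  obtain f1 where f1: "loop_of_word w1 f1" using loop_of_word_exists[OF t(1)] by blast
  obtain f2 where f2: "loop_of_word w2 f2" using loop_of_word_exists[OF t(3)] by blast
  have hom: "homotopic_paths griffiths_space f1 f2"
    by (rule common_reduct_imp_homotopic[OF t(2) f1 t(4) f2 v])
  note p1 = loop_of_word_path[OF f1 t(2)]
  have sub: "path_image f1 \<subseteq> griffiths_space" using p1(2) earring_subset_griffiths by blast
  define c where "c = homotopy_class griffiths_space f1"
  have "c \<in> pi1 griffiths_space 0"
    unfolding c_def pi1_def using p1 sub by (intro imageI CollectI conjI)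
  moreover have "f1 \<in> c" "f2 \<in> c"
    using p1(1) sub hom by (simp_all add: c_def homotopy_class_def)
  ultimately show "\<exists>c \<in> pi1 griffiths_space 0. represents w1 c \<and> represents w2 c"
    unfolding represents_def using f1 f2 by blast
qed

end
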